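(* Let $G$ be a group and let $R$ be a commutative ring with a unit. (1) If $G$ has jump homology over $R$, then every subgroup $S<G$ has jump homology over $R$ with $hjh_R(S)\le hjh_R(G)$. If $G$ has jump cohomology over $R$, then every subgroup $S<G$ has jump cohomology over $R$ with $cjh_R(S)\le cjh_R(G)$. (2) If $G$ has jump homology of height zero over $R$, or jump cohomology of height zero over $R$, then $G$ is a torsion group. Conversely, if $G$ is an $R$-torsion group, then $G$ has jump homology of height zero over $R$ and jump cohomology of height zero over $R$. (3) If $G$ has jump cohomology over $R$, then $G$ has jump homology over $R$ and $hjh_R(G)\le cjh_R(G)$. If $G$ is countable, then $G$ has jump cohomology over $R$ if and only if $G$ has jump homology over $R$, and in this case $hjh_R(G)\le cjh_R(G)\le hjh_R(G)+1$.
   Context: For a commutative ring $R$ with unit and a group $H$, $cd_R(H)$ and $hd_R(H)$ denote the cohomological and homological dimension of $H$ over $R$ (the projective, respectively flat, dimension of the trivial $RH$-module $R$). A discrete group $G$ has jump homology (respectively jump cohomology) over $R$ if there exists an integer $k\ge 0$ such that for each subgroup $H$ of $G$ we have $hd_R(H)=\infty$ or $hd_R(H)\le k$ (respectively $cd_R(H)=\infty$ or $cd_R(H)\le k$). The smallest such $k$ is called the jump height and denoted $hjh_R(G)$ (respectively $cjh_R(G)$). A group is an $R$-torsion group if it is a torsion group and the order of every nontrivial element is not invertible in $R$.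
   Formalization: In the first half of (2) the ring R is assumed nonzero: over the zero ring all dimensions are 0, so the infinite cyclic group would have height zero without being a torsion group. *)

theory Defs
  imports
    "HOL-Algebra.Algebra"
    "HOL-Library.Extended_Nat"
    "HOL-Library.Countable_Set"
begin

section \<open>Modules over a not necessarily commutative ring\<close>

text \<open>
  The locale \<^locale>\<open>module\<close> of the library requires a commutative ring of scalars, whereas group
  rings are usually not commutative. The record type of the library is reused; its
  multiplicative fields \<open>mult\<close> and \<open>one\<close> are irrelevant here.
\<close>

locale left_module = A?: ring A + M?: abelian_group M
  for A :: "('a, 'c) ring_scheme" (structure)
    and M :: "('a, 'm, 'd) module_scheme" (structure) +
  assumes smult_closed:
      "\<lbrakk>a \<in> carrier A; x \<in> carrier M\<rbrakk> \<Longrightarrow> a \<odot>\<^bsub>M\<^esub> x \<in> carrier M"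
    and smult_l_distr:
      "\<lbrakk>a \<in> carrier A; b \<in> carrier A; x \<in> carrier M\<rbrakk> \<Longrightarrow>
        (a \<oplus>\<^bsub>A\<^esub> b) \<odot>\<^bsub>M\<^esub> x = (a \<odot>\<^bsub>M\<^esub> x) \<oplus>\<^bsub>M\<^esub> (b \<odot>\<^bsub>M\<^esub> x)"
    and smult_r_distr:
      "\<lbrakk>a \<in> carrier A; x \<in> carrier M; y \<in> carrier M\<rbrakk> \<Longrightarrow>
        a \<odot>\<^bsub>M\<^esub> (x \<oplus>\<^bsub>M\<^esub> y) = (a \<odot>\<^bsub>M\<^esub> x) \<oplus>\<^bsub>M\<^esub> (a \<odot>\<^bsub>M\<^esub> y)"
    and smult_assoc:
      "\<lbrakk>a \<in> carrier A; b \<in> carrier A; x \<in> carrier M\<rbrakk> \<Longrightarrow>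
        (a \<otimes>\<^bsub>A\<^esub> b) \<odot>\<^bsub>M\<^esub> x = a \<odot>\<^bsub>M\<^esub> (b \<odot>\<^bsub>M\<^esub> x)"
    and smult_one:
      "x \<in> carrier M \<Longrightarrow> \<one>\<^bsub>A\<^esub> \<odot>\<^bsub>M\<^esub> x = x"

text \<open>
  For a right module \<open>N\<close> the term \<open>a \<odot>\<^bsub>N\<^esub> x\<close> stands for what is usually written \<open>x \<cdot> a\<close>;
  hence the order of the factors in the associativity law.
\<close>

locale right_module = A?: ring A + N?: abelian_group N
  for A :: "('a, 'c) ring_scheme" (structure)
    and N :: "('a, 'n, 'd) module_scheme" (structure) +
  assumes smult_closed:
      "\<lbrakk>a \<in> carrier A; x \<in> carrier N\<rbrakk> \<Longrightarrow> a \<odot>\<^bsub>N\<^esub> x \<in> carrier N"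
    and smult_l_distr:
      "\<lbrakk>a \<in> carrier A; b \<in> carrier A; x \<in> carrier N\<rbrakk> \<Longrightarrow>
        (a \<oplus>\<^bsub>A\<^esub> b) \<odot>\<^bsub>N\<^esub> x = (a \<odot>\<^bsub>N\<^esub> x) \<oplus>\<^bsub>N\<^esub> (b \<odot>\<^bsub>N\<^esub> x)"
    and smult_r_distr:
      "\<lbrakk>a \<in> carrier A; x \<in> carrier N; y \<in> carrier N\<rbrakk> \<Longrightarrow>
        a \<odot>\<^bsub>N\<^esub> (x \<oplus>\<^bsub>N\<^esub> y) = (a \<odot>\<^bsub>N\<^esub> x) \<oplus>\<^bsub>N\<^esub> (a \<odot>\<^bsub>N\<^esub> y)"
    and smult_assoc:
      "\<lbrakk>a \<in> carrier A; b \<in> carrier A; x \<in> carrier N\<rbrakk> \<Longrightarrow>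
        (a \<otimes>\<^bsub>A\<^esub> b) \<odot>\<^bsub>N\<^esub> x = b \<odot>\<^bsub>N\<^esub> (a \<odot>\<^bsub>N\<^esub> x)"
    and smult_one:
      "x \<in> carrier N \<Longrightarrow> \<one>\<^bsub>A\<^esub> \<odot>\<^bsub>N\<^esub> x = x"

definition mod_hom ::
    "('a, 'c) ring_scheme \<Rightarrow> ('a, 'm) module \<Rightarrow> ('a, 'n) module \<Rightarrow> ('m \<Rightarrow> 'n) set"
  where "mod_hom A M N =
    {f. f \<in> carrier M \<rightarrow> carrier N
      \<and> (\<forall>x\<in>carrier M. \<forall>y\<in>carrier M. f (x \<oplus>\<^bsub>M\<^esub> y) = f x \<oplus>\<^bsub>N\<^esub> f y)
      \<and> (\<forall>a\<in>carrier A. \<forall>x\<in>carrier M. f (a \<odot>\<^bsub>M\<^esub> x) = a \<odot>\<^bsub>N\<^esub> f x)}"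

section \<open>Projective modules\<close>

text \<open>
  The lifting property, tested on surjections \<open>N \<rightarrow> N'\<close>. A definition cannot quantify over types, so
  the types carrying \<open>N\<close> and \<open>N'\<close> are fixed. They are large enough: \<open>'m\<close> carries \<open>P\<close> itself, and
  \<open>'m \<Rightarrow> 'a\<close> carries the free module on the set \<open>carrier P\<close> (finitely supported functions).
  Hence the test includes the canonical surjection from this free module onto \<open>P\<close>; a splitting of
  it exhibits \<open>P\<close> as a direct summand of a free module, which yields the lifting property for
  modules carried by arbitrary types.
\<close>

definition projective_module :: "('a, 'c) ring_scheme \<Rightarrow> ('a, 'm) module \<Rightarrow> bool"
  where "projective_module A P \<longleftrightarrow> left_module A P \<and>
    (\<forall>(N :: ('a, 'm \<Rightarrow> 'a) module) (N' :: ('a, 'm) module) g f.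
      left_module A N \<longrightarrow> left_module A N' \<longrightarrow>
      g \<in> mod_hom A N N' \<longrightarrow> g ` carrier N = carrier N' \<longrightarrow> f \<in> mod_hom A P N' \<longrightarrow>
      (\<exists>h\<in>mod_hom A P N. \<forall>x\<in>carrier P. g (h x) = f x))"

section \<open>Tensor products and flat modules\<close>

definition tensor_relators ::
    "('a, 'c) ring_scheme \<Rightarrow> ('a, 'n) module \<Rightarrow> ('a, 'm) module \<Rightarrow> (('n \<times> 'm) \<Rightarrow>\<^sub>0 int) set"
  where "tensor_relators A N M =
      {frag_of (x \<oplus>\<^bsub>N\<^esub> x', y) - frag_of (x, y) - frag_of (x', y) | x x' y.
        x \<in> carrier N \<and> x' \<in> carrier N \<and> y \<in> carrier M}
    \<union> {frag_of (x, y \<oplus>\<^bsub>M\<^esub> y') - frag_of (x, y) - frag_of (x, y') | x y y'.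
        x \<in> carrier N \<and> y \<in> carrier M \<and> y' \<in> carrier M}
    \<union> {frag_of (a \<odot>\<^bsub>N\<^esub> x, y) - frag_of (x, a \<odot>\<^bsub>M\<^esub> y) | a x y.
        a \<in> carrier A \<and> x \<in> carrier N \<and> y \<in> carrier M}"

definition tensor_null ::
    "('a, 'c) ring_scheme \<Rightarrow> ('a, 'n) module \<Rightarrow> ('a, 'm) module \<Rightarrow> (('n \<times> 'm) \<Rightarrow>\<^sub>0 int) set"
  where "tensor_null A N M =
    generate (free_Abelian_group (carrier N \<times> carrier M)) (tensor_relators A N M)"

text \<open>The abelian group \<open>N \<otimes>\<^sub>A M\<close> of a right module \<open>N\<close> and a left module \<open>M\<close>.\<close>

definition tensor_product ::
    "('a, 'c) ring_scheme \<Rightarrow> ('a, 'n) module \<Rightarrow> ('a, 'm) module \<Rightarrow> (('n \<times> 'm) \<Rightarrow>\<^sub>0 int) set monoid"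
  where "tensor_product A N M =
    free_Abelian_group (carrier N \<times> carrier M) Mod tensor_null A N M"

text \<open>
  The map \<open>f \<otimes> id : N \<otimes>\<^sub>A M \<rightarrow> N' \<otimes>\<^sub>A M\<close>. Elements of a tensor product are cosets; the cosets in the
  union below all coincide if \<open>f\<close> is a homomorphism of right modules.
\<close>

definition tensor_map ::
    "('a, 'c) ring_scheme \<Rightarrow> ('a, 'n') module \<Rightarrow> ('a, 'm) module \<Rightarrow> ('n \<Rightarrow> 'n')
      \<Rightarrow> (('n \<times> 'm) \<Rightarrow>\<^sub>0 int) set \<Rightarrow> (('n' \<times> 'm) \<Rightarrow>\<^sub>0 int) set"
  where "tensor_map A N' M f C =
    (\<Union>w\<in>C. r_coset (free_Abelian_group (carrier N' \<times> carrier M)) (tensor_null A N' M)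
             (frag_extend (\<lambda>(x, y). frag_of (f x, y)) w))"

text \<open>
  Flatness: tensoring with \<open>M\<close> preserves injectivity of homomorphisms of right modules. The test
  modules are carried by the type \<open>'a\<close> of the scalars. This is no restriction: they include
  the inclusions of all right ideals into the ring, and by the ideal criterion these already
  imply flatness with respect to modules carried by arbitrary types.
\<close>

definition flat_module :: "('a, 'c) ring_scheme \<Rightarrow> ('a, 'm) module \<Rightarrow> bool"
  where "flat_module A M \<longleftrightarrow> left_module A M \<and>
    (\<forall>(N :: ('a, 'a) module) (N' :: ('a, 'a) module) f.
      right_module A N \<longrightarrow> right_module A N' \<longrightarrow>
      f \<in> mod_hom A N N' \<longrightarrow> inj_on f (carrier N) \<longrightarrow>
      inj_on (tensor_map A N' M f) (carrier (tensor_product A N M)))"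

section \<open>Resolutions, projective and flat dimension\<close>

text \<open>Exactness of \<open>\<dots> \<rightarrow> P\<^sub>2 \<rightarrow> P\<^sub>1 \<rightarrow> P\<^sub>0 \<rightarrow> M \<rightarrow> 0\<close>, with \<open>d i : P\<^sub>i\<^sub>+\<^sub>1 \<rightarrow> P\<^sub>i\<close> and augmentation \<open>e\<close>.\<close>

definition resolution ::
    "('a, 'c) ring_scheme \<Rightarrow> ('a, 'm) module
      \<Rightarrow> (nat \<Rightarrow> ('a, 'u) module) \<Rightarrow> (nat \<Rightarrow> 'u \<Rightarrow> 'u) \<Rightarrow> ('u \<Rightarrow> 'm) \<Rightarrow> bool"
  where "resolution A M P d e \<longleftrightarrow>
    left_module A M \<and> (\<forall>i. left_module A (P i)) \<and>
    e \<in> mod_hom A (P 0) M \<and> (\<forall>i. d i \<in> mod_hom A (P (Suc i)) (P i)) \<and>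
    e ` carrier (P 0) = carrier M \<and>
    d 0 ` carrier (P 1) = a_kernel (P 0) M e \<and>
    (\<forall>i. d (Suc i) ` carrier (P (Suc (Suc i))) = a_kernel (P (Suc i)) (P i) (d i))"

definition vanishes_above :: "nat \<Rightarrow> (nat \<Rightarrow> ('a, 'u) module) \<Rightarrow> bool"
  where "vanishes_above n P \<longleftrightarrow> (\<forall>i>n. carrier (P i) = {\<zero>\<^bsub>P i\<^esub>})"

text \<open>
  The dimensions are relative to the type \<open>'u\<close> carrying the modules of the resolutions. They are the
  usual ones as soon as \<open>'u\<close> carries some free resolution of \<open>M\<close>: if \<open>M\<close> has any projective (flat)
  resolution of length \<open>n\<close>, then by the generalised Schanuel lemma (by dimension shifting for Tor)
  the \<open>n\<close>-th syzygy in that free resolution is projective (flat), so truncating there gives a resolution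
  of length \<open>n\<close> carried by \<open>'u\<close>. The infimum of the empty set is \<open>\<infinity>\<close>.
\<close>

definition projective_dim :: "'u itself \<Rightarrow> ('a, 'c) ring_scheme \<Rightarrow> ('a, 'm) module \<Rightarrow> enat"
  where "projective_dim _ A M =
    Inf {enat n | n. \<exists>(P :: nat \<Rightarrow> ('a, 'u) module) d e.
      resolution A M P d e \<and> (\<forall>i. projective_module A (P i)) \<and> vanishes_above n P}"

definition flat_dim :: "'u itself \<Rightarrow> ('a, 'c) ring_scheme \<Rightarrow> ('a, 'm) module \<Rightarrow> enat"
  where "flat_dim _ A M =
    Inf {enat n | n. \<exists>(P :: nat \<Rightarrow> ('a, 'u) module) d e.
      resolution A M P d e \<and> (\<forall>i. flat_module A (P i)) \<and> vanishes_above n P}"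

section \<open>Group rings and the dimensions of a group\<close>

definition supp :: "('r, 'c) ring_scheme \<Rightarrow> ('g \<Rightarrow> 'r) \<Rightarrow> 'g set"
  where "supp R f = {x. f x \<noteq> \<zero>\<^bsub>R\<^esub>}"

text \<open>
  Elements are functions vanishing outside the group, so that the group ring of a subgroup
  is literally a subring.
\<close>

definition group_ring ::
    "('r, 'c) ring_scheme \<Rightarrow> ('g, 'd) monoid_scheme \<Rightarrow> ('g \<Rightarrow> 'r) ring"
  where "group_ring R G =
    \<lparr>carrier = {f. (\<forall>x. f x \<in> carrier R) \<and> supp R f \<subseteq> carrier G \<and> finite (supp R f)},
     monoid.mult = (\<lambda>f g x. \<Oplus>\<^bsub>R\<^esub>p\<in>{(y, z). y \<in> supp R f \<and> z \<in> supp R g \<and> y \<otimes>\<^bsub>G\<^esub> z = x}.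
                       f (fst p) \<otimes>\<^bsub>R\<^esub> g (snd p)),
     one = (\<lambda>x. if x = \<one>\<^bsub>G\<^esub> then \<one>\<^bsub>R\<^esub> else \<zero>\<^bsub>R\<^esub>),
     ring.zero = (\<lambda>x. \<zero>\<^bsub>R\<^esub>),
     ring.add = (\<lambda>f g x. f x \<oplus>\<^bsub>R\<^esub> g x)\<rparr>"

text \<open>The module \<open>R\<close> on which every group element acts as the identity.\<close>

definition trivial_module ::
    "('r, 'c) ring_scheme \<Rightarrow> ('g \<Rightarrow> 'r, 'r) module"
  where "trivial_module R =
    \<lparr>carrier = carrier R, monoid.mult = monoid.mult R, one = \<one>\<^bsub>R\<^esub>, ring.zero = \<zero>\<^bsub>R\<^esub>, ring.add = ring.add R,
     smult = (\<lambda>f r. (\<Oplus>\<^bsub>R\<^esub>x\<in>supp R f. f x) \<otimes>\<^bsub>R\<^esub> r)\<rparr>"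

text \<open>
  The type \<open>'g list \<Rightarrow> 'g \<Rightarrow> 'r\<close> carries the bar resolution of the trivial module, whose \<open>n\<close>-th term is
  the free module over the group ring on the set of lists of length \<open>n\<close> of group elements.
\<close>

definition cd :: "('r, 'c) ring_scheme \<Rightarrow> ('g, 'd) monoid_scheme \<Rightarrow> enat"
  where "cd R G =
    projective_dim TYPE('g list \<Rightarrow> 'g \<Rightarrow> 'r) (group_ring R G) (trivial_module R)"

text \<open>Primed because \<^const>\<open>hd\<close> is the head of a list.\<close>

definition hd' :: "('r, 'c) ring_scheme \<Rightarrow> ('g, 'd) monoid_scheme \<Rightarrow> enat"
  where "hd' R G =
    flat_dim TYPE('g list \<Rightarrow> 'g \<Rightarrow> 'r) (group_ring R G) (trivial_module R)"

section \<open>Jump (co)homology\<close>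

definition jump_homology_bound ::
    "('r, 'c) ring_scheme \<Rightarrow> ('g, 'd) monoid_scheme \<Rightarrow> nat \<Rightarrow> bool"
  where "jump_homology_bound R G k \<longleftrightarrow>
    (\<forall>H. subgroup H G \<longrightarrow>
      hd' R (G\<lparr>carrier := H\<rparr>) = \<infinity> \<or> hd' R (G\<lparr>carrier := H\<rparr>) \<le> enat k)"

definition jump_cohomology_bound ::
    "('r, 'c) ring_scheme \<Rightarrow> ('g, 'd) monoid_scheme \<Rightarrow> nat \<Rightarrow> bool"
  where "jump_cohomology_bound R G k \<longleftrightarrow>
    (\<forall>H. subgroup H G \<longrightarrow>
      cd R (G\<lparr>carrier := H\<rparr>) = \<infinity> \<or> cd R (G\<lparr>carrier := H\<rparr>) \<le> enat k)"

definition jump_homology :: "('r, 'c) ring_scheme \<Rightarrow> ('g, 'd) monoid_scheme \<Rightarrow> bool"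
  where "jump_homology R G \<longleftrightarrow> (\<exists>k. jump_homology_bound R G k)"

definition jump_cohomology :: "('r, 'c) ring_scheme \<Rightarrow> ('g, 'd) monoid_scheme \<Rightarrow> bool"
  where "jump_cohomology R G \<longleftrightarrow> (\<exists>k. jump_cohomology_bound R G k)"

text \<open>The jump heights are meaningful only if \<open>G\<close> has jump homology or jump cohomology, respectively.\<close>

definition hjh :: "('r, 'c) ring_scheme \<Rightarrow> ('g, 'd) monoid_scheme \<Rightarrow> nat"
  where "hjh R G = (LEAST k. jump_homology_bound R G k)"

definition cjh :: "('r, 'c) ring_scheme \<Rightarrow> ('g, 'd) monoid_scheme \<Rightarrow> nat"
  where "cjh R G = (LEAST k. jump_cohomology_bound R G k)"

section \<open>Torsion groups\<close>

definition torsion_group :: "('g, 'd) monoid_scheme \<Rightarrow> bool"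
  where "torsion_group G \<longleftrightarrow>
    group G \<and> (\<forall>x\<in>carrier G. \<exists>n::nat. n > 0 \<and> x [^]\<^bsub>G\<^esub> n = \<one>\<^bsub>G\<^esub>)"

text \<open>The order \<open>n\<close> of an element is viewed in \<open>R\<close> as \<open>n \<cdot> 1\<close>.\<close>

definition R_torsion_group :: "('r, 'c) ring_scheme \<Rightarrow> ('g, 'd) monoid_scheme \<Rightarrow> bool"
  where "R_torsion_group R G \<longleftrightarrow> torsion_group G \<and>
    (\<forall>x\<in>carrier G. x \<noteq> \<one>\<^bsub>G\<^esub> \<longrightarrow> [group.ord G x] \<cdot>\<^bsub>R\<^esub> \<one>\<^bsub>R\<^esub> \<notin> Units R)"

end

theory Submission
  imports Defs
begin

text \<open>
  Part (1) is immediate: a subgroup of a subgroup of \<open>G\<close> is a subgroup of \<open>G\<close>, so a bound for \<open>G\<close> is a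
  bound for \<open>S\<close>. The other two parts rest on four facts about the dimensions of a group \<open>H\<close>:

  \<^item> \<open>hd H \<le> cd H\<close>, because projective modules are flat;
  \<^item> \<open>cd H \<le> hd H + 1\<close> if \<open>H\<close> is countable (\<open>cd_le_Suc\<close>);
  \<^item> \<open>hd K \<le> hd H\<close> for a subgroup \<open>K\<close> of \<open>H\<close> (\<open>hd'_subgroup_le\<close>);
  \<^item> \<open>hd H\<close> is the supremum of \<open>hd K\<close> over the countable subgroups \<open>K\<close> of \<open>H\<close>
    (\<open>hd'_le_of_countable_subgroups\<close>).

  For part (3), let \<open>k\<close> be a bound for the finite cohomological dimensions of subgroups and let \<open>hd H\<close> be
  finite. If \<open>H\<close> is uncountable, this gives no control over \<open>cd H\<close>, so the bound cannot be applied to \<open>H\<close> itself.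
  However, each countable subgroup \<open>K\<close> of \<open>H\<close> has \<open>hd K \<le> hd H\<close>, hence \<open>cd K\<close> is finite, hence
  \<open>hd K \<le> cd K \<le> k\<close>; by the last fact \<open>hd H \<le> k\<close>. For countable \<open>G\<close> the first two facts give the rest.

  For part (2), an element of infinite order generates an infinite cyclic group \<open>C\<close>. Its augmentation
  ideal is free on \<open>x - 1\<close>, so \<open>cd C \<le> 1\<close>; and \<open>R \<noteq> 0\<close> is not flat over the group ring, as \<open>x - 1\<close> is regular
  in the group ring but acts as zero on \<open>R\<close>. Hence \<open>hd C = 1\<close>, and the jump height is not zero.
  Conversely, for a finite cyclic group of order \<open>n\<close> with generator \<open>x\<close> and norm \<open>\<nu>\<close> (the sum of all group elements)
  multiplications by \<open>x - 1\<close> and by \<open>\<nu>\<close> alternate in an exact sequence on each flat module. A flat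
  resolution of finite length passes this exactness on to \<open>R\<close>, where \<open>x - 1\<close> acts as zero and \<open>\<nu>\<close> as \<open>n\<close>; so \<open>n\<close> is
  invertible in \<open>R\<close> (\<open>finite_cyclic_order_unit\<close>). In an \<open>R\<close>-torsion group all nontrivial subgroups
  therefore have infinite dimensions.

  The four facts are reduced to linear algebra with homomorphisms between free modules.
  First, flatness is equivalent to the equational criterion: a homomorphism from a finite free module to
  \<open>M\<close> that kills \<open>r\<close> factors through a finite free module in which \<open>r\<close> already dies
  (\<open>flat_iff_equationally_flat\<close>). Tensor products do not occur afterwards. Second, the quotient of a
  free module \<open>F\<close> by a submodule \<open>L\<close> is flat iff each finite subset of \<open>L\<close> is fixed by some homomorphism
  \<open>F \<rightarrow> L\<close>; here \<open>L\<close> is called locally split. Comparing a flat resolution with the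
  bar resolution by a mapping cone, one finds that \<open>hd H \<le> n\<close> iff the image of the \<open>n\<close>-th bar differential is locally
  split (\<open>hd'_le_iff\<close>). Third, countably generated locally split submodules are projective
  (\<open>locally_split_countable_imp_projective\<close>), which gives \<open>cd \<le> hd + 1\<close>. Finally, the bar resolution of a
  subgroup is literally contained in that of the group, and a finite set of elements involves only finitely
  many group elements; so the splitting homomorphisms required for \<open>H\<close> can be extended from those of
  finitely generated subgroups. Monotonicity of \<open>hd\<close> holds because the group ring is free over the group
  ring of a subgroup, so that flat resolutions can be restricted.
\<close>

section \<open>Modules and their homomorphisms\<close>

lemma left_module_abelian: "left_module A M \<Longrightarrow> abelian_group M"
  by (rule left_module.axioms)

context left_module
begin

lemma smult_l_zero: "x \<in> carrier M \<Longrightarrow> \<zero>\<^bsub>A\<^esub> \<odot>\<^bsub>M\<^esub> x = \<zero>\<^bsub>M\<^esub>"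
  by (metis A.r_zero A.zero_closed M.add.l_cancel_one' M.r_zero smult_closed smult_l_distr M.add.r_cancel_one')

lemma smult_r_zero: "a \<in> carrier A \<Longrightarrow> a \<odot>\<^bsub>M\<^esub> \<zero>\<^bsub>M\<^esub> = \<zero>\<^bsub>M\<^esub>"
  by (metis M.add.r_cancel_one' M.r_zero M.zero_closed smult_closed smult_r_distr)

lemma smult_l_minus:
  assumes "a \<in> carrier A" "x \<in> carrier M" shows "(\<ominus>\<^bsub>A\<^esub> a) \<odot>\<^bsub>M\<^esub> x = \<ominus>\<^bsub>M\<^esub> (a \<odot>\<^bsub>M\<^esub> x)"
proof -
  have "(\<ominus>\<^bsub>A\<^esub> a) \<odot>\<^bsub>M\<^esub> x \<oplus>\<^bsub>M\<^esub> a \<odot>\<^bsub>M\<^esub> x = \<zero>\<^bsub>M\<^esub>"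
    using assms by (metis A.a_inv_closed A.l_neg smult_l_distr smult_l_zero)
  thus ?thesis using assms by (simp add: M.minus_equality smult_closed)
qed

lemma smult_r_minus:
  assumes "a \<in> carrier A" "x \<in> carrier M" shows "a \<odot>\<^bsub>M\<^esub> (\<ominus>\<^bsub>M\<^esub> x) = \<ominus>\<^bsub>M\<^esub> (a \<odot>\<^bsub>M\<^esub> x)"
proof -
  have "a \<odot>\<^bsub>M\<^esub> (\<ominus>\<^bsub>M\<^esub> x) \<oplus>\<^bsub>M\<^esub> a \<odot>\<^bsub>M\<^esub> x = \<zero>\<^bsub>M\<^esub>"
    using assms by (metis M.a_inv_closed M.l_neg smult_r_distr smult_r_zero)
  thus ?thesis using assms by (simp add: M.minus_equality smult_closed)
qed

lemma smult_finsum: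
  "finite S \<Longrightarrow> f \<in> S \<rightarrow> carrier M \<Longrightarrow> a \<in> carrier A \<Longrightarrow>
    a \<odot>\<^bsub>M\<^esub> (\<Oplus>\<^bsub>M\<^esub>x\<in>S. f x) = (\<Oplus>\<^bsub>M\<^esub>x\<in>S. a \<odot>\<^bsub>M\<^esub> f x)"
proof (induction S rule: finite_induct)
  case (insert x F)
  have "f \<in> F \<rightarrow> carrier M" "f x \<in> carrier M" using insert by auto
  moreover have "(\<lambda>x. a \<odot>\<^bsub>M\<^esub> f x) \<in> F \<rightarrow> carrier M" using insert smult_closed by auto
  ultimately show ?case
    using insert by (simp add: smult_r_distr smult_closed)
qed (simp add: smult_r_zero)

end

lemma left_moduleI:
  assumes "ring A" "abelian_group M"
    and "\<And>a x. a \<in> carrier A \<Longrightarrow> x \<in> carrier M \<Longrightarrow> a \<odot>\<^bsub>M\<^esub> x \<in> carrier M"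
    and "\<And>a b x. a \<in> carrier A \<Longrightarrow> b \<in> carrier A \<Longrightarrow> x \<in> carrier M \<Longrightarrow>
        (a \<oplus>\<^bsub>A\<^esub> b) \<odot>\<^bsub>M\<^esub> x = (a \<odot>\<^bsub>M\<^esub> x) \<oplus>\<^bsub>M\<^esub> (b \<odot>\<^bsub>M\<^esub> x)"
    and "\<And>a x y. a \<in> carrier A \<Longrightarrow> x \<in> carrier M \<Longrightarrow> y \<in> carrier M \<Longrightarrow>
        a \<odot>\<^bsub>M\<^esub> (x \<oplus>\<^bsub>M\<^esub> y) = (a \<odot>\<^bsub>M\<^esub> x) \<oplus>\<^bsub>M\<^esub> (a \<odot>\<^bsub>M\<^esub> y)"
    and "\<And>a b x. a \<in> carrier A \<Longrightarrow> b \<in> carrier A \<Longrightarrow> x \<in> carrier M \<Longrightarrow>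
        (a \<otimes>\<^bsub>A\<^esub> b) \<odot>\<^bsub>M\<^esub> x = a \<odot>\<^bsub>M\<^esub> (b \<odot>\<^bsub>M\<^esub> x)"
    and "\<And>x. x \<in> carrier M \<Longrightarrow> \<one>\<^bsub>A\<^esub> \<odot>\<^bsub>M\<^esub> x = x"
  shows "left_module A M"
  using assms by (intro left_module.intro left_module_axioms.intro) auto

lemma mod_homI:
  assumes "\<And>x. x \<in> carrier M \<Longrightarrow> f x \<in> carrier N"
    and "\<And>x y. x \<in> carrier M \<Longrightarrow> y \<in> carrier M \<Longrightarrow> f (x \<oplus>\<^bsub>M\<^esub> y) = f x \<oplus>\<^bsub>N\<^esub> f y"
    and "\<And>a x. a \<in> carrier A \<Longrightarrow> x \<in> carrier M \<Longrightarrow> f (a \<odot>\<^bsub>M\<^esub> x) = a \<odot>\<^bsub>N\<^esub> f x"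
  shows "f \<in> mod_hom A M N"
  using assms by (auto simp: mod_hom_def)

lemma mod_hom_closed: "f \<in> mod_hom A M N \<Longrightarrow> x \<in> carrier M \<Longrightarrow> f x \<in> carrier N"
  by (auto simp: mod_hom_def)

lemma mod_hom_add:
  "f \<in> mod_hom A M N \<Longrightarrow> x \<in> carrier M \<Longrightarrow> y \<in> carrier M \<Longrightarrow> f (x \<oplus>\<^bsub>M\<^esub> y) = f x \<oplus>\<^bsub>N\<^esub> f y"
  by (auto simp: mod_hom_def)

lemma mod_hom_smult:
  "f \<in> mod_hom A M N \<Longrightarrow> a \<in> carrier A \<Longrightarrow> x \<in> carrier M \<Longrightarrow> f (a \<odot>\<^bsub>M\<^esub> x) = a \<odot>\<^bsub>N\<^esub> f x"
  by (auto simp: mod_hom_def)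

lemma mod_hom_zero:
  assumes "abelian_group M" "abelian_group N" "f \<in> mod_hom A M N"
  shows "f \<zero>\<^bsub>M\<^esub> = \<zero>\<^bsub>N\<^esub>"
proof -
  interpret M: abelian_group M by fact
  interpret N: abelian_group N by fact
  have "f \<zero>\<^bsub>M\<^esub> = f \<zero>\<^bsub>M\<^esub> \<oplus>\<^bsub>N\<^esub> f \<zero>\<^bsub>M\<^esub>"
    using mod_hom_add[OF assms(3), of "\<zero>\<^bsub>M\<^esub>" "\<zero>\<^bsub>M\<^esub>"] by simp
  thus ?thesis using mod_hom_closed[OF assms(3), of "\<zero>\<^bsub>M\<^esub>"]
    by (metis M.zero_closed N.add.l_cancel_one')
qed

lemma mod_hom_minus:
  assumes "abelian_group M" "abelian_group N" "f \<in> mod_hom A M N" "x \<in> carrier M"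
  shows "f (\<ominus>\<^bsub>M\<^esub> x) = \<ominus>\<^bsub>N\<^esub> f x"
proof -
  interpret M: abelian_group M by fact
  interpret N: abelian_group N by fact
  have "f (\<ominus>\<^bsub>M\<^esub> x) \<oplus>\<^bsub>N\<^esub> f x = \<zero>\<^bsub>N\<^esub>"
    using mod_hom_add[OF assms(3), of "\<ominus>\<^bsub>M\<^esub> x" x] mod_hom_zero[OF assms(1-3)] assms(4)
    by (simp add: M.l_neg)
  thus ?thesis using mod_hom_closed[OF assms(3)] assms(4)
    by (simp add: N.minus_equality)
qed

lemma mod_hom_diff:
  assumes "abelian_group M" "abelian_group N" "f \<in> mod_hom A M N" "x \<in> carrier M" "y \<in> carrier M"
  shows "f (x \<ominus>\<^bsub>M\<^esub> y) = f x \<ominus>\<^bsub>N\<^esub> f y"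
proof -
  interpret M: abelian_group M by fact
  show ?thesis unfolding a_minus_def
    using assms mod_hom_add[OF assms(3), of x "\<ominus>\<^bsub>M\<^esub> y"] mod_hom_minus[OF assms(1-3)] by simp
qed

lemma mod_hom_id: "(\<lambda>x. x) \<in> mod_hom A M M"
  by (auto simp: mod_hom_def)

lemma mod_hom_comp:
  "f \<in> mod_hom A M N \<Longrightarrow> g \<in> mod_hom A N L \<Longrightarrow> (\<lambda>x. g (f x)) \<in> mod_hom A M L"
  by (auto simp: mod_hom_def Pi_iff)

lemma mod_hom_plus:
  assumes N: "left_module A N" and f: "f \<in> mod_hom A M N" and g: "g \<in> mod_hom A M N"
  shows "(\<lambda>x. f x \<oplus>\<^bsub>N\<^esub> g x) \<in> mod_hom A M N"
proof -
  interpret N: left_module A N by fact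
  show ?thesis
    using mod_hom_closed[OF f] mod_hom_closed[OF g]
    by (intro mod_homI)
       (simp_all add: mod_hom_add[OF f] mod_hom_add[OF g] mod_hom_smult[OF f] mod_hom_smult[OF g]
         N.smult_r_distr N.M.a_ac)
qed

lemma mod_hom_sub:
  assumes N: "left_module A N" and f: "f \<in> mod_hom A M N" and g: "g \<in> mod_hom A M N"
  shows "(\<lambda>x. f x \<ominus>\<^bsub>N\<^esub> g x) \<in> mod_hom A M N"
proof -
  interpret N: left_module A N by fact
  show ?thesis
    using mod_hom_closed[OF f] mod_hom_closed[OF g]
    by (intro mod_homI)
       (simp_all add: a_minus_def mod_hom_add[OF f] mod_hom_add[OF g] mod_hom_smult[OF f] mod_hom_smult[OF g]
         N.smult_r_distr N.smult_r_minus N.M.minus_add N.smult_closed N.M.a_ac)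
qed

lemma mod_hom_const_zero: "left_module A N \<Longrightarrow> (\<lambda>x. \<zero>\<^bsub>N\<^esub>) \<in> mod_hom A M N"
proof -
  assume "left_module A N"
  interpret N: left_module A N by fact
  show ?thesis by (intro mod_homI) (simp_all add: N.smult_r_zero)
qed

lemma mod_hom_restrict:
  "f \<in> mod_hom A M N \<Longrightarrow> S \<subseteq> carrier M \<Longrightarrow> f \<in> mod_hom A (M\<lparr>carrier := S\<rparr>) N"
  by (auto simp: mod_hom_def Pi_iff subset_iff)

lemma mod_hom_corestrict:
  "f \<in> mod_hom A M N \<Longrightarrow> f ` carrier M \<subseteq> S \<Longrightarrow> f \<in> mod_hom A M (N\<lparr>carrier := S\<rparr>)"
  by (auto simp: mod_hom_def Pi_iff)

lemma mod_hom_into_larger: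
  "f \<in> mod_hom A M (N\<lparr>carrier := S\<rparr>) \<Longrightarrow> S \<subseteq> carrier N \<Longrightarrow> f \<in> mod_hom A M N"
  by (auto simp: mod_hom_def Pi_iff)

text \<open>
  A submodule is given by its carrier only, so that the submodule as a module in its own right is
  \<open>M\<lparr>carrier := S\<rparr>\<close>, with the operations of \<open>M\<close>.
\<close>

definition submodule_set :: "('a, 'c) ring_scheme \<Rightarrow> ('a, 'm) module \<Rightarrow> 'm set \<Rightarrow> bool"
  where "submodule_set A M S \<longleftrightarrow> S \<subseteq> carrier M \<and> \<zero>\<^bsub>M\<^esub> \<in> S \<and> (\<forall>x\<in>S. \<forall>y\<in>S. x \<oplus>\<^bsub>M\<^esub> y \<in> S)
    \<and> (\<forall>a\<in>carrier A. \<forall>x\<in>S. a \<odot>\<^bsub>M\<^esub> x \<in> S)"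

lemma left_module_submodule:
  assumes M: "left_module A M" and S: "submodule_set A M S"
  shows "left_module A (M\<lparr>carrier := S\<rparr>)"
proof -
  interpret M: left_module A M by fact
  note * = S[unfolded submodule_set_def]
  have inv: "\<ominus>\<^bsub>M\<^esub> x \<in> S" if "x \<in> S" for x
  proof -
    have "(\<ominus>\<^bsub>A\<^esub> \<one>\<^bsub>A\<^esub>) \<odot>\<^bsub>M\<^esub> x = \<ominus>\<^bsub>M\<^esub> x"
      using that * by (subst M.smult_l_minus) (auto simp: M.smult_one)
    thus ?thesis using * that by (metis M.A.a_inv_closed M.A.one_closed)
  qed
  have "abelian_group (M\<lparr>carrier := S\<rparr>)"
  proof (rule abelian_groupI, goal_cases)
    case (6 x)
    then show ?case using inv * by (auto intro!: bexI[of _ "\<ominus>\<^bsub>M\<^esub> x"] M.M.l_neg)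
  qed (use * in \<open>auto simp: subset_iff M.M.a_ac\<close>)
  thus ?thesis
    using * by (intro left_moduleI)
      (auto simp: subset_iff M.A.ring_axioms M.smult_l_distr M.smult_r_distr M.smult_assoc M.smult_one)
qed

lemma a_kernel_eq: "a_kernel M N f = {x \<in> carrier M. f x = \<zero>\<^bsub>N\<^esub>}"
  by (auto simp: a_kernel_def kernel_def)

lemma submodule_set_kernel:
  assumes M: "left_module A M" and N: "left_module A N" and f: "f \<in> mod_hom A M N"
  shows "submodule_set A M (a_kernel M N f)"
proof -
  interpret M: left_module A M by fact
  interpret N: left_module A N by fact
  show ?thesis unfolding submodule_set_def a_kernel_eq
    using mod_hom_zero[OF M.M.abelian_group_axioms N.M.abelian_group_axioms f]
    by (auto simp: mod_hom_add[OF f] mod_hom_smult[OF f] M.smult_closed N.smult_r_zero)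
qed

lemma submodule_set_image:
  assumes M: "left_module A M" and N: "left_module A N" and f: "f \<in> mod_hom A M N"
  shows "submodule_set A N (f ` carrier M)"
proof -
  interpret M: left_module A M by fact
  interpret N: left_module A N by fact
  show ?thesis unfolding submodule_set_def
    using mod_hom_zero[OF M.M.abelian_group_axioms N.M.abelian_group_axioms f] mod_hom_closed[OF f]
    by (auto simp: mod_hom_add[OF f, symmetric] mod_hom_smult[OF f, symmetric] M.smult_closed
        intro!: imageI intro: rev_image_eqI[of "\<zero>\<^bsub>M\<^esub>"])
qed

section \<open>Free modules\<close>

text \<open>
  The finitely supported functions on \<open>I\<close>, defined on the whole index type. Consequently an element of a free module on
  \<open>I\<close> is also an element of the free module on any larger set, and of the free module over any larger ring with the
  same zero. Only this makes the bar resolution of a subgroup a part of that of the group.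
\<close>

definition free_mod :: "('a, 'c) ring_scheme \<Rightarrow> 'i set \<Rightarrow> ('a, 'i \<Rightarrow> 'a) module"
  where "free_mod A I =
    \<lparr>carrier = {f. (\<forall>x. f x \<in> carrier A) \<and> finite {x. f x \<noteq> \<zero>\<^bsub>A\<^esub>} \<and> {x. f x \<noteq> \<zero>\<^bsub>A\<^esub>} \<subseteq> I},
     monoid.mult = (\<lambda>f g. f), one = (\<lambda>x. \<zero>\<^bsub>A\<^esub>),
     ring.zero = (\<lambda>x. \<zero>\<^bsub>A\<^esub>),
     ring.add = (\<lambda>f g x. f x \<oplus>\<^bsub>A\<^esub> g x),
     smult = (\<lambda>a f x. a \<otimes>\<^bsub>A\<^esub> f x)\<rparr>"

definition free_basis :: "('a, 'c) ring_scheme \<Rightarrow> 'i \<Rightarrow> 'i \<Rightarrow> 'a"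
  where "free_basis A x = (\<lambda>y. if y = x then \<one>\<^bsub>A\<^esub> else \<zero>\<^bsub>A\<^esub>)"

text \<open>
  The linear extension of a family \<open>v\<close>. It does not mention the index set, hence a family has the same extension
  on all index sets.
\<close>

definition free_ext ::
    "('a, 'c) ring_scheme \<Rightarrow> ('a, 'm) module \<Rightarrow> ('i \<Rightarrow> 'm) \<Rightarrow> ('i \<Rightarrow> 'a) \<Rightarrow> 'm"
  where "free_ext A M v f = (\<Oplus>\<^bsub>M\<^esub>x\<in>{x. f x \<noteq> \<zero>\<^bsub>A\<^esub>}. f x \<odot>\<^bsub>M\<^esub> v x)"

lemma free_mod_simps [simp]:
  "f \<oplus>\<^bsub>free_mod A I\<^esub> g = (\<lambda>x. f x \<oplus>\<^bsub>A\<^esub> g x)"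
  "\<zero>\<^bsub>free_mod A I\<^esub> = (\<lambda>x. \<zero>\<^bsub>A\<^esub>)"
  "a \<odot>\<^bsub>free_mod A I\<^esub> f = (\<lambda>x. a \<otimes>\<^bsub>A\<^esub> f x)"
  by (simp_all add: free_mod_def)

lemma free_mod_carrier:
  "f \<in> carrier (free_mod A I) \<longleftrightarrow>
    (\<forall>x. f x \<in> carrier A) \<and> finite {x. f x \<noteq> \<zero>\<^bsub>A\<^esub>} \<and> {x. f x \<noteq> \<zero>\<^bsub>A\<^esub>} \<subseteq> I"
  by (simp add: free_mod_def)

lemma free_mod_mono: "I \<subseteq> J \<Longrightarrow> carrier (free_mod A I) \<subseteq> carrier (free_mod A J)"
  unfolding free_mod_def by (simp add: subset_iff)

lemma free_mod_inclusion: "I \<subseteq> J \<Longrightarrow> (\<lambda>v. v) \<in> mod_hom A (free_mod A I) (free_mod A J)"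
  using free_mod_mono[of I J A] by (intro mod_homI) auto

context ring
begin

lemma left_module_free_mod: "left_module R (free_mod R I)"
proof (rule left_moduleI)
  show "ring R" by (rule ring_axioms)
  show "abelian_group (free_mod R I)"
  proof (rule abelian_groupI, goal_cases)
    case (1 f g)
    have "{x. f x \<oplus> g x \<noteq> \<zero>} \<subseteq> {x. f x \<noteq> \<zero>} \<union> {x. g x \<noteq> \<zero>}" by auto
    with 1 show ?case by (auto simp: free_mod_carrier elim: finite_subset)
  next
    case (6 f)
    have "\<ominus> f x \<noteq> \<zero> \<Longrightarrow> f x \<noteq> \<zero>" for x by auto
    hence "{x. \<ominus> f x \<noteq> \<zero>} \<subseteq> {x. f x \<noteq> \<zero>}" by auto
    with 6 show ?case
      by (intro bexI[of _ "\<lambda>x. \<ominus> f x"]) (auto simp: free_mod_carrier l_neg elim: finite_subset)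
  qed (auto simp: free_mod_carrier a_ac)
next
  fix a f assume a: "a \<in> carrier R" and f: "f \<in> carrier (free_mod R I)"
  have "{x. a \<otimes> f x \<noteq> \<zero>} \<subseteq> {x. f x \<noteq> \<zero>}" using a by auto
  with a f show "a \<odot>\<^bsub>free_mod R I\<^esub> f \<in> carrier (free_mod R I)"
    by (auto simp: free_mod_carrier elim: finite_subset)
qed (auto simp: free_mod_carrier l_distr r_distr m_assoc)

lemma abelian_group_free_mod: "abelian_group (free_mod R I)"
  by (rule left_module_abelian[OF left_module_free_mod])

lemma free_mod_minus:
  assumes "f \<in> carrier (free_mod R I)" shows "\<ominus>\<^bsub>free_mod R I\<^esub> f = (\<lambda>x. \<ominus> f x)"
proof -
  interpret F: abelian_group "free_mod R I" by (rule abelian_group_free_mod)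
  have eq: "{x. \<ominus> f x \<noteq> \<zero>} = {x. f x \<noteq> \<zero>}"
    using assms by (auto simp: free_mod_carrier)
  show ?thesis
    by (rule F.minus_equality) (use assms eq in \<open>auto simp: free_mod_carrier l_neg\<close>)
qed

lemma free_mod_diff:
  assumes "f \<in> carrier (free_mod R I)" "g \<in> carrier (free_mod R I)"
  shows "f \<ominus>\<^bsub>free_mod R I\<^esub> g = (\<lambda>x. f x \<ominus> g x)"
  using assms by (simp add: a_minus_def free_mod_minus)

lemma free_basis_closed: "x \<in> I \<Longrightarrow> free_basis R x \<in> carrier (free_mod R I)"
  by (auto simp: free_basis_def free_mod_carrier)

lemma smult_free_basis:
  "a \<in> carrier R \<Longrightarrow> a \<odot>\<^bsub>free_mod R I\<^esub> free_basis R x = (\<lambda>y. if y = x then a else \<zero>)"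
  by (auto simp: free_basis_def)

text \<open>
  Additivity reduces a statement on a free module to single multiples of basis vectors; for homomorphisms
  and for the contracting homotopy of the bar resolution this is where computations become possible.
\<close>

lemma free_mod_induct [consumes 1, case_names zero add basis]:
  assumes "f \<in> carrier (free_mod R I)"
    and zero: "P (\<lambda>x. \<zero>)"
    and add: "\<And>f g. f \<in> carrier (free_mod R I) \<Longrightarrow> g \<in> carrier (free_mod R I) \<Longrightarrow> P f \<Longrightarrow> P g
      \<Longrightarrow> P (f \<oplus>\<^bsub>free_mod R I\<^esub> g)"
    and basis: "\<And>a x. a \<in> carrier R \<Longrightarrow> x \<in> I \<Longrightarrow> P (a \<odot>\<^bsub>free_mod R I\<^esub> free_basis R x)"
  shows "P f"
proof -
  have "P f" if "finite S" "S = {x. f x \<noteq> \<zero>}" "f \<in> carrier (free_mod R I)" for S f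
    using that
  proof (induction S arbitrary: f rule: finite_induct)
    case empty
    hence "f = (\<lambda>x. \<zero>)" by auto
    thus ?case using zero by simp
  next
    case (insert x S f)
    let ?g = "f(x := \<zero>)" and ?h = "f x \<odot>\<^bsub>free_mod R I\<^esub> free_basis R x"
    have S: "S = {y. ?g y \<noteq> \<zero>}" using insert.hyps insert.prems(1) by auto
    have x: "x \<in> I" "f x \<in> carrier R" using insert.prems by (auto simp: free_mod_carrier)
    have g: "?g \<in> carrier (free_mod R I)"
      using insert.prems insert.hyps S unfolding free_mod_carrier by (metis fun_upd_apply insert_subset zero_closed)
    have h: "?h \<in> carrier (free_mod R I)"
      by (rule left_module.smult_closed[OF left_module_free_mod x(2) free_basis_closed[OF x(1)]])
    have "f = ?g \<oplus>\<^bsub>free_mod R I\<^esub> ?h"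
      using x insert.prems(2) by (auto simp: fun_eq_iff smult_free_basis free_mod_carrier free_basis_def)
    with add[OF g h insert.IH[OF S g] basis[OF x(2,1)]] show ?case by simp
  qed
  with assms(1) show ?thesis by (auto simp: free_mod_carrier)
qed

lemma mod_hom_free_eqI:
  assumes M: "left_module R M" and f: "f \<in> mod_hom R (free_mod R I) M" and g: "g \<in> mod_hom R (free_mod R I) M"
    and eq: "\<And>x. x \<in> I \<Longrightarrow> f (free_basis R x) = g (free_basis R x)"
    and v: "v \<in> carrier (free_mod R I)"
  shows "f v = g v"
  using v
proof (induction v rule: free_mod_induct)
  case zero
  show ?case
    using mod_hom_zero[OF abelian_group_free_mod left_module_abelian[OF M] f]
      mod_hom_zero[OF abelian_group_free_mod left_module_abelian[OF M] g] by simp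
next
  case (add u v)
  show ?case
    by (simp only: mod_hom_add[OF f add(1,2)] mod_hom_add[OF g add(1,2)] add(3,4))
next
  case (basis a x)
  note b = basis(1) free_basis_closed[OF basis(2)]
  show ?case by (simp only: mod_hom_smult[OF f b] mod_hom_smult[OF g b] eq[OF basis(2)])
qed

text \<open>
  Padding the sum with zero terms allows all elements of a finite free module to be expanded over one index set.
\<close>

lemma free_ext_superset:
  assumes M: "left_module R M" and v: "v \<in> I \<rightarrow> carrier M" and f: "f \<in> carrier (free_mod R I)"
    and S: "finite S" "{x. f x \<noteq> \<zero>} \<subseteq> S" "S \<subseteq> I"
  shows "free_ext R M v f = (\<Oplus>\<^bsub>M\<^esub>x\<in>S. f x \<odot>\<^bsub>M\<^esub> v x)"
proof -
  interpret M: left_module R M by fact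
  show ?thesis unfolding free_ext_def
    using S v f
    by (intro M.M.add.finprod_mono_neutral_cong_left)
       (auto simp: free_mod_carrier Pi_iff subset_iff intro!: M.smult_closed M.smult_l_zero)
qed

lemma free_ext_hom:
  assumes M: "left_module R M" and v: "v \<in> I \<rightarrow> carrier M"
  shows "free_ext R M v \<in> mod_hom R (free_mod R I) M"
proof (rule mod_homI)
  interpret M: left_module R M by fact
  interpret F: left_module R "free_mod R I" by (rule left_module_free_mod)
  have cl: "f x \<odot>\<^bsub>M\<^esub> v x \<in> carrier M" if "f \<in> carrier (free_mod R I)" "x \<in> I" for f x
    using that v by (intro M.smult_closed) (auto simp: free_mod_carrier)
  fix f assume f: "f \<in> carrier (free_mod R I)"
  show "free_ext R M v f \<in> carrier M"
    unfolding free_ext_def using f cl[OF f] by (intro M.M.finsum_closed) (auto simp: free_mod_carrier)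
  {
    fix g assume g: "g \<in> carrier (free_mod R I)"
    let ?S = "{x. f x \<noteq> \<zero>} \<union> {x. g x \<noteq> \<zero>}"
    have S: "finite ?S" "{x. f x \<noteq> \<zero>} \<subseteq> ?S" "{x. g x \<noteq> \<zero>} \<subseteq> ?S" "?S \<subseteq> I"
      "{x. (f \<oplus>\<^bsub>free_mod R I\<^esub> g) x \<noteq> \<zero>} \<subseteq> ?S" using f g by (auto simp: free_mod_carrier)
    have fg: "f \<oplus>\<^bsub>free_mod R I\<^esub> g \<in> carrier (free_mod R I)" using f g by (rule F.M.a_closed)
    have "free_ext R M v (f \<oplus>\<^bsub>free_mod R I\<^esub> g) = (\<Oplus>\<^bsub>M\<^esub>x\<in>?S. (f x \<oplus> g x) \<odot>\<^bsub>M\<^esub> v x)"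
      by (subst free_ext_superset[OF M v fg S(1,5,4)]) simp
    also have "\<dots> = (\<Oplus>\<^bsub>M\<^esub>x\<in>?S. f x \<odot>\<^bsub>M\<^esub> v x \<oplus>\<^bsub>M\<^esub> g x \<odot>\<^bsub>M\<^esub> v x)"
    proof (rule M.M.finsum_cong'[OF refl])
      show "(\<lambda>x. f x \<odot>\<^bsub>M\<^esub> v x \<oplus>\<^bsub>M\<^esub> g x \<odot>\<^bsub>M\<^esub> v x) \<in> ?S \<rightarrow> carrier M"
        using cl[OF f] cl[OF g] S(4) by blast
      fix x assume "x \<in> ?S"
      thus "(f x \<oplus> g x) \<odot>\<^bsub>M\<^esub> v x = f x \<odot>\<^bsub>M\<^esub> v x \<oplus>\<^bsub>M\<^esub> g x \<odot>\<^bsub>M\<^esub> v x"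
        using f g v S(4) by (intro M.smult_l_distr) (auto simp: free_mod_carrier)
    qed
    also have "\<dots> = (\<Oplus>\<^bsub>M\<^esub>x\<in>?S. f x \<odot>\<^bsub>M\<^esub> v x) \<oplus>\<^bsub>M\<^esub> (\<Oplus>\<^bsub>M\<^esub>x\<in>?S. g x \<odot>\<^bsub>M\<^esub> v x)"
      using cl[OF f] cl[OF g] S(4) by (intro M.M.finsum_addf) blast+
    also have "\<dots> = free_ext R M v f \<oplus>\<^bsub>M\<^esub> free_ext R M v g"
      using free_ext_superset[OF M v f S(1,2,4)] free_ext_superset[OF M v g S(1,3,4)] by simp
    finally show "free_ext R M v (f \<oplus>\<^bsub>free_mod R I\<^esub> g) = free_ext R M v f \<oplus>\<^bsub>M\<^esub> free_ext R M v g" .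
  }
  fix a assume a: "a \<in> carrier R"
  let ?S = "{x. f x \<noteq> \<zero>}"
  have S: "finite ?S" "?S \<subseteq> I" "{x. (a \<odot>\<^bsub>free_mod R I\<^esub> f) x \<noteq> \<zero>} \<subseteq> ?S"
    using f a by (auto simp: free_mod_carrier)
  have af: "a \<odot>\<^bsub>free_mod R I\<^esub> f \<in> carrier (free_mod R I)" using a f by (rule F.smult_closed)
  have "free_ext R M v (a \<odot>\<^bsub>free_mod R I\<^esub> f) = (\<Oplus>\<^bsub>M\<^esub>x\<in>?S. (a \<otimes> f x) \<odot>\<^bsub>M\<^esub> v x)"
    by (subst free_ext_superset[OF M v af S(1,3,2)]) simp
  also have "\<dots> = (\<Oplus>\<^bsub>M\<^esub>x\<in>?S. a \<odot>\<^bsub>M\<^esub> (f x \<odot>\<^bsub>M\<^esub> v x))"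
  proof (rule M.M.finsum_cong'[OF refl])
    show "(\<lambda>x. a \<odot>\<^bsub>M\<^esub> (f x \<odot>\<^bsub>M\<^esub> v x)) \<in> ?S \<rightarrow> carrier M"
      using cl[OF f] S(2) a M.smult_closed by blast
    fix x assume "x \<in> ?S"
    thus "(a \<otimes> f x) \<odot>\<^bsub>M\<^esub> v x = a \<odot>\<^bsub>M\<^esub> (f x \<odot>\<^bsub>M\<^esub> v x)"
      using f v S(2) a by (intro M.smult_assoc) (auto simp: free_mod_carrier)
  qed
  also have "\<dots> = a \<odot>\<^bsub>M\<^esub> free_ext R M v f"
    unfolding free_ext_def using cl[OF f] S a by (intro M.smult_finsum[symmetric]) blast+
  finally show "free_ext R M v (a \<odot>\<^bsub>free_mod R I\<^esub> f) = a \<odot>\<^bsub>M\<^esub> free_ext R M v f" .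
qed

lemma free_ext_basis:
  assumes M: "left_module R M" and v: "v \<in> I \<rightarrow> carrier M" and x: "x \<in> I"
  shows "free_ext R M v (free_basis R x) = v x"
proof -
  interpret M: left_module R M by fact
  have vx: "v x \<in> carrier M" using v x by auto
  have "free_ext R M v (free_basis R x) = (\<Oplus>\<^bsub>M\<^esub>y\<in>{x}. free_basis R x y \<odot>\<^bsub>M\<^esub> v y)"
    using x by (intro free_ext_superset[OF M v]) (auto simp: free_basis_def free_mod_carrier)
  also have "\<dots> = v x" using vx by (simp add: free_basis_def M.smult_one)
  finally show ?thesis .
qed

text \<open>
  Choosing preimages of the images of the basis vectors defines the lift.
\<close>

lemma free_mod_lift:
  assumes N: "left_module R N" and N': "left_module R N'"
    and g: "g \<in> mod_hom R N N'" and f: "f \<in> mod_hom R (free_mod R I) N'"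
    and im: "f ` carrier (free_mod R I) \<subseteq> g ` carrier N"
  obtains h where "h \<in> mod_hom R (free_mod R I) N" "\<And>v. v \<in> carrier (free_mod R I) \<Longrightarrow> g (h v) = f v"
proof -
  have "\<exists>y\<in>carrier N. g y = f (free_basis R x)" if "x \<in> I" for x
    using subsetD[OF im imageI[OF free_basis_closed[OF that]]] by (metis imageE)
  then obtain w where w: "\<And>x. x \<in> I \<Longrightarrow> w x \<in> carrier N \<and> g (w x) = f (free_basis R x)" by metis
  hence wX: "w \<in> I \<rightarrow> carrier N" by auto
  show ?thesis
  proof
    show h: "free_ext R N w \<in> mod_hom R (free_mod R I) N" by (rule free_ext_hom[OF N wX])
    show "g (free_ext R N w v) = f v" if "v \<in> carrier (free_mod R I)" for v
      by (rule mod_hom_free_eqI[OF N' mod_hom_comp[OF h g] f _ that]) (simp add: free_ext_basis[OF N wX] w)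
  qed
qed

end

section \<open>The equational criterion\<close>

text \<open>
  \<open>\<phi>\<close> factors as \<open>A\<^sup>I \<rightarrow> A\<^sup>J \<rightarrow> M\<close> with \<open>J\<close> finite, and the relations in \<open>E\<close> are zero already in \<open>A\<^sup>J\<close>. The set \<open>J\<close>
  consists of natural numbers because a definition cannot quantify over types; every finite set can be
  renamed into one of these.
\<close>

definition factors_killing ::
    "('a, 'c) ring_scheme \<Rightarrow> ('a, 'm) module \<Rightarrow> 'i set \<Rightarrow> (('i \<Rightarrow> 'a) \<Rightarrow> 'm) \<Rightarrow> ('i \<Rightarrow> 'a) set \<Rightarrow> bool"
  where "factors_killing A M I \<phi> E \<longleftrightarrow>
    (\<exists>(J :: nat set) \<psi> \<chi>. finite J \<and> \<psi> \<in> mod_hom A (free_mod A I) (free_mod A J) \<and>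
      \<chi> \<in> mod_hom A (free_mod A J) M \<and>
      (\<forall>v\<in>carrier (free_mod A I). \<chi> (\<psi> v) = \<phi> v) \<and> (\<forall>r\<in>E. \<psi> r = (\<lambda>x. \<zero>\<^bsub>A\<^esub>)))"

text \<open>
  In coordinates, with \<open>m i = \<phi> (e i)\<close>: each relation \<open>\<Sum>i. r i \<cdot> m i = 0\<close> in \<open>M\<close> is a consequence of relations in the
  ring, that is, \<open>m i = \<Sum>j. b i j \<cdot> n j\<close> for some \<open>n j\<close> in \<open>M\<close> and coefficients with \<open>\<Sum>i. r i \<cdot> b i j = 0\<close> for all \<open>j\<close>.
  Homomorphisms replace the matrices \<open>r\<close> and \<open>b\<close>, so that composition replaces manipulation of double sums.
\<close>

definition equationally_flat :: "('a, 'c) ring_scheme \<Rightarrow> ('a, 'm) module \<Rightarrow> bool"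
  where "equationally_flat A M \<longleftrightarrow> left_module A M \<and>
    (\<forall>(I :: nat set) \<phi> r. finite I \<longrightarrow> \<phi> \<in> mod_hom A (free_mod A I) M \<longrightarrow>
      r \<in> carrier (free_mod A I) \<longrightarrow> \<phi> r = \<zero>\<^bsub>M\<^esub> \<longrightarrow> factors_killing A M I \<phi> {r})"

text \<open>
  For free \<open>F\<close> this is equivalent to flatness of \<open>F/L\<close>, as \<open>locally_split_kernel\<close> and
  \<open>equationally_flat_quotient\<close> show together. It refers to \<open>L\<close> and its elements only, which makes it usable for a
  union of submodules defined over smaller rings.
\<close>

definition locally_split :: "('a, 'c) ring_scheme \<Rightarrow> ('a, 'm) module \<Rightarrow> 'm set \<Rightarrow> bool"
  where "locally_split A F L \<longleftrightarrow>
    (\<forall>E. finite E \<longrightarrow> E \<subseteq> L \<longrightarrow> (\<exists>u\<in>mod_hom A F (F\<lparr>carrier := L\<rparr>). \<forall>x\<in>E. u x = x))"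

lemma factors_killingI:
  fixes J :: "nat set"
  assumes "finite J" "\<psi> \<in> mod_hom A (free_mod A I) (free_mod A J)" "\<chi> \<in> mod_hom A (free_mod A J) M"
    "\<And>v. v \<in> carrier (free_mod A I) \<Longrightarrow> \<chi> (\<psi> v) = \<phi> v" "\<And>r. r \<in> E \<Longrightarrow> \<psi> r = (\<lambda>x. \<zero>\<^bsub>A\<^esub>)"
  shows "factors_killing A M I \<phi> E"
  unfolding factors_killing_def using assms by blast

lemma factors_killingE:
  assumes "factors_killing A M I \<phi> E"
  obtains J :: "nat set" and \<psi> \<chi> where
    "finite J" "\<psi> \<in> mod_hom A (free_mod A I) (free_mod A J)" "\<chi> \<in> mod_hom A (free_mod A J) M"
    "\<And>v. v \<in> carrier (free_mod A I) \<Longrightarrow> \<chi> (\<psi> v) = \<phi> v" "\<And>r. r \<in> E \<Longrightarrow> \<psi> r = (\<lambda>x. \<zero>\<^bsub>A\<^esub>)"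
  using assms unfolding factors_killing_def by blast

lemma equationally_flatD:
  fixes I :: "nat set"
  assumes "equationally_flat A M" "finite I" "\<phi> \<in> mod_hom A (free_mod A I) M"
    "r \<in> carrier (free_mod A I)" "\<phi> r = \<zero>\<^bsub>M\<^esub>"
  shows "factors_killing A M I \<phi> {r}"
  using assms unfolding equationally_flat_def by blast

lemma equationally_flatI:
  assumes "left_module A M"
    and "\<And>(I :: nat set) \<phi> r. finite I \<Longrightarrow> \<phi> \<in> mod_hom A (free_mod A I) M \<Longrightarrow>
      r \<in> carrier (free_mod A I) \<Longrightarrow> \<phi> r = \<zero>\<^bsub>M\<^esub> \<Longrightarrow> factors_killing A M I \<phi> {r}"
  shows "equationally_flat A M"
  using assms unfolding equationally_flat_def by blast

lemma equationally_flat_left_module: "equationally_flat A M \<Longrightarrow> left_module A M"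
  by (simp add: equationally_flat_def)

lemma factors_killing_comp:
  assumes "factors_killing A M I \<phi> E" and h: "h \<in> mod_hom A M N"
  shows "factors_killing A N I (\<lambda>v. h (\<phi> v)) E"
  using assms(1)
proof (rule factors_killingE)
  fix J :: "nat set" and \<psi> \<chi>
  assume J: "finite J" and \<psi>: "\<psi> \<in> mod_hom A (free_mod A I) (free_mod A J)"
    and \<chi>: "\<chi> \<in> mod_hom A (free_mod A J) M"
    and "\<And>v. v \<in> carrier (free_mod A I) \<Longrightarrow> \<chi> (\<psi> v) = \<phi> v" "\<And>r. r \<in> E \<Longrightarrow> \<psi> r = (\<lambda>x. \<zero>\<^bsub>A\<^esub>)"
  thus ?thesis by (intro factors_killingI[OF J \<psi> mod_hom_comp[OF \<chi> h]]) simp_all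
qed

lemma factors_killing_cong:
  assumes "factors_killing A M I \<phi> E" "\<And>v. v \<in> carrier (free_mod A I) \<Longrightarrow> \<phi> v = \<phi>' v"
  shows "factors_killing A M I \<phi>' E"
  using assms unfolding factors_killing_def by auto

context ring
begin

lemma free_hom_zero:
  assumes "\<psi> \<in> mod_hom R (free_mod R I) (free_mod R J)" shows "\<psi> (\<lambda>x. \<zero>) = (\<lambda>x. \<zero>)"
  using mod_hom_zero[OF abelian_group_free_mod abelian_group_free_mod assms] by simp

text \<open>
  This is how arbitrary finite index sets are replaced by sets of natural numbers.
\<close>

lemma free_mod_reindex:
  fixes I :: "'i set"
  assumes "inj_on h I"
  obtains \<rho> \<sigma> where "\<rho> \<in> mod_hom R (free_mod R I) (free_mod R (h ` I))"
    "\<sigma> \<in> mod_hom R (free_mod R (h ` I)) (free_mod R I)"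
    "\<And>v. v \<in> carrier (free_mod R I) \<Longrightarrow> \<sigma> (\<rho> v) = v"
proof
  let ?\<rho> = "free_ext R (free_mod R (h ` I)) (\<lambda>x. free_basis R (h x))"
  let ?\<sigma> = "free_ext R (free_mod R I) (\<lambda>y. free_basis R (the_inv_into I h y))"
  have 1: "(\<lambda>x. free_basis R (h x)) \<in> I \<rightarrow> carrier (free_mod R (h ` I))"
    by (auto intro: free_basis_closed)
  have 2: "(\<lambda>y. free_basis R (the_inv_into I h y)) \<in> h ` I \<rightarrow> carrier (free_mod R I)"
    using assms by (auto intro!: free_basis_closed simp: the_inv_into_f_f)
  show r: "?\<rho> \<in> mod_hom R (free_mod R I) (free_mod R (h ` I))"
    by (rule free_ext_hom[OF left_module_free_mod 1])
  show s: "?\<sigma> \<in> mod_hom R (free_mod R (h ` I)) (free_mod R I)"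
    by (rule free_ext_hom[OF left_module_free_mod 2])
  show "?\<sigma> (?\<rho> v) = v" if "v \<in> carrier (free_mod R I)" for v
    by (rule mod_hom_free_eqI[OF left_module_free_mod mod_hom_comp[OF r s] mod_hom_id _ that])
       (simp add: free_ext_basis[OF left_module_free_mod 1] free_ext_basis[OF left_module_free_mod 2]
         the_inv_into_f_f[OF assms])
qed

text \<open>
  The images of finitely many basis vectors have finitely many nonzero coordinates altogether.
\<close>

lemma hom_free_finite_image:
  assumes f: "f \<in> mod_hom R (free_mod R J) (free_mod R I)" and J: "finite J"
  obtains I0 where "finite I0" "I0 \<subseteq> I" "f \<in> mod_hom R (free_mod R J) (free_mod R I0)"
proof -
  let ?I0 = "\<Union>x\<in>J. {y. f (free_basis R x) y \<noteq> \<zero>}"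
  have cl: "f (free_basis R x) \<in> carrier (free_mod R I)" if "x \<in> J" for x
    by (rule mod_hom_closed[OF f free_basis_closed[OF that]])
  hence fin: "finite ?I0" and sub: "?I0 \<subseteq> I" using J by (auto simp: free_mod_carrier)
  have cl0: "(\<lambda>x. f (free_basis R x)) \<in> J \<rightarrow> carrier (free_mod R ?I0)"
    using cl by (auto simp: free_mod_carrier)
  note h = free_ext_hom[OF left_module_free_mod cl0]
  have eq: "f v = free_ext R (free_mod R ?I0) (\<lambda>x. f (free_basis R x)) v"
    if "v \<in> carrier (free_mod R J)" for v
    by (rule mod_hom_free_eqI[OF left_module_free_mod f mod_hom_comp[OF h free_mod_inclusion[OF sub]] _ that])
       (rule free_ext_basis[OF left_module_free_mod cl0, symmetric])
  have "f \<in> mod_hom R (free_mod R J) (free_mod R ?I0)"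
  proof (rule mod_homI)
    fix v assume v: "v \<in> carrier (free_mod R J)"
    show "f v \<in> carrier (free_mod R ?I0)" unfolding eq[OF v] by (rule mod_hom_closed[OF h v])
  next
    fix v w assume "v \<in> carrier (free_mod R J)" "w \<in> carrier (free_mod R J)"
    from mod_hom_add[OF f this] show "f (v \<oplus>\<^bsub>free_mod R J\<^esub> w) = f v \<oplus>\<^bsub>free_mod R ?I0\<^esub> f w" by simp
  next
    fix a v assume "a \<in> carrier R" "v \<in> carrier (free_mod R J)"
    from mod_hom_smult[OF f this] show "f (a \<odot>\<^bsub>free_mod R J\<^esub> v) = a \<odot>\<^bsub>free_mod R ?I0\<^esub> f v" by simp
  qed
  with fin sub that show ?thesis by blast
qed

text \<open>
  The relations are killed one after the other: if \<open>\<phi> = \<chi> \<psi>\<close> and \<open>\<psi>\<close> kills \<open>E\<close>, then \<open>\<psi> r\<close> is a relation for \<open>\<chi>\<close>,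
  and a factorization \<open>\<chi> = \<chi>' \<psi>'\<close> killing it yields \<open>\<phi> = \<chi>' (\<psi>' \<psi>)\<close>, where \<open>\<psi>' \<psi>\<close> still kills \<open>E\<close>.
\<close>

lemma factors_killing_finite:
  fixes I :: "'i set"
  assumes M: "equationally_flat R M" and I: "finite I" and \<phi>: "\<phi> \<in> mod_hom R (free_mod R I) M"
    and E: "finite E" "E \<subseteq> carrier (free_mod R I)" "\<And>r. r \<in> E \<Longrightarrow> \<phi> r = \<zero>\<^bsub>M\<^esub>"
  shows "factors_killing R M I \<phi> E"
proof -
  have nat: "factors_killing R M K \<phi> E"
    if "finite K" "\<phi> \<in> mod_hom R (free_mod R K) M" "finite E" "E \<subseteq> carrier (free_mod R K)"
      "\<And>r. r \<in> E \<Longrightarrow> \<phi> r = \<zero>\<^bsub>M\<^esub>" for K :: "nat set" and \<phi> E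
    using that(3-5)
  proof (induction E rule: finite_induct)
    case empty
    show ?case by (rule factors_killingI[OF that(1) mod_hom_id that(2)]) auto
  next
    case (insert r E)
    from insert obtain J \<psi> \<chi> where J: "finite (J::nat set)" and \<psi>: "\<psi> \<in> mod_hom R (free_mod R K) (free_mod R J)"
      and \<chi>: "\<chi> \<in> mod_hom R (free_mod R J) M" and eq: "\<And>v. v \<in> carrier (free_mod R K) \<Longrightarrow> \<chi> (\<psi> v) = \<phi> v"
      and kill: "\<And>r. r \<in> E \<Longrightarrow> \<psi> r = (\<lambda>x. \<zero>)"
      by (auto elim: factors_killingE)
    have r: "r \<in> carrier (free_mod R K)" using insert by auto
    have "\<chi> (\<psi> r) = \<zero>\<^bsub>M\<^esub>" using eq[OF r] insert by auto
    then obtain J' \<psi>' \<chi>' where J': "finite (J'::nat set)" and \<psi>': "\<psi>' \<in> mod_hom R (free_mod R J) (free_mod R J')"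
      and \<chi>': "\<chi>' \<in> mod_hom R (free_mod R J') M" and eq': "\<And>v. v \<in> carrier (free_mod R J) \<Longrightarrow> \<chi>' (\<psi>' v) = \<chi> v"
      and kill': "\<psi>' (\<psi> r) = (\<lambda>x. \<zero>)"
      using equationally_flatD[OF M J \<chi> mod_hom_closed[OF \<psi> r]] by (auto elim: factors_killingE)
    show ?case
    proof (rule factors_killingI[OF J' mod_hom_comp[OF \<psi> \<psi>'] \<chi>'])
      fix v assume v: "v \<in> carrier (free_mod R K)"
      show "\<chi>' (\<psi>' (\<psi> v)) = \<phi> v" using eq'[OF mod_hom_closed[OF \<psi> v]] eq[OF v] by simp
    next
      fix q assume "q \<in> insert r E"
      thus "\<psi>' (\<psi> q) = (\<lambda>x. \<zero>)" using kill kill' free_hom_zero[OF \<psi>'] by auto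
    qed
  qed
  obtain h :: "'i \<Rightarrow> nat" where h: "inj_on h I" using finite_imp_inj_to_nat_seg[OF I] by metis
  obtain \<rho> \<sigma> where \<rho>: "\<rho> \<in> mod_hom R (free_mod R I) (free_mod R (h ` I))"
    and \<sigma>: "\<sigma> \<in> mod_hom R (free_mod R (h ` I)) (free_mod R I)"
    and id: "\<And>v. v \<in> carrier (free_mod R I) \<Longrightarrow> \<sigma> (\<rho> v) = v"
    by (rule free_mod_reindex[OF h]) blast
  have "factors_killing R M (h ` I) (\<lambda>w. \<phi> (\<sigma> w)) (\<rho> ` E)"
  proof (rule nat)
    show "(\<lambda>w. \<phi> (\<sigma> w)) \<in> mod_hom R (free_mod R (h ` I)) M" by (rule mod_hom_comp[OF \<sigma> \<phi>])
    show "\<rho> ` E \<subseteq> carrier (free_mod R (h ` I))" using E(2) mod_hom_closed[OF \<rho>] by blast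
    show "\<phi> (\<sigma> r) = \<zero>\<^bsub>M\<^esub>" if "r \<in> \<rho> ` E" for r
      using that
    proof
      fix q assume "r = \<rho> q" "q \<in> E"
      thus ?thesis using id[of q] E(2,3) by auto
    qed
    show "finite (h ` I)" "finite (\<rho> ` E)" using I E(1) by simp_all
  qed
  then obtain J \<psi> \<chi> where J: "finite (J::nat set)" and \<psi>: "\<psi> \<in> mod_hom R (free_mod R (h ` I)) (free_mod R J)"
      and \<chi>: "\<chi> \<in> mod_hom R (free_mod R J) M"
      and eq: "\<And>v. v \<in> carrier (free_mod R (h ` I)) \<Longrightarrow> \<chi> (\<psi> v) = \<phi> (\<sigma> v)"
      and kill: "\<And>r. r \<in> \<rho> ` E \<Longrightarrow> \<psi> r = (\<lambda>x. \<zero>)"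
    by (rule factors_killingE) blast
  show ?thesis
  proof (rule factors_killingI[OF J mod_hom_comp[OF \<rho> \<psi>] \<chi>])
    fix v assume v: "v \<in> carrier (free_mod R I)"
    show "\<chi> (\<psi> (\<rho> v)) = \<phi> v" using eq[OF mod_hom_closed[OF \<rho> v]] id[OF v] by simp
  qed (use kill in auto)
qed

text \<open>
  A homomorphism from a finite free module has values in a finite free submodule, and serves itself as the
  first factor.
\<close>

lemma equationally_flat_free: "equationally_flat R (free_mod R (I :: 'i set))"
proof (rule equationally_flatI[OF left_module_free_mod])
  fix K :: "nat set" and \<phi> r
  assume K: "finite K" and \<phi>: "\<phi> \<in> mod_hom R (free_mod R K) (free_mod R I)"
    and r: "r \<in> carrier (free_mod R K)" "\<phi> r = \<zero>\<^bsub>free_mod R I\<^esub>"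
  obtain I0 where I0: "finite I0" "I0 \<subseteq> I" and \<phi>0: "\<phi> \<in> mod_hom R (free_mod R K) (free_mod R I0)"
    by (rule hom_free_finite_image[OF \<phi> K])
  obtain h :: "'i \<Rightarrow> nat" where h: "inj_on h I0" using finite_imp_inj_to_nat_seg[OF I0(1)] by metis
  obtain \<rho> \<sigma> where \<rho>: "\<rho> \<in> mod_hom R (free_mod R I0) (free_mod R (h ` I0))"
    and \<sigma>: "\<sigma> \<in> mod_hom R (free_mod R (h ` I0)) (free_mod R I0)"
    and id: "\<And>v. v \<in> carrier (free_mod R I0) \<Longrightarrow> \<sigma> (\<rho> v) = v"
    by (rule free_mod_reindex[OF h]) blast
  show "factors_killing R (free_mod R I) K \<phi> {r}"
  proof (rule factors_killingI)
    show "finite (h ` I0)" using I0 by simp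
    show "(\<lambda>v. \<rho> (\<phi> v)) \<in> mod_hom R (free_mod R K) (free_mod R (h ` I0))" by (rule mod_hom_comp[OF \<phi>0 \<rho>])
    show "\<sigma> \<in> mod_hom R (free_mod R (h ` I0)) (free_mod R I)"
      using mod_hom_comp[OF \<sigma> free_mod_inclusion[OF I0(2)]] .
    show "\<sigma> (\<rho> (\<phi> v)) = \<phi> v" if "v \<in> carrier (free_mod R K)" for v
      by (rule id[OF mod_hom_closed[OF \<phi>0 that]])
    show "\<rho> (\<phi> q) = (\<lambda>x. \<zero>)" if "q \<in> {r}" for q using that r free_hom_zero[OF \<rho>] by simp
  qed
qed

lemma equationally_flat_retract:
  assumes P: "left_module R P" and N: "equationally_flat R N"
    and s: "s \<in> mod_hom R P N" and t: "t \<in> mod_hom R N P" and ts: "\<And>x. x \<in> carrier P \<Longrightarrow> t (s x) = x"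
  shows "equationally_flat R P"
proof (rule equationally_flatI[OF P])
  fix K :: "nat set" and \<phi> r
  assume K: "finite K" and \<phi>: "\<phi> \<in> mod_hom R (free_mod R K) P"
    and r: "r \<in> carrier (free_mod R K)" "\<phi> r = \<zero>\<^bsub>P\<^esub>"
  note NM = equationally_flat_left_module[OF N]
  have "s (\<phi> r) = \<zero>\<^bsub>N\<^esub>"
    using r mod_hom_zero[OF left_module_abelian[OF P] left_module_abelian[OF NM] s] by simp
  from factors_killing_comp[OF equationally_flatD[OF N K mod_hom_comp[OF \<phi> s] r(1) this] t]
  show "factors_killing R P K \<phi> {r}"
    by (rule factors_killing_cong) (rule ts[OF mod_hom_closed[OF \<phi>]])
qed

lemma projective_retract_of_free:
  fixes P :: "('a, 'p) module"
  assumes P: "left_module R P" and s: "s \<in> mod_hom R P (free_mod R I)" and t: "t \<in> mod_hom R (free_mod R I) P"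
    and ts: "\<And>x. x \<in> carrier P \<Longrightarrow> t (s x) = x"
  shows "projective_module R P"
  unfolding projective_module_def
proof (intro conjI allI impI P)
  fix N :: "('a, 'p \<Rightarrow> 'a) module" and N' :: "('a, 'p) module" and g f
  assume N: "left_module R N" and N': "left_module R N'" and g: "g \<in> mod_hom R N N'"
    and onto: "g ` carrier N = carrier N'" and f: "f \<in> mod_hom R P N'"
  note ft = mod_hom_comp[OF t f]
  have im: "(\<lambda>v. f (t v)) ` carrier (free_mod R I) \<subseteq> g ` carrier N"
    unfolding onto using mod_hom_closed[OF ft] by blast
  obtain h where h: "h \<in> mod_hom R (free_mod R I) N"
    and gh: "\<And>v. v \<in> carrier (free_mod R I) \<Longrightarrow> g (h v) = f (t v)"
    by (rule free_mod_lift[OF N N' g ft im]) blast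
  show "\<exists>h\<in>mod_hom R P N. \<forall>x\<in>carrier P. g (h x) = f x"
  proof (intro bexI ballI)
    show "(\<lambda>x. h (s x)) \<in> mod_hom R P N" by (rule mod_hom_comp[OF s h])
    fix x assume x: "x \<in> carrier P"
    show "g (h (s x)) = f x" using gh[OF mod_hom_closed[OF s x]] ts[OF x] by simp
  qed
qed

lemma projective_free: "projective_module R (free_mod R I)"
  by (rule projective_retract_of_free[OF left_module_free_mod mod_hom_id mod_hom_id]) simp

text \<open>
  A splitting of the canonical surjection from the free module on \<open>carrier P\<close> makes \<open>P\<close> a retract of a free module.
\<close>

lemma projective_imp_equationally_flat:
  assumes "projective_module R P" shows "equationally_flat R P"
proof -
  have P: "left_module R P" using assms by (simp add: projective_module_def)
  have id: "(\<lambda>x. x) \<in> carrier P \<rightarrow> carrier P" by simp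
  let ?F = "free_mod R (carrier P)" and ?g = "free_ext R P (\<lambda>x. x)"
  have g: "?g \<in> mod_hom R ?F P" by (rule free_ext_hom[OF P id])
  have onto: "?g ` carrier ?F = carrier P"
  proof
    show "?g ` carrier ?F \<subseteq> carrier P" using mod_hom_closed[OF g] by blast
    show "carrier P \<subseteq> ?g ` carrier ?F"
    proof
      fix x assume x: "x \<in> carrier P"
      show "x \<in> ?g ` carrier ?F"
        using free_ext_basis[OF P id x] free_basis_closed[OF x] by (rule image_eqI[where x = "free_basis R x", OF sym])
    qed
  qed
  obtain s where s: "s \<in> mod_hom R P ?F" "\<forall>x\<in>carrier P. ?g (s x) = x"
    using assms[unfolded projective_module_def, THEN conjunct2, rule_format,
        OF left_module_free_mod P g onto mod_hom_id] by blast
  show ?thesis by (rule equationally_flat_retract[OF P equationally_flat_free s(1) g]) (use s(2) in simp)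
qed

text \<open>
  Factor \<open>\<phi> = \<chi> \<psi>\<close> over \<open>M\<close>. The composite \<open>\<pi> \<chi>\<close> kills the image of \<open>\<psi>\<close>, because \<open>\<phi>\<close> has values in the kernel. As \<open>P\<close> is
  flat, \<open>\<pi> \<chi> = \<eta> \<theta>\<close> for some \<open>\<theta>\<close> with \<open>\<theta> \<psi> = 0\<close>. Lifting \<open>\<eta>\<close> to \<open>M\<close> and subtracting its composite with \<open>\<theta>\<close> from \<open>\<chi>\<close> moves \<open>\<chi>\<close>
  into the kernel without changing \<open>\<chi> \<psi>\<close>.
\<close>

lemma equationally_flat_kernel:
  assumes M: "equationally_flat R M" and P: "equationally_flat R P"
    and \<pi>: "\<pi> \<in> mod_hom R M P" and onto: "\<pi> ` carrier M = carrier P"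
  shows "equationally_flat R (M\<lparr>carrier := a_kernel M P \<pi>\<rparr>)" (is "equationally_flat R ?K")
proof -
  note MM = equationally_flat_left_module[OF M] and PM = equationally_flat_left_module[OF P]
  interpret M: left_module R M by (rule MM)
  interpret P: left_module R P by (rule PM)
  have sub: "a_kernel M P \<pi> \<subseteq> carrier M" by (auto simp: a_kernel_eq)
  show ?thesis
  proof (rule equationally_flatI[OF left_module_submodule[OF MM submodule_set_kernel[OF MM PM \<pi>]]])
    fix I :: "nat set" and \<phi> r
    assume I: "finite I" and \<phi>: "\<phi> \<in> mod_hom R (free_mod R I) ?K"
      and r: "r \<in> carrier (free_mod R I)" "\<phi> r = \<zero>\<^bsub>?K\<^esub>"
    have \<phi>M: "\<phi> \<in> mod_hom R (free_mod R I) M" by (rule mod_hom_into_larger[OF \<phi> sub])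
    have \<pi>\<phi>: "\<pi> (\<phi> v) = \<zero>\<^bsub>P\<^esub>" if "v \<in> carrier (free_mod R I)" for v
      using mod_hom_closed[OF \<phi> that] by (simp add: a_kernel_eq)
    obtain J \<psi> \<chi> where J: "finite (J::nat set)" and \<psi>: "\<psi> \<in> mod_hom R (free_mod R I) (free_mod R J)"
      and \<chi>: "\<chi> \<in> mod_hom R (free_mod R J) M" and eq: "\<And>v. v \<in> carrier (free_mod R I) \<Longrightarrow> \<chi> (\<psi> v) = \<phi> v"
      and kill: "\<psi> r = (\<lambda>x. \<zero>)"
      using equationally_flatD[OF M I \<phi>M r(1)] r(2) by (auto elim: factors_killingE)
    let ?E = "(\<lambda>x. \<psi> (free_basis R x)) ` I"
    have bE: "\<psi> (free_basis R x) \<in> carrier (free_mod R J)" if "x \<in> I" for x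
      by (rule mod_hom_closed[OF \<psi> free_basis_closed[OF that]])
    have "factors_killing R P J (\<lambda>w. \<pi> (\<chi> w)) ?E"
    proof (rule factors_killing_finite[OF P J mod_hom_comp[OF \<chi> \<pi>]])
      show "finite ?E" using I by simp
      show "?E \<subseteq> carrier (free_mod R J)" using bE by auto
      show "\<pi> (\<chi> q) = \<zero>\<^bsub>P\<^esub>" if "q \<in> ?E" for q
        using that eq[OF free_basis_closed] \<pi>\<phi>[OF free_basis_closed] by auto
    qed
    then obtain J' \<theta> \<eta> where J': "finite (J'::nat set)" and \<theta>: "\<theta> \<in> mod_hom R (free_mod R J) (free_mod R J')"
      and \<eta>: "\<eta> \<in> mod_hom R (free_mod R J') P" and eq': "\<And>v. v \<in> carrier (free_mod R J) \<Longrightarrow> \<eta> (\<theta> v) = \<pi> (\<chi> v)"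
      and kill': "\<And>q. q \<in> ?E \<Longrightarrow> \<theta> q = (\<lambda>x. \<zero>)"
      by (rule factors_killingE) blast
    have \<theta>\<psi>: "\<theta> (\<psi> v) = (\<lambda>x. \<zero>)" if "v \<in> carrier (free_mod R I)" for v
    proof -
      have "\<theta> (\<psi> v) = \<zero>\<^bsub>free_mod R J'\<^esub>"
        by (rule mod_hom_free_eqI[OF left_module_free_mod mod_hom_comp[OF \<psi> \<theta>]
              mod_hom_const_zero[OF left_module_free_mod] _ that]) (simp add: kill')
      thus ?thesis by simp
    qed
    have im: "\<eta> ` carrier (free_mod R J') \<subseteq> \<pi> ` carrier M"
      unfolding onto using mod_hom_closed[OF \<eta>] by blast
    obtain lft where l: "lft \<in> mod_hom R (free_mod R J') M"
      and \<pi>l: "\<And>v. v \<in> carrier (free_mod R J') \<Longrightarrow> \<pi> (lft v) = \<eta> v"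
      by (rule free_mod_lift[OF MM PM \<pi> \<eta> im]) blast
    let ?\<chi> = "\<lambda>w. \<chi> w \<ominus>\<^bsub>M\<^esub> lft (\<theta> w)"
    have \<chi>2M: "?\<chi> \<in> mod_hom R (free_mod R J) M" by (rule mod_hom_sub[OF MM \<chi> mod_hom_comp[OF \<theta> l]])
    have "\<pi> (?\<chi> w) = \<zero>\<^bsub>P\<^esub>" if w: "w \<in> carrier (free_mod R J)" for w
    proof -
      note c = mod_hom_closed[OF \<chi> w] mod_hom_closed[OF l mod_hom_closed[OF \<theta> w]]
      have "\<pi> (?\<chi> w) = \<pi> (\<chi> w) \<ominus>\<^bsub>P\<^esub> \<pi> (lft (\<theta> w))"
        by (rule mod_hom_diff[OF M.M.abelian_group_axioms P.M.abelian_group_axioms \<pi> c])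
      also have "\<dots> = \<zero>\<^bsub>P\<^esub>"
        using \<pi>l[OF mod_hom_closed[OF \<theta> w]] eq'[OF w] mod_hom_closed[OF \<pi> c(1)]
        by (simp add: a_minus_def P.M.r_neg)
      finally show ?thesis .
    qed
    hence \<chi>2: "?\<chi> \<in> mod_hom R (free_mod R J) ?K"
      using mod_hom_closed[OF \<chi>2M] by (intro mod_hom_corestrict[OF \<chi>2M]) (auto simp: a_kernel_eq)
    show "factors_killing R ?K I \<phi> {r}"
    proof (rule factors_killingI[OF J \<psi> \<chi>2])
      fix v assume v: "v \<in> carrier (free_mod R I)"
      have "lft (\<theta> (\<psi> v)) = \<zero>\<^bsub>M\<^esub>"
        using \<theta>\<psi>[OF v] mod_hom_zero[OF abelian_group_free_mod M.M.abelian_group_axioms l] by simp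
      thus "?\<chi> (\<psi> v) = \<phi> v" using eq[OF v] mod_hom_closed[OF \<phi>M v] by (simp add: a_minus_def)
    qed (use kill in simp)
  qed
qed

end

definition mod_prod :: "('a, 'm) module \<Rightarrow> ('a, 'n) module \<Rightarrow> ('a, 'm \<times> 'n) module"
  where "mod_prod M N =
    \<lparr>carrier = carrier M \<times> carrier N, monoid.mult = (\<lambda>p q. p), one = (\<zero>\<^bsub>M\<^esub>, \<zero>\<^bsub>N\<^esub>),
     ring.zero = (\<zero>\<^bsub>M\<^esub>, \<zero>\<^bsub>N\<^esub>),
     ring.add = (\<lambda>p q. (fst p \<oplus>\<^bsub>M\<^esub> fst q, snd p \<oplus>\<^bsub>N\<^esub> snd q)),
     smult = (\<lambda>a p. (a \<odot>\<^bsub>M\<^esub> fst p, a \<odot>\<^bsub>N\<^esub> snd p))\<rparr>"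

lemma mod_prod_simps [simp]:
  "carrier (mod_prod M N) = carrier M \<times> carrier N"
  "\<zero>\<^bsub>mod_prod M N\<^esub> = (\<zero>\<^bsub>M\<^esub>, \<zero>\<^bsub>N\<^esub>)"
  "p \<oplus>\<^bsub>mod_prod M N\<^esub> q = (fst p \<oplus>\<^bsub>M\<^esub> fst q, snd p \<oplus>\<^bsub>N\<^esub> snd q)"
  "a \<odot>\<^bsub>mod_prod M N\<^esub> p = (a \<odot>\<^bsub>M\<^esub> fst p, a \<odot>\<^bsub>N\<^esub> snd p)"
  by (simp_all add: mod_prod_def)

lemma left_module_prod:
  assumes "left_module A M" "left_module A N" shows "left_module A (mod_prod M N)"
proof -
  interpret M: left_module A M by fact
  interpret N: left_module A N by fact
  have "abelian_group (mod_prod M N)"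
  proof (rule abelian_groupI, goal_cases)
    case (6 p)
    then show ?case
      by (intro bexI[of _ "(\<ominus>\<^bsub>M\<^esub> fst p, \<ominus>\<^bsub>N\<^esub> snd p)"]) (auto simp: M.M.l_neg N.M.l_neg)
  qed (auto simp: M.M.a_ac N.M.a_ac)
  thus ?thesis
    by (intro left_moduleI M.A.ring_axioms)
       (auto simp: M.smult_closed N.smult_closed M.smult_l_distr N.smult_l_distr M.smult_r_distr N.smult_r_distr
          M.smult_assoc N.smult_assoc M.smult_one N.smult_one)
qed

lemma mod_hom_pair:
  "f \<in> mod_hom A L M \<Longrightarrow> g \<in> mod_hom A L N \<Longrightarrow> (\<lambda>x. (f x, g x)) \<in> mod_hom A L (mod_prod M N)"
  by (intro mod_homI) (simp_all add: mod_hom_closed mod_hom_add mod_hom_smult)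

lemma mod_hom_fst: "(\<lambda>p. fst p) \<in> mod_hom A (mod_prod M N) M"
  by (rule mod_homI) auto

lemma mod_hom_snd: "(\<lambda>p. snd p) \<in> mod_hom A (mod_prod M N) N"
  by (rule mod_homI) auto

context ring
begin

text \<open>
  The index sets of the two summands are made disjoint by doubling: \<open>J1\<close> is sent to even and \<open>J2\<close> to odd numbers.
\<close>

lemma free_mod_sum:
  fixes J1 J2 :: "nat set"
  assumes "finite J1" "finite J2"
  obtains J :: "nat set" and i1 i2 p1 p2 where "finite J"
    "i1 \<in> mod_hom R (free_mod R J1) (free_mod R J)" "i2 \<in> mod_hom R (free_mod R J2) (free_mod R J)"
    "p1 \<in> mod_hom R (free_mod R J) (free_mod R J1)" "p2 \<in> mod_hom R (free_mod R J) (free_mod R J2)"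
    "\<And>v w. v \<in> carrier (free_mod R J1) \<Longrightarrow> w \<in> carrier (free_mod R J2) \<Longrightarrow>
      p1 (i1 v \<oplus>\<^bsub>free_mod R J\<^esub> i2 w) = v \<and> p2 (i1 v \<oplus>\<^bsub>free_mod R J\<^esub> i2 w) = w"
proof
  let ?J = "(\<lambda>i. 2 * i) ` J1 \<union> (\<lambda>i. Suc (2 * i)) ` J2"
  let ?i1 = "\<lambda>v k. if even k then v (k div 2) else \<zero>"
  let ?i2 = "\<lambda>v k. if odd k then v (k div 2) else \<zero>"
  let ?p1 = "\<lambda>v i. v (2 * i)" and ?p2 = "\<lambda>v i. v (Suc (2 * i))"
  show "finite ?J" using assms by simp
  have fin: "(f \<in> carrier (free_mod R K)) = ((\<forall>x. f x \<in> carrier R) \<and> (\<forall>x. f x \<noteq> \<zero> \<longrightarrow> x \<in> K))"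
    if "finite K" for f and K :: "nat set"
    unfolding free_mod_carrier using that by (auto intro: finite_subset)
  note fins = fin[OF assms(1)] fin[OF assms(2)] fin[OF \<open>finite ?J\<close>]
  show "?i1 \<in> mod_hom R (free_mod R J1) (free_mod R ?J)"
    by (rule mod_homI) (simp only: fins, auto simp: fun_eq_iff image_iff elim!: evenE)
  show "?i2 \<in> mod_hom R (free_mod R J2) (free_mod R ?J)"
    by (rule mod_homI) (simp only: fins, auto simp: fun_eq_iff image_iff elim!: oddE)
  show "?p1 \<in> mod_hom R (free_mod R ?J) (free_mod R J1)"
  proof (rule mod_homI)
    fix v assume "v \<in> carrier (free_mod R ?J)"
    hence v: "\<forall>x. v x \<in> carrier R" "\<forall>x. v x \<noteq> \<zero> \<longrightarrow> x \<in> ?J" by (auto simp only: fins)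
    have "i \<in> J1" if "v (2 * i) \<noteq> \<zero>" for i using v(2)[rule_format, OF that] by (auto, presburger)
    thus "(\<lambda>i. v (2 * i)) \<in> carrier (free_mod R J1)" using v by (simp add: fins)
  qed auto
  show "?p2 \<in> mod_hom R (free_mod R ?J) (free_mod R J2)"
  proof (rule mod_homI)
    fix v assume "v \<in> carrier (free_mod R ?J)"
    hence v: "\<forall>x. v x \<in> carrier R" "\<forall>x. v x \<noteq> \<zero> \<longrightarrow> x \<in> ?J" by (auto simp only: fins)
    have "i \<in> J2" if "v (Suc (2 * i)) \<noteq> \<zero>" for i using v(2)[rule_format, OF that] by (auto, presburger)
    thus "(\<lambda>i. v (Suc (2 * i))) \<in> carrier (free_mod R J2)" using v by (simp add: fins)
  qed auto
  fix v w assume "v \<in> carrier (free_mod R J1)" "w \<in> carrier (free_mod R J2)"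
  thus "?p1 (?i1 v \<oplus>\<^bsub>free_mod R ?J\<^esub> ?i2 w) = v \<and> ?p2 (?i1 v \<oplus>\<^bsub>free_mod R ?J\<^esub> ?i2 w) = w"
    by (auto simp: fins)
qed

text \<open>
  The sum factors through the direct sum of the two intermediate free modules. Hence the
  homomorphisms that factor in this way form a group.
\<close>

lemma factors_killing_add:
  assumes M: "left_module R M" and 1: "factors_killing R M I \<phi>1 E" and 2: "factors_killing R M I \<phi>2 E"
  shows "factors_killing R M I (\<lambda>v. \<phi>1 v \<oplus>\<^bsub>M\<^esub> \<phi>2 v) E"
proof -
  from 1 obtain J1 \<psi>1 \<chi>1 where J1: "finite (J1::nat set)" and \<psi>1: "\<psi>1 \<in> mod_hom R (free_mod R I) (free_mod R J1)"
    and \<chi>1: "\<chi>1 \<in> mod_hom R (free_mod R J1) M"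
    and eq1: "\<And>v. v \<in> carrier (free_mod R I) \<Longrightarrow> \<chi>1 (\<psi>1 v) = \<phi>1 v"
    and kill1: "\<And>r. r \<in> E \<Longrightarrow> \<psi>1 r = (\<lambda>x. \<zero>)"
    by (rule factors_killingE) blast
  from 2 obtain J2 \<psi>2 \<chi>2 where J2: "finite (J2::nat set)" and \<psi>2: "\<psi>2 \<in> mod_hom R (free_mod R I) (free_mod R J2)"
    and \<chi>2: "\<chi>2 \<in> mod_hom R (free_mod R J2) M"
    and eq2: "\<And>v. v \<in> carrier (free_mod R I) \<Longrightarrow> \<chi>2 (\<psi>2 v) = \<phi>2 v"
    and kill2: "\<And>r. r \<in> E \<Longrightarrow> \<psi>2 r = (\<lambda>x. \<zero>)"
    by (rule factors_killingE) blast
  obtain J i1 i2 p1 p2 where J: "finite (J :: nat set)"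
    and i1: "i1 \<in> mod_hom R (free_mod R J1) (free_mod R J)" and i2: "i2 \<in> mod_hom R (free_mod R J2) (free_mod R J)"
    and p1: "p1 \<in> mod_hom R (free_mod R J) (free_mod R J1)" and p2: "p2 \<in> mod_hom R (free_mod R J) (free_mod R J2)"
    and pi: "\<And>v w. v \<in> carrier (free_mod R J1) \<Longrightarrow> w \<in> carrier (free_mod R J2) \<Longrightarrow>
      p1 (i1 v \<oplus>\<^bsub>free_mod R J\<^esub> i2 w) = v \<and> p2 (i1 v \<oplus>\<^bsub>free_mod R J\<^esub> i2 w) = w"
    by (rule free_mod_sum[OF J1 J2]) blast
  let ?\<psi> = "\<lambda>v. i1 (\<psi>1 v) \<oplus>\<^bsub>free_mod R J\<^esub> i2 (\<psi>2 v)"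
  let ?\<chi> = "\<lambda>w. \<chi>1 (p1 w) \<oplus>\<^bsub>M\<^esub> \<chi>2 (p2 w)"
  show ?thesis
  proof (rule factors_killingI[OF J])
    show "?\<psi> \<in> mod_hom R (free_mod R I) (free_mod R J)"
      by (rule mod_hom_plus[OF left_module_free_mod mod_hom_comp[OF \<psi>1 i1] mod_hom_comp[OF \<psi>2 i2]])
    show "?\<chi> \<in> mod_hom R (free_mod R J) M"
      by (rule mod_hom_plus[OF M mod_hom_comp[OF p1 \<chi>1] mod_hom_comp[OF p2 \<chi>2]])
    fix v assume v: "v \<in> carrier (free_mod R I)"
    show "?\<chi> (?\<psi> v) = \<phi>1 v \<oplus>\<^bsub>M\<^esub> \<phi>2 v"
      using pi[OF mod_hom_closed[OF \<psi>1 v] mod_hom_closed[OF \<psi>2 v]] eq1[OF v] eq2[OF v]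
      by (simp del: free_mod_simps)
  next
    fix q assume "q \<in> E"
    thus "?\<psi> q = (\<lambda>x. \<zero>)"
      using kill1 kill2 free_hom_zero[OF i1] free_hom_zero[OF i2] by simp
  qed
qed

lemma factors_killing_minus:
  assumes M: "left_module R M" and 1: "factors_killing R M I \<phi> E"
  shows "factors_killing R M I (\<lambda>v. \<ominus>\<^bsub>M\<^esub> \<phi> v) E"
proof -
  interpret M: left_module R M by (rule M)
  from 1 obtain J \<psi> \<chi> where J: "finite (J::nat set)" and \<psi>: "\<psi> \<in> mod_hom R (free_mod R I) (free_mod R J)"
    and \<chi>: "\<chi> \<in> mod_hom R (free_mod R J) M"
    and eq: "\<And>v. v \<in> carrier (free_mod R I) \<Longrightarrow> \<chi> (\<psi> v) = \<phi> v"
    and kill: "\<And>r. r \<in> E \<Longrightarrow> \<psi> r = (\<lambda>x. \<zero>)"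
    by (rule factors_killingE) blast
  have "(\<lambda>w. \<ominus>\<^bsub>M\<^esub> \<chi> w) \<in> mod_hom R (free_mod R J) M"
    using mod_hom_closed[OF \<chi>]
    by (intro mod_homI) (simp_all add: mod_hom_add[OF \<chi>] mod_hom_smult[OF \<chi>] M.M.minus_add M.smult_r_minus del: free_mod_simps)
  from factors_killingI[OF J \<psi> this] eq kill show ?thesis by simp
qed

lemma factors_killing_zero:
  assumes M: "left_module R M"
  shows "factors_killing R M I (\<lambda>v. \<zero>\<^bsub>M\<^esub>) E"
proof (rule factors_killingI[where J = "{}"])
  show "(\<lambda>v. \<zero>\<^bsub>free_mod R {}\<^esub>) \<in> mod_hom R (free_mod R I) (free_mod R {})"
    by (rule mod_hom_const_zero[OF left_module_free_mod])
  show "(\<lambda>v. \<zero>\<^bsub>M\<^esub>) \<in> mod_hom R (free_mod R {}) M" by (rule mod_hom_const_zero[OF M])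
qed auto

lemma equationally_flat_prod:
  assumes M: "equationally_flat R M" and N: "equationally_flat R N"
  shows "equationally_flat R (mod_prod M N)"
proof -
  note MM = equationally_flat_left_module[OF M] and NM = equationally_flat_left_module[OF N]
  interpret M: left_module R M by (rule MM)
  interpret N: left_module R N by (rule NM)
  have inl: "(\<lambda>x. (x, \<zero>\<^bsub>N\<^esub>)) \<in> mod_hom R M (mod_prod M N)"
    by (rule mod_hom_pair[OF mod_hom_id mod_hom_const_zero[OF NM]])
  have inr: "(\<lambda>y. (\<zero>\<^bsub>M\<^esub>, y)) \<in> mod_hom R N (mod_prod M N)"
    by (rule mod_hom_pair[OF mod_hom_const_zero[OF MM] mod_hom_id])
  show ?thesis
  proof (rule equationally_flatI[OF left_module_prod[OF MM NM]])
    fix I :: "nat set" and \<phi> r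
    assume I: "finite I" and \<phi>: "\<phi> \<in> mod_hom R (free_mod R I) (mod_prod M N)"
      and r: "r \<in> carrier (free_mod R I)" "\<phi> r = \<zero>\<^bsub>mod_prod M N\<^esub>"
    have "factors_killing R M I (\<lambda>v. fst (\<phi> v)) {r}" "factors_killing R N I (\<lambda>v. snd (\<phi> v)) {r}"
      using equationally_flatD[OF M I mod_hom_comp[OF \<phi> mod_hom_fst] r(1)]
        equationally_flatD[OF N I mod_hom_comp[OF \<phi> mod_hom_snd] r(1)] r(2) by simp_all
    from factors_killing_add[OF left_module_prod[OF MM NM]
        factors_killing_comp[OF this(1) inl] factors_killing_comp[OF this(2) inr]]
    show "factors_killing R (mod_prod M N) I \<phi> {r}"
    proof (rule factors_killing_cong)
      fix v assume v: "v \<in> carrier (free_mod R I)"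
      have "fst (\<phi> v) \<in> carrier M" "snd (\<phi> v) \<in> carrier N" using mod_hom_closed[OF \<phi> v] by auto
      thus "(fst (\<phi> v), \<zero>\<^bsub>N\<^esub>) \<oplus>\<^bsub>mod_prod M N\<^esub> (\<zero>\<^bsub>M\<^esub>, snd (\<phi> v)) = \<phi> v" by simp
    qed
  qed
qed

section \<open>Locally split submodules of free modules\<close>

text \<open>
  The elements of \<open>E\<close> have finitely many coordinates. On these, \<open>p = \<chi> \<psi>\<close> with \<open>\<psi>\<close> killing \<open>E\<close> by flatness of \<open>Z\<close>.
  If \<open>l\<close> lifts \<open>\<chi>\<close> along \<open>p\<close>, then \<open>v - l (\<psi> v)\<close> lies in the kernel of \<open>p\<close>, and it is \<open>v\<close> itself for \<open>v\<close> in \<open>E\<close>.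
  The remaining basis vectors are sent to zero.
\<close>

lemma locally_split_kernel:
  assumes Z: "equationally_flat R Z" and p: "p \<in> mod_hom R (free_mod R I) Z"
    and onto: "p ` carrier (free_mod R I) = carrier Z"
  shows "locally_split R (free_mod R I) (a_kernel (free_mod R I) Z p)"
  unfolding locally_split_def
proof (intro allI impI)
  let ?F = "free_mod R I" and ?L = "a_kernel (free_mod R I) Z p"
  note ZM = equationally_flat_left_module[OF Z]
  interpret Z: left_module R Z by (rule ZM)
  interpret F: left_module R ?F by (rule left_module_free_mod)
  have LM: "left_module R (?F\<lparr>carrier := ?L\<rparr>)"
    by (rule left_module_submodule[OF left_module_free_mod submodule_set_kernel[OF left_module_free_mod ZM p]])
  have Lsub: "?L \<subseteq> carrier ?F" by (auto simp: a_kernel_eq)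
  fix E assume E: "finite E" "E \<subseteq> ?L"
  let ?I0 = "\<Union>e\<in>E. {x. e x \<noteq> \<zero>}"
  have EF: "e \<in> carrier ?F" if "e \<in> E" for e using E Lsub that by auto
  have I0: "finite ?I0" "?I0 \<subseteq> I" using E EF by (auto simp: free_mod_carrier)
  have E0: "E \<subseteq> carrier (free_mod R ?I0)" using EF by (auto simp: free_mod_carrier)
  have p0: "p \<in> mod_hom R (free_mod R ?I0) Z" using mod_hom_comp[OF free_mod_inclusion[OF I0(2)] p] .
  have "factors_killing R Z ?I0 p E"
    using E by (intro factors_killing_finite[OF Z I0(1) p0 _ E0]) (auto simp: a_kernel_eq)
  then obtain J \<psi> \<chi> where J: "finite (J::nat set)" and \<psi>: "\<psi> \<in> mod_hom R (free_mod R ?I0) (free_mod R J)"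
      and \<chi>: "\<chi> \<in> mod_hom R (free_mod R J) Z"
      and eq: "\<And>v. v \<in> carrier (free_mod R ?I0) \<Longrightarrow> \<chi> (\<psi> v) = p v"
      and kill: "\<And>r. r \<in> E \<Longrightarrow> \<psi> r = (\<lambda>x. \<zero>)"
    by (rule factors_killingE) blast
  have im: "\<chi> ` carrier (free_mod R J) \<subseteq> p ` carrier ?F"
    unfolding onto using mod_hom_closed[OF \<chi>] by blast
  obtain l where l: "l \<in> mod_hom R (free_mod R J) ?F"
    and pl: "\<And>v. v \<in> carrier (free_mod R J) \<Longrightarrow> p (l v) = \<chi> v"
    by (rule free_mod_lift[OF left_module_free_mod ZM p \<chi> im]) blast
  define u0 where "u0 = (\<lambda>v. v \<ominus>\<^bsub>?F\<^esub> l (\<psi> v))"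
  have u0F: "u0 \<in> mod_hom R (free_mod R ?I0) ?F" unfolding u0_def
    by (rule mod_hom_sub[OF left_module_free_mod free_mod_inclusion[OF I0(2)] mod_hom_comp[OF \<psi> l]])
  have "p (u0 v) = \<zero>\<^bsub>Z\<^esub>" if v: "v \<in> carrier (free_mod R ?I0)" for v
  proof -
    note c = mod_hom_closed[OF free_mod_inclusion[OF I0(2)] v] mod_hom_closed[OF l mod_hom_closed[OF \<psi> v]]
    have "p (u0 v) = p v \<ominus>\<^bsub>Z\<^esub> p (l (\<psi> v))" unfolding u0_def
      by (rule mod_hom_diff[OF F.M.abelian_group_axioms Z.M.abelian_group_axioms p c])
    also have "\<dots> = \<zero>\<^bsub>Z\<^esub>"
      using pl[OF mod_hom_closed[OF \<psi> v]] eq[OF v] mod_hom_closed[OF p c(1)]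
      by (simp add: a_minus_def Z.M.r_neg)
    finally show ?thesis .
  qed
  hence u0: "u0 \<in> mod_hom R (free_mod R ?I0) (?F\<lparr>carrier := ?L\<rparr>)"
    using mod_hom_closed[OF u0F] by (intro mod_hom_corestrict[OF u0F]) (auto simp: a_kernel_eq)
  let ?w = "\<lambda>x. if x \<in> ?I0 then u0 (free_basis R x) else \<zero>\<^bsub>?F\<^esub>"
  let ?u = "free_ext R (?F\<lparr>carrier := ?L\<rparr>) ?w"
  have z: "\<zero>\<^bsub>?F\<^esub> \<in> ?L"
    using submodule_set_kernel[OF left_module_free_mod ZM p] by (simp add: submodule_set_def del: free_mod_simps)
  have w: "?w \<in> I \<rightarrow> carrier (?F\<lparr>carrier := ?L\<rparr>)"
  proof
    fix x
    show "?w x \<in> carrier (?F\<lparr>carrier := ?L\<rparr>)"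
      using mod_hom_closed[OF u0 free_basis_closed, of x] z by auto
  qed
  have u: "?u \<in> mod_hom R ?F (?F\<lparr>carrier := ?L\<rparr>)" by (rule free_ext_hom[OF LM w])
  show "\<exists>u\<in>mod_hom R ?F (?F\<lparr>carrier := ?L\<rparr>). \<forall>x\<in>E. u x = x"
  proof (intro bexI[OF _ u] ballI)
    fix e assume e: "e \<in> E"
    have e0: "e \<in> carrier (free_mod R ?I0)" using E0 e by blast
    have "?u e = u0 e"
    proof (rule mod_hom_free_eqI[OF LM mod_hom_comp[OF free_mod_inclusion[OF I0(2)] u] u0 _ e0])
      fix x assume x: "x \<in> ?I0"
      hence "x \<in> I" using I0(2) by blast
      from free_ext_basis[OF LM w this] x show "?u (free_basis R x) = u0 (free_basis R x)" by simp
    qed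
    also have "\<dots> = e"
    proof -
      have "l (\<psi> e) = \<zero>\<^bsub>?F\<^esub>" using kill[OF e] free_hom_zero[OF l] by simp
      thus ?thesis using EF[OF e] by (simp add: u0_def a_minus_def del: free_mod_simps)
    qed
    finally show "?u e = e" .
  qed
qed

text \<open>
  Lift \<open>\<phi>\<close> to \<open>l\<close> with values in the free module. If \<open>u\<close> fixes the element \<open>l r\<close> of the kernel, then \<open>l - u l\<close> is another lift,
  and it kills \<open>r\<close>; so the relation is killed already in a free module.
\<close>

lemma equationally_flat_quotient:
  assumes Z: "left_module R Z" and p: "p \<in> mod_hom R (free_mod R I) Z"
    and onto: "p ` carrier (free_mod R I) = carrier Z"
    and split: "locally_split R (free_mod R I) (a_kernel (free_mod R I) Z p)"
  shows "equationally_flat R Z"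
proof (rule equationally_flatI[OF Z])
  let ?F = "free_mod R I" and ?L = "a_kernel (free_mod R I) Z p"
  interpret Z: left_module R Z by (rule Z)
  interpret F: left_module R ?F by (rule left_module_free_mod)
  fix K :: "nat set" and \<phi> r
  assume K: "finite K" and \<phi>: "\<phi> \<in> mod_hom R (free_mod R K) Z"
    and r: "r \<in> carrier (free_mod R K)" "\<phi> r = \<zero>\<^bsub>Z\<^esub>"
  have im: "\<phi> ` carrier (free_mod R K) \<subseteq> p ` carrier ?F"
    unfolding onto using mod_hom_closed[OF \<phi>] by blast
  obtain l where l: "l \<in> mod_hom R (free_mod R K) ?F"
    and pl: "\<And>v. v \<in> carrier (free_mod R K) \<Longrightarrow> p (l v) = \<phi> v"
    by (rule free_mod_lift[OF left_module_free_mod Z p \<phi> im]) blast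
  have lr: "l r \<in> ?L" using pl[OF r(1)] r mod_hom_closed[OF l] by (simp add: a_kernel_eq)
  then obtain u where u: "u \<in> mod_hom R ?F (?F\<lparr>carrier := ?L\<rparr>)" "u (l r) = l r"
    using split[unfolded locally_split_def, rule_format, of "{l r}"] by auto
  have uF: "u \<in> mod_hom R ?F ?F" by (rule mod_hom_into_larger[OF u(1)]) (auto simp: a_kernel_eq)
  let ?k = "\<lambda>v. l v \<ominus>\<^bsub>?F\<^esub> u (l v)"
  have k: "?k \<in> mod_hom R (free_mod R K) ?F" by (rule mod_hom_sub[OF left_module_free_mod l mod_hom_comp[OF l uF]])
  have pk: "p (?k v) = \<phi> v" if v: "v \<in> carrier (free_mod R K)" for v
  proof -
    note c = mod_hom_closed[OF l v]
    have "p (u (l v)) = \<zero>\<^bsub>Z\<^esub>" using mod_hom_closed[OF u(1) c] by (simp add: a_kernel_eq)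
    thus ?thesis
      using mod_hom_diff[OF F.M.abelian_group_axioms Z.M.abelian_group_axioms p c mod_hom_closed[OF uF c]]
        pl[OF v] mod_hom_closed[OF \<phi> v] by (simp add: a_minus_def del: free_mod_simps)
  qed
  have "?k r = \<zero>\<^bsub>?F\<^esub>" using u(2) mod_hom_closed[OF l r(1)] by (simp add: a_minus_def F.M.r_neg del: free_mod_simps)
  from equationally_flatD[OF equationally_flat_free K k r(1) this]
  obtain J \<psi> \<chi> where J: "finite (J::nat set)" and \<psi>: "\<psi> \<in> mod_hom R (free_mod R K) (free_mod R J)"
      and \<chi>: "\<chi> \<in> mod_hom R (free_mod R J) ?F"
      and eq: "\<And>v. v \<in> carrier (free_mod R K) \<Longrightarrow> \<chi> (\<psi> v) = ?k v"
      and kill: "\<And>q. q \<in> {r} \<Longrightarrow> \<psi> q = (\<lambda>x. \<zero>)"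
    by (rule factors_killingE) blast
  show "factors_killing R Z K \<phi> {r}"
    by (rule factors_killingI[OF J \<psi> mod_hom_comp[OF \<chi> p] _ kill]) (simp_all only: eq pk)
qed

end

section \<open>Flatness and the equational criterion\<close>

text \<open>
  A map on pairs is extended additively to formal sums of pairs. The compatibility with sums, differences and
  generators is recorded at once, since the extension itself is not unique outside of \<open>S\<close>.
\<close>

lemma (in abelian_group) frag_universal:
  assumes "\<And>x. x \<in> S \<Longrightarrow> f x \<in> carrier G"
  obtains h where "\<And>u. Poly_Mapping.keys u \<subseteq> S \<Longrightarrow> h u \<in> carrier G"
    "\<And>u v. Poly_Mapping.keys u \<subseteq> S \<Longrightarrow> Poly_Mapping.keys v \<subseteq> S \<Longrightarrow> h (u + v) = h u \<oplus> h v"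
    "\<And>u. Poly_Mapping.keys u \<subseteq> S \<Longrightarrow> h (- u) = \<ominus> h u"
    "\<And>u v. Poly_Mapping.keys u \<subseteq> S \<Longrightarrow> Poly_Mapping.keys v \<subseteq> S \<Longrightarrow> h (u - v) = h u \<ominus> h v"
    "h 0 = \<zero>" "\<And>x. x \<in> S \<Longrightarrow> h (frag_of x) = f x"
proof -
  obtain h where h: "h \<in> hom (free_Abelian_group S) (add_monoid G)" and hf: "\<And>x. x \<in> S \<Longrightarrow> h (frag_of x) = f x"
    using comm_group.free_Abelian_group_universal[OF a_comm_group, of f S] assms by auto
  have cl: "h u \<in> carrier G" if "Poly_Mapping.keys u \<subseteq> S" for u
    using hom_in_carrier[OF h, of u] that by simp
  have add: "h (u + v) = h u \<oplus> h v" if "Poly_Mapping.keys u \<subseteq> S" "Poly_Mapping.keys v \<subseteq> S" for u v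
    using hom_mult[OF h, of u v] that by simp
  have zero: "h 0 = \<zero>" using add[of 0 0] cl[of 0] by (simp add: add.l_cancel_one')
  have minus: "h (- u) = \<ominus> h u" if "Poly_Mapping.keys u \<subseteq> S" for u
    using add[of "- u" u] cl[of u] cl[of "- u"] that zero by (simp add: minus_equality)
  have "h (u - v) = h u \<ominus> h v" if "Poly_Mapping.keys u \<subseteq> S" "Poly_Mapping.keys v \<subseteq> S" for u v
    using add[of u "- v"] minus[of v] that by (simp add: a_minus_def)
  with cl add zero minus hf that show ?thesis by blast
qed

lemma tensor_relators_keys:
  assumes N: "right_module A N" and M: "left_module A M" and r: "r \<in> tensor_relators A N M"
  shows "Poly_Mapping.keys r \<subseteq> carrier N \<times> carrier M"
proof -
  interpret N: right_module A N by fact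
  interpret M: left_module A M by fact
  have 2: "Poly_Mapping.keys (frag_of p - frag_of q) \<subseteq> {p, q}" for p q :: "'c \<times> 'd"
    using keys_diff[of "frag_of p" "frag_of q"] by (auto simp: keys_frag_of)
  have 3: "Poly_Mapping.keys (frag_of p - frag_of q - frag_of s) \<subseteq> {p, q, s}" for p q s :: "'c \<times> 'd"
    using keys_diff[of "frag_of p - frag_of q" "frag_of s"] 2[of p q] by (auto simp: keys_frag_of)
  from r show ?thesis
    unfolding tensor_relators_def
  proof (elim UnE CollectE exE conjE)
    fix x x' y assume "r = frag_of (x \<oplus>\<^bsub>N\<^esub> x', y) - frag_of (x, y) - frag_of (x', y)"
      "x \<in> carrier N" "x' \<in> carrier N" "y \<in> carrier M"
    thus ?thesis using 3[of "(x \<oplus>\<^bsub>N\<^esub> x', y)" "(x, y)" "(x', y)"] by auto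
  next
    fix x y y' assume "r = frag_of (x, y \<oplus>\<^bsub>M\<^esub> y') - frag_of (x, y) - frag_of (x, y')"
      "x \<in> carrier N" "y \<in> carrier M" "y' \<in> carrier M"
    thus ?thesis using 3[of "(x, y \<oplus>\<^bsub>M\<^esub> y')" "(x, y)" "(x, y')"] by auto
  next
    fix a x y assume "r = frag_of (a \<odot>\<^bsub>N\<^esub> x, y) - frag_of (x, a \<odot>\<^bsub>M\<^esub> y)"
      "a \<in> carrier A" "x \<in> carrier N" "y \<in> carrier M"
    thus ?thesis using 2[of "(a \<odot>\<^bsub>N\<^esub> x, y)" "(x, a \<odot>\<^bsub>M\<^esub> y)"] N.smult_closed M.smult_closed by auto
  qed
qed

locale tensor_pair =
  fixes A :: "('a, 'c) ring_scheme" and N :: "('a, 'n) module" and M :: "('a, 'm) module"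
  assumes N: "right_module A N" and M: "left_module A M"
begin

abbreviation "T \<equiv> tensor_null A N M"
abbreviation "S \<equiv> carrier N \<times> carrier M"

lemma keys_null:
  assumes "w \<in> T" shows "Poly_Mapping.keys w \<subseteq> S"
proof -
  have "tensor_relators A N M \<subseteq> carrier (free_Abelian_group S)"
    using tensor_relators_keys[OF N M] by auto
  from group.generate_incl[OF group_free_Abelian_group this] assms
  have "w \<in> carrier (free_Abelian_group S)" unfolding tensor_null_def by (rule subsetD)
  thus ?thesis by simp
qed

lemma null_subgroup: "subgroup T (free_Abelian_group S)"
  unfolding tensor_null_def
  using tensor_relators_keys[OF N M]
  by (intro group.generate_is_subgroup[OF group_free_Abelian_group]) auto

lemma null_zero: "0 \<in> T"
  using subgroup.one_closed[OF null_subgroup] by simp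

lemma null_add: "u \<in> T \<Longrightarrow> v \<in> T \<Longrightarrow> u + v \<in> T"
  using subgroup.m_closed[OF null_subgroup] by simp

lemma null_minus: "u \<in> T \<Longrightarrow> - u \<in> T"
  using subgroup.m_inv_closed[OF null_subgroup, of u] keys_null by simp

lemma null_diff: "u \<in> T \<Longrightarrow> v \<in> T \<Longrightarrow> u - v \<in> T"
  using null_add[of u "- v"] null_minus by simp

lemma null_sum: "(\<And>i. i \<in> K \<Longrightarrow> f i \<in> T) \<Longrightarrow> (\<Sum>i\<in>K. f i) \<in> T"
  by (induction K rule: infinite_finite_induct) (auto intro: null_zero null_add)

lemma null_relator: "r \<in> tensor_relators A N M \<Longrightarrow> r \<in> T"
  unfolding tensor_null_def by (rule generate.incl)

lemma null_add_left:
  assumes "x \<in> carrier N" "x' \<in> carrier N" "y \<in> carrier M"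
  shows "frag_of (x \<oplus>\<^bsub>N\<^esub> x', y) - frag_of (x, y) - frag_of (x', y) \<in> T"
  by (rule null_relator) (use assms in \<open>unfold tensor_relators_def, blast\<close>)

lemma null_add_right:
  assumes "x \<in> carrier N" "y \<in> carrier M" "y' \<in> carrier M"
  shows "frag_of (x, y \<oplus>\<^bsub>M\<^esub> y') - frag_of (x, y) - frag_of (x, y') \<in> T"
  by (rule null_relator) (use assms in \<open>unfold tensor_relators_def, blast\<close>)

lemma null_smult:
  assumes "a \<in> carrier A" "x \<in> carrier N" "y \<in> carrier M"
  shows "frag_of (a \<odot>\<^bsub>N\<^esub> x, y) - frag_of (x, a \<odot>\<^bsub>M\<^esub> y) \<in> T"
  by (rule null_relator) (use assms in \<open>unfold tensor_relators_def, blast\<close>)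

lemma null_induct [consumes 1, case_names zero add minus left right smult]:
  assumes w: "w \<in> T"
    and zero: "P 0" and add: "\<And>u v. u \<in> T \<Longrightarrow> v \<in> T \<Longrightarrow> P u \<Longrightarrow> P v \<Longrightarrow> P (u + v)"
    and minus: "\<And>u. u \<in> T \<Longrightarrow> P u \<Longrightarrow> P (- u)"
    and left: "\<And>x x' y. x \<in> carrier N \<Longrightarrow> x' \<in> carrier N \<Longrightarrow> y \<in> carrier M \<Longrightarrow>
      P (frag_of (x \<oplus>\<^bsub>N\<^esub> x', y) - frag_of (x, y) - frag_of (x', y))"
    and right: "\<And>x y y'. x \<in> carrier N \<Longrightarrow> y \<in> carrier M \<Longrightarrow> y' \<in> carrier M \<Longrightarrow>
      P (frag_of (x, y \<oplus>\<^bsub>M\<^esub> y') - frag_of (x, y) - frag_of (x, y'))"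
    and smult: "\<And>a x y. a \<in> carrier A \<Longrightarrow> x \<in> carrier N \<Longrightarrow> y \<in> carrier M \<Longrightarrow>
      P (frag_of (a \<odot>\<^bsub>N\<^esub> x, y) - frag_of (x, a \<odot>\<^bsub>M\<^esub> y))"
  shows "P w"
proof -
  have rel: "P r" if "r \<in> tensor_relators A N M" for r
    using that left right smult unfolding tensor_relators_def by blast
  from w show ?thesis
    unfolding tensor_null_def
  proof (induction rule: generate.induct)
    case one
    then show ?case using zero by simp
  next
    case (incl h)
    then show ?case by (rule rel)
  next
    case (inv h)
    then show ?case using minus[OF null_relator rel] tensor_relators_keys[OF N M] by simp
  next
    case (eng h1 h2)
    then show ?case using add by (simp add: tensor_null_def)
  qed
qed

lemma null_zero_left:
  assumes "y \<in> carrier M" shows "frag_of (\<zero>\<^bsub>N\<^esub>, y) \<in> T"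
proof -
  interpret N: right_module A N by (rule N)
  show ?thesis using null_minus[OF null_add_left[OF N.N.zero_closed N.N.zero_closed assms]] by simp
qed

lemma null_zero_right:
  assumes "x \<in> carrier N" shows "frag_of (x, \<zero>\<^bsub>M\<^esub>) \<in> T"
proof -
  interpret M: left_module A M by (rule M)
  show ?thesis using null_minus[OF null_add_right[OF assms M.M.zero_closed M.M.zero_closed]] by simp
qed

lemma null_finsum_right:
  assumes "finite K" "x \<in> carrier N" "y \<in> K \<rightarrow> carrier M"
  shows "frag_of (x, \<Oplus>\<^bsub>M\<^esub>i\<in>K. y i) - (\<Sum>i\<in>K. frag_of (x, y i)) \<in> T"
  using assms(1,3)
proof (induction K rule: finite_induct)
  case empty
  interpret M: left_module A M by (rule M)
  show ?case using null_zero_right[OF assms(2)] by simp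
next
  case (insert i K)
  interpret M: left_module A M by (rule M)
  have y: "y \<in> K \<rightarrow> carrier M" "y i \<in> carrier M" using insert by auto
  have "frag_of (x, y i \<oplus>\<^bsub>M\<^esub> (\<Oplus>\<^bsub>M\<^esub>i\<in>K. y i)) - frag_of (x, y i) - frag_of (x, \<Oplus>\<^bsub>M\<^esub>i\<in>K. y i)
      + (frag_of (x, \<Oplus>\<^bsub>M\<^esub>i\<in>K. y i) - (\<Sum>i\<in>K. frag_of (x, y i))) \<in> T"
    by (rule null_add[OF null_add_right[OF assms(2) y(2) M.M.finsum_closed[OF y(1)]] insert.IH[OF y(1)]])
  thus ?case using insert y by (simp add: algebra_simps)
qed

end

text \<open>
  By additivity, injectivity on cosets means that a formal sum is null as soon as its image is.
\<close>

lemma flat_moduleI: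
  fixes A :: "('a, 'c) ring_scheme" and M :: "('a, 'm) module"
  assumes M: "left_module A M"
    and *: "\<And>(N :: ('a, 'a) module) (N' :: ('a, 'a) module) f w.
      right_module A N \<Longrightarrow> right_module A N' \<Longrightarrow> f \<in> mod_hom A N N' \<Longrightarrow> inj_on f (carrier N) \<Longrightarrow>
      Poly_Mapping.keys w \<subseteq> carrier N \<times> carrier M \<Longrightarrow>
      frag_extend (\<lambda>(x, y). frag_of (f x, y)) w \<in> tensor_null A N' M \<Longrightarrow> w \<in> tensor_null A N M"
  shows "flat_module A M"
  unfolding flat_module_def
proof (intro conjI allI impI M inj_onI)
  fix N N' :: "('a, 'a) module" and f C1 C2
  assume N: "right_module A N" and N': "right_module A N'" and f: "f \<in> mod_hom A N N'" "inj_on f (carrier N)"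
    and C: "C1 \<in> carrier (tensor_product A N M)" "C2 \<in> carrier (tensor_product A N M)"
    and eq: "tensor_map A N' M f C1 = tensor_map A N' M f C2"
  interpret T: tensor_pair A N M by (rule tensor_pair.intro[OF N M])
  interpret T': tensor_pair A N' M by (rule tensor_pair.intro[OF N' M])
  let ?G = "free_Abelian_group (carrier N \<times> carrier M)"
  let ?F = "frag_extend (\<lambda>(x, y). frag_of (f x, y))"
  have coset: "r_coset (free_Abelian_group Q) K w = {k + w | k. k \<in> K}" for Q K and w :: "'z \<Rightarrow>\<^sub>0 int"
    by (auto simp: r_coset_def)
  obtain w1 w2 where w: "Poly_Mapping.keys w1 \<subseteq> carrier N \<times> carrier M" "C1 = r_coset ?G (tensor_null A N M) w1"
    "Poly_Mapping.keys w2 \<subseteq> carrier N \<times> carrier M" "C2 = r_coset ?G (tensor_null A N M) w2"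
    using C unfolding tensor_product_def FactGroup_def RCOSETS_def by auto
  have "?F w1 \<in> tensor_map A N' M f C1"
    unfolding tensor_map_def w(2) coset using T.null_zero T'.null_zero by force
  hence "?F w1 \<in> tensor_map A N' M f C2" unfolding eq .
  then obtain w' where w': "w' \<in> C2" "?F w1 - ?F w' \<in> tensor_null A N' M"
    unfolding tensor_map_def coset by auto
  then obtain k where k: "k \<in> tensor_null A N M" "w' = k + w2" unfolding w(4) coset by auto
  have kw': "Poly_Mapping.keys w' \<subseteq> carrier N \<times> carrier M"
    using T.keys_null[OF k(1)] w(3) keys_add[of k w2] unfolding k(2) by blast
  have "Poly_Mapping.keys (w1 - w') \<subseteq> carrier N \<times> carrier M" using kw' w(1) keys_diff[of w1 w'] by blast
  moreover have "?F (w1 - w') \<in> tensor_null A N' M" using w'(2) by (simp add: frag_extend_diff)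
  ultimately have "w1 - w' \<in> tensor_null A N M" by (rule *[OF N N' f])
  from T.null_add[OF this k(1)] have d: "w1 - w2 \<in> tensor_null A N M" using k(2) by simp
  show "C1 = C2"
  proof
    show "C1 \<subseteq> C2"
    proof
      fix u assume "u \<in> C1"
      then obtain k where "k \<in> tensor_null A N M" "u = k + w1" unfolding w coset by auto
      with T.null_add[OF this(1) d] show "u \<in> C2" unfolding w coset by (intro CollectI exI[of _ "k + (w1 - w2)"]) auto
    qed
    show "C2 \<subseteq> C1"
    proof
      fix u assume "u \<in> C2"
      then obtain k where "k \<in> tensor_null A N M" "u = k + w2" unfolding w coset by auto
      with T.null_diff[OF this(1) d] show "u \<in> C1" unfolding w coset by (intro CollectI exI[of _ "k - (w1 - w2)"]) auto
    qed
  qed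
qed

lemma flat_moduleD:
  fixes A :: "('a, 'c) ring_scheme" and M :: "('a, 'm) module" and N N' :: "('a, 'a) module"
  assumes flat: "flat_module A M" and N: "right_module A N" and N': "right_module A N'"
    and incl: "(\<lambda>x. x) \<in> mod_hom A N N'"
    and w: "Poly_Mapping.keys w \<subseteq> carrier N \<times> carrier M" "w \<in> tensor_null A N' M"
  shows "w \<in> tensor_null A N M"
proof -
  have M: "left_module A M" using flat by (simp add: flat_module_def)
  interpret T: tensor_pair A N M by (rule tensor_pair.intro[OF N M])
  interpret T': tensor_pair A N' M by (rule tensor_pair.intro[OF N' M])
  let ?G = "free_Abelian_group (carrier N \<times> carrier M)"
  have coset: "r_coset (free_Abelian_group Q) K w = {k + w | k. k \<in> K}" for Q K and w :: "'z \<Rightarrow>\<^sub>0 int"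
    by (auto simp: r_coset_def)
  have sub: "u \<in> tensor_null A N' M" if "u \<in> tensor_null A N M" for u
    using that
  proof (induction rule: T.null_induct)
    case (left x x' y)
    thus ?case using T'.null_add_left[of x x' y] mod_hom_closed[OF incl] mod_hom_add[OF incl] by metis
  next
    case (right x y y')
    thus ?case using T'.null_add_right[of x y y'] mod_hom_closed[OF incl] by metis
  next
    case (smult a x y)
    thus ?case using T'.null_smult[of a x y] mod_hom_closed[OF incl] mod_hom_smult[OF incl] by metis
  qed (auto intro: T'.null_zero T'.null_add T'.null_minus)
  have id: "frag_extend (\<lambda>(x, y). frag_of (x, y)) u = u" for u :: "('a \<times> 'm) \<Rightarrow>\<^sub>0 int"
    using frag_expansion[of u] by (simp add: case_prod_beta')
  have map: "tensor_map A N' M (\<lambda>x. x) C = tensor_null A N' M"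
    if ne: "C \<noteq> {}" and C: "C \<subseteq> tensor_null A N' M" for C
  proof
    show "tensor_map A N' M (\<lambda>x. x) C \<subseteq> tensor_null A N' M"
      unfolding tensor_map_def coset id using C T'.null_add by auto
    show "tensor_null A N' M \<subseteq> tensor_map A N' M (\<lambda>x. x) C"
    proof
      fix u assume u: "u \<in> tensor_null A N' M"
      obtain c where c: "c \<in> C" using ne by auto
      have "u - c \<in> tensor_null A N' M" using u c C T'.null_diff by auto
      thus "u \<in> tensor_map A N' M (\<lambda>x. x) C"
        unfolding tensor_map_def coset id using c by (intro UN_I[OF c] CollectI exI[of _ "u - c"]) simp
    qed
  qed
  let ?C = "\<lambda>w. r_coset ?G (tensor_null A N M) w"
  have "inj_on (tensor_map A N' M (\<lambda>x. x)) (carrier (tensor_product A N M))"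
    using flat N N' incl unfolding flat_module_def by (metis inj_on_id2)
  moreover have "?C w \<in> carrier (tensor_product A N M)" "?C 0 \<in> carrier (tensor_product A N M)"
    using w(1) unfolding tensor_product_def FactGroup_def RCOSETS_def by auto
  moreover have "tensor_map A N' M (\<lambda>x. x) (?C w) = tensor_map A N' M (\<lambda>x. x) (?C 0)"
    using w(2) T.null_zero sub T'.null_add by (subst (1 2) map) (auto simp: coset)
  ultimately have "?C w = ?C 0" by (metis inj_onD)
  moreover have "w \<in> ?C w" using T.null_zero unfolding coset by force
  ultimately show ?thesis unfolding coset by auto
qed

context ring
begin

text \<open>
  The homomorphism with values \<open>c i \<cdot> y\<close> on the basis factors through the free module of rank one, by the row \<open>c\<close>,
  and the row \<open>c\<close> kills \<open>r\<close>. Such trivial syzygies account for all choices made in \<open>flat_imp_equationally_flat\<close>.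
\<close>

lemma factors_killing_single:
  assumes M: "left_module R M" and I: "finite I" and r: "r \<in> carrier (free_mod R I)"
    and c: "c \<in> I \<rightarrow> carrier R" "(\<Oplus>i\<in>I. r i \<otimes> c i) = \<zero>" and y: "y \<in> carrier M"
  shows "factors_killing R M I (free_ext R M (\<lambda>i. c i \<odot>\<^bsub>M\<^esub> y)) {r}"
proof -
  interpret M: left_module R M by (rule M)
  let ?F = "free_mod R {0::nat}"
  interpret F: left_module R ?F by (rule left_module_free_mod)
  let ?e = "free_basis R (0::nat)"
  have e: "?e \<in> carrier ?F" by (simp add: free_basis_closed)
  have w: "(\<lambda>i. c i \<odot>\<^bsub>?F\<^esub> ?e) \<in> I \<rightarrow> carrier ?F"
    using F.smult_closed[OF _ e] c(1) by blast
  have w': "(\<lambda>i. c i \<odot>\<^bsub>M\<^esub> y) \<in> I \<rightarrow> carrier M" using c(1) y M.smult_closed by blast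
  have k: "(\<lambda>i. y) \<in> {0::nat} \<rightarrow> carrier M" using y by auto
  let ?\<psi> = "free_ext R ?F (\<lambda>i. c i \<odot>\<^bsub>?F\<^esub> ?e)" and ?\<chi> = "free_ext R M (\<lambda>i::nat. y)"
  note \<psi> = free_ext_hom[OF left_module_free_mod w] and \<chi> = free_ext_hom[OF M k]
  show ?thesis
  proof (rule factors_killingI[OF _ \<psi> \<chi>])
    fix v assume v: "v \<in> carrier (free_mod R I)"
    show "?\<chi> (?\<psi> v) = free_ext R M (\<lambda>i. c i \<odot>\<^bsub>M\<^esub> y) v"
    proof (rule mod_hom_free_eqI[OF M mod_hom_comp[OF \<psi> \<chi>] free_ext_hom[OF M w'] _ v])
      fix i assume i: "i \<in> I"
      hence ci: "c i \<in> carrier R" using c by auto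
      show "?\<chi> (?\<psi> (free_basis R i)) = free_ext R M (\<lambda>i. c i \<odot>\<^bsub>M\<^esub> y) (free_basis R i)"
        unfolding free_ext_basis[OF left_module_free_mod w i] free_ext_basis[OF M w' i]
          mod_hom_smult[OF \<chi> ci e] free_ext_basis[OF M k singletonI] ..
    qed
  next
    fix q assume "q \<in> {r}"
    have ri: "r i \<in> carrier R" for i using r by (simp add: free_mod_carrier)
    have "?\<psi> r = (\<Oplus>\<^bsub>?F\<^esub>i\<in>I. r i \<odot>\<^bsub>?F\<^esub> (c i \<odot>\<^bsub>?F\<^esub> ?e))"
      using r by (intro free_ext_superset[OF left_module_free_mod w r I]) (auto simp: free_mod_carrier)
    also have "\<dots> = (\<Oplus>\<^bsub>?F\<^esub>i\<in>I. (r i \<otimes> c i) \<odot>\<^bsub>?F\<^esub> ?e)"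
    proof (rule F.M.finsum_cong'[OF refl])
      show "(\<lambda>i. (r i \<otimes> c i) \<odot>\<^bsub>?F\<^esub> ?e) \<in> I \<rightarrow> carrier ?F"
        using F.smult_closed[OF _ e] c(1) ri by blast
      fix i assume "i \<in> I"
      hence "c i \<in> carrier R" using c by auto
      from F.smult_assoc[OF ri this e, symmetric]
      show "r i \<odot>\<^bsub>?F\<^esub> (c i \<odot>\<^bsub>?F\<^esub> ?e) = (r i \<otimes> c i) \<odot>\<^bsub>?F\<^esub> ?e" .
    qed
    also have "\<dots> = (\<Oplus>i\<in>I. r i \<otimes> c i) \<odot>\<^bsub>?F\<^esub> ?e"
    proof -
      have "finite K \<Longrightarrow> K \<subseteq> I \<Longrightarrow> (\<Oplus>\<^bsub>?F\<^esub>i\<in>K. (r i \<otimes> c i) \<odot>\<^bsub>?F\<^esub> ?e) = (\<Oplus>i\<in>K. r i \<otimes> c i) \<odot>\<^bsub>?F\<^esub> ?e" for K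
      proof (induction K rule: finite_induct)
        case empty
        show ?case using F.smult_l_zero[OF e] by simp
      next
        case (insert k K)
        have rc: "r i \<otimes> c i \<in> carrier R" if "i \<in> I" for i using ri c(1) that by auto
        have 1: "(\<lambda>i. r i \<otimes> c i) \<in> K \<rightarrow> carrier R" "r k \<otimes> c k \<in> carrier R" using rc insert by auto
        have 2: "(\<lambda>i. (r i \<otimes> c i) \<odot>\<^bsub>?F\<^esub> ?e) \<in> K \<rightarrow> carrier ?F" "(r k \<otimes> c k) \<odot>\<^bsub>?F\<^esub> ?e \<in> carrier ?F"
          using F.smult_closed[OF _ e] 1 by blast+
        show ?case
          using insert.IH insert.prems unfolding finsum_insert[OF insert(1,2) 1] F.M.finsum_insert[OF insert(1,2) 2]
            F.smult_l_distr[OF 1(2) finsum_closed[OF 1(1)] e] by (simp del: free_mod_simps)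
      qed
      from this[OF I subset_refl] show ?thesis .
    qed
    also have "\<dots> = (\<lambda>x. \<zero>)" unfolding c(2) using F.smult_l_zero[OF e] by simp
    finally show "?\<psi> q = (\<lambda>x. \<zero>)" using \<open>q \<in> {r}\<close> by simp
  qed simp
qed

text \<open>
  A right ideal \<open>S\<close>, or the ring itself, as a right module: the test modules for flatness.
\<close>

definition right_regular :: "('a, 'c) ring_scheme \<Rightarrow> 'a set \<Rightarrow> ('a, 'a) module"
  where "right_regular A S =
    \<lparr>carrier = S, monoid.mult = monoid.mult A, one = \<one>\<^bsub>A\<^esub>, ring.zero = \<zero>\<^bsub>A\<^esub>, ring.add = ring.add A,
     smult = (\<lambda>a x. x \<otimes>\<^bsub>A\<^esub> a)\<rparr>"

lemma right_module_right_regular: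
  assumes S: "S \<subseteq> carrier R" "\<zero> \<in> S" "\<And>x y. x \<in> S \<Longrightarrow> y \<in> S \<Longrightarrow> x \<oplus> y \<in> S"
    "\<And>a x. a \<in> carrier R \<Longrightarrow> x \<in> S \<Longrightarrow> x \<otimes> a \<in> S"
  shows "right_module R (right_regular R S)"
proof -
  have neg: "\<ominus> x \<in> S" if "x \<in> S" for x
    using S(4)[of "\<ominus> \<one>" x] that S(1) by (auto simp: r_minus subset_iff)
  have "abelian_group (right_regular R S)"
  proof (rule abelian_groupI, goal_cases)
    case (6 x)
    then show ?case using neg S(1) by (auto simp: right_regular_def subset_iff intro!: bexI[of _ "\<ominus> x"] l_neg)
  qed (use S in \<open>auto simp: right_regular_def subset_iff a_ac\<close>)
  thus ?thesis
    using S by (intro right_module.intro right_module_axioms.intro ring_axioms)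
      (auto simp: right_regular_def subset_iff r_distr l_distr m_assoc)
qed

text \<open>
  Let \<open>m i = \<phi> (e i)\<close>, so that \<open>\<Sum>i. r i \<cdot> m i = 0\<close>, and let \<open>S\<close> be the right ideal generated by the \<open>r i\<close>. The element
  \<open>\<Sum>i. r i \<otimes> m i\<close> vanishes in \<open>R \<otimes> M\<close>, hence by flatness in \<open>S \<otimes> M\<close>. Choose coefficients with
  \<open>c = \<Sum>i. r i \<cdot> b c i\<close> for each \<open>c\<close> in \<open>S\<close> and send \<open>c \<otimes> y\<close> to the family \<open>b c i \<cdot> y\<close>. The choice is not additive
  in \<open>c\<close>, but the error in each defining relation of the tensor product is a trivial syzygy. Hence the
  families coming from null elements define factorizable homomorphisms (the predicate \<open>P\<close> in the proof),
  and up to another trivial syzygy the family of \<open>\<Sum>i. r i \<otimes> m i\<close> is \<open>m\<close>.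
\<close>

lemma flat_imp_equationally_flat:
  assumes flat: "flat_module R M" shows "equationally_flat R M"
proof -
  have M: "left_module R M" using flat by (simp add: flat_module_def)
  interpret M: left_module R M by (rule M)
  show ?thesis
  proof (rule equationally_flatI[OF M])
    fix I :: "nat set" and \<phi> r
    assume I: "finite I" and \<phi>: "\<phi> \<in> mod_hom R (free_mod R I) M"
      and r: "r \<in> carrier (free_mod R I)" "\<phi> r = \<zero>\<^bsub>M\<^esub>"
    have ri: "r i \<in> carrier R" for i using r by (simp add: free_mod_carrier)
    define m where "m = (\<lambda>i. \<phi> (free_basis R i))"
    have mi: "m i \<in> carrier M" if "i \<in> I" for i
      unfolding m_def by (rule mod_hom_closed[OF \<phi> free_basis_closed[OF that]])
    define S where "S = {\<Oplus>i\<in>I. r i \<otimes> b i | b. b \<in> I \<rightarrow> carrier R}"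
    have rb: "(\<lambda>i. r i \<otimes> b i) \<in> I \<rightarrow> carrier R" if "b \<in> I \<rightarrow> carrier R" for b using that ri by auto
    have Ssub: "S \<subseteq> carrier R" unfolding S_def using finsum_closed[OF rb] by auto
    have Szero: "\<zero> \<in> S"
      unfolding S_def using ri by (intro CollectI exI[of _ "\<lambda>i. \<zero>"]) (auto intro!: add.finprod_one_eqI[symmetric])
    have Splus: "(\<Oplus>i\<in>I. r i \<otimes> b i) \<oplus> (\<Oplus>i\<in>I. r i \<otimes> c i) = (\<Oplus>i\<in>I. r i \<otimes> (b i \<oplus> c i))"
      if "b \<in> I \<rightarrow> carrier R" "c \<in> I \<rightarrow> carrier R" for b c
      unfolding finsum_addf[OF rb[OF that(1)] rb[OF that(2)], symmetric]
      using that ri by (intro finsum_cong') (auto simp: r_distr Pi_iff)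
    have Sminus: "\<ominus> (\<Oplus>i\<in>I. r i \<otimes> b i) = (\<Oplus>i\<in>I. r i \<otimes> (\<ominus> b i))" if b: "b \<in> I \<rightarrow> carrier R" for b
    proof (rule minus_equality)
      have "(\<Oplus>i\<in>I. r i \<otimes> (\<ominus> b i)) \<oplus> (\<Oplus>i\<in>I. r i \<otimes> b i) = (\<Oplus>i\<in>I. r i \<otimes> (\<ominus> b i \<oplus> b i))"
        using b by (intro Splus) auto
      also have "\<dots> = \<zero>" using b ri by (intro add.finprod_one_eqI) (auto simp: l_neg Pi_iff)
      finally show "(\<Oplus>i\<in>I. r i \<otimes> (\<ominus> b i)) \<oplus> (\<Oplus>i\<in>I. r i \<otimes> b i) = \<zero>" .
      show "(\<Oplus>i\<in>I. r i \<otimes> b i) \<in> carrier R" by (rule finsum_closed[OF rb[OF b]])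
      show "(\<Oplus>i\<in>I. r i \<otimes> (\<ominus> b i)) \<in> carrier R" using b by (intro finsum_closed[OF rb]) auto
    qed
    have Smult: "(\<Oplus>i\<in>I. r i \<otimes> b i) \<otimes> a = (\<Oplus>i\<in>I. r i \<otimes> (b i \<otimes> a))"
      if "b \<in> I \<rightarrow> carrier R" "a \<in> carrier R" for b a
      using that ri I by (subst finsum_ldistr) (auto intro!: finsum_cong' simp: m_assoc Pi_iff)
    have unit: "(\<Oplus>i\<in>I. r i \<otimes> (if i = k then \<one> else \<zero>)) = r k" if "k \<in> I" for k
    proof -
      have "(\<Oplus>i\<in>I. r i \<otimes> (if i = k then \<one> else \<zero>)) = (\<Oplus>i\<in>I. if i = k then r i else \<zero>)"
        using ri by (intro finsum_cong') auto
      also have "\<dots> = r k" using ri by (intro add.finprod_singleton_swap[OF that I]) auto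
      finally show ?thesis .
    qed
    have rS: "r k \<in> S" if "k \<in> I" for k
      unfolding S_def using unit[OF that, symmetric] by auto
    let ?N = "right_regular R S" and ?N' = "right_regular R (carrier R)"
    have N': "right_module R ?N'" by (rule right_module_right_regular) auto
    have N: "right_module R ?N"
    proof (rule right_module_right_regular[OF Ssub Szero])
      fix x y assume "x \<in> S" "y \<in> S"
      then obtain b c where "b \<in> I \<rightarrow> carrier R" "c \<in> I \<rightarrow> carrier R"
        "x = (\<Oplus>i\<in>I. r i \<otimes> b i)" "y = (\<Oplus>i\<in>I. r i \<otimes> c i)" unfolding S_def by blast
      thus "x \<oplus> y \<in> S" unfolding S_def by (intro CollectI exI[of _ "\<lambda>i. b i \<oplus> c i"]) (simp add: Splus Pi_iff)
    next
      fix a x assume "a \<in> carrier R" "x \<in> S"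
      then obtain b where "b \<in> I \<rightarrow> carrier R" "x = (\<Oplus>i\<in>I. r i \<otimes> b i)" unfolding S_def by blast
      thus "x \<otimes> a \<in> S" using \<open>a \<in> carrier R\<close> unfolding S_def
        by (intro CollectI exI[of _ "\<lambda>i. b i \<otimes> a"]) (simp add: Smult Pi_iff)
    qed
    have Nsimps: "carrier (right_regular R K) = K" "x \<oplus>\<^bsub>right_regular R K\<^esub> y = x \<oplus> y"
      "a \<odot>\<^bsub>right_regular R K\<^esub> x = x \<otimes> a" "\<zero>\<^bsub>right_regular R K\<^esub> = \<zero>" for K a x y
      by (simp_all add: right_regular_def)
    interpret T: tensor_pair R ?N M by (rule tensor_pair.intro[OF N M])
    interpret T': tensor_pair R ?N' M by (rule tensor_pair.intro[OF N' M])
    let ?w = "\<Sum>i\<in>I. frag_of (r i, m i)"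
    have wT': "?w \<in> T'.T"
    proof -
      have ym: "(\<lambda>i. r i \<odot>\<^bsub>M\<^esub> m i) \<in> I \<rightarrow> carrier M" using ri mi M.smult_closed by auto
      have mI: "m \<in> I \<rightarrow> carrier M" using mi by auto
      have "\<phi> r = free_ext R M m r"
        by (rule mod_hom_free_eqI[OF M \<phi> free_ext_hom[OF M mI] _ r(1)])
           (simp only: free_ext_basis[OF M mI], simp only: m_def)
      also have "\<dots> = (\<Oplus>\<^bsub>M\<^esub>i\<in>I. r i \<odot>\<^bsub>M\<^esub> m i)"
        using r by (intro free_ext_superset[OF M mI r(1) I]) (auto simp: free_mod_carrier)
      finally have sum0: "(\<Oplus>\<^bsub>M\<^esub>i\<in>I. r i \<odot>\<^bsub>M\<^esub> m i) = \<zero>\<^bsub>M\<^esub>" using r(2) by simp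
      have 1: "(\<Sum>i\<in>I. frag_of (r i, m i) - frag_of (\<one>, r i \<odot>\<^bsub>M\<^esub> m i)) \<in> T'.T"
      proof (rule T'.null_sum)
        fix i assume "i \<in> I"
        thus "frag_of (r i, m i) - frag_of (\<one>, r i \<odot>\<^bsub>M\<^esub> m i) \<in> T'.T"
          using T'.null_smult[of "r i" \<one> "m i"] ri mi by (simp add: Nsimps)
      qed
      have 2: "frag_of (\<one>, \<zero>\<^bsub>M\<^esub>) - (\<Sum>i\<in>I. frag_of (\<one>, r i \<odot>\<^bsub>M\<^esub> m i)) \<in> T'.T"
        using T'.null_finsum_right[OF I _ ym, of \<one>] unfolding sum0 by (simp add: Nsimps)
      have 3: "frag_of (\<one>, \<zero>\<^bsub>M\<^esub>) \<in> T'.T" by (rule T'.null_zero_right) (simp add: Nsimps)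
      from T'.null_add[OF 1 T'.null_diff[OF 3 2]] show ?thesis by (simp add: sum_subtractf)
    qed
    have keys_w: "Poly_Mapping.keys ?w \<subseteq> S \<times> carrier M"
    proof -
      have "Poly_Mapping.keys ?w \<subseteq> (\<Union>i\<in>I. Poly_Mapping.keys (frag_of (r i, m i)))" by (rule keys_sum)
      also have "\<dots> \<subseteq> S \<times> carrier M" using rS mi by (auto simp: keys_frag_of)
      finally show ?thesis .
    qed
    have wT: "?w \<in> T.T"
      by (rule flat_moduleD[OF flat N N' _ _ wT']) (use Ssub keys_w in \<open>auto simp: mod_hom_def Nsimps\<close>)
    have "\<exists>b. b \<in> I \<rightarrow> carrier R \<and> (\<Oplus>i\<in>I. r i \<otimes> b i) = c" if "c \<in> S" for c
      using that unfolding S_def by blast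
    then obtain b where bI: "\<And>c. c \<in> S \<Longrightarrow> b c \<in> I \<rightarrow> carrier R"
      and bs: "\<And>c. c \<in> S \<Longrightarrow> (\<Oplus>i\<in>I. r i \<otimes> b c i) = c" by metis
    have bc: "b c i \<in> carrier R" if "c \<in> S" "i \<in> I" for c i using bI that by auto
    define g where "g = (\<lambda>i p. b (fst p) i \<odot>\<^bsub>M\<^esub> snd p)"
    have g: "g i p \<in> carrier M" if "i \<in> I" "p \<in> S \<times> carrier M" for i p
      unfolding g_def using that bc M.smult_closed by auto
    let ?S = "S \<times> carrier M"
    define hom_like where "hom_like i h \<longleftrightarrow> (\<forall>u. Poly_Mapping.keys u \<subseteq> ?S \<longrightarrow> h u \<in> carrier M) \<and>
        (\<forall>u v. Poly_Mapping.keys u \<subseteq> ?S \<longrightarrow> Poly_Mapping.keys v \<subseteq> ?S \<longrightarrow> h (u + v) = h u \<oplus>\<^bsub>M\<^esub> h v) \<and>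
        (\<forall>u v. Poly_Mapping.keys u \<subseteq> ?S \<longrightarrow> Poly_Mapping.keys v \<subseteq> ?S \<longrightarrow> h (u - v) = h u \<ominus>\<^bsub>M\<^esub> h v) \<and>
        h 0 = \<zero>\<^bsub>M\<^esub> \<and> (\<forall>p\<in>?S. h (frag_of p) = g i p)" for i h
    have "\<exists>h. hom_like i h" if "i \<in> I" for i
    proof (rule M.M.frag_universal[of ?S "g i"], goal_cases)
      case (1 p)
      show ?case by (rule g[OF that 1])
    next
      case (2 h)
      show ?case unfolding hom_like_def by (intro exI[of _ h] conjI allI impI ballI 2)
    qed
    then obtain h where h: "\<And>i. i \<in> I \<Longrightarrow> hom_like i (h i)" by metis
    have
      hcl: "\<And>i u. i \<in> I \<Longrightarrow> Poly_Mapping.keys u \<subseteq> ?S \<Longrightarrow> h i u \<in> carrier M" and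
      hadd: "\<And>i u v. i \<in> I \<Longrightarrow> Poly_Mapping.keys u \<subseteq> ?S \<Longrightarrow> Poly_Mapping.keys v \<subseteq> ?S \<Longrightarrow>
          h i (u + v) = h i u \<oplus>\<^bsub>M\<^esub> h i v" and
      hdiff: "\<And>i u v. i \<in> I \<Longrightarrow> Poly_Mapping.keys u \<subseteq> ?S \<Longrightarrow> Poly_Mapping.keys v \<subseteq> ?S \<Longrightarrow>
          h i (u - v) = h i u \<ominus>\<^bsub>M\<^esub> h i v" and
      hzero: "\<And>i. i \<in> I \<Longrightarrow> h i 0 = \<zero>\<^bsub>M\<^esub>" and
      hfrag: "\<And>i p. i \<in> I \<Longrightarrow> p \<in> ?S \<Longrightarrow> h i (frag_of p) = g i p"
      using h unfolding hom_like_def by auto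
    have h2: "h i (frag_of p - frag_of q) = g i p \<ominus>\<^bsub>M\<^esub> g i q" if "i \<in> I" "p \<in> ?S" "q \<in> ?S" for i p q
      using that by (simp add: hdiff hfrag keys_frag_of)
    have k2: "Poly_Mapping.keys (frag_of p - frag_of q) \<subseteq> ?S" if "p \<in> ?S" "q \<in> ?S" for p q
      using keys_diff[of "frag_of p" "frag_of q"] that by (auto simp: keys_frag_of)
    have h3: "h i (frag_of p - frag_of q - frag_of s) = g i p \<ominus>\<^bsub>M\<^esub> g i q \<ominus>\<^bsub>M\<^esub> g i s"
      if "i \<in> I" "p \<in> ?S" "q \<in> ?S" "s \<in> ?S" for i p q s
      using that k2[OF that(2,3)] by (simp add: hdiff[of i "frag_of p - frag_of q"] h2 hfrag keys_frag_of)
    \<comment> \<open>A family satisfying \<open>P\<close> is one for which the required factorization exists; these families form a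
      group that contains the trivial syzygies.\<close>
    define P where "P v \<longleftrightarrow> v \<in> I \<rightarrow> carrier M \<and> factors_killing R M I (free_ext R M v) {r}" for v
    have P_cong: "P v'" if "P v" "\<And>i. i \<in> I \<Longrightarrow> v i = v' i" for v v'
    proof -
      have v1: "v \<in> I \<rightarrow> carrier M" using that(1) by (simp add: P_def)
      hence "v' \<in> I \<rightarrow> carrier M" by (simp add: Pi_iff that(2)[symmetric])
      note v = v1 this
      have "free_ext R M v x = free_ext R M v' x" if x: "x \<in> carrier (free_mod R I)" for x
        by (rule mod_hom_free_eqI[OF M free_ext_hom[OF M v(1)] free_ext_hom[OF M v(2)] _ x])
           (simp add: free_ext_basis[OF M v(1)] free_ext_basis[OF M v(2)] \<open>\<And>i. i \<in> I \<Longrightarrow> v i = v' i\<close>)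
      thus ?thesis unfolding P_def
        by (intro conjI v(2) factors_killing_cong[OF conjunct2[OF that(1)[unfolded P_def]]])
    qed
    have P_zero: "P (\<lambda>i. \<zero>\<^bsub>M\<^esub>)"
    proof -
      have v: "(\<lambda>i. \<zero>\<^bsub>M\<^esub>) \<in> I \<rightarrow> carrier M" by auto
      have "\<zero>\<^bsub>M\<^esub> = free_ext R M (\<lambda>i. \<zero>\<^bsub>M\<^esub>) x" if x: "x \<in> carrier (free_mod R I)" for x
        by (rule mod_hom_free_eqI[OF M mod_hom_const_zero[OF M] free_ext_hom[OF M v] _ x])
           (simp add: free_ext_basis[OF M v])
      thus ?thesis unfolding P_def by (intro conjI v factors_killing_cong[OF factors_killing_zero[OF M]])
    qed
    have P_add: "P (\<lambda>i. v i \<oplus>\<^bsub>M\<^esub> w i)" if "P v" "P w" for v w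
    proof -
      have v: "v \<in> I \<rightarrow> carrier M" and w: "w \<in> I \<rightarrow> carrier M" using that by (auto simp: P_def)
      have vw: "(\<lambda>i. v i \<oplus>\<^bsub>M\<^esub> w i) \<in> I \<rightarrow> carrier M" using v w by auto
      have "free_ext R M v x \<oplus>\<^bsub>M\<^esub> free_ext R M w x = free_ext R M (\<lambda>i. v i \<oplus>\<^bsub>M\<^esub> w i) x"
        if x: "x \<in> carrier (free_mod R I)" for x
        by (rule mod_hom_free_eqI[OF M mod_hom_plus[OF M free_ext_hom[OF M v] free_ext_hom[OF M w]] free_ext_hom[OF M vw] _ x])
           (simp add: free_ext_basis[OF M v] free_ext_basis[OF M w] free_ext_basis[OF M vw])
      note eq = this
      have fk: "factors_killing R M I (free_ext R M v) {r}" "factors_killing R M I (free_ext R M w) {r}"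
        using that by (simp_all add: P_def)
      show ?thesis unfolding P_def
        by (intro conjI vw factors_killing_cong[OF factors_killing_add[OF M fk]] eq)
    qed
    have P_single: "P (\<lambda>i. c i \<odot>\<^bsub>M\<^esub> y)"
      if "c \<in> I \<rightarrow> carrier R" "(\<Oplus>i\<in>I. r i \<otimes> c i) = \<zero>" "y \<in> carrier M" for c y
      unfolding P_def using factors_killing_single[OF M I r(1) that] that M.smult_closed by auto
    have P_minus: "P (\<lambda>i. \<ominus>\<^bsub>M\<^esub> v i)" if "P v" for v
    proof -
      have v: "v \<in> I \<rightarrow> carrier M" using that by (auto simp: P_def)
      have v': "(\<lambda>i. \<ominus>\<^bsub>M\<^esub> v i) \<in> I \<rightarrow> carrier M" using v by auto
      note z = mod_hom_sub[OF M mod_hom_const_zero[OF M] free_ext_hom[OF M v]]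
      have "\<ominus>\<^bsub>M\<^esub> free_ext R M v x = free_ext R M (\<lambda>i. \<ominus>\<^bsub>M\<^esub> v i) x" if x: "x \<in> carrier (free_mod R I)" for x
      proof -
        have "\<zero>\<^bsub>M\<^esub> \<ominus>\<^bsub>M\<^esub> free_ext R M v x = free_ext R M (\<lambda>i. \<ominus>\<^bsub>M\<^esub> v i) x"
          by (rule mod_hom_free_eqI[OF M z free_ext_hom[OF M v'] _ x])
             (use v in \<open>simp add: free_ext_basis[OF M v] free_ext_basis[OF M v'] a_minus_def Pi_iff\<close>)
        thus ?thesis using mod_hom_closed[OF free_ext_hom[OF M v] x] by (simp add: a_minus_def)
      qed
      note eq = this
      have fk: "factors_killing R M I (free_ext R M v) {r}" using that by (simp add: P_def)
      show ?thesis unfolding P_def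
        by (intro conjI v' factors_killing_cong[OF factors_killing_minus[OF M fk]] eq)
    qed
    \<comment> \<open>Each generator of the relations of \<open>S \<otimes> M\<close> is sent into that group.\<close>
    have main: "P (\<lambda>i. h i w)" if "w \<in> T.T" for w
      using that
    proof (induction rule: T.null_induct)
      case zero
      show ?case by (rule P_cong[OF P_zero]) (simp add: hzero)
    next
      case (add u v)
      show ?case by (rule P_cong[OF P_add[OF add(3,4)]])
        (use T.keys_null[OF add(1)] T.keys_null[OF add(2)] in \<open>simp add: hadd Nsimps\<close>)
    next
      case (minus u)
      show ?case
      proof (rule P_cong[OF P_minus[OF minus(2)]])
        fix i assume i: "i \<in> I"
        show "\<ominus>\<^bsub>M\<^esub> h i u = h i (- u)"
          using hdiff[OF i, of 0 u] hzero[OF i] hcl[OF i, of u] T.keys_null[OF minus(1)]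
          by (simp add: a_minus_def Nsimps)
      qed
    next
      case (left x x' y)
      hence x: "x \<in> S" "x' \<in> S" and y: "y \<in> carrier M" by (simp_all add: Nsimps)
      have xx: "x \<oplus> x' \<in> S" using right_module.axioms(2)[OF N] x abelian_group.axioms(1)[of ?N]
          abelian_monoid.a_closed[of ?N x x'] by (simp add: Nsimps)
      let ?c = "\<lambda>i. b (x \<oplus> x') i \<oplus> \<ominus> b x i \<oplus> \<ominus> b x' i"
      have neg: "(\<lambda>i. \<ominus> b z i) \<in> I \<rightarrow> carrier R" if "z \<in> S" for z using bc[OF that] by auto
      have pl: "(\<lambda>i. b (x \<oplus> x') i \<oplus> \<ominus> b x i) \<in> I \<rightarrow> carrier R" using bc xx x by auto
      have "(\<Oplus>i\<in>I. r i \<otimes> ?c i) = x \<oplus> x' \<oplus> \<ominus> x \<oplus> \<ominus> x'"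
        unfolding Splus[OF pl neg[OF x(2)], symmetric] Splus[OF bI[OF xx] neg[OF x(1)], symmetric]
          Sminus[OF bI[OF x(1)], symmetric] Sminus[OF bI[OF x(2)], symmetric] bs[OF xx] bs[OF x(1)] bs[OF x(2)] ..
      also have "\<dots> = \<zero>"
      proof -
        have "x \<in> carrier R" "x' \<in> carrier R" using x Ssub by auto
        thus ?thesis by (simp add: a_ac r_neg1 r_neg)
      qed
      finally have "P (\<lambda>i. ?c i \<odot>\<^bsub>M\<^esub> y)" using bc x xx y by (intro P_single) auto
      thus ?case
      proof (rule P_cong)
        fix i assume i: "i \<in> I"
        have "?c i \<odot>\<^bsub>M\<^esub> y = b (x \<oplus> x') i \<odot>\<^bsub>M\<^esub> y \<ominus>\<^bsub>M\<^esub> b x i \<odot>\<^bsub>M\<^esub> y \<ominus>\<^bsub>M\<^esub> b x' i \<odot>\<^bsub>M\<^esub> y"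
          using bc[OF xx i] bc[OF x(1) i] bc[OF x(2) i] y
          by (simp add: M.smult_l_distr M.smult_l_minus a_minus_def)
        also have "\<dots> = h i (frag_of (x \<oplus> x', y) - frag_of (x, y) - frag_of (x', y))"
          using x xx y i by (simp add: h3 g_def)
        finally show "?c i \<odot>\<^bsub>M\<^esub> y = h i (frag_of (x \<oplus>\<^bsub>?N\<^esub> x', y) - frag_of (x, y) - frag_of (x', y))"
          by (simp add: Nsimps)
      qed
    next
      case (right x y y')
      hence x: "x \<in> S" by (simp add: Nsimps)
      show ?case
      proof (rule P_cong[OF P_zero])
        fix i assume i: "i \<in> I"
        note c = bc[OF x i]
        show "\<zero>\<^bsub>M\<^esub> = h i (frag_of (x, y \<oplus>\<^bsub>M\<^esub> y') - frag_of (x, y) - frag_of (x, y'))"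
          using x right(2,3) i c
          by (simp add: h3 g_def M.smult_r_distr a_minus_def M.M.a_ac M.smult_closed M.M.r_neg M.M.r_neg1)
      qed
    next
      case (smult a x y)
      hence x: "x \<in> S" and y: "y \<in> carrier M" and a: "a \<in> carrier R" by (simp_all add: Nsimps)
      have xa: "x \<otimes> a \<in> S" using right_module.smult_closed[OF N, of a x] x a by (simp add: Nsimps)
      let ?c = "\<lambda>i. b (x \<otimes> a) i \<oplus> \<ominus> (b x i \<otimes> a)"
      have ba: "(\<lambda>i. b x i \<otimes> a) \<in> I \<rightarrow> carrier R" using bc[OF x] a by auto
      have nba: "(\<lambda>i. \<ominus> (b x i \<otimes> a)) \<in> I \<rightarrow> carrier R" using bc[OF x] a by auto
      have "(\<Oplus>i\<in>I. r i \<otimes> ?c i) = x \<otimes> a \<oplus> \<ominus> (x \<otimes> a)"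
        unfolding Splus[OF bI[OF xa] nba, symmetric] Sminus[OF ba, symmetric]
          Smult[OF bI[OF x] a, symmetric] bs[OF xa] bs[OF x] ..
      also have "\<dots> = \<zero>" using xa Ssub by (auto simp: r_neg)
      finally have "P (\<lambda>i. ?c i \<odot>\<^bsub>M\<^esub> y)" using bc xa nba y by (intro P_single) auto
      thus ?case
      proof (rule P_cong)
        fix i assume i: "i \<in> I"
        have "?c i \<odot>\<^bsub>M\<^esub> y = b (x \<otimes> a) i \<odot>\<^bsub>M\<^esub> y \<ominus>\<^bsub>M\<^esub> b x i \<odot>\<^bsub>M\<^esub> (a \<odot>\<^bsub>M\<^esub> y)"
          using bc[OF xa i] bc[OF x i] y a
          by (simp add: M.smult_l_distr M.smult_l_minus M.smult_assoc a_minus_def)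
        also have "\<dots> = h i (frag_of (x \<otimes> a, y) - frag_of (x, a \<odot>\<^bsub>M\<^esub> y))"
          using x xa y i a by (simp add: h2 g_def M.smult_closed)
        finally show "?c i \<odot>\<^bsub>M\<^esub> y = h i (frag_of (a \<odot>\<^bsub>?N\<^esub> x, y) - frag_of (x, a \<odot>\<^bsub>M\<^esub> y))"
          by (simp add: Nsimps)
      qed
    qed
    \<comment> \<open>The chosen coefficients of \<open>r k\<close> and the obvious ones differ by a syzygy; summing over \<open>k\<close> compares \<open>m\<close> with
      the family of \<open>\<Sum>k. r k \<otimes> m k\<close>.\<close>
    have "P (\<lambda>i. (if i \<in> K then m i else \<zero>\<^bsub>M\<^esub>) \<ominus>\<^bsub>M\<^esub> h i (\<Sum>k\<in>K. frag_of (r k, m k)))"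
      if "finite K" "K \<subseteq> I" for K
      using that
    proof (induction K rule: finite_induct)
      case empty
      have m0: "\<ominus>\<^bsub>M\<^esub> \<zero>\<^bsub>M\<^esub> = \<zero>\<^bsub>M\<^esub>" by (rule M.M.minus_equality) simp_all
      show ?case by (rule P_cong[OF P_zero]) (simp add: hzero a_minus_def m0)
    next
      case (insert k K)
      hence k: "k \<in> I" and K: "K \<subseteq> I" by auto
      have "Poly_Mapping.keys (\<Sum>k\<in>K. frag_of (r k, m k)) \<subseteq> (\<Union>k\<in>K. Poly_Mapping.keys (frag_of (r k, m k)))"
        by (rule keys_sum)
      also have "\<dots> \<subseteq> ?S" using rS mi K by (auto simp: keys_frag_of)
      finally have keysK: "Poly_Mapping.keys (\<Sum>k\<in>K. frag_of (r k, m k)) \<subseteq> ?S" .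
      let ?d = "\<lambda>i. if i = k then \<one> else \<zero>"
      let ?c = "\<lambda>i. ?d i \<oplus> \<ominus> b (r k) i"
      have d: "?d \<in> I \<rightarrow> carrier R" by auto
      have nb: "(\<lambda>i. \<ominus> b (r k) i) \<in> I \<rightarrow> carrier R" using bc[OF rS[OF k]] by auto
      have "(\<Oplus>i\<in>I. r i \<otimes> ?c i) = r k \<oplus> \<ominus> r k"
        unfolding Splus[OF d nb, symmetric] Sminus[OF bI[OF rS[OF k]], symmetric] bs[OF rS[OF k]] unit[OF k] ..
      also have "\<dots> = \<zero>" using ri by (simp add: r_neg)
      finally have "P (\<lambda>i. ?c i \<odot>\<^bsub>M\<^esub> m k)" using nb mi[OF k] by (intro P_single) auto
      from P_add[OF insert.IH[OF K] this] show ?case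
      proof (rule P_cong)
        fix i assume i: "i \<in> I"
        note c = bc[OF rS[OF k] i] mi[OF k] hcl[OF i keysK] mi[OF i]
        have "h i (\<Sum>k\<in>insert k K. frag_of (r k, m k)) = b (r k) i \<odot>\<^bsub>M\<^esub> m k \<oplus>\<^bsub>M\<^esub> h i (\<Sum>k\<in>K. frag_of (r k, m k))"
          using insert(1,2) hadd[OF i _ keysK, of "frag_of (r k, m k)"] hfrag[OF i, of "(r k, m k)"] rS[OF k] mi[OF k]
          by (simp add: keys_frag_of g_def)
        thus "(if i \<in> K then m i else \<zero>\<^bsub>M\<^esub>) \<ominus>\<^bsub>M\<^esub> h i (\<Sum>k\<in>K. frag_of (r k, m k)) \<oplus>\<^bsub>M\<^esub> ?c i \<odot>\<^bsub>M\<^esub> m k =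
          (if i \<in> insert k K then m i else \<zero>\<^bsub>M\<^esub>) \<ominus>\<^bsub>M\<^esub> h i (\<Sum>k\<in>insert k K. frag_of (r k, m k))"
          using c insert(2)
          by (auto simp: a_minus_def M.smult_l_distr M.smult_l_minus M.smult_one M.smult_l_zero M.smult_closed
              M.M.minus_add M.M.a_ac)
      qed
    qed
    from P_add[OF this[OF I subset_refl] main[OF wT]] have "P m"
    proof (rule P_cong)
      fix i assume i: "i \<in> I"
      have "h i ?w \<in> carrier M" using hcl[OF i] keys_w by blast
      thus "(if i \<in> I then m i else \<zero>\<^bsub>M\<^esub>) \<ominus>\<^bsub>M\<^esub> h i ?w \<oplus>\<^bsub>M\<^esub> h i ?w = m i"
        using i mi[OF i] by (simp add: a_minus_def M.M.a_assoc M.M.l_neg)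
    qed
    hence mI: "m \<in> I \<rightarrow> carrier M" and fk: "factors_killing R M I (free_ext R M m) {r}" by (simp_all add: P_def)
    have "free_ext R M m v = \<phi> v" if v: "v \<in> carrier (free_mod R I)" for v
      by (rule mod_hom_free_eqI[OF M free_ext_hom[OF M mI] \<phi> _ v]) (simp only: free_ext_basis[OF M mI], simp only: m_def)
    with fk show "factors_killing R M I \<phi> {r}" by (rule factors_killing_cong)
  qed
qed

text \<open>
  \<open>\<Phi> b\<close> stands for the additive extension of \<open>n \<otimes> m \<mapsto> n \<cdot> b m\<close>. It respects the relations of the tensor product if
  \<open>b\<close> is linear. A single null element involves finitely many relations, so it is already killed if \<open>b\<close> respects
  finitely many of the relations \<open>y + y' = (y + y')\<close> and \<open>a \<cdot> y = (a \<cdot> y)\<close> between elements of \<open>M\<close>: these are collected in \<open>E\<close>,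
  as elements of the kernel of the canonical surjection from the free module on \<open>carrier M\<close>.
\<close>

lemma tensor_null_finitely_many_relations:
  fixes M :: "('a, 'm) module" and N :: "('a, 'n) module"
  assumes N: "right_module R N" and M: "left_module R M"
    and cl: "\<And>b u. b \<in> carrier M \<rightarrow> carrier R \<Longrightarrow> Poly_Mapping.keys u \<subseteq> carrier N \<times> carrier M \<Longrightarrow> \<Phi> b u \<in> carrier N"
    and add: "\<And>b u v. b \<in> carrier M \<rightarrow> carrier R \<Longrightarrow> Poly_Mapping.keys u \<subseteq> carrier N \<times> carrier M \<Longrightarrow>
      Poly_Mapping.keys v \<subseteq> carrier N \<times> carrier M \<Longrightarrow> \<Phi> b (u + v) = \<Phi> b u \<oplus>\<^bsub>N\<^esub> \<Phi> b v"
    and diff: "\<And>b u v. b \<in> carrier M \<rightarrow> carrier R \<Longrightarrow> Poly_Mapping.keys u \<subseteq> carrier N \<times> carrier M \<Longrightarrow>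
      Poly_Mapping.keys v \<subseteq> carrier N \<times> carrier M \<Longrightarrow> \<Phi> b (u - v) = \<Phi> b u \<ominus>\<^bsub>N\<^esub> \<Phi> b v"
    and zero: "\<And>b. b \<in> carrier M \<rightarrow> carrier R \<Longrightarrow> \<Phi> b 0 = \<zero>\<^bsub>N\<^esub>"
    and frag: "\<And>b n m. b \<in> carrier M \<rightarrow> carrier R \<Longrightarrow> n \<in> carrier N \<Longrightarrow> m \<in> carrier M \<Longrightarrow>
      \<Phi> b (frag_of (n, m)) = b m \<odot>\<^bsub>N\<^esub> n"
    and w: "w \<in> tensor_null R N M"
  obtains E where "finite E" "E \<subseteq> a_kernel (free_mod R (carrier M)) M (free_ext R M (\<lambda>x. x))"
    "\<And>(J :: nat set) B j. B \<in> carrier M \<rightarrow> carrier (free_mod R J) \<Longrightarrow>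
      (\<And>r. r \<in> E \<Longrightarrow> free_ext R (free_mod R J) B r = (\<lambda>x. \<zero>)) \<Longrightarrow> \<Phi> (\<lambda>m. B m j) w = \<zero>\<^bsub>N\<^esub>"
proof -
  interpret N: right_module R N by (rule N)
  interpret M: left_module R M by (rule M)
  interpret T: tensor_pair R N M by (rule tensor_pair.intro[OF N M])
  let ?F = "free_mod R (carrier M)"
  interpret F: left_module R ?F by (rule left_module_free_mod)
  have idM: "(\<lambda>x. x) \<in> carrier M \<rightarrow> carrier M" by simp
  let ?\<pi> = "free_ext R M (\<lambda>x. x)"
  have \<pi>: "?\<pi> \<in> mod_hom R ?F M" by (rule free_ext_hom[OF M idM])
  have e: "free_basis R x \<in> carrier ?F" if "x \<in> carrier M" for x by (rule free_basis_closed[OF that])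
  let ?good = "\<lambda>E w. finite E \<and> E \<subseteq> a_kernel ?F M ?\<pi> \<and> (\<forall>(J :: nat set) B j. B \<in> carrier M \<rightarrow> carrier (free_mod R J) \<longrightarrow>
      (\<forall>r\<in>E. free_ext R (free_mod R J) B r = (\<lambda>x. \<zero>)) \<longrightarrow> \<Phi> (\<lambda>m. B m j) w = \<zero>\<^bsub>N\<^esub>)"
  have Bj: "(\<lambda>m. B m j) \<in> carrier M \<rightarrow> carrier R" if "B \<in> carrier M \<rightarrow> carrier (free_mod R J)" for B j and J :: "nat set"
    using that by (auto simp: Pi_iff free_mod_carrier)
  have k2: "Poly_Mapping.keys (frag_of p - frag_of q) \<subseteq> carrier N \<times> carrier M"
    if "p \<in> carrier N \<times> carrier M" "q \<in> carrier N \<times> carrier M" for p q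
    using keys_diff[of "frag_of p" "frag_of q"] that by (auto simp: keys_frag_of)
  have m0: "\<ominus>\<^bsub>N\<^esub> \<zero>\<^bsub>N\<^esub> = \<zero>\<^bsub>N\<^esub>" by (rule N.N.minus_equality) simp_all
  from w have "\<exists>E. ?good E w"
  proof (induction rule: T.null_induct)
    case zero
    show ?case by (rule exI[of _ "{}"]) (simp add: assms(6) Bj)
  next
    case (add u v)
    then obtain E E' where "?good E u" "?good E' v" by blast
    moreover have "Poly_Mapping.keys u \<subseteq> carrier N \<times> carrier M" "Poly_Mapping.keys v \<subseteq> carrier N \<times> carrier M"
      using add T.keys_null by auto
    ultimately show ?case by (intro exI[of _ "E \<union> E'"]) (auto simp: assms(4) Bj)
  next
    case (minus u)
    then obtain E where "?good E u" by blast
    moreover have "Poly_Mapping.keys u \<subseteq> carrier N \<times> carrier M" using minus T.keys_null by auto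
    moreover have "\<Phi> b (- u) = \<ominus>\<^bsub>N\<^esub> \<Phi> b u" if "b \<in> carrier M \<rightarrow> carrier R" for b
      using diff[OF that, of 0 u] zero[OF that] cl[OF that, of u] calculation(2) by (simp add: a_minus_def)
    ultimately show ?case by (intro exI[of _ E]) (auto simp: Bj m0)
  next
    case (left x x' y)
    have "\<Phi> b (frag_of (x \<oplus>\<^bsub>N\<^esub> x', y) - frag_of (x, y) - frag_of (x', y)) = \<zero>\<^bsub>N\<^esub>"
      if b: "b \<in> carrier M \<rightarrow> carrier R" for b
    proof -
      have byR: "b y \<in> carrier R" using b left by auto
      show ?thesis using left k2[of "(x \<oplus>\<^bsub>N\<^esub> x', y)" "(x, y)"] byR
        by (simp add: diff[OF b] frag[OF b] keys_frag_of N.smult_r_distr a_minus_def N.smult_closed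
            N.N.a_ac N.N.r_neg N.N.r_neg1)
    qed
    thus ?case using Bj by (intro exI[of _ "{}"]) auto
  next
    case (right x y y')
    let ?e = "free_basis R :: 'm \<Rightarrow> 'm \<Rightarrow> 'a"
    let ?r = "?e (y \<oplus>\<^bsub>M\<^esub> y') \<ominus>\<^bsub>?F\<^esub> ?e y \<ominus>\<^bsub>?F\<^esub> ?e y'"
    have yy: "y \<oplus>\<^bsub>M\<^esub> y' \<in> carrier M" using right by simp
    note es = e[OF yy] e[OF right(2)] e[OF right(3)]
    have homM: "?\<pi> ?r = ?\<pi> (?e (y \<oplus>\<^bsub>M\<^esub> y')) \<ominus>\<^bsub>M\<^esub> ?\<pi> (?e y) \<ominus>\<^bsub>M\<^esub> ?\<pi> (?e y')"
      using es mod_hom_diff[OF F.M.abelian_group_axioms M.M.abelian_group_axioms \<pi>] by (simp del: free_mod_simps)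
    have rk: "?r \<in> a_kernel ?F M ?\<pi>"
      using es right(2,3) homM unfolding a_kernel_eq
      by (simp add: free_ext_basis[OF M idM] a_minus_def M.M.a_ac M.M.r_neg M.M.r_neg1 del: free_mod_simps)
    show ?case
    proof (intro exI[of _ "{?r}"] conjI allI impI)
      fix J :: "nat set" and B j assume B: "B \<in> carrier M \<rightarrow> carrier (free_mod R J)"
        and kill: "\<forall>r\<in>{?r}. free_ext R (free_mod R J) B r = (\<lambda>x. \<zero>)"
      note h = free_ext_hom[OF left_module_free_mod B]
      have Bc: "B m i \<in> carrier R" if "m \<in> carrier M" for m i using B that by (auto simp: Pi_iff free_mod_carrier)
      have "free_ext R (free_mod R J) B ?r = B (y \<oplus>\<^bsub>M\<^esub> y') \<ominus>\<^bsub>free_mod R J\<^esub> B y \<ominus>\<^bsub>free_mod R J\<^esub> B y'"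
        using es mod_hom_diff[OF F.M.abelian_group_axioms abelian_group_free_mod h] right yy
        by (simp add: free_ext_basis[OF left_module_free_mod B] del: free_mod_simps)
      also have "\<dots> = (\<lambda>i. B (y \<oplus>\<^bsub>M\<^esub> y') i \<ominus> B y i \<ominus> B y' i)"
      proof -
        have c: "B (y \<oplus>\<^bsub>M\<^esub> y') \<in> carrier (free_mod R J)" "B y \<in> carrier (free_mod R J)" "B y' \<in> carrier (free_mod R J)"
          using B right yy by auto
        interpret FJ: left_module R "free_mod R J" by (rule left_module_free_mod)
        show ?thesis using free_mod_diff[OF FJ.M.minus_closed[OF c(1,2)] c(3)] free_mod_diff[OF c(1,2)] by simp
      qed
      finally have "B (y \<oplus>\<^bsub>M\<^esub> y') j \<ominus> B y j \<ominus> B y' j = \<zero>" using kill by (simp add: fun_eq_iff)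
      hence "B (y \<oplus>\<^bsub>M\<^esub> y') j \<ominus> B y j = B y' j"
        using Bc[OF yy, of j] Bc[OF right(2), of j] Bc[OF right(3), of j] by simp
      moreover have "B y j \<oplus> (B (y \<oplus>\<^bsub>M\<^esub> y') j \<ominus> B y j) = B (y \<oplus>\<^bsub>M\<^esub> y') j"
        using Bc[OF yy, of j] Bc[OF right(2), of j]
          a_lcomm[of "B y j" "B (y \<oplus>\<^bsub>M\<^esub> y') j" "\<ominus> B y j"] by (simp add: a_minus_def r_neg)
      ultimately have "B (y \<oplus>\<^bsub>M\<^esub> y') j = B y j \<oplus> B y' j" by simp
      thus "\<Phi> (\<lambda>m. B m j) (frag_of (x, y \<oplus>\<^bsub>M\<^esub> y') - frag_of (x, y) - frag_of (x, y')) = \<zero>\<^bsub>N\<^esub>"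
        using right yy k2[of "(x, y \<oplus>\<^bsub>M\<^esub> y')" "(x, y)"] Bc[of y j] Bc[of y' j]
        by (simp add: diff[OF Bj[OF B]] frag[OF Bj[OF B]] keys_frag_of N.smult_l_distr a_minus_def N.smult_closed
            N.N.a_ac N.N.r_neg N.N.r_neg1)
    qed (use rk in auto)
  next
    case (smult a x y)
    let ?e = "free_basis R :: 'm \<Rightarrow> 'm \<Rightarrow> 'a"
    let ?r = "?e (a \<odot>\<^bsub>M\<^esub> y) \<ominus>\<^bsub>?F\<^esub> a \<odot>\<^bsub>?F\<^esub> ?e y"
    have ay: "a \<odot>\<^bsub>M\<^esub> y \<in> carrier M" using smult M.smult_closed by simp
    have es: "?e (a \<odot>\<^bsub>M\<^esub> y) \<in> carrier ?F" "?e y \<in> carrier ?F" "a \<odot>\<^bsub>?F\<^esub> ?e y \<in> carrier ?F"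
      using e[OF ay] e[OF smult(3)] F.smult_closed[OF smult(1) e[OF smult(3)]] by auto
    have "?\<pi> ?r = ?\<pi> (?e (a \<odot>\<^bsub>M\<^esub> y)) \<ominus>\<^bsub>M\<^esub> a \<odot>\<^bsub>M\<^esub> ?\<pi> (?e y)"
      unfolding mod_hom_diff[OF F.M.abelian_group_axioms M.M.abelian_group_axioms \<pi> es(1,3)]
        mod_hom_smult[OF \<pi> smult(1) es(2)] ..
    hence rk: "?r \<in> a_kernel ?F M ?\<pi>"
      using F.M.minus_closed[OF es(1,3)] smult(1,3) ay unfolding a_kernel_eq
      by (simp add: free_ext_basis[OF M idM] a_minus_def M.M.r_neg del: free_mod_simps)
    show ?case
    proof (intro exI[of _ "{?r}"] conjI allI impI)
      fix J :: "nat set" and B j assume B: "B \<in> carrier M \<rightarrow> carrier (free_mod R J)"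
        and kill: "\<forall>r\<in>{?r}. free_ext R (free_mod R J) B r = (\<lambda>x. \<zero>)"
      note h = free_ext_hom[OF left_module_free_mod B]
      interpret FJ: left_module R "free_mod R J" by (rule left_module_free_mod)
      have Bc: "B m i \<in> carrier R" if "m \<in> carrier M" for m i using B that by (auto simp: Pi_iff free_mod_carrier)
      have c: "B (a \<odot>\<^bsub>M\<^esub> y) \<in> carrier (free_mod R J)" "B y \<in> carrier (free_mod R J)" using B smult ay by auto
      have "free_ext R (free_mod R J) B ?r = B (a \<odot>\<^bsub>M\<^esub> y) \<ominus>\<^bsub>free_mod R J\<^esub> a \<odot>\<^bsub>free_mod R J\<^esub> B y"
        unfolding mod_hom_diff[OF F.M.abelian_group_axioms abelian_group_free_mod h es(1,3)]
          mod_hom_smult[OF h smult(1) es(2)] free_ext_basis[OF left_module_free_mod B ay]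
          free_ext_basis[OF left_module_free_mod B smult(3)] ..
      also have "\<dots> = (\<lambda>i. B (a \<odot>\<^bsub>M\<^esub> y) i \<ominus> a \<otimes> B y i)"
        using free_mod_diff[OF c(1) FJ.smult_closed[OF smult(1) c(2)]] by simp
      finally have "B (a \<odot>\<^bsub>M\<^esub> y) j \<ominus> a \<otimes> B y j = \<zero>" using kill by (simp add: fun_eq_iff)
      hence "B (a \<odot>\<^bsub>M\<^esub> y) j = a \<otimes> B y j"
        using Bc smult ay by simp
      thus "\<Phi> (\<lambda>m. B m j) (frag_of (a \<odot>\<^bsub>N\<^esub> x, y) - frag_of (x, a \<odot>\<^bsub>M\<^esub> y)) = \<zero>\<^bsub>N\<^esub>"
        using smult ay Bc[of y j] N.smult_closed
        by (simp add: diff[OF Bj[OF B]] frag[OF Bj[OF B]] keys_frag_of N.smult_assoc a_minus_def N.N.r_neg)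
    qed (use rk in auto)
  qed
  then obtain E where "?good E w" ..
  thus ?thesis using that[of E] by blast
qed

lemma tensor_pairing:
  fixes M :: "('a, 'm) module" and N :: "('a, 'n) module"
  assumes N: "right_module R N"
  obtains \<Phi> where
    "\<And>b u. b \<in> carrier M \<rightarrow> carrier R \<Longrightarrow> Poly_Mapping.keys u \<subseteq> carrier N \<times> carrier M \<Longrightarrow> \<Phi> b u \<in> carrier N"
    "\<And>b u v. b \<in> carrier M \<rightarrow> carrier R \<Longrightarrow> Poly_Mapping.keys u \<subseteq> carrier N \<times> carrier M \<Longrightarrow>
      Poly_Mapping.keys v \<subseteq> carrier N \<times> carrier M \<Longrightarrow> \<Phi> b (u + v) = \<Phi> b u \<oplus>\<^bsub>N\<^esub> \<Phi> b v"
    "\<And>b u v. b \<in> carrier M \<rightarrow> carrier R \<Longrightarrow> Poly_Mapping.keys u \<subseteq> carrier N \<times> carrier M \<Longrightarrow>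
      Poly_Mapping.keys v \<subseteq> carrier N \<times> carrier M \<Longrightarrow> \<Phi> b (u - v) = \<Phi> b u \<ominus>\<^bsub>N\<^esub> \<Phi> b v"
    "\<And>b. b \<in> carrier M \<rightarrow> carrier R \<Longrightarrow> \<Phi> b 0 = \<zero>\<^bsub>N\<^esub>"
    "\<And>b n m. b \<in> carrier M \<rightarrow> carrier R \<Longrightarrow> n \<in> carrier N \<Longrightarrow> m \<in> carrier M \<Longrightarrow>
      \<Phi> b (frag_of (n, m)) = b m \<odot>\<^bsub>N\<^esub> n"
proof -
  interpret N: right_module R N by (rule N)
  let ?S = "carrier N \<times> carrier M"
  define hom_like where "hom_like b h \<longleftrightarrow> (\<forall>u. Poly_Mapping.keys u \<subseteq> ?S \<longrightarrow> h u \<in> carrier N) \<and>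
        (\<forall>u v. Poly_Mapping.keys u \<subseteq> ?S \<longrightarrow> Poly_Mapping.keys v \<subseteq> ?S \<longrightarrow> h (u + v) = h u \<oplus>\<^bsub>N\<^esub> h v) \<and>
        (\<forall>u v. Poly_Mapping.keys u \<subseteq> ?S \<longrightarrow> Poly_Mapping.keys v \<subseteq> ?S \<longrightarrow> h (u - v) = h u \<ominus>\<^bsub>N\<^esub> h v) \<and>
        h 0 = \<zero>\<^bsub>N\<^esub> \<and> (\<forall>p\<in>?S. h (frag_of p) = b (snd p) \<odot>\<^bsub>N\<^esub> fst p)" for b h
  have "\<exists>h. hom_like b h" if b: "b \<in> carrier M \<rightarrow> carrier R" for b
  proof (rule N.N.frag_universal[of ?S "\<lambda>p. b (snd p) \<odot>\<^bsub>N\<^esub> fst p"], goal_cases)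
    case (1 p)
    show ?case using 1 b by (intro N.smult_closed) auto
  next
    case (2 h)
    show ?case unfolding hom_like_def by (intro exI[of _ h] conjI allI impI ballI 2)
  qed
  then obtain \<Phi> where \<Phi>: "\<And>b. b \<in> carrier M \<rightarrow> carrier R \<Longrightarrow> hom_like b (\<Phi> b)" by metis
  note \<Phi>' = \<Phi>[unfolded hom_like_def]
  show ?thesis
  proof (rule that[of \<Phi>], goal_cases)
    case (1 b u) thus ?case using \<Phi>'[OF 1(1)] by simp
  next
    case (2 b u v) thus ?case using \<Phi>'[OF 2(1)] by simp
  next
    case (3 b u v) thus ?case using \<Phi>'[OF 3(1)] by simp
  next
    case (4 b) thus ?case using \<Phi>'[OF 4(1)] by simp
  next
    case (5 b n m) thus ?case using \<Phi>'[OF 5(1)] by simp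
  qed
qed

text \<open>
  If the image of \<open>w = \<Sum> n \<otimes> m\<close> in \<open>N' \<otimes> M\<close> is null, this is due to finitely many relations in \<open>M\<close>. By the criterion the
  elements \<open>m\<close> involved are \<open>m = \<Sum>j. B m j \<cdot> c j\<close> with coefficients respecting these relations. Hence
  \<open>w = \<Sum>j. \<Phi> (B j) w \<otimes> c j\<close>, and \<open>f\<close> sends the coefficient \<open>\<Phi> (B j) w\<close> to \<open>\<Phi>' (B j) (f w) = 0\<close>. By injectivity of \<open>f\<close> the
  coefficients vanish, and with them \<open>w\<close>.
\<close>

lemma equationally_flat_imp_flat:
  fixes M :: "('a, 'm) module"
  assumes M: "equationally_flat R M" shows "flat_module R M"
proof (rule flat_moduleI)
  show MM: "left_module R M" by (rule equationally_flat_left_module[OF M])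
  interpret M: left_module R M by (rule MM)
  fix N N' :: "('a, 'a) module" and f w
  assume N: "right_module R N" and N': "right_module R N'" and f: "f \<in> mod_hom R N N'"
    and inj: "inj_on f (carrier N)" and w: "Poly_Mapping.keys w \<subseteq> carrier N \<times> carrier M"
    and null: "frag_extend (\<lambda>(x, y). frag_of (f x, y)) w \<in> tensor_null R N' M"
  let ?F = "frag_extend (\<lambda>(x, y). frag_of (f x, y :: 'm))"
  interpret N: right_module R N by (rule N)
  interpret N': right_module R N' by (rule N')
  interpret T: tensor_pair R N M by (rule tensor_pair.intro[OF N MM])
  obtain \<Phi>' where \<Phi>': "\<And>b u. b \<in> carrier M \<rightarrow> carrier R \<Longrightarrow> Poly_Mapping.keys u \<subseteq> carrier N' \<times> carrier M \<Longrightarrow> \<Phi>' b u \<in> carrier N'"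
    "\<And>b u v. b \<in> carrier M \<rightarrow> carrier R \<Longrightarrow> Poly_Mapping.keys u \<subseteq> carrier N' \<times> carrier M \<Longrightarrow>
      Poly_Mapping.keys v \<subseteq> carrier N' \<times> carrier M \<Longrightarrow> \<Phi>' b (u + v) = \<Phi>' b u \<oplus>\<^bsub>N'\<^esub> \<Phi>' b v"
    "\<And>b u v. b \<in> carrier M \<rightarrow> carrier R \<Longrightarrow> Poly_Mapping.keys u \<subseteq> carrier N' \<times> carrier M \<Longrightarrow>
      Poly_Mapping.keys v \<subseteq> carrier N' \<times> carrier M \<Longrightarrow> \<Phi>' b (u - v) = \<Phi>' b u \<ominus>\<^bsub>N'\<^esub> \<Phi>' b v"
    "\<And>b. b \<in> carrier M \<rightarrow> carrier R \<Longrightarrow> \<Phi>' b 0 = \<zero>\<^bsub>N'\<^esub>"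
    "\<And>b n m. b \<in> carrier M \<rightarrow> carrier R \<Longrightarrow> n \<in> carrier N' \<Longrightarrow> m \<in> carrier M \<Longrightarrow>
      \<Phi>' b (frag_of (n, m)) = b m \<odot>\<^bsub>N'\<^esub> n"
    by (rule tensor_pairing[OF N', of M]) blast
  obtain \<Phi> where \<Phi>: "\<And>b u. b \<in> carrier M \<rightarrow> carrier R \<Longrightarrow> Poly_Mapping.keys u \<subseteq> carrier N \<times> carrier M \<Longrightarrow> \<Phi> b u \<in> carrier N"
    "\<And>b u v. b \<in> carrier M \<rightarrow> carrier R \<Longrightarrow> Poly_Mapping.keys u \<subseteq> carrier N \<times> carrier M \<Longrightarrow>
      Poly_Mapping.keys v \<subseteq> carrier N \<times> carrier M \<Longrightarrow> \<Phi> b (u + v) = \<Phi> b u \<oplus>\<^bsub>N\<^esub> \<Phi> b v"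
    "\<And>b u v. b \<in> carrier M \<rightarrow> carrier R \<Longrightarrow> Poly_Mapping.keys u \<subseteq> carrier N \<times> carrier M \<Longrightarrow>
      Poly_Mapping.keys v \<subseteq> carrier N \<times> carrier M \<Longrightarrow> \<Phi> b (u - v) = \<Phi> b u \<ominus>\<^bsub>N\<^esub> \<Phi> b v"
    "\<And>b. b \<in> carrier M \<rightarrow> carrier R \<Longrightarrow> \<Phi> b 0 = \<zero>\<^bsub>N\<^esub>"
    "\<And>b n m. b \<in> carrier M \<rightarrow> carrier R \<Longrightarrow> n \<in> carrier N \<Longrightarrow> m \<in> carrier M \<Longrightarrow>
      \<Phi> b (frag_of (n, m)) = b m \<odot>\<^bsub>N\<^esub> n"
    by (rule tensor_pairing[OF N, of M]) blast
  have Fkeys: "Poly_Mapping.keys (?F u) \<subseteq> carrier N' \<times> carrier M"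
    if "Poly_Mapping.keys u \<subseteq> carrier N \<times> carrier M" for u
  proof
    fix p assume "p \<in> Poly_Mapping.keys (?F u)"
    then obtain q where q: "q \<in> Poly_Mapping.keys u" "p \<in> Poly_Mapping.keys ((\<lambda>(x, y). frag_of (f x, y)) q)"
      using subsetD[OF keys_frag_extend[of "\<lambda>(x, y). frag_of (f x, y)" u]] by (meson UN_E)
    obtain n m where nm: "q = (n, m)" by (cases q)
    hence "n \<in> carrier N" "m \<in> carrier M" "p = (f n, m)" using q that by (auto simp: keys_frag_of)
    thus "p \<in> carrier N' \<times> carrier M" using mod_hom_closed[OF f] by simp
  qed
  have f\<Phi>: "f (\<Phi> b u) = \<Phi>' b (?F u)"
    if b: "b \<in> carrier M \<rightarrow> carrier R" and u: "Poly_Mapping.keys u \<subseteq> carrier N \<times> carrier M" for b u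
    using u
  proof (induction u rule: free_Abelian_group_induct[consumes 1])
    case 1
    show ?case using mod_hom_zero[OF N.N.abelian_group_axioms N'.N.abelian_group_axioms f] \<Phi>(4)[OF b] \<Phi>'(4)[OF b] by simp
  next
    case (2 u v)
    thus ?case
      using mod_hom_diff[OF N.N.abelian_group_axioms N'.N.abelian_group_axioms f \<Phi>(1)[OF b 2(1)] \<Phi>(1)[OF b 2(2)]]
      by (simp add: \<Phi>(3)[OF b] \<Phi>'(3)[OF b] Fkeys frag_extend_diff)
  next
    case (3 p)
    obtain n m where p: "p = (n, m)" "n \<in> carrier N" "m \<in> carrier M" using 3 by auto
    hence "b m \<in> carrier R" using b by auto
    with p show ?case using mod_hom_smult[OF f, of "b m" n] mod_hom_closed[OF f]
      by (simp add: \<Phi>(5)[OF b] \<Phi>'(5)[OF b])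
  qed
  have idM: "(\<lambda>x. x) \<in> carrier M \<rightarrow> carrier M" by simp
  let ?\<pi> = "free_ext R M (\<lambda>x. x)" and ?FM = "free_mod R (carrier M)"
  have \<pi>: "?\<pi> \<in> mod_hom R ?FM M" by (rule free_ext_hom[OF MM idM])
  obtain E where E: "finite E" "E \<subseteq> a_kernel ?FM M ?\<pi>"
    and Ekill: "\<And>(J :: nat set) B j. B \<in> carrier M \<rightarrow> carrier (free_mod R J) \<Longrightarrow>
      (\<And>r. r \<in> E \<Longrightarrow> free_ext R (free_mod R J) B r = (\<lambda>x. \<zero>)) \<Longrightarrow> \<Phi>' (\<lambda>m. B m j) (?F w) = \<zero>\<^bsub>N'\<^esub>"
  proof (rule tensor_null_finitely_many_relations[OF N' MM _ _ _ _ _ null, of \<Phi>'], goal_cases)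
    case (6 E)
    show ?case
    proof (rule 6(1)[OF 6(2,3)])
      fix J :: "nat set" and B j
      assume "B \<in> carrier M \<rightarrow> carrier (free_mod R J)"
        and "\<And>r. r \<in> E \<Longrightarrow> free_ext R (free_mod R J) B r = (\<lambda>x. \<zero>)"
      thus "\<Phi>' (\<lambda>m. B m j) (?F w) = \<zero>\<^bsub>N'\<^esub>" by (rule 6(4))
    qed
  qed (use \<Phi>' in simp_all)
  let ?I = "snd ` Poly_Mapping.keys w \<union> (\<Union>r\<in>E. {x. r x \<noteq> \<zero>})"
  have EF: "(\<forall>x. r x \<in> carrier R) \<and> finite {x. r x \<noteq> \<zero>} \<and> {x. r x \<noteq> \<zero>} \<subseteq> carrier M" if "r \<in> E" for r
    using subsetD[OF E(2) that] by (simp add: a_kernel_eq free_mod_carrier)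
  have I: "finite ?I" "?I \<subseteq> carrier M" using E(1) EF w by auto
  have EI: "E \<subseteq> carrier (free_mod R ?I)"
  proof
    fix r assume "r \<in> E"
    with EF[OF this] show "r \<in> carrier (free_mod R ?I)" unfolding free_mod_carrier by blast
  qed
  note incl = free_mod_inclusion[OF I(2)]
  have "factors_killing R M ?I ?\<pi> E"
    using E(2) by (intro factors_killing_finite[OF M I(1) mod_hom_comp[OF incl \<pi>] E(1) EI]) (auto simp: a_kernel_eq)
  then obtain J \<psi> \<chi> where J: "finite (J::nat set)" and \<psi>: "\<psi> \<in> mod_hom R (free_mod R ?I) (free_mod R J)"
    and \<chi>: "\<chi> \<in> mod_hom R (free_mod R J) M"
    and eq: "\<And>v. v \<in> carrier (free_mod R ?I) \<Longrightarrow> \<chi> (\<psi> v) = ?\<pi> v"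
    and kill: "\<And>r. r \<in> E \<Longrightarrow> \<psi> r = (\<lambda>x. \<zero>)"
    by (rule factors_killingE) blast
  define B where "B = (\<lambda>m. if m \<in> ?I then \<psi> (free_basis R m) else \<zero>\<^bsub>free_mod R J\<^esub>)"
  have B: "B \<in> carrier M \<rightarrow> carrier (free_mod R J)"
  proof
    interpret FJ: left_module R "free_mod R J" by (rule left_module_free_mod)
    fix m
    show "B m \<in> carrier (free_mod R J)"
      unfolding B_def using mod_hom_closed[OF \<psi> free_basis_closed, of m] FJ.M.zero_closed
      by (simp del: free_mod_simps)
  qed
  have Bj: "(\<lambda>m. B m j) \<in> carrier M \<rightarrow> carrier R" for j
    using B by (auto simp: Pi_iff free_mod_carrier)
  have "free_ext R (free_mod R J) B r = \<psi> r" if r: "r \<in> carrier (free_mod R ?I)" for r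
  proof (rule mod_hom_free_eqI[OF left_module_free_mod mod_hom_comp[OF incl free_ext_hom[OF left_module_free_mod B]] \<psi> _ r])
    fix x assume x: "x \<in> ?I"
    hence "x \<in> carrier M" using I(2) by blast
    from free_ext_basis[OF left_module_free_mod B this] x
    show "free_ext R (free_mod R J) B (free_basis R x) = \<psi> (free_basis R x)" by (simp add: B_def)
  qed
  hence "\<Phi>' (\<lambda>m. B m j) (?F w) = \<zero>\<^bsub>N'\<^esub>" for j
    using EI kill by (intro Ekill[OF B]) auto
  hence zero: "\<Phi> (\<lambda>m. B m j) w = \<zero>\<^bsub>N\<^esub>" for j
    using f\<Phi>[OF Bj w, of j] mod_hom_zero[OF N.N.abelian_group_axioms N'.N.abelian_group_axioms f]
      inj_onD[OF inj, of "\<Phi> (\<lambda>m. B m j) w" "\<zero>\<^bsub>N\<^esub>"] \<Phi>(1)[OF Bj w, of j] by simp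
  let ?c = "\<lambda>j. \<chi> (free_basis R j)"
  have c: "?c j \<in> carrier M" if "j \<in> J" for j
    by (rule mod_hom_closed[OF \<chi> free_basis_closed[OF that]])
  have "u - (\<Sum>j\<in>J. frag_of (\<Phi> (\<lambda>m. B m j) u, ?c j)) \<in> T.T"
    if "Poly_Mapping.keys u \<subseteq> carrier N \<times> ?I" for u
    using that
  proof (induction u rule: free_Abelian_group_induct[consumes 1])
    case 1
    have "(\<Sum>j\<in>J. frag_of (\<Phi> (\<lambda>m. B m j) 0, ?c j)) \<in> T.T"
      using c by (intro T.null_sum) (simp add: \<Phi>(4)[OF Bj] T.null_zero_left)
    from T.null_minus[OF this] show ?case by simp
  next
    case (2 u v)
    have k: "Poly_Mapping.keys u \<subseteq> carrier N \<times> carrier M" "Poly_Mapping.keys v \<subseteq> carrier N \<times> carrier M"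
      using 2 I(2) by blast+
    note cl = \<Phi>(1)[OF Bj k(1)] \<Phi>(1)[OF Bj k(2)]
    have "(\<Sum>j\<in>J. frag_of (\<Phi> (\<lambda>m. B m j) u, ?c j) - frag_of (\<Phi> (\<lambda>m. B m j) (u - v), ?c j)
        - frag_of (\<Phi> (\<lambda>m. B m j) v, ?c j)) \<in> T.T"
    proof (rule T.null_sum)
      fix j assume j: "j \<in> J"
      have "\<Phi> (\<lambda>m. B m j) (u - v) \<oplus>\<^bsub>N\<^esub> \<Phi> (\<lambda>m. B m j) v = \<Phi> (\<lambda>m. B m j) u"
        unfolding \<Phi>(3)[OF Bj k] using cl[of j] by (simp add: a_minus_def N.N.a_assoc N.N.l_neg)
      with T.null_add_left[of "\<Phi> (\<lambda>m. B m j) (u - v)" "\<Phi> (\<lambda>m. B m j) v" "?c j"]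
      show "frag_of (\<Phi> (\<lambda>m. B m j) u, ?c j) - frag_of (\<Phi> (\<lambda>m. B m j) (u - v), ?c j)
        - frag_of (\<Phi> (\<lambda>m. B m j) v, ?c j) \<in> T.T"
        using cl[of j] c[OF j] \<Phi>(3)[OF Bj k, of j] by simp
    qed
    from T.null_add[OF T.null_diff[OF 2(3,4)] this] show ?case
      by (simp add: sum_subtractf sum.distrib algebra_simps)
  next
    case (3 p)
    obtain n m where p: "p = (n, m)" "n \<in> carrier N" "m \<in> ?I" using 3 by auto
    hence m: "m \<in> carrier M" using I(2) by blast
    have bm: "B m = \<psi> (free_basis R m)" using p by (simp add: B_def)
    have bc: "B m \<in> carrier (free_mod R J)" using B m by auto
    hence bj: "B m j \<in> carrier R" for j by (simp add: free_mod_carrier)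
    have cJ: "?c \<in> J \<rightarrow> carrier M" using c by auto
    have "m = \<chi> (B m)"
      using eq[OF free_basis_closed[OF p(3)]] free_ext_basis[OF MM idM m] by (simp add: bm)
    also have "\<dots> = free_ext R M ?c (B m)"
      by (rule mod_hom_free_eqI[OF MM \<chi> free_ext_hom[OF MM cJ] _ bc]) (simp only: free_ext_basis[OF MM cJ])
    also have "\<dots> = (\<Oplus>\<^bsub>M\<^esub>j\<in>J. B m j \<odot>\<^bsub>M\<^esub> ?c j)"
      using bc by (intro free_ext_superset[OF MM cJ bc J]) (auto simp: free_mod_carrier)
    finally have msum: "m = (\<Oplus>\<^bsub>M\<^esub>j\<in>J. B m j \<odot>\<^bsub>M\<^esub> ?c j)" .
    have "(\<lambda>j. B m j \<odot>\<^bsub>M\<^esub> ?c j) \<in> J \<rightarrow> carrier M" using bj c M.smult_closed by auto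
    from T.null_finsum_right[OF J p(2) this]
    have 1: "frag_of (n, m) - (\<Sum>j\<in>J. frag_of (n, B m j \<odot>\<^bsub>M\<^esub> ?c j)) \<in> T.T"
      unfolding msum[symmetric] .
    have 2: "(\<Sum>j\<in>J. frag_of (B m j \<odot>\<^bsub>N\<^esub> n, ?c j) - frag_of (n, B m j \<odot>\<^bsub>M\<^esub> ?c j)) \<in> T.T"
      by (intro T.null_sum T.null_smult bj p c)
    have "frag_of p - (\<Sum>j\<in>J. frag_of (\<Phi> (\<lambda>m. B m j) (frag_of p), ?c j)) =
      frag_of (n, m) - (\<Sum>j\<in>J. frag_of (n, B m j \<odot>\<^bsub>M\<^esub> ?c j))
      - (\<Sum>j\<in>J. frag_of (B m j \<odot>\<^bsub>N\<^esub> n, ?c j) - frag_of (n, B m j \<odot>\<^bsub>M\<^esub> ?c j))"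
      unfolding p(1) \<Phi>(5)[OF Bj p(2) m] by (simp add: sum_subtractf)
    with T.null_diff[OF 1 2] show ?case by (simp only:)
  qed
  note reduce = this
  have "Poly_Mapping.keys w \<subseteq> carrier N \<times> ?I" using w by force
  from reduce[OF this] have "w - (\<Sum>j\<in>J. frag_of (\<zero>\<^bsub>N\<^esub>, ?c j)) \<in> T.T" by (simp only: zero)
  moreover have "(\<Sum>j\<in>J. frag_of (\<zero>\<^bsub>N\<^esub>, ?c j)) \<in> T.T" using c by (intro T.null_sum T.null_zero_left)
  ultimately show "w \<in> T.T" using T.null_add by fastforce
qed

theorem flat_iff_equationally_flat: "flat_module R M \<longleftrightarrow> equationally_flat R M"
  using flat_imp_equationally_flat equationally_flat_imp_flat by blast

section \<open>Countably generated locally split submodules\<close>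

text \<open>
  The homomorphism \<open>u\<close> may be chosen to have a finitely generated image: it is zero on the basis vectors that do not
  occur in \<open>E\<close>. Then any \<open>u'\<close> fixing the finite generating set \<open>B\<close> of the image satisfies \<open>u' u = u\<close>.
\<close>

lemma locally_split_finite_rank:
  assumes L: "submodule_set R (free_mod R I) L" and split: "locally_split R (free_mod R I) L"
    and E: "finite E" "E \<subseteq> L"
  obtains u B where "u \<in> mod_hom R (free_mod R I) (free_mod R I\<lparr>carrier := L\<rparr>)" "finite B" "B \<subseteq> L"
    "\<And>x. x \<in> E \<Longrightarrow> u x = x"
    "\<And>u' v. u' \<in> mod_hom R (free_mod R I) (free_mod R I\<lparr>carrier := L\<rparr>) \<Longrightarrow> (\<And>x. x \<in> B \<Longrightarrow> u' x = x) \<Longrightarrow>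
      v \<in> carrier (free_mod R I) \<Longrightarrow> u' (u v) = u v"
proof -
  let ?F = "free_mod R I" and ?M = "free_mod R I\<lparr>carrier := L\<rparr>"
  have LM: "left_module R ?M" by (rule left_module_submodule[OF left_module_free_mod L])
  have Lsub: "L \<subseteq> carrier ?F" and z: "\<zero>\<^bsub>?F\<^esub> \<in> L" using L by (auto simp: submodule_set_def)
  obtain u0 where u0: "u0 \<in> mod_hom R ?F ?M" and fix0: "\<And>x. x \<in> E \<Longrightarrow> u0 x = x"
    using split E unfolding locally_split_def by metis
  let ?I0 = "\<Union>e\<in>E. {x. e x \<noteq> \<zero>}"
  have EF: "(\<forall>x. e x \<in> carrier R) \<and> finite {x. e x \<noteq> \<zero>} \<and> {x. e x \<noteq> \<zero>} \<subseteq> I" if "e \<in> E" for e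
    using subsetD[OF Lsub subsetD[OF E(2) that]] by (simp add: free_mod_carrier)
  have I0: "finite ?I0" "?I0 \<subseteq> I" using E(1) EF by auto
  define w where "w = (\<lambda>x. if x \<in> ?I0 then u0 (free_basis R x) else \<zero>\<^bsub>?F\<^esub>)"
  have wL: "w x \<in> L" if "x \<in> I" for x
    using mod_hom_closed[OF u0 free_basis_closed[OF that]] z unfolding w_def by (simp del: free_mod_simps)
  hence w: "w \<in> I \<rightarrow> carrier ?M" by simp
  let ?u = "free_ext R ?M w"
  have u: "?u \<in> mod_hom R ?F ?M" by (rule free_ext_hom[OF LM w])
  show ?thesis
  proof (rule that[OF u])
    let ?B = "insert \<zero>\<^bsub>?F\<^esub> (w ` ?I0)"
    show "finite ?B" using I0 by simp
    show "?B \<subseteq> L" using z wL I0(2) by blast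
    show "?u e = e" if e: "e \<in> E" for e
    proof -
      have "e \<in> carrier (free_mod R ?I0)" using EF[OF e] e unfolding free_mod_carrier by blast
      have "?u e = u0 e"
      proof (rule mod_hom_free_eqI[OF LM mod_hom_comp[OF free_mod_inclusion[OF I0(2)] u]
            mod_hom_comp[OF free_mod_inclusion[OF I0(2)] u0] _ \<open>e \<in> carrier (free_mod R ?I0)\<close>])
        fix x assume x: "x \<in> ?I0"
        hence "x \<in> I" using I0(2) by blast
        from free_ext_basis[OF LM w this] x show "?u (free_basis R x) = u0 (free_basis R x)"
          unfolding w_def by simp
      qed
      with fix0[OF e] show ?thesis by simp
    qed
    show "u' (?u v) = ?u v" if u': "u' \<in> mod_hom R ?F ?M" and fix': "\<And>x. x \<in> ?B \<Longrightarrow> u' x = x"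
      and v: "v \<in> carrier ?F" for u' v
    proof -
      have u'M: "u' \<in> mod_hom R ?M ?M" using mod_hom_restrict[OF u' Lsub] .
      show ?thesis
      proof (rule mod_hom_free_eqI[OF LM mod_hom_comp[OF u u'M] u _ v])
        fix x assume x: "x \<in> I"
        have "w x \<in> ?B" unfolding w_def by auto
        thus "u' (?u (free_basis R x)) = ?u (free_basis R x)"
          unfolding free_ext_basis[OF LM w x] by (rule fix')
      qed
    qed
  qed
qed

text \<open>
  Choose homomorphisms \<open>u k : F \<rightarrow> L\<close> with \<open>u 0 = 0\<close>, \<open>u (k + 1) u k = u k\<close>, and \<open>u (k + 1)\<close> fixing the first \<open>k + 1\<close> of the countably
  many generators of \<open>L\<close>; so \<open>u k x = x\<close> for all large \<open>k\<close> if \<open>x\<close> is in \<open>L\<close>. The family \<open>x - u k x\<close> then defines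
  \<open>s : L \<rightarrow> \<Oplus>k. F\<close>, and \<open>t = \<Sum>k. u (k + 1)\<close> maps back. As \<open>u (k + 1) (x - u k x) = u (k + 1) x - u k x\<close>, the sum
  telescopes: \<open>t (s x) = x\<close>. Hence \<open>L\<close> is a retract of a free module.
\<close>

lemma locally_split_countable_imp_projective:
  fixes I :: "'i set" and K :: "'k set"
  assumes K: "countable K" and d: "d \<in> mod_hom R (free_mod R K) (free_mod R I)"
    and L: "L = d ` carrier (free_mod R K)" and split: "locally_split R (free_mod R I) L"
  shows "projective_module R (free_mod R I\<lparr>carrier := L\<rparr>)"
proof -
  let ?F = "free_mod R I" and ?M = "free_mod R I\<lparr>carrier := L\<rparr>"
  have Lsm: "submodule_set R ?F L" unfolding L
    by (rule submodule_set_image[OF left_module_free_mod left_module_free_mod d])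
  have LM: "left_module R ?M" by (rule left_module_submodule[OF left_module_free_mod Lsm])
  interpret F: left_module R ?F by (rule left_module_free_mod)
  have Lsub: "L \<subseteq> carrier ?F" and z: "\<zero>\<^bsub>?F\<^esub> \<in> L" using Lsm by (auto simp: submodule_set_def)
  define gens where "gens = insert \<zero>\<^bsub>?F\<^esub> ((\<lambda>x. d (free_basis R x)) ` K)"
  have gens: "countable gens" "gens \<noteq> {}" using K by (auto simp: gens_def)
  have gensL: "gens \<subseteq> L"
  proof
    fix x assume "x \<in> gens"
    then consider "x = \<zero>\<^bsub>?F\<^esub>" | k where "k \<in> K" "x = d (free_basis R k)" unfolding gens_def by blast
    thus "x \<in> L"
    proof cases
      case 1 thus ?thesis using z by simp
    next
      case 2 show ?thesis unfolding L 2(2) by (rule imageI[OF free_basis_closed[OF 2(1)]])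
    qed
  qed
  define l where "l = from_nat_into gens"
  have lL: "l i \<in> L" for i using from_nat_into[OF gens(2)] gensL by (auto simp: l_def)
  have lgen: "\<exists>i. l i = d (free_basis R x)" if "x \<in> K" for x
  proof -
    have "d (free_basis R x) \<in> range l"
      using that unfolding l_def range_from_nat_into[OF gens(2,1)] by (auto simp: gens_def)
    thus ?thesis by (metis rangeE)
  qed
  let ?H = "mod_hom R ?F ?M"
  define good where "good k p \<longleftrightarrow> fst p \<in> ?H \<and> finite (snd p) \<and> snd p \<subseteq> L \<and> (\<forall>i\<le>k. fst p (l i) = l i) \<and>
    (\<forall>u'\<in>?H. (\<forall>x\<in>snd p. u' x = x) \<longrightarrow> (\<forall>v\<in>carrier ?F. u' (fst p v) = fst p v))" for k :: nat and p
  have ex: "\<exists>p. good k p \<and> (\<forall>x\<in>B. fst p x = x)" if B: "finite B" "B \<subseteq> L" for k B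
  proof -
    have "finite (B \<union> l ` {..k})" "B \<union> l ` {..k} \<subseteq> L" using B lL by auto
    then obtain u B' where "u \<in> ?H" "finite B'" "B' \<subseteq> L" "\<And>x. x \<in> B \<union> l ` {..k} \<Longrightarrow> u x = x"
      "\<And>u' v. u' \<in> ?H \<Longrightarrow> (\<And>x. x \<in> B' \<Longrightarrow> u' x = x) \<Longrightarrow> v \<in> carrier ?F \<Longrightarrow> u' (u v) = u v"
      by (rule locally_split_finite_rank[OF Lsm split]) blast
    thus ?thesis unfolding good_def by (intro exI[of _ "(u, B')"]) auto
  qed
  have "\<exists>f. \<forall>k. good k (f k) \<and> (\<forall>x\<in>snd (f k). fst (f (Suc k)) x = x)"
  proof (rule dependent_nat_choice)
    show "\<exists>p. good 0 p" using ex[of "{}" 0] by auto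
    fix p k assume "good k p"
    thus "\<exists>q. good (Suc k) q \<and> (\<forall>x\<in>snd p. fst q x = x)" by (intro ex) (auto simp: good_def)
  qed
  then obtain f where f: "\<And>k. good k (f k)" "\<And>k x. x \<in> snd (f k) \<Longrightarrow> fst (f (Suc k)) x = x" by blast
  define u where "u k = (case k of 0 \<Rightarrow> (\<lambda>v. \<zero>\<^bsub>?F\<^esub>) | Suc j \<Rightarrow> fst (f j))" for k
  have u: "u k \<in> ?H" for k
    using f(1) mod_hom_const_zero[OF LM] by (cases k) (auto simp: u_def good_def)
  have uu: "u (Suc k) (u k v) = u k v" if "v \<in> carrier ?F" for k v
  proof (cases k)
    case 0
    have "u 1 \<zero>\<^bsub>?F\<^esub> = \<zero>\<^bsub>?F\<^esub>"
      using mod_hom_zero[OF F.M.abelian_group_axioms left_module_abelian[OF LM] u[of 1]] by simp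
    thus ?thesis using 0 by (simp add: u_def)
  next
    case (Suc j)
    have "fst (f (Suc j)) \<in> ?H" "\<forall>x\<in>snd (f j). fst (f (Suc j)) x = x" using f by (auto simp: good_def)
    with f(1)[of j] that show ?thesis unfolding Suc u_def good_def by auto
  qed
  have fixed: "\<exists>k. \<forall>j\<ge>k. u j x = x" if xL: "x \<in> L" for x
  proof -
    obtain y where y: "y \<in> carrier (free_mod R K)" "x = d y" using xL L by auto
    have "\<exists>k. \<forall>j\<ge>k. u j (d y) = d y"
      using y(1)
    proof (induction y rule: free_mod_induct)
      case zero
      have "u j \<zero>\<^bsub>?F\<^esub> = \<zero>\<^bsub>?F\<^esub>" for j
        using mod_hom_zero[OF F.M.abelian_group_axioms left_module_abelian[OF LM] u[of j]] by simp
      thus ?case using free_hom_zero[OF d] by simp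
    next
      case (add v w)
      then obtain k k' where k: "\<forall>j\<ge>k. u j (d v) = d v" "\<forall>j\<ge>k'. u j (d w) = d w" by blast
      have "u j (d (v \<oplus>\<^bsub>free_mod R K\<^esub> w)) = d (v \<oplus>\<^bsub>free_mod R K\<^esub> w)" if "j \<ge> max k k'" for j
        using k that mod_hom_add[OF u[of j] mod_hom_closed[OF d add(1)] mod_hom_closed[OF d add(2)]]
        unfolding mod_hom_add[OF d add(1,2)] by simp
      thus ?case by blast
    next
      case (basis a x)
      note e = free_basis_closed[OF basis(2)]
      obtain i where i: "l i = d (free_basis R x)" using lgen[OF basis(2)] by blast
      have "u j (d (a \<odot>\<^bsub>free_mod R K\<^esub> free_basis R x)) = d (a \<odot>\<^bsub>free_mod R K\<^esub> free_basis R x)" if "j \<ge> Suc i" for j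
      proof -
        have "u j (l i) = l i" using that f(1)[of "j - 1"] by (cases j) (auto simp: u_def good_def)
        thus ?thesis using mod_hom_smult[OF u[of j] basis(1) mod_hom_closed[OF d e]] i
          unfolding mod_hom_smult[OF d basis(1) e] by simp
      qed
      thus ?case by blast
    qed
    thus ?thesis using y by simp
  qed
  let ?G = "free_mod R ((UNIV :: nat set) \<times> I)"
  interpret G: left_module R ?G by (rule left_module_free_mod)
  let ?s = "\<lambda>x (p :: nat \<times> 'i). (x \<ominus>\<^bsub>?F\<^esub> u (fst p) x) (snd p)"
  have xF: "x \<ominus>\<^bsub>?F\<^esub> u k x \<in> carrier ?F" if "x \<in> L" for x k
    using subsetD[OF Lsub that] subsetD[OF Lsub] mod_hom_closed[OF u[of k] subsetD[OF Lsub that]]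
    by (intro F.M.minus_closed) auto
  have finsupp: "finite {x. g x \<noteq> \<zero>}" "{x. g x \<noteq> \<zero>} \<subseteq> I" "g x \<in> carrier R" if "g \<in> carrier ?F" for g x
    using that by (auto simp: free_mod_carrier)
  \<comment> \<open>The truncation of \<open>s x\<close> to the summands below \<open>n\<close>; all of \<open>s x\<close> for large \<open>n\<close>.\<close>
  define part where "part n x = (\<lambda>p :: nat \<times> 'i. if fst p < n then ?s x p else \<zero>)" for n x
  have partG: "part n x \<in> carrier ?G" if x: "x \<in> L" for n x
  proof -
    have "{p. part n x p \<noteq> \<zero>} \<subseteq> (SIGMA k:{..<n}. {i. (x \<ominus>\<^bsub>?F\<^esub> u k x) i \<noteq> \<zero>})" by (auto simp: part_def)
    moreover have "finite (SIGMA k:{..<n}. {i. (x \<ominus>\<^bsub>?F\<^esub> u k x) i \<noteq> \<zero>})"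
      using finsupp(1)[OF xF[OF x]] by auto
    ultimately have "finite {p. part n x p \<noteq> \<zero>}" by (rule finite_subset)
    moreover have "p \<in> UNIV \<times> I" if "part n x p \<noteq> \<zero>" for p
      using that finsupp(2)[OF xF[OF x, of "fst p"]] by (cases p) (auto simp: part_def split: if_splits)
    moreover have "part n x p \<in> carrier R" for p
      using finsupp(3)[OF xF[OF x]] by (auto simp: part_def)
    ultimately show ?thesis by (auto simp: free_mod_carrier)
  qed
  have s_part: "\<exists>n. ?s x = part n x \<and> u n x = x" if x: "x \<in> L" for x
  proof -
    obtain n where n: "\<forall>j\<ge>n. u j x = x" using fixed[OF x] by blast
    have z': "x \<ominus>\<^bsub>?F\<^esub> u k x = (\<lambda>i. \<zero>)" if "k \<ge> n" for k
    proof -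
      have "u k x = x" using n that by blast
      thus ?thesis using subsetD[OF Lsub x] by (simp add: a_minus_def F.M.r_neg del: free_mod_simps(1))
    qed
    have "?s x p = part n x p" for p using z'[of "fst p"] by (simp add: part_def not_less)
    thus ?thesis using n by (intro exI[of _ n]) auto
  qed
  have s: "?s \<in> mod_hom R ?M ?G"
  proof (rule mod_homI)
    fix x assume "x \<in> carrier ?M"
    hence x: "x \<in> L" by simp
    show "?s x \<in> carrier ?G" using s_part[OF x] partG[OF x] by metis
    {
      fix y assume "y \<in> carrier ?M"
      hence y: "y \<in> L" by simp
      note c = subsetD[OF Lsub x] subsetD[OF Lsub y]
      have h: "x \<oplus>\<^bsub>?F\<^esub> y \<ominus>\<^bsub>?F\<^esub> u k (x \<oplus>\<^bsub>?F\<^esub> y) = (x \<ominus>\<^bsub>?F\<^esub> u k x) \<oplus>\<^bsub>?F\<^esub> (y \<ominus>\<^bsub>?F\<^esub> u k y)" for k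
        using mod_hom_add[OF mod_hom_sub[OF left_module_free_mod mod_hom_id mod_hom_into_larger[OF u[of k] Lsub]] c] .
      show "?s (x \<oplus>\<^bsub>?M\<^esub> y) = ?s x \<oplus>\<^bsub>?G\<^esub> ?s y" using h by (auto simp: fun_eq_iff)
    }
    fix a assume a: "a \<in> carrier R"
    have h: "a \<odot>\<^bsub>?F\<^esub> x \<ominus>\<^bsub>?F\<^esub> u k (a \<odot>\<^bsub>?F\<^esub> x) = a \<odot>\<^bsub>?F\<^esub> (x \<ominus>\<^bsub>?F\<^esub> u k x)" for k
      using mod_hom_smult[OF mod_hom_sub[OF left_module_free_mod mod_hom_id mod_hom_into_larger[OF u[of k] Lsub]] a subsetD[OF Lsub x]] .
    show "?s (a \<odot>\<^bsub>?M\<^esub> x) = a \<odot>\<^bsub>?G\<^esub> ?s x" using h by (auto simp: fun_eq_iff)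
  qed
  let ?w = "\<lambda>p :: nat \<times> 'i. u (Suc (fst p)) (free_basis R (snd p))"
  have w: "?w \<in> UNIV \<times> I \<rightarrow> carrier ?M"
    using mod_hom_closed[OF u free_basis_closed] by auto
  let ?t = "free_ext R ?M ?w"
  have t: "?t \<in> mod_hom R ?G ?M" by (rule free_ext_hom[OF LM w])
  \<comment> \<open>The inclusion of the \<open>k\<close>-th summand.\<close>
  let ?\<iota> = "\<lambda>k v (p :: nat \<times> 'i). if fst p = k then v (snd p) else \<zero>"
  have \<iota>: "?\<iota> k \<in> mod_hom R ?F ?G" for k
  proof (rule mod_homI)
    fix v assume v: "v \<in> carrier ?F"
    have "{p. ?\<iota> k v p \<noteq> \<zero>} \<subseteq> {k} \<times> {i. v i \<noteq> \<zero>}" by (auto split: if_splits)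
    from finite_subset[OF this] finsupp[OF v] show "?\<iota> k v \<in> carrier ?G"
      by (auto simp: free_mod_carrier split: if_splits)
  qed (auto simp: fun_eq_iff)
  have t\<iota>: "?t (?\<iota> k v) = u (Suc k) v" if v: "v \<in> carrier ?F" for k v
  proof (rule mod_hom_free_eqI[OF LM mod_hom_comp[OF \<iota> t] u _ v])
    fix i assume i: "i \<in> I"
    have "?\<iota> k (free_basis R i) = free_basis R (k, i)" by (auto simp: free_basis_def fun_eq_iff)
    thus "?t (?\<iota> k (free_basis R i)) = u (Suc k) (free_basis R i)"
      using free_ext_basis[OF LM w, of "(k, i)"] i by simp
  qed
  have t_part: "?t (part n x) = u n x" if x: "x \<in> L" for n x
  proof (induction n)
    case 0
    have "part 0 x = \<zero>\<^bsub>?G\<^esub>" by (simp add: part_def)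
    thus ?case using mod_hom_zero[OF G.M.abelian_group_axioms left_module_abelian[OF LM] t] by (simp add: u_def)
  next
    case (Suc n)
    note xc = subsetD[OF Lsub x]
    have unx: "u n x \<in> carrier ?F" "u n x \<in> L" using mod_hom_closed[OF u[of n] xc] Lsub by auto
    have "part (Suc n) x = part n x \<oplus>\<^bsub>?G\<^esub> ?\<iota> n (x \<ominus>\<^bsub>?F\<^esub> u n x)"
      using finsupp(3)[OF xF[OF x]] by (auto simp: part_def fun_eq_iff less_Suc_eq)
    hence "?t (part (Suc n) x) = u n x \<oplus>\<^bsub>?F\<^esub> u (Suc n) (x \<ominus>\<^bsub>?F\<^esub> u n x)"
      using mod_hom_add[OF t partG[OF x] mod_hom_closed[OF \<iota> xF[OF x]]] Suc.IH t\<iota>[OF xF[OF x]]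
      by (simp del: free_mod_simps)
    also have "u (Suc n) (x \<ominus>\<^bsub>?F\<^esub> u n x) = u (Suc n) x \<ominus>\<^bsub>?F\<^esub> u n x"
      using mod_hom_diff[OF F.M.abelian_group_axioms F.M.abelian_group_axioms mod_hom_into_larger[OF u[of "Suc n"] Lsub] xc unx(1)]
        uu[OF xc] by simp
    also have "u n x \<oplus>\<^bsub>?F\<^esub> (u (Suc n) x \<ominus>\<^bsub>?F\<^esub> u n x) = u (Suc n) x"
    proof -
      have "u (Suc n) x \<in> carrier ?F" using mod_hom_closed[OF u[of "Suc n"] xc] Lsub by auto
      thus ?thesis using unx(1) F.M.a_lcomm[of "u n x" "u (Suc n) x" "\<ominus>\<^bsub>?F\<^esub> u n x"]
        by (simp add: a_minus_def F.M.r_neg del: free_mod_simps)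
    qed
    finally show ?case .
  qed
  show ?thesis
  proof (rule projective_retract_of_free[OF LM s t])
    fix x assume "x \<in> carrier ?M"
    hence x: "x \<in> L" by simp
    obtain n where n: "?s x = part n x" "u n x = x" using s_part[OF x] by blast
    show "?t (?s x) = x" unfolding n(1) t_part[OF x] by (rule n(2))
  qed
qed

end

section \<open>Comparing a free with a flat resolution\<close>

lemma resolutionD:
  assumes "resolution A M P d e"
  shows "left_module A M" "\<And>i. left_module A (P i)" "e \<in> mod_hom A (P 0) M"
    "\<And>i. d i \<in> mod_hom A (P (Suc i)) (P i)" "e ` carrier (P 0) = carrier M"
    "d 0 ` carrier (P (Suc 0)) = a_kernel (P 0) M e"
    "\<And>i. d (Suc i) ` carrier (P (Suc (Suc i))) = a_kernel (P (Suc i)) (P i) (d i)"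
  using assms unfolding resolution_def by auto

lemma resolution_complex:
  assumes "resolution A M P d e"
  shows "\<And>v. v \<in> carrier (P (Suc 0)) \<Longrightarrow> e (d 0 v) = \<zero>\<^bsub>M\<^esub>"
    "\<And>i v. v \<in> carrier (P (Suc (Suc i))) \<Longrightarrow> d i (d (Suc i) v) = \<zero>\<^bsub>P i\<^esub>"
    "\<And>v. v \<in> carrier (P 0) \<Longrightarrow> e v = \<zero>\<^bsub>M\<^esub> \<Longrightarrow> \<exists>w\<in>carrier (P (Suc 0)). d 0 w = v"
    "\<And>i v. v \<in> carrier (P (Suc i)) \<Longrightarrow> d i v = \<zero>\<^bsub>P i\<^esub> \<Longrightarrow> \<exists>w\<in>carrier (P (Suc (Suc i))). d (Suc i) w = v"
proof -
  note r = resolutionD[OF assms, unfolded a_kernel_eq]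
  fix v
  show "e (d 0 v) = \<zero>\<^bsub>M\<^esub>" if "v \<in> carrier (P (Suc 0))" using imageI[OF that, of "d 0"] unfolding r(6) by simp
  show "d i (d (Suc i) v) = \<zero>\<^bsub>P i\<^esub>" if "v \<in> carrier (P (Suc (Suc i)))" for i
    using imageI[OF that, of "d (Suc i)"] unfolding r(7) by simp
  show "\<exists>w\<in>carrier (P (Suc 0)). d 0 w = v" if "v \<in> carrier (P 0)" "e v = \<zero>\<^bsub>M\<^esub>"
  proof -
    have "v \<in> d 0 ` carrier (P (Suc 0))" unfolding r(6) using that by simp
    thus ?thesis by (auto simp: image_iff)
  qed
  show "\<exists>w\<in>carrier (P (Suc (Suc i))). d (Suc i) w = v" if "v \<in> carrier (P (Suc i))" "d i v = \<zero>\<^bsub>P i\<^esub>" for i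
  proof -
    have "v \<in> d (Suc i) ` carrier (P (Suc (Suc i)))" unfolding r(7) using that by simp
    thus ?thesis by (auto simp: image_iff)
  qed
qed

context ring
begin

text \<open>
  The comparison theorem. Each \<open>\<phi> i\<close> is chosen together with the fact that its composite with the
  differential has values in the next image, which is what the next lift needs.
\<close>

lemma free_resolution_chain_map:
  assumes F: "resolution R M (\<lambda>i. free_mod R (K i)) dF eF" and P: "resolution R M P dP eP"
  obtains \<phi> where "\<And>i. \<phi> i \<in> mod_hom R (free_mod R (K i)) (P i)"
    "\<And>v. v \<in> carrier (free_mod R (K 0)) \<Longrightarrow> eP (\<phi> 0 v) = eF v"
    "\<And>i v. v \<in> carrier (free_mod R (K (Suc i))) \<Longrightarrow> dP i (\<phi> (Suc i) v) = \<phi> i (dF i v)"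
proof -
  note rF = resolutionD[OF F] and rP = resolutionD[OF P]
  note cF = resolution_complex[OF F]
  let ?F = "\<lambda>i. free_mod R (K i)"
  obtain \<phi>0 where \<phi>0: "\<phi>0 \<in> mod_hom R (?F 0) (P 0)" "\<And>v. v \<in> carrier (?F 0) \<Longrightarrow> eP (\<phi>0 v) = eF v"
  proof (rule free_mod_lift[OF rP(2)[of 0] rP(1) rP(3) rF(3)])
    show "eF ` carrier (?F 0) \<subseteq> eP ` carrier (P 0)" unfolding rF(5) rP(5) ..
  qed blast
  define good where "good i f \<longleftrightarrow> f \<in> mod_hom R (?F i) (P i) \<and> (i = 0 \<longrightarrow> f = \<phi>0) \<and>
      (\<forall>v\<in>carrier (?F (Suc i)). f (dF i v) \<in> dP i ` carrier (P (Suc i)))" for i f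
  have "\<exists>\<phi>. \<forall>i. good i (\<phi> i) \<and> (\<forall>v\<in>carrier (?F (Suc i)). dP i (\<phi> (Suc i) v) = \<phi> i (dF i v))"
  proof (rule dependent_nat_choice)
    have "\<phi>0 (dF 0 v) \<in> dP 0 ` carrier (P (Suc 0))" if v: "v \<in> carrier (?F (Suc 0))" for v
    proof -
      note d = mod_hom_closed[OF rF(4) v]
      show ?thesis unfolding rP(6) a_kernel_eq
        using mod_hom_closed[OF \<phi>0(1) d] \<phi>0(2)[OF d] cF(1)[OF v] by simp
    qed
    thus "\<exists>f. good 0 f" unfolding good_def using \<phi>0 by blast
  next
    fix f i assume "good i f"
    hence f: "f \<in> mod_hom R (?F i) (P i)" and fd: "\<And>v. v \<in> carrier (?F (Suc i)) \<Longrightarrow> f (dF i v) \<in> dP i ` carrier (P (Suc i))"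
      unfolding good_def by blast+
    obtain g where g: "g \<in> mod_hom R (?F (Suc i)) (P (Suc i))"
      and dg: "\<And>v. v \<in> carrier (?F (Suc i)) \<Longrightarrow> dP i (g v) = f (dF i v)"
    proof (rule free_mod_lift[OF rP(2)[of "Suc i"] rP(2)[of i] rP(4)[of i] mod_hom_comp[OF rF(4)[of i] f]])
      show "(\<lambda>v. f (dF i v)) ` carrier (?F (Suc i)) \<subseteq> dP i ` carrier (P (Suc i))" using fd by blast
    qed blast
    have "g (dF (Suc i) v) \<in> dP (Suc i) ` carrier (P (Suc (Suc i)))" if v: "v \<in> carrier (?F (Suc (Suc i)))" for v
    proof -
      note d = mod_hom_closed[OF rF(4) v]
      have "f (dF i (dF (Suc i) v)) = \<zero>\<^bsub>P i\<^esub>"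
        unfolding cF(2)[OF v] by (rule mod_hom_zero[OF abelian_group_free_mod left_module_abelian[OF rP(2)] f])
      thus ?thesis unfolding rP(7) a_kernel_eq
        using mod_hom_closed[OF g d] dg[OF d] by simp
    qed
    thus "\<exists>g. good (Suc i) g \<and> (\<forall>v\<in>carrier (?F (Suc i)). dP i (g v) = f (dF i v))"
      unfolding good_def using g dg by blast
  qed
  then obtain \<phi> where \<phi>: "\<And>i. good i (\<phi> i)"
    "\<And>i v. v \<in> carrier (?F (Suc i)) \<Longrightarrow> dP i (\<phi> (Suc i) v) = \<phi> i (dF i v)" by blast
  show ?thesis
  proof (rule that[of \<phi>])
    show "\<phi> i \<in> mod_hom R (?F i) (P i)" for i using \<phi>(1)[of i] by (simp add: good_def)
    show "eP (\<phi> 0 v) = eF v" if "v \<in> carrier (?F 0)" for v using \<phi>(1)[of 0] \<phi>0(2)[OF that] by (simp add: good_def)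
    show "dP i (\<phi> (Suc i) v) = \<phi> i (dF i v)" if "v \<in> carrier (?F (Suc i))" for i v by (rule \<phi>(2)[OF that])
  qed
qed

text \<open>
  Let \<open>\<phi>\<close> be a chain map from the free to the flat resolution. It induces the identity on \<open>M\<close>, so its mapping cone \<open>C\<close> is exact, with
  terms \<open>C i = F (i - 1) \<oplus> P i\<close>, and all of these are flat. Starting from \<open>Z 0 = C 0\<close>, the modules of cycles \<open>Z i\<close>
  are flat as kernels of surjections \<open>C i \<rightarrow> Z (i - 1)\<close> between flat modules. Since
  \<open>P (n + 1) = 0\<close>, the module \<open>Z n\<close> is a quotient of \<open>F n\<close> alone, and the kernel of \<open>F n \<rightarrow> Z n\<close> is the image of \<open>F (n + 1)\<close>.
\<close>

lemma flat_resolution_imp_locally_split: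
  assumes F: "resolution R M (\<lambda>i. free_mod R (K i)) dF eF" and P: "resolution R M P dP eP"
    and flat: "\<And>i. equationally_flat R (P i)" and n: "vanishes_above n P"
  shows "locally_split R (free_mod R (K n)) (dF n ` carrier (free_mod R (K (Suc n))))"
proof -
  note rF = resolutionD[OF F] and rP = resolutionD[OF P]
  note cF = resolution_complex[OF F] and cP = resolution_complex[OF P]
  let ?F = "\<lambda>i. free_mod R (K i)"
  obtain \<phi> where \<phi>: "\<And>i. \<phi> i \<in> mod_hom R (?F i) (P i)"
    "\<And>v. v \<in> carrier (?F 0) \<Longrightarrow> eP (\<phi> 0 v) = eF v"
    "\<And>i v. v \<in> carrier (?F (Suc i)) \<Longrightarrow> dP i (\<phi> (Suc i) v) = \<phi> i (dF i v)"
    by (rule free_resolution_chain_map[OF F P]) blast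
  \<comment> \<open>The index sets and differentials of \<open>F\<close> shifted by one; \<open>F (- 1) = 0\<close>.\<close>
  define K' where "K' i = (case i of 0 \<Rightarrow> {} | Suc j \<Rightarrow> K j)" for i
  define d' where "d' i = (case i of 0 \<Rightarrow> (\<lambda>v x. \<zero>) | Suc j \<Rightarrow> dF j)" for i
  define C where "C i = mod_prod (free_mod R (K' i)) (P i)" for i
  define \<delta> where "\<delta> i = (\<lambda>p. (d' i (fst p), \<phi> i (fst p) \<ominus>\<^bsub>P i\<^esub> dP i (snd p)))" for i
  define Z where "Z i = (case i of 0 \<Rightarrow> carrier (C 0) | Suc j \<Rightarrow> a_kernel (C (Suc j)) (C j) (\<delta> j))" for i
  have K'_Suc: "K' (Suc i) = K i" for i by (simp add: K'_def)
  have d': "d' i \<in> mod_hom R (?F i) (free_mod R (K' i))" for i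
  proof (cases i)
    case 0
    show ?thesis using mod_hom_const_zero[OF left_module_free_mod] 0 by (simp add: d'_def)
  next
    case (Suc j)
    show ?thesis using rF(4)[of j] unfolding Suc d'_def K'_def by simp
  qed
  have Cflat: "equationally_flat R (C i)" for i
    unfolding C_def by (rule equationally_flat_prod[OF equationally_flat_free flat])
  have fst: "(\<lambda>p. fst p) \<in> mod_hom R (C (Suc i)) (?F i)" for i
    unfolding C_def K'_Suc by (rule mod_hom_fst)
  have snd: "(\<lambda>p. snd p) \<in> mod_hom R (C (Suc i)) (P (Suc i))" for i unfolding C_def by (rule mod_hom_snd)
  have \<delta>: "\<delta> i \<in> mod_hom R (C (Suc i)) (C i)" for i
    unfolding \<delta>_def C_def[of i]
    by (rule mod_hom_pair[OF mod_hom_comp[OF fst d'] mod_hom_sub[OF rP(2) mod_hom_comp[OF fst \<phi>(1)] mod_hom_comp[OF snd rP(4)]]])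
  have Zsub: "Z i \<subseteq> carrier (C i)" for i by (cases i) (auto simp: Z_def a_kernel_eq)
  have Czero: "\<zero>\<^bsub>C i\<^esub> = ((\<lambda>x. \<zero>), \<zero>\<^bsub>P i\<^esub>)" for i by (simp add: C_def)
  have dd': "d' i (dF i v) = (\<lambda>x. \<zero>)" if "v \<in> carrier (?F (Suc i))" for i v
    using that cF(2) by (cases i) (auto simp: d'_def)
  have P0: "dP i \<zero>\<^bsub>P (Suc i)\<^esub> = \<zero>\<^bsub>P i\<^esub>" for i
    by (rule mod_hom_zero[OF left_module_abelian[OF rP(2)] left_module_abelian[OF rP(2)] rP(4)])
  have onto: "\<delta> i ` carrier (C (Suc i)) = Z i" for i
  proof (intro equalityI subsetI)
    interpret Pi: left_module R "P i" by (rule rP(2))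
    interpret Ps: left_module R "P (Suc i)" by (rule rP(2))
    fix q assume "q \<in> \<delta> i ` carrier (C (Suc i))"
    then obtain p where p: "p \<in> carrier (C (Suc i))" "q = \<delta> i p" by blast
    show "q \<in> Z i"
    proof (cases i)
      case 0
      show ?thesis using mod_hom_closed[OF \<delta> p(1)] unfolding p(2) 0 by (simp add: Z_def)
    next
      case (Suc j)
      interpret Pj: left_module R "P j" by (rule rP(2))
      have f: "fst p \<in> carrier (?F (Suc j))" and s: "snd p \<in> carrier (P (Suc (Suc j)))"
        using p(1) by (auto simp: C_def K'_def Suc)
      have dsj: "d' (Suc j) (fst p) = dF j (fst p)" by (simp add: d'_def)
      note c = mod_hom_closed[OF \<phi>(1)[of "Suc j"] f] mod_hom_closed[OF rP(4) s]
      have "dP j (\<phi> (Suc j) (fst p) \<ominus>\<^bsub>P (Suc j)\<^esub> dP (Suc j) (snd p)) = \<phi> j (dF j (fst p)) \<ominus>\<^bsub>P j\<^esub> \<zero>\<^bsub>P j\<^esub>"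
        unfolding mod_hom_diff[OF left_module_abelian[OF rP(2)] left_module_abelian[OF rP(2)] rP(4) c]
          \<phi>(3)[OF f] cP(2)[OF s] ..
      hence "dP j (snd (\<delta> (Suc j) p)) = \<phi> j (fst (\<delta> (Suc j) p)) \<ominus>\<^bsub>P j\<^esub> \<zero>\<^bsub>P j\<^esub>"
        by (simp add: \<delta>_def dsj)
      moreover have "\<phi> j (fst (\<delta> (Suc j) p)) \<in> carrier (P j)"
        using mod_hom_closed[OF \<phi>(1) mod_hom_closed[OF rF(4) f]] by (simp add: \<delta>_def dsj)
      moreover have z: "\<ominus>\<^bsub>P j\<^esub> \<zero>\<^bsub>P j\<^esub> = \<zero>\<^bsub>P j\<^esub>" by (rule Pj.M.minus_equality) simp_all
      moreover have "d' j (fst (\<delta> (Suc j) p)) = (\<lambda>x. \<zero>)" using dd'[OF f] by (simp add: \<delta>_def dsj)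
      ultimately have "\<delta> j (\<delta> (Suc j) p) = \<zero>\<^bsub>C j\<^esub>"
        unfolding Czero by (simp add: \<delta>_def[of j] a_minus_def Pj.M.r_neg)
      thus ?thesis using mod_hom_closed[OF \<delta> p(1)] unfolding p(2) Suc by (simp add: Z_def a_kernel_eq)
    qed
  next
    interpret Pi: left_module R "P i" by (rule rP(2))
    interpret Ps: left_module R "P (Suc i)" by (rule rP(2))
    fix q assume q: "q \<in> Z i"
    have sq: "snd q \<in> carrier (P i)" using subsetD[OF Zsub q] by (auto simp: C_def)
    \<comment> \<open>It suffices to find a preimage of the first component.\<close>
    have "\<exists>g. g \<in> carrier (?F i) \<and> d' i g = fst q \<and> (\<exists>r\<in>carrier (P (Suc i)). dP i r = \<phi> i g \<ominus>\<^bsub>P i\<^esub> snd q)"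
    proof (cases i)
      case 0
      have "eP (snd q) \<in> eF ` carrier (?F 0)" using mod_hom_closed[OF rP(3)] sq 0 unfolding rF(5) by blast
      then obtain g where g: "g \<in> carrier (?F 0)" "eF g = eP (snd q)" by (metis imageE)
      interpret M: left_module R M by (rule rP(1))
      have "fst q = (\<lambda>x. \<zero>)" using subsetD[OF Zsub q] by (auto simp: 0 C_def K'_def free_mod_carrier)
      moreover have c: "\<phi> 0 g \<in> carrier (P 0)" "snd q \<in> carrier (P 0)" using mod_hom_closed[OF \<phi>(1) g(1)] sq 0 by auto
      have "eP (\<phi> 0 g \<ominus>\<^bsub>P 0\<^esub> snd q) = \<zero>\<^bsub>M\<^esub>"
        unfolding mod_hom_diff[OF left_module_abelian[OF rP(2)] left_module_abelian[OF rP(1)] rP(3) c] \<phi>(2)[OF g(1)] g(2)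
        using mod_hom_closed[OF rP(3) c(2)] by (simp add: a_minus_def M.M.r_neg)
      from cP(3)[OF _ this] have "\<exists>r\<in>carrier (P (Suc 0)). dP 0 r = \<phi> 0 g \<ominus>\<^bsub>P 0\<^esub> snd q"
        using c Pi.M.minus_closed 0 by simp
      ultimately show ?thesis unfolding 0 using g(1) by (intro exI[of _ g]) (simp add: d'_def)
    next
      case (Suc j)
      interpret Pj: left_module R "P j" by (rule rP(2))
      have f: "fst q \<in> carrier (?F j)" using subsetD[OF Zsub q] by (auto simp: Suc C_def K'_def)
      have "\<delta> j q = \<zero>\<^bsub>C j\<^esub>" using q by (simp add: Suc Z_def a_kernel_eq)
      hence d0: "d' j (fst q) = (\<lambda>x. \<zero>)" and "\<phi> j (fst q) \<ominus>\<^bsub>P j\<^esub> dP j (snd q) = \<zero>\<^bsub>P j\<^esub>"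
        unfolding Czero by (simp_all add: \<delta>_def)
      moreover have sq': "snd q \<in> carrier (P (Suc j))" using sq Suc by simp
      moreover note c = mod_hom_closed[OF \<phi>(1) f] mod_hom_closed[OF rP(4) sq']
      ultimately have eq: "\<phi> j (fst q) = dP j (snd q)"
        by (metis Pj.M.add.inv_closed Pj.M.add.inv_inv Pj.M.minus_equality a_minus_def Pj.M.a_comm)
      have "\<exists>g\<in>carrier (?F (Suc j)). dF j g = fst q"
      proof (cases j)
        case 0
        have "eF (fst q) = eP (\<phi> 0 (fst q))" using \<phi>(2) f 0 by simp
        also have "\<dots> = \<zero>\<^bsub>M\<^esub>" using cP(1) sq' eq 0 by simp
        finally show ?thesis using cF(3) f 0 by simp
      next
        case (Suc l)
        show ?thesis using cF(4)[of "fst q" l] f d0 unfolding Suc d'_def by simp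
      qed
      then obtain g where g: "g \<in> carrier (?F (Suc j))" "dF j g = fst q" by blast
      note gc = mod_hom_closed[OF \<phi>(1) g(1)]
      have "dP j (\<phi> (Suc j) g \<ominus>\<^bsub>P (Suc j)\<^esub> snd q) = \<zero>\<^bsub>P j\<^esub>"
        unfolding mod_hom_diff[OF left_module_abelian[OF rP(2)] left_module_abelian[OF rP(2)] rP(4) gc sq'] \<phi>(3)[OF g(1)] g(2) eq
        using c(2) by (simp add: a_minus_def Pj.M.r_neg)
      from cP(4)[OF _ this] have "\<exists>r\<in>carrier (P (Suc (Suc j))). dP (Suc j) r = \<phi> (Suc j) g \<ominus>\<^bsub>P (Suc j)\<^esub> snd q"
        using gc sq' Pi.M.minus_closed Suc by simp
      thus ?thesis unfolding Suc using g by (intro exI[of _ g]) (simp add: d'_def)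
    qed
    then obtain g r where g: "g \<in> carrier (?F i)" "d' i g = fst q"
      and r: "r \<in> carrier (P (Suc i))" "dP i r = \<phi> i g \<ominus>\<^bsub>P i\<^esub> snd q" by blast
    have "\<phi> i g \<ominus>\<^bsub>P i\<^esub> dP i r = snd q"
      unfolding r(2) using mod_hom_closed[OF \<phi>(1) g(1)] sq
      by (simp add: a_minus_def Pi.M.minus_add Pi.M.a_assoc[symmetric] Pi.M.r_neg)
    hence "\<delta> i (g, r) = q" using g by (simp add: \<delta>_def)
    moreover have "(g, r) \<in> carrier (C (Suc i))" using g r by (simp add: C_def K'_Suc)
    ultimately show "q \<in> \<delta> i ` carrier (C (Suc i))" by blast
  qed
  have Zflat: "equationally_flat R (C i\<lparr>carrier := Z i\<rparr>)" for i
  proof (induction i)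
    case 0
    show ?case using Cflat[of 0] by (simp add: Z_def)
  next
    case (Suc i)
    have h: "\<delta> i \<in> mod_hom R (C (Suc i)) (C i\<lparr>carrier := Z i\<rparr>)"
      by (rule mod_hom_corestrict[OF \<delta>]) (simp add: onto)
    have "a_kernel (C (Suc i)) (C i\<lparr>carrier := Z i\<rparr>) (\<delta> i) = Z (Suc i)"
      by (simp add: Z_def a_kernel_eq)
    thus ?case using equationally_flat_kernel[OF Cflat Suc h] by (simp add: onto)
  qed
  let ?Z = "C n\<lparr>carrier := Z n\<rparr>"
  have P0': "carrier (P (Suc n)) = {\<zero>\<^bsub>P (Suc n)\<^esub>}" using n by (simp add: vanishes_above_def)
  let ?p = "\<lambda>v. \<delta> n (v, \<zero>\<^bsub>P (Suc n)\<^esub>)"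
  have inj: "(\<lambda>v. (v, \<zero>\<^bsub>P (Suc n)\<^esub>)) \<in> mod_hom R (?F n) (C (Suc n))"
    unfolding C_def K'_Suc by (rule mod_hom_pair[OF mod_hom_id mod_hom_const_zero[OF rP(2)]])
  have "carrier (C (Suc n)) = (\<lambda>v. (v, \<zero>\<^bsub>P (Suc n)\<^esub>)) ` carrier (?F n)"
    using P0' by (auto simp: C_def K'_Suc)
  hence im: "?p ` carrier (?F n) = Z n" unfolding onto[symmetric] by (simp add: image_image)
  have p: "?p \<in> mod_hom R (?F n) ?Z"
    by (rule mod_hom_corestrict[OF mod_hom_comp[OF inj \<delta>]]) (simp add: im)
  have "a_kernel (?F n) ?Z ?p = dF n ` carrier (?F (Suc n))"
  proof (intro equalityI subsetI)
    interpret Pn: left_module R "P n" by (rule rP(2))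
    have z: "\<ominus>\<^bsub>P n\<^esub> \<zero>\<^bsub>P n\<^esub> = \<zero>\<^bsub>P n\<^esub>" by (rule Pn.M.minus_equality) simp_all
    have pv: "?p v = (d' n v, \<phi> n v)" if "v \<in> carrier (?F n)" for v
      using mod_hom_closed[OF \<phi>(1) that] by (simp add: \<delta>_def P0 a_minus_def z)
    {
      fix v assume "v \<in> a_kernel (?F n) ?Z ?p"
      hence v: "v \<in> carrier (?F n)" and "d' n v = (\<lambda>x. \<zero>)" "\<phi> n v = \<zero>\<^bsub>P n\<^esub>"
        using pv by (auto simp: a_kernel_eq Czero)
      hence "\<exists>w\<in>carrier (?F (Suc n)). dF n w = v"
      proof (cases n)
        case 0
        have "eF v = \<zero>\<^bsub>M\<^esub>"
          using \<phi>(2)[of v] v \<open>\<phi> n v = _\<close> mod_hom_zero[OF left_module_abelian[OF rP(2)] left_module_abelian[OF rP(1)] rP(3)]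
          unfolding 0 by simp
        thus ?thesis using cF(3) v 0 by simp
      next
        case (Suc l)
        thus ?thesis using cF(4)[of v l] v \<open>d' n v = _\<close> by (simp add: d'_def)
      qed
      thus "v \<in> dF n ` carrier (?F (Suc n))" by blast
    }
    fix v assume "v \<in> dF n ` carrier (?F (Suc n))"
    then obtain w where w: "w \<in> carrier (?F (Suc n))" "v = dF n w" by blast
    note v = mod_hom_closed[OF rF(4) w(1)]
    have "\<phi> (Suc n) w = \<zero>\<^bsub>P (Suc n)\<^esub>" using mod_hom_closed[OF \<phi>(1) w(1)] P0' by simp
    hence "\<phi> n v = \<zero>\<^bsub>P n\<^esub>" using \<phi>(3)[OF w(1)] P0 w(2) by simp
    thus "v \<in> a_kernel (?F n) ?Z ?p"
      using v dd'[OF w(1)] pv by (simp add: a_kernel_eq Czero w(2))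
  qed
  moreover have "locally_split R (?F n) (a_kernel (?F n) ?Z ?p)"
    by (rule locally_split_kernel[OF Zflat p]) (simp add: im)
  ultimately show ?thesis by simp
qed

end

section \<open>Truncating a free resolution\<close>

text \<open>
  The infimum in the definitions of the dimensions is attained, so a dimension \<open>\<le> n\<close> provides a resolution of length \<open>n\<close>.
\<close>

lemma Inf_enat_le_iff:
  assumes mono: "\<And>m n. Q m \<Longrightarrow> m \<le> n \<Longrightarrow> Q n"
  shows "Inf {enat n | n. Q n} \<le> enat n \<longleftrightarrow> Q n"
proof
  let ?S = "{enat n | n. Q n}"
  assume le: "Inf ?S \<le> enat n"
  have ne: "?S \<noteq> {}"
  proof
    assume "?S = {}"
    hence "Inf ?S = \<infinity>" by (simp only: Inf_empty top_enat_def)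
    with le show False by simp
  qed
  then obtain x where x: "x \<in> ?S" by blast
  have "Inf ?S = (LEAST x. x \<in> ?S)" using ne unfolding Inf_enat_def by (rule if_not_P)
  hence "Inf ?S \<in> ?S" using LeastI[of "\<lambda>x. x \<in> ?S", OF x] by simp
  then obtain m where "Q m" "Inf ?S = enat m" by blast
  with le mono show "Q n" by simp
qed (intro Inf_lower, blast)

lemma flat_dim_le_iff_resolution:
  "flat_dim TYPE('u) A M \<le> enat n \<longleftrightarrow> (\<exists>(P :: nat \<Rightarrow> ('a, 'u) module) d e.
      resolution A M P d e \<and> (\<forall>i. flat_module A (P i)) \<and> vanishes_above n P)"
  unfolding flat_dim_def
  by (rule Inf_enat_le_iff) (unfold vanishes_above_def, meson le_less_trans)

lemma projective_dim_le_iff_resolution: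
  "projective_dim TYPE('u) A M \<le> enat n \<longleftrightarrow> (\<exists>(P :: nat \<Rightarrow> ('a, 'u) module) d e.
      resolution A M P d e \<and> (\<forall>i. projective_module A (P i)) \<and> vanishes_above n P)"
  unfolding projective_dim_def
  by (rule Inf_enat_le_iff) (unfold vanishes_above_def, meson le_less_trans)

text \<open>
  The terms of a resolution have to live on a prescribed type, so \<open>M\<close> itself can only be a term after it is
  transported along an injection.
\<close>

definition mod_copy :: "('m \<Rightarrow> 'u) \<Rightarrow> ('a, 'm) module \<Rightarrow> ('a, 'u) module"
  where "mod_copy j M =
    \<lparr>carrier = j ` carrier M, monoid.mult = (\<lambda>x y. x), one = j \<zero>\<^bsub>M\<^esub>, ring.zero = j \<zero>\<^bsub>M\<^esub>,
     ring.add = (\<lambda>x y. j (the_inv_into (carrier M) j x \<oplus>\<^bsub>M\<^esub> the_inv_into (carrier M) j y)),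
     smult = (\<lambda>a x. j (a \<odot>\<^bsub>M\<^esub> the_inv_into (carrier M) j x))\<rparr>"

lemma mod_copy:
  assumes M: "left_module A M" and j: "inj_on j (carrier M)"
  shows "left_module A (mod_copy j M)" "j \<in> mod_hom A M (mod_copy j M)"
    "the_inv_into (carrier M) j \<in> mod_hom A (mod_copy j M) M"
proof -
  interpret M: left_module A M by (rule M)
  note [simp] = the_inv_into_f_f[OF j] M.smult_closed
  show "j \<in> mod_hom A M (mod_copy j M)" by (rule mod_homI) (auto simp: mod_copy_def)
  show "the_inv_into (carrier M) j \<in> mod_hom A (mod_copy j M) M" by (rule mod_homI) (auto simp: mod_copy_def)
  have "abelian_group (mod_copy j M)"
  proof (rule abelian_groupI, goal_cases)
    case (6 x)
    then obtain m where "x = j m" "m \<in> carrier M" by (auto simp: mod_copy_def)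
    thus ?case by (intro bexI[of _ "j (\<ominus>\<^bsub>M\<^esub> m)"]) (auto simp: mod_copy_def M.M.l_neg)
  qed (auto simp: mod_copy_def M.M.a_ac)
  thus "left_module A (mod_copy j M)"
    by (intro left_moduleI M.A.ring_axioms)
       (auto simp: mod_copy_def M.smult_l_distr M.smult_r_distr M.smult_assoc M.smult_one)
qed

context ring
begin

lemma flat_dim_le_projective_dim: "flat_dim TYPE('u) R M \<le> projective_dim TYPE('u) R M"
proof (cases "projective_dim TYPE('u) R M")
  case (enat n)
  hence "projective_dim TYPE('u) R M \<le> enat n" by simp
  hence "flat_dim TYPE('u) R M \<le> enat n"
    unfolding projective_dim_le_iff_resolution flat_dim_le_iff_resolution flat_iff_equationally_flat
    using projective_imp_equationally_flat by blast
  with enat show ?thesis by simp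
qed simp

lemma free_mod_empty: "carrier (free_mod R {}) = {\<lambda>x. \<zero>}"
  by (auto simp: free_mod_carrier)

text \<open>
  The image of \<open>d n\<close> in degree \<open>n + 1\<close>, mapped by inclusion, ends the resolution. Being a subset of \<open>F n\<close>, it lives on the
  right type.
\<close>

lemma truncated_resolution:
  fixes K :: "nat \<Rightarrow> 'i set"
  assumes F: "resolution R M (\<lambda>i. free_mod R (K i)) d e"
  obtains P d' where "resolution R M P d' e" "vanishes_above (Suc n) P"
    "\<And>i. i \<noteq> Suc n \<Longrightarrow> \<exists>I. P i = free_mod R (I :: 'i set)"
    "P (Suc n) = free_mod R (K n)\<lparr>carrier := d n ` carrier (free_mod R (K (Suc n)))\<rparr>"
proof -
  note r = resolutionD[OF F]
  let ?F = "\<lambda>i. free_mod R (K i)" and ?L = "d n ` carrier (free_mod R (K (Suc n)))"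
  have Lsm: "submodule_set R (?F n) ?L"
    by (rule submodule_set_image[OF left_module_free_mod left_module_free_mod r(4)])
  have LM: "left_module R (?F n\<lparr>carrier := ?L\<rparr>)" by (rule left_module_submodule[OF left_module_free_mod Lsm])
  have Lsub: "?L \<subseteq> carrier (?F n)" and z: "(\<lambda>x. \<zero>) \<in> ?L" using Lsm by (auto simp: submodule_set_def)
  define P where "P i = (if i \<le> n then ?F i else if i = Suc n then ?F n\<lparr>carrier := ?L\<rparr> else free_mod R {})" for i
  define d' where "d' i = (if i < n then d i else if i = n then (\<lambda>v. v) else (\<lambda>v x. \<zero>))" for i
  have zP: "\<zero>\<^bsub>P i\<^esub> = (\<lambda>x. \<zero>)" for i by (simp add: P_def)
  have PM: "left_module R (P i)" for i unfolding P_def using LM left_module_free_mod by auto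
  have hom: "d' i \<in> mod_hom R (P (Suc i)) (P i)" for i
  proof -
    consider "i < n" | "i = n" | "i > n" by linarith
    thus ?thesis
    proof cases
      case 1 thus ?thesis using r(4) by (simp add: P_def d'_def)
    next
      case 2 thus ?thesis using mod_hom_restrict[OF mod_hom_id Lsub] by (simp add: P_def d'_def)
    next
      case 3 thus ?thesis using mod_hom_const_zero[OF PM[of i]] unfolding zP by (simp add: d'_def)
    qed
  qed
  have "d' (Suc i) ` carrier (P (Suc (Suc i))) = a_kernel (P (Suc i)) (P i) (d' i)" for i
  proof -
    consider "Suc i < n" | "Suc i = n" | "i = n" | "i > n" by linarith
    thus ?thesis
    proof cases
      case 1 thus ?thesis using r(7)[of i] by (simp add: P_def d'_def)
    next
      case 2 thus ?thesis using r(7)[of i] by (auto simp: P_def d'_def)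
    next
      case 3 thus ?thesis using z by (auto simp: P_def d'_def a_kernel_eq free_mod_empty)
    next
      case 4 thus ?thesis by (auto simp: P_def d'_def a_kernel_eq free_mod_empty)
    qed
  qed
  moreover have "d' 0 ` carrier (P (Suc 0)) = a_kernel (P 0) M e"
    using r(6) by (cases "n = 0") (auto simp: P_def d'_def)
  moreover have "P 0 = ?F 0" by (simp add: P_def)
  ultimately have "resolution R M P d' e"
    unfolding resolution_def using r(1,3,5) PM hom by auto
  moreover have "vanishes_above (Suc n) P" by (auto simp: vanishes_above_def P_def free_mod_empty)
  moreover have "\<exists>I. P i = free_mod R I" if "i \<noteq> Suc n" for i using that by (auto simp: P_def)
  moreover have "P (Suc n) = ?F n\<lparr>carrier := ?L\<rparr>" by (simp add: P_def)
  ultimately show ?thesis by (rule that)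
qed

text \<open>
  Truncation reaches lengths \<open>\<ge> 1\<close> only; length \<open>0\<close> means that \<open>M\<close> is its own resolution, up to the transport.
\<close>

lemma resolution_of_length_zero:
  fixes j :: "'m \<Rightarrow> 'i \<Rightarrow> 'a"
  assumes M: "left_module R M" and j: "inj_on j (carrier M)"
  obtains P d e where "resolution R M P d e" "vanishes_above 0 P" "P 0 = mod_copy j M"
    "\<And>i. P (Suc i) = free_mod R ({} :: 'i set)"
proof -
  define P where "P i = (case i of 0 \<Rightarrow> mod_copy j M | Suc _ \<Rightarrow> free_mod R {})" for i :: nat
  define d where "d i = (\<lambda>v :: 'i \<Rightarrow> 'a. \<zero>\<^bsub>P i\<^esub>)" for i
  let ?e = "the_inv_into (carrier M) j"
  have PM: "left_module R (P i)" for i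
    using mod_copy(1)[OF M j] left_module_free_mod by (cases i) (simp_all add: P_def)
  have e: "?e \<in> mod_hom R (P 0) M" using mod_copy(3)[OF M j] by (simp add: P_def)
  have im: "?e ` carrier (P 0) = carrier M" using the_inv_into_f_f[OF j] by (force simp: P_def mod_copy_def image_iff)
  have "carrier (P (Suc i)) = {\<lambda>x. \<zero>}" for i by (simp add: P_def free_mod_empty)
  moreover have "a_kernel (P 0) M ?e = {\<zero>\<^bsub>P 0\<^esub>}"
  proof -
    interpret M: left_module R M by (rule M)
    show ?thesis using M.M.zero_closed the_inv_into_f_f[OF j] by (auto simp: a_kernel_eq P_def mod_copy_def)
  qed
  moreover have "\<zero>\<^bsub>P (Suc i)\<^esub> = (\<lambda>x. \<zero>)" for i by (simp add: P_def)
  ultimately have "resolution R M P d ?e"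
    unfolding resolution_def using M PM e im mod_hom_const_zero[OF PM]
    by (auto simp: d_def a_kernel_eq)
  moreover have "vanishes_above 0 P"
    unfolding vanishes_above_def by (auto simp: P_def free_mod_empty split: nat.split)
  ultimately show ?thesis by (rule that) (simp_all add: P_def)
qed

text \<open>
  One direction is the comparison of resolutions. Conversely, if the image of \<open>d n\<close> is locally split in \<open>F n\<close>, then
  \<open>F n\<close> modulo this image is flat. This quotient is \<open>M\<close> for \<open>n = 0\<close>, and the image of \<open>d (n - 1)\<close> otherwise, where the
  resolution can be truncated.
\<close>

theorem flat_dim_le_iff_locally_split:
  fixes K :: "nat \<Rightarrow> 'i set" and j :: "'m \<Rightarrow> 'i \<Rightarrow> 'a"
  assumes F: "resolution R M (\<lambda>i. free_mod R (K i)) d e" and j: "inj_on j (carrier M)"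
  shows "flat_dim TYPE('i \<Rightarrow> 'a) R M \<le> enat n \<longleftrightarrow>
    locally_split R (free_mod R (K n)) (d n ` carrier (free_mod R (K (Suc n))))"
proof
  assume "flat_dim TYPE('i \<Rightarrow> 'a) R M \<le> enat n"
  thus "locally_split R (free_mod R (K n)) (d n ` carrier (free_mod R (K (Suc n))))"
    unfolding flat_dim_le_iff_resolution flat_iff_equationally_flat
    using flat_resolution_imp_locally_split[OF F] by blast
next
  note r = resolutionD[OF F]
  assume split: "locally_split R (free_mod R (K n)) (d n ` carrier (free_mod R (K (Suc n))))"
  show "flat_dim TYPE('i \<Rightarrow> 'a) R M \<le> enat n"
  proof (cases n)
    case 0
    have M: "equationally_flat R M"
      using split unfolding 0 by (intro equationally_flat_quotient[OF r(1,3,5)]) (simp add: r(6))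
    note c = mod_copy[OF r(1) j]
    have cflat: "equationally_flat R (mod_copy j M)"
      by (rule equationally_flat_retract[OF c(1) M c(3,2)])
         (auto simp: mod_copy_def the_inv_into_f_f[OF j])
    obtain P d e where P: "resolution R M P d e" "vanishes_above 0 P" "P 0 = mod_copy j M"
      "\<And>i. P (Suc i) = free_mod R ({} :: 'i set)"
      by (rule resolution_of_length_zero[OF r(1) j]) blast
    have "equationally_flat R (P i)" for i
      using cflat equationally_flat_free by (cases i) (simp_all add: P)
    with P(1,2) show ?thesis unfolding flat_dim_le_iff_resolution flat_iff_equationally_flat 0 by blast
  next
    case (Suc k)
    let ?Fk = "free_mod R (K k)" and ?L = "d k ` carrier (free_mod R (K (Suc k)))"
    have Lsm: "submodule_set R ?Fk ?L"
      by (rule submodule_set_image[OF left_module_free_mod left_module_free_mod r(4)])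
    have LM: "left_module R (?Fk\<lparr>carrier := ?L\<rparr>)" by (rule left_module_submodule[OF left_module_free_mod Lsm])
    have dL: "d k \<in> mod_hom R (free_mod R (K (Suc k))) (?Fk\<lparr>carrier := ?L\<rparr>)"
      by (rule mod_hom_corestrict[OF r(4)]) simp
    have "a_kernel (free_mod R (K (Suc k))) (?Fk\<lparr>carrier := ?L\<rparr>) (d k) = d n ` carrier (free_mod R (K (Suc n)))"
      unfolding Suc r(7) by (simp add: a_kernel_eq)
    hence Lflat: "equationally_flat R (?Fk\<lparr>carrier := ?L\<rparr>)"
      using split unfolding Suc by (intro equationally_flat_quotient[OF LM dL]) simp_all
    obtain P d' where P: "resolution R M P d' e" "vanishes_above (Suc k) P"
      "\<And>i. i \<noteq> Suc k \<Longrightarrow> \<exists>I. P i = free_mod R (I :: 'i set)" "P (Suc k) = ?Fk\<lparr>carrier := ?L\<rparr>"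
      by (rule truncated_resolution[OF F, of k]) blast
    have "equationally_flat R (P i)" for i
      using P(3)[of i] Lflat equationally_flat_free P(4) by (cases "i = Suc k") auto
    with P(1,2) show ?thesis unfolding flat_dim_le_iff_resolution flat_iff_equationally_flat Suc by blast
  qed
qed

lemma projective_dim_le_Suc:
  fixes K :: "nat \<Rightarrow> 'i set"
  assumes F: "resolution R M (\<lambda>i. free_mod R (K i)) d e"
    and proj: "projective_module R (free_mod R (K n)\<lparr>carrier := d n ` carrier (free_mod R (K (Suc n)))\<rparr>)"
  shows "projective_dim TYPE('i \<Rightarrow> 'a) R M \<le> enat (Suc n)"
proof -
  obtain P d' where P: "resolution R M P d' e" "vanishes_above (Suc n) P"
    "\<And>i. i \<noteq> Suc n \<Longrightarrow> \<exists>I. P i = free_mod R (I :: 'i set)"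
    "P (Suc n) = free_mod R (K n)\<lparr>carrier := d n ` carrier (free_mod R (K (Suc n)))\<rparr>"
    by (rule truncated_resolution[OF F, of n]) blast
  have "projective_module R (P i)" for i
    using P(3)[of i] proj projective_free P(4) by (cases "i = Suc n") auto
  with P(1,2) show ?thesis unfolding projective_dim_le_iff_resolution by blast
qed

text \<open>
  The image of \<open>d n\<close> is locally split and generated by the countably many images of basis vectors, hence projective; truncating
  there costs one more degree than truncating at the flat image of \<open>d (n - 1)\<close>.
\<close>

theorem projective_dim_le_Suc_of_flat_dim_le:
  fixes K :: "nat \<Rightarrow> 'i set" and j :: "'m \<Rightarrow> 'i \<Rightarrow> 'a"
  assumes F: "resolution R M (\<lambda>i. free_mod R (K i)) d e" and j: "inj_on j (carrier M)"
    and K: "countable (K (Suc n))" and le: "flat_dim TYPE('i \<Rightarrow> 'a) R M \<le> enat n"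
  shows "projective_dim TYPE('i \<Rightarrow> 'a) R M \<le> enat (Suc n)"
  using le unfolding flat_dim_le_iff_locally_split[OF F j]
  by (intro projective_dim_le_Suc[OF F] locally_split_countable_imp_projective[OF K resolutionD(4)[OF F] refl])

lemma projective_dim_le_0:
  fixes j :: "'m \<Rightarrow> 'i \<Rightarrow> 'a"
  assumes M: "left_module R M" and j: "inj_on j (carrier M)"
    and s: "s \<in> mod_hom R M (free_mod R I)" and t: "t \<in> mod_hom R (free_mod R I) M"
    and ts: "\<And>x. x \<in> carrier M \<Longrightarrow> t (s x) = x"
  shows "projective_dim TYPE('i \<Rightarrow> 'a) R M \<le> 0"
proof -
  note c = mod_copy[OF M j]
  have cproj: "projective_module R (mod_copy j M)"
    by (rule projective_retract_of_free[OF c(1) mod_hom_comp[OF c(3) s] mod_hom_comp[OF t c(2)]])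
       (auto simp: mod_copy_def the_inv_into_f_f[OF j] ts)
  obtain P d e where P: "resolution R M P d e" "vanishes_above 0 P" "P 0 = mod_copy j M"
    "\<And>i. P (Suc i) = free_mod R ({} :: 'i set)"
    by (rule resolution_of_length_zero[OF M j]) blast
  have "projective_module R (P i)" for i
    using cproj projective_free by (cases i) (simp_all add: P)
  with P(1,2) show ?thesis unfolding zero_enat_def projective_dim_le_iff_resolution by blast
qed

end

section \<open>Periodicity\<close>

text \<open>If \<open>a\<close> and \<open>b\<close> annihilate each other, this says that \<open>M \<leftarrow> M \<leftarrow> M\<close>, multiplication by \<open>b\<close>
  followed by multiplication by \<open>a\<close>, is exact.\<close>

definition exact_pair :: "'a \<Rightarrow> 'a \<Rightarrow> ('a, 'm) module \<Rightarrow> 'm set \<Rightarrow> bool"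
  where "exact_pair a b M S \<longleftrightarrow> (\<forall>m\<in>S. a \<odot>\<^bsub>M\<^esub> m = \<zero>\<^bsub>M\<^esub> \<longrightarrow> (\<exists>m'\<in>S. m = b \<odot>\<^bsub>M\<^esub> m'))"

text \<open>
  A diagram chase: if \<open>a\<close> kills \<open>f m\<close>, then \<open>a m\<close> lies in the kernel and is killed by \<open>b\<close>, hence is \<open>a k\<close> for some \<open>k\<close> in the kernel, and
  \<open>m - k\<close>, with the same image as \<open>m\<close>, is a multiple of \<open>b\<close>. The roles of \<open>a\<close> and \<open>b\<close> are exchanged on the kernel, which is why
  both orders have to be carried along a resolution.
\<close>

lemma exact_pair_step:
  assumes M: "left_module A M" and N: "left_module A N" and f: "f \<in> mod_hom A M N"
    and a: "a \<in> carrier A" and b: "b \<in> carrier A" and ba: "b \<otimes>\<^bsub>A\<^esub> a = \<zero>\<^bsub>A\<^esub>"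
    and M_exact: "exact_pair a b M (carrier M)" and K: "exact_pair b a M (a_kernel M N f)"
  shows "exact_pair a b N (f ` carrier M)"
  unfolding exact_pair_def
proof (intro ballI impI)
  interpret M: left_module A M by (rule M)
  interpret N: left_module A N by (rule N)
  fix n assume "n \<in> f ` carrier M" and an: "a \<odot>\<^bsub>N\<^esub> n = \<zero>\<^bsub>N\<^esub>"
  then obtain m where m: "m \<in> carrier M" "n = f m" by blast
  have am: "a \<odot>\<^bsub>M\<^esub> m \<in> a_kernel M N f"
    using an m mod_hom_smult[OF f a m(1)] M.smult_closed[OF a m(1)] by (simp add: a_kernel_eq)
  moreover have "b \<odot>\<^bsub>M\<^esub> (a \<odot>\<^bsub>M\<^esub> m) = \<zero>\<^bsub>M\<^esub>"
    using M.smult_assoc[OF b a m(1)] ba M.smult_l_zero[OF m(1)] by simp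
  ultimately obtain k where k: "k \<in> carrier M" "f k = \<zero>\<^bsub>N\<^esub>" "a \<odot>\<^bsub>M\<^esub> m = a \<odot>\<^bsub>M\<^esub> k"
    using K unfolding exact_pair_def a_kernel_eq by blast
  have mk: "m \<ominus>\<^bsub>M\<^esub> k \<in> carrier M" using m k by simp
  have "a \<odot>\<^bsub>M\<^esub> (m \<ominus>\<^bsub>M\<^esub> k) = \<zero>\<^bsub>M\<^esub>"
    using m(1) k(1) a M.smult_closed by (simp add: a_minus_def M.smult_r_distr M.smult_r_minus k(3) M.M.r_neg)
  then obtain p where p: "p \<in> carrier M" "m \<ominus>\<^bsub>M\<^esub> k = b \<odot>\<^bsub>M\<^esub> p"
    using M_exact mk unfolding exact_pair_def by blast
  have z: "\<ominus>\<^bsub>N\<^esub> \<zero>\<^bsub>N\<^esub> = \<zero>\<^bsub>N\<^esub>" by (rule N.M.minus_equality) simp_all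
  have "n = f (m \<ominus>\<^bsub>M\<^esub> k)"
    using mod_hom_diff[OF M.M.abelian_group_axioms N.M.abelian_group_axioms f m(1) k(1)] k(2) m
      mod_hom_closed[OF f m(1)] by (simp add: a_minus_def z)
  also have "\<dots> = b \<odot>\<^bsub>N\<^esub> f p" unfolding p(2) by (rule mod_hom_smult[OF f b p(1)])
  finally show "\<exists>m'\<in>f ` carrier M. n = b \<odot>\<^bsub>N\<^esub> m'" using p(1) by blast
qed

context ring
begin

text \<open>
  The relation \<open>a \<cdot> m = 0\<close> has a single coefficient. The criterion gives \<open>m = \<Sum>j. c j \<cdot> n j\<close> with \<open>a c j = 0\<close>, so that each \<open>c j\<close> is a multiple of
  \<open>b\<close>.
\<close>

lemma exact_pair_flat:
  assumes M: "equationally_flat R M" and a: "a \<in> carrier R" and b: "b \<in> carrier R"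
    and ann: "\<And>c. c \<in> carrier R \<Longrightarrow> a \<otimes> c = \<zero> \<Longrightarrow> \<exists>c'\<in>carrier R. c = b \<otimes> c'"
  shows "exact_pair a b M (carrier M)"
  unfolding exact_pair_def
proof (intro ballI impI)
  note MM = equationally_flat_left_module[OF M]
  interpret M: left_module R M by (rule MM)
  fix m assume m: "m \<in> carrier M" and am: "a \<odot>\<^bsub>M\<^esub> m = \<zero>\<^bsub>M\<^esub>"
  let ?F = "free_mod R {0::nat}" and ?e = "free_basis R (0::nat)"
  interpret F: left_module R ?F by (rule left_module_free_mod)
  have w: "(\<lambda>i. m) \<in> {0::nat} \<rightarrow> carrier M" using m by simp
  let ?\<phi> = "free_ext R M (\<lambda>i::nat. m)"
  have \<phi>: "?\<phi> \<in> mod_hom R ?F M" by (rule free_ext_hom[OF MM w])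
  have e: "?e \<in> carrier ?F" by (simp add: free_basis_closed)
  have \<phi>e: "?\<phi> ?e = m" using free_ext_basis[OF MM w] by simp
  have "?\<phi> (a \<odot>\<^bsub>?F\<^esub> ?e) = \<zero>\<^bsub>M\<^esub>" unfolding mod_hom_smult[OF \<phi> a e] \<phi>e am ..
  from equationally_flatD[OF M _ \<phi> F.smult_closed[OF a e] this]
  obtain J \<psi> \<chi> where J: "finite (J::nat set)" and \<psi>: "\<psi> \<in> mod_hom R ?F (free_mod R J)"
    and \<chi>: "\<chi> \<in> mod_hom R (free_mod R J) M" and eq: "\<And>v. v \<in> carrier ?F \<Longrightarrow> \<chi> (\<psi> v) = ?\<phi> v"
    and kill: "\<psi> (a \<odot>\<^bsub>?F\<^esub> ?e) = (\<lambda>x. \<zero>)"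
    by (auto elim: factors_killingE)
  define c where "c = \<psi> ?e"
  have c: "c \<in> carrier (free_mod R J)" unfolding c_def by (rule mod_hom_closed[OF \<psi> e])
  have "a \<otimes> c i = \<zero>" for i using kill mod_hom_smult[OF \<psi> a e] by (simp add: c_def fun_eq_iff)
  hence "\<exists>c'\<in>carrier R. c i = b \<otimes> c'" for i using ann c by (simp add: free_mod_carrier)
  then obtain g where g: "\<And>i. g i \<in> carrier R" "\<And>i. c i = b \<otimes> g i" by metis
  define c' where "c' = (\<lambda>i. if c i = \<zero> then \<zero> else g i)"
  have "{i. c' i \<noteq> \<zero>} \<subseteq> {i. c i \<noteq> \<zero>}" by (auto simp: c'_def)
  with c have c': "c' \<in> carrier (free_mod R J)" using g unfolding free_mod_carrier
    by (auto simp: c'_def elim: finite_subset)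
  have "c = b \<odot>\<^bsub>free_mod R J\<^esub> c'"
  proof
    fix i show "c i = (b \<odot>\<^bsub>free_mod R J\<^esub> c') i"
    proof (cases "c i = \<zero>")
      case True thus ?thesis using b by (simp add: c'_def)
    next
      case False thus ?thesis using g(2)[of i] by (simp add: c'_def)
    qed
  qed
  hence "m = b \<odot>\<^bsub>M\<^esub> \<chi> c'"
    using eq[OF e] \<phi>e mod_hom_smult[OF \<chi> b c'] by (simp add: c_def del: free_mod_simps)
  thus "\<exists>m'\<in>carrier M. m = b \<odot>\<^bsub>M\<^esub> m'" using mod_hom_closed[OF \<chi> c'] by blast
qed

text \<open>
  Exactness passes from flat modules to all syzygies of a finite flat resolution by descending
  induction, starting from the zero module, and finally to \<open>M\<close>. This replaces the periodicity of \<open>Tor\<close> over a finite cyclic group.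
\<close>

theorem exact_pair_of_finite_flat_dim:
  assumes P: "resolution R M P d e" and flat: "\<And>i. equationally_flat R (P i)" and n: "vanishes_above n P"
    and a: "a \<in> carrier R" and b: "b \<in> carrier R" and ab: "a \<otimes> b = \<zero>" and ba: "b \<otimes> a = \<zero>"
    and ann_a: "\<And>c. c \<in> carrier R \<Longrightarrow> a \<otimes> c = \<zero> \<Longrightarrow> \<exists>c'\<in>carrier R. c = b \<otimes> c'"
    and ann_b: "\<And>c. c \<in> carrier R \<Longrightarrow> b \<otimes> c = \<zero> \<Longrightarrow> \<exists>c'\<in>carrier R. c = a \<otimes> c'"
  shows "exact_pair a b M (carrier M)"
proof -
  note r = resolutionD[OF P]
  have exP: "exact_pair a b (P i) (carrier (P i))" "exact_pair b a (P i) (carrier (P i))" for i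
    by (rule exact_pair_flat[OF flat a b ann_a], assumption+) (rule exact_pair_flat[OF flat b a ann_b], assumption+)
  have "exact_pair a b (P i) (d i ` carrier (P (Suc i))) \<and> exact_pair b a (P i) (d i ` carrier (P (Suc i)))"
    if "k + i = n" for i k
    using that
  proof (induction k arbitrary: i)
    case 0
    interpret Pi: left_module R "P i" by (rule r(2))
    have "carrier (P (Suc i)) = {\<zero>\<^bsub>P (Suc i)\<^esub>}" using n 0 by (simp add: vanishes_above_def)
    hence im: "d i ` carrier (P (Suc i)) = {\<zero>\<^bsub>P i\<^esub>}"
      using mod_hom_zero[OF left_module_abelian[OF r(2)] left_module_abelian[OF r(2)] r(4)] by simp
    show ?case unfolding im exact_pair_def using a b by (simp add: Pi.smult_r_zero)
  next
    case (Suc k)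
    hence IH: "exact_pair a b (P (Suc i)) (a_kernel (P (Suc i)) (P i) (d i))"
      "exact_pair b a (P (Suc i)) (a_kernel (P (Suc i)) (P i) (d i))"
      using Suc.IH[of "Suc i"] unfolding r(7) by simp_all
    show ?case
      using exact_pair_step[OF r(2) r(2) r(4) a b ba exP(1) IH(2)] exact_pair_step[OF r(2) r(2) r(4) b a ab exP(2) IH(1)] by blast
  qed
  from this[of n 0] have "exact_pair b a (P 0) (a_kernel (P 0) M e)" unfolding r(6) by simp
  from exact_pair_step[OF r(2) r(1) r(3) a b ba exP(1) this] show ?thesis unfolding r(5) .
qed

end

section \<open>Group rings\<close>

text \<open>
  The element \<open>r g\<close> of the group ring.
\<close>

definition grmono :: "('r, 'c) ring_scheme \<Rightarrow> 'r \<Rightarrow> 'g \<Rightarrow> 'g \<Rightarrow> 'r"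
  where "grmono R r g = (\<lambda>h. if h = g then r else \<zero>\<^bsub>R\<^esub>)"

definition augmentation :: "('r, 'c) ring_scheme \<Rightarrow> ('g \<Rightarrow> 'r) \<Rightarrow> 'r"
  where "augmentation R f = (\<Oplus>\<^bsub>R\<^esub>x\<in>supp R f. f x)"

lemma group_ring_simps:
  "f \<oplus>\<^bsub>group_ring R G\<^esub> g = (\<lambda>x. f x \<oplus>\<^bsub>R\<^esub> g x)"
  "\<zero>\<^bsub>group_ring R G\<^esub> = (\<lambda>x. \<zero>\<^bsub>R\<^esub>)"
  "\<one>\<^bsub>group_ring R G\<^esub> = grmono R \<one>\<^bsub>R\<^esub> \<one>\<^bsub>G\<^esub>"
  by (simp_all add: group_ring_def grmono_def)

lemma group_ring_carrier:
  "f \<in> carrier (group_ring R G) \<longleftrightarrow> (\<forall>x. f x \<in> carrier R) \<and> supp R f \<subseteq> carrier G \<and> finite (supp R f)"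
  by (simp add: group_ring_def)

lemma group_ring_carrier_free: "carrier (group_ring R G) = carrier (free_mod R (carrier G))"
  by (auto simp: group_ring_carrier free_mod_carrier supp_def)

lemma group_ring_mult:
  "(f \<otimes>\<^bsub>group_ring R G\<^esub> g) x = (\<Oplus>\<^bsub>R\<^esub>p\<in>{(y, z). y \<in> supp R f \<and> z \<in> supp R g \<and> y \<otimes>\<^bsub>G\<^esub> z = x}.
                       f (fst p) \<otimes>\<^bsub>R\<^esub> g (snd p))"
  by (simp add: group_ring_def)

locale group_and_ring = G: group G + R: cring R
  for G :: "('g, 'd) monoid_scheme" and R :: "('r, 'c) ring_scheme"
begin

abbreviation "A \<equiv> group_ring R G"

lemma mono_closed: "r \<in> carrier R \<Longrightarrow> g \<in> carrier G \<Longrightarrow> grmono R r g \<in> carrier A"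
  by (auto simp: group_ring_carrier grmono_def supp_def)

text \<open>
  The group ring is free over \<open>R\<close> on the group, so induction on free modules applies.
\<close>

lemma A_induct [consumes 1, case_names zero add mono]:
  assumes "f \<in> carrier A" and "P (\<lambda>x. \<zero>\<^bsub>R\<^esub>)"
    and "\<And>f g. f \<in> carrier A \<Longrightarrow> g \<in> carrier A \<Longrightarrow> P f \<Longrightarrow> P g \<Longrightarrow> P (f \<oplus>\<^bsub>A\<^esub> g)"
    and "\<And>r g. r \<in> carrier R \<Longrightarrow> g \<in> carrier G \<Longrightarrow> P (grmono R r g)"
  shows "P f"
  using assms(1) unfolding group_ring_carrier_free
proof (induction f rule: R.free_mod_induct)
  case (basis a x)
  have "a \<odot>\<^bsub>free_mod R (carrier G)\<^esub> free_basis R x = grmono R a x"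
    using basis by (simp add: R.smult_free_basis grmono_def del: free_mod_simps)
  thus ?case using assms(4)[OF basis] by simp
qed (use assms in \<open>auto simp: group_ring_carrier_free group_ring_simps\<close>)

text \<open>
  The supports occurring in the product vary with the factors. Enlarging them to fixed finite sets is what
  makes distributivity and associativity accessible.
\<close>

lemma mult_superset:
  assumes "f \<in> carrier A" "g \<in> carrier A" "finite S" "supp R f \<subseteq> S" "finite T" "supp R g \<subseteq> T"
  shows "(f \<otimes>\<^bsub>A\<^esub> g) x = (\<Oplus>\<^bsub>R\<^esub>p\<in>{p \<in> S \<times> T. fst p \<otimes>\<^bsub>G\<^esub> snd p = x}. f (fst p) \<otimes>\<^bsub>R\<^esub> g (snd p))"
  unfolding group_ring_mult
proof (rule R.add.finprod_mono_neutral_cong_left)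
  show "finite {p \<in> S \<times> T. fst p \<otimes>\<^bsub>G\<^esub> snd p = x}" using assms(3,5) by simp
  show "{(y, z). y \<in> supp R f \<and> z \<in> supp R g \<and> y \<otimes>\<^bsub>G\<^esub> z = x} \<subseteq> {p \<in> S \<times> T. fst p \<otimes>\<^bsub>G\<^esub> snd p = x}"
    using assms by auto
  have cl: "f y \<in> carrier R" "g y \<in> carrier R" for y using assms(1,2) by (auto simp: group_ring_carrier)
  show "f (fst p) \<otimes>\<^bsub>R\<^esub> g (snd p) = \<zero>\<^bsub>R\<^esub>"
    if "p \<in> {p \<in> S \<times> T. fst p \<otimes>\<^bsub>G\<^esub> snd p = x} - {(y, z). y \<in> supp R f \<and> z \<in> supp R g \<and> y \<otimes>\<^bsub>G\<^esub> z = x}" for p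
  proof -
    have "f (fst p) = \<zero>\<^bsub>R\<^esub> \<or> g (snd p) = \<zero>\<^bsub>R\<^esub>" using that by (auto simp: supp_def)
    thus ?thesis using cl by auto
  qed
  show "(\<lambda>p. f (fst p) \<otimes>\<^bsub>R\<^esub> g (snd p)) \<in> {p \<in> S \<times> T. fst p \<otimes>\<^bsub>G\<^esub> snd p = x} \<rightarrow> carrier R"
    using cl by auto
qed simp

lemma mult_closed:
  assumes f: "f \<in> carrier A" and g: "g \<in> carrier A" shows "f \<otimes>\<^bsub>A\<^esub> g \<in> carrier A"
proof -
  have cl: "f y \<in> carrier R" "g y \<in> carrier R" for y using f g by (auto simp: group_ring_carrier)
  have fin: "finite (supp R f)" "finite (supp R g)" and sub: "supp R f \<subseteq> carrier G" "supp R g \<subseteq> carrier G"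
    using f g by (auto simp: group_ring_carrier)
  have "supp R (f \<otimes>\<^bsub>A\<^esub> g) \<subseteq> (\<lambda>p. fst p \<otimes>\<^bsub>G\<^esub> snd p) ` (supp R f \<times> supp R g)"
  proof
    fix x assume x: "x \<in> supp R (f \<otimes>\<^bsub>A\<^esub> g)"
    show "x \<in> (\<lambda>p. fst p \<otimes>\<^bsub>G\<^esub> snd p) ` (supp R f \<times> supp R g)"
    proof (rule ccontr)
      assume "x \<notin> (\<lambda>p. fst p \<otimes>\<^bsub>G\<^esub> snd p) ` (supp R f \<times> supp R g)"
      hence e: "{(y, z). y \<in> supp R f \<and> z \<in> supp R g \<and> y \<otimes>\<^bsub>G\<^esub> z = x} = {}" by force
      have "(f \<otimes>\<^bsub>A\<^esub> g) x = \<zero>\<^bsub>R\<^esub>" unfolding group_ring_mult e by (rule R.finsum_empty)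
      with x show False by (simp add: supp_def)
    qed
  qed
  moreover have "finite ((\<lambda>p. fst p \<otimes>\<^bsub>G\<^esub> snd p) ` (supp R f \<times> supp R g))" using fin by simp
  moreover have "(\<lambda>p. fst p \<otimes>\<^bsub>G\<^esub> snd p) ` (supp R f \<times> supp R g) \<subseteq> carrier G"
    using sub by (auto simp: subset_iff)
  moreover have "(f \<otimes>\<^bsub>A\<^esub> g) x \<in> carrier R" for x
    unfolding group_ring_mult using cl by (intro R.finsum_closed) auto
  ultimately show ?thesis unfolding group_ring_carrier using finite_subset by blast
qed

lemma mono_mult:
  assumes "r \<in> carrier R" "s \<in> carrier R" "g \<in> carrier G" "h \<in> carrier G"
  shows "grmono R r g \<otimes>\<^bsub>A\<^esub> grmono R s h = grmono R (r \<otimes>\<^bsub>R\<^esub> s) (g \<otimes>\<^bsub>G\<^esub> h)"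
proof
  fix x
  have 0: "supp R (grmono R r g) \<subseteq> {g}" "supp R (grmono R s h) \<subseteq> {h}" by (auto simp: supp_def grmono_def)
  have "(grmono R r g \<otimes>\<^bsub>A\<^esub> grmono R s h) x =
    (\<Oplus>\<^bsub>R\<^esub>p\<in>{p \<in> {g} \<times> {h}. fst p \<otimes>\<^bsub>G\<^esub> snd p = x}. grmono R r g (fst p) \<otimes>\<^bsub>R\<^esub> grmono R s h (snd p))"
    by (rule mult_superset[OF mono_closed mono_closed _ 0(1) _ 0(2)]) (use assms in auto)
  also have "{p \<in> {g} \<times> {h}. fst p \<otimes>\<^bsub>G\<^esub> snd p = x} = (if g \<otimes>\<^bsub>G\<^esub> h = x then {(g, h)} else {})" by auto
  finally show "(grmono R r g \<otimes>\<^bsub>A\<^esub> grmono R s h) x = grmono R (r \<otimes>\<^bsub>R\<^esub> s) (g \<otimes>\<^bsub>G\<^esub> h) x"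
    using assms by (auto simp: grmono_def)
qed

lemma A_add_closed: "f \<in> carrier A \<Longrightarrow> g \<in> carrier A \<Longrightarrow> f \<oplus>\<^bsub>A\<^esub> g \<in> carrier A"
  using abelian_monoid.a_closed[OF abelian_group.axioms(1)[OF R.abelian_group_free_mod[of "carrier G"]], of f g]
  by (simp add: group_ring_carrier_free group_ring_simps)

lemma A_l_distr:
  assumes f: "f \<in> carrier A" and g: "g \<in> carrier A" and h: "h \<in> carrier A"
  shows "(f \<oplus>\<^bsub>A\<^esub> g) \<otimes>\<^bsub>A\<^esub> h = f \<otimes>\<^bsub>A\<^esub> h \<oplus>\<^bsub>A\<^esub> g \<otimes>\<^bsub>A\<^esub> h"
proof
  fix x
  let ?S = "supp R f \<union> supp R g" and ?T = "supp R h"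
  let ?I = "{p \<in> ?S \<times> ?T. fst p \<otimes>\<^bsub>G\<^esub> snd p = x}"
  have fin: "finite ?S" "finite ?T" using f g h by (auto simp: group_ring_carrier)
  have cl: "f y \<in> carrier R" "g y \<in> carrier R" "h y \<in> carrier R" for y using f g h by (auto simp: group_ring_carrier)
  have sub: "supp R (f \<oplus>\<^bsub>A\<^esub> g) \<subseteq> ?S" by (auto simp: supp_def group_ring_simps)
  have "((f \<oplus>\<^bsub>A\<^esub> g) \<otimes>\<^bsub>A\<^esub> h) x = (\<Oplus>\<^bsub>R\<^esub>p\<in>?I. f (fst p) \<otimes>\<^bsub>R\<^esub> h (snd p) \<oplus>\<^bsub>R\<^esub> g (fst p) \<otimes>\<^bsub>R\<^esub> h (snd p))"
    unfolding mult_superset[OF A_add_closed[OF f g] h fin(1) sub fin(2) subset_refl]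
    using cl by (intro R.finsum_cong') (auto simp: group_ring_simps R.l_distr)
  also have "\<dots> = (f \<otimes>\<^bsub>A\<^esub> h \<oplus>\<^bsub>A\<^esub> g \<otimes>\<^bsub>A\<^esub> h) x"
    unfolding group_ring_simps mult_superset[OF f h fin(1) Un_upper1 fin(2) subset_refl]
      mult_superset[OF g h fin(1) Un_upper2 fin(2) subset_refl]
    using cl by (intro R.finsum_addf) auto
  finally show "((f \<oplus>\<^bsub>A\<^esub> g) \<otimes>\<^bsub>A\<^esub> h) x = (f \<otimes>\<^bsub>A\<^esub> h \<oplus>\<^bsub>A\<^esub> g \<otimes>\<^bsub>A\<^esub> h) x" .
qed

lemma A_r_distr:
  assumes f: "f \<in> carrier A" and g: "g \<in> carrier A" and h: "h \<in> carrier A"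
  shows "h \<otimes>\<^bsub>A\<^esub> (f \<oplus>\<^bsub>A\<^esub> g) = h \<otimes>\<^bsub>A\<^esub> f \<oplus>\<^bsub>A\<^esub> h \<otimes>\<^bsub>A\<^esub> g"
proof
  fix x
  let ?S = "supp R f \<union> supp R g" and ?T = "supp R h"
  let ?I = "{p \<in> ?T \<times> ?S. fst p \<otimes>\<^bsub>G\<^esub> snd p = x}"
  have fin: "finite ?S" "finite ?T" using f g h by (auto simp: group_ring_carrier)
  have cl: "f y \<in> carrier R" "g y \<in> carrier R" "h y \<in> carrier R" for y using f g h by (auto simp: group_ring_carrier)
  have sub: "supp R (f \<oplus>\<^bsub>A\<^esub> g) \<subseteq> ?S" by (auto simp: supp_def group_ring_simps)
  have "(h \<otimes>\<^bsub>A\<^esub> (f \<oplus>\<^bsub>A\<^esub> g)) x = (\<Oplus>\<^bsub>R\<^esub>p\<in>?I. h (fst p) \<otimes>\<^bsub>R\<^esub> f (snd p) \<oplus>\<^bsub>R\<^esub> h (fst p) \<otimes>\<^bsub>R\<^esub> g (snd p))"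
    unfolding mult_superset[OF h A_add_closed[OF f g] fin(2) subset_refl fin(1) sub]
    using cl by (intro R.finsum_cong') (auto simp: group_ring_simps R.r_distr)
  also have "\<dots> = (h \<otimes>\<^bsub>A\<^esub> f \<oplus>\<^bsub>A\<^esub> h \<otimes>\<^bsub>A\<^esub> g) x"
    unfolding group_ring_simps mult_superset[OF h f fin(2) subset_refl fin(1) Un_upper1]
      mult_superset[OF h g fin(2) subset_refl fin(1) Un_upper2]
    using cl by (intro R.finsum_addf) auto
  finally show "(h \<otimes>\<^bsub>A\<^esub> (f \<oplus>\<^bsub>A\<^esub> g)) x = (h \<otimes>\<^bsub>A\<^esub> f \<oplus>\<^bsub>A\<^esub> h \<otimes>\<^bsub>A\<^esub> g) x" .
qed

lemma A_zero_mult: "(\<lambda>x. \<zero>\<^bsub>R\<^esub>) \<otimes>\<^bsub>A\<^esub> f = (\<lambda>x. \<zero>\<^bsub>R\<^esub>)" "f \<otimes>\<^bsub>A\<^esub> (\<lambda>x. \<zero>\<^bsub>R\<^esub>) = (\<lambda>x. \<zero>\<^bsub>R\<^esub>)"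
  by (auto simp: fun_eq_iff group_ring_mult supp_def)

lemma A_assoc:
  assumes f: "f \<in> carrier A" and g: "g \<in> carrier A" and h: "h \<in> carrier A"
  shows "f \<otimes>\<^bsub>A\<^esub> g \<otimes>\<^bsub>A\<^esub> h = f \<otimes>\<^bsub>A\<^esub> (g \<otimes>\<^bsub>A\<^esub> h)"
  using f
proof (induction f rule: A_induct)
  case zero
  show ?case by (simp add: A_zero_mult)
next
  case (add f f')
  thus ?case using g h by (simp add: A_l_distr mult_closed del: group_ring_simps)
next
  case f: (mono r x)
  note fm = mono_closed[OF f]
  show ?case
    using g
  proof (induction g rule: A_induct)
    case zero
    show ?case by (simp add: A_zero_mult)
  next
    case (add g g')
    thus ?case using fm h by (simp add: A_l_distr A_r_distr mult_closed)
  next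
    case g: (mono s y)
    note gm = mono_closed[OF g]
    show ?case
      using h
    proof (induction h rule: A_induct)
      case zero
      show ?case by (simp add: A_zero_mult)
    next
      case (add h h')
      thus ?case using fm gm by (simp add: A_r_distr mult_closed)
    next
      case (mono t z)
      thus ?case using f g by (simp add: mono_mult R.m_assoc G.m_assoc)
    qed
  qed
qed

lemma A_one: 
  assumes f: "f \<in> carrier A"
  shows "\<one>\<^bsub>A\<^esub> \<otimes>\<^bsub>A\<^esub> f = f" "f \<otimes>\<^bsub>A\<^esub> \<one>\<^bsub>A\<^esub> = f"
proof -
  have 1: "grmono R \<one>\<^bsub>R\<^esub> \<one>\<^bsub>G\<^esub> \<in> carrier A" by (rule mono_closed) auto
  have "grmono R \<one>\<^bsub>R\<^esub> \<one>\<^bsub>G\<^esub> \<otimes>\<^bsub>A\<^esub> f = f \<and> f \<otimes>\<^bsub>A\<^esub> grmono R \<one>\<^bsub>R\<^esub> \<one>\<^bsub>G\<^esub> = f"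
    using f
  proof (induction f rule: A_induct)
    case (add f g)
    thus ?case using 1 by (simp add: A_l_distr A_r_distr)
  qed (auto simp: A_zero_mult mono_mult)
  thus "\<one>\<^bsub>A\<^esub> \<otimes>\<^bsub>A\<^esub> f = f" "f \<otimes>\<^bsub>A\<^esub> \<one>\<^bsub>A\<^esub> = f" by (simp_all add: group_ring_simps)
qed

lemma abelian_group_A: "abelian_group A"
proof -
  interpret F: abelian_group "free_mod R (carrier G)" by (rule R.abelian_group_free_mod)
  show ?thesis
  proof (rule abelian_groupI, goal_cases)
    case (1 x y)
    show ?case by (rule A_add_closed[OF 1])
  next
    case 2
    show ?case using F.zero_closed by (simp add: group_ring_carrier_free group_ring_simps)
  next
    case (6 x)
    thus ?case using F.add.l_inv_ex[of x] by (auto simp: group_ring_carrier_free group_ring_simps)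
  qed (auto simp: group_ring_simps group_ring_carrier R.a_ac)
qed

sublocale A: ring A
proof (rule ringI)
  show "abelian_group A" by (rule abelian_group_A)
  show "monoid A"
    by (rule monoidI) (auto simp: mult_closed A_assoc A_one, simp add: group_ring_simps mono_closed)
qed (auto simp: A_l_distr A_r_distr)

lemma A_minus: "f \<in> carrier A \<Longrightarrow> \<ominus>\<^bsub>A\<^esub> f = (\<lambda>x. \<ominus>\<^bsub>R\<^esub> f x)"
proof -
  assume f: "f \<in> carrier A"
  interpret F: abelian_group "free_mod R (carrier G)" by (rule R.abelian_group_free_mod)
  have "\<ominus>\<^bsub>free_mod R (carrier G)\<^esub> f \<in> carrier A" using f by (simp add: group_ring_carrier_free)
  hence m: "(\<lambda>x. \<ominus>\<^bsub>R\<^esub> f x) \<in> carrier A" using R.free_mod_minus[of f "carrier G"] f by (simp add: group_ring_carrier_free)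
  show ?thesis
    by (rule A.minus_equality) (use f m in \<open>auto simp: group_ring_simps group_ring_carrier R.l_neg\<close>)
qed

lemma A_diff: "f \<in> carrier A \<Longrightarrow> g \<in> carrier A \<Longrightarrow> f \<ominus>\<^bsub>A\<^esub> g = (\<lambda>x. f x \<ominus>\<^bsub>R\<^esub> g x)"
  by (simp add: a_minus_def A_minus group_ring_simps)

lemma mono_left_mult:
  assumes "r \<in> carrier R" "a \<in> carrier A"
  shows "grmono R r \<one>\<^bsub>G\<^esub> \<otimes>\<^bsub>A\<^esub> a = (\<lambda>h. r \<otimes>\<^bsub>R\<^esub> a h)"
  using assms(2)
proof (induction a rule: A_induct)
  case zero
  thus ?case using assms(1) by (simp add: A_zero_mult)
next
  case (add f g)
  thus ?case using assms(1) mono_closed[of r "\<one>\<^bsub>G\<^esub>"]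
    by (simp add: A_r_distr) (simp add: group_ring_simps group_ring_carrier R.r_distr)
next
  case (mono s g)
  thus ?case using assms(1) by (simp add: mono_mult) (auto simp: grmono_def)
qed

lemma augmentation_superset:
  assumes "f \<in> carrier A" "finite S" "supp R f \<subseteq> S"
  shows "augmentation R f = (\<Oplus>\<^bsub>R\<^esub>x\<in>S. f x)"
  unfolding augmentation_def using assms
  by (intro R.add.finprod_mono_neutral_cong_left) (auto simp: group_ring_carrier supp_def)

lemma augmentation_closed: "f \<in> carrier A \<Longrightarrow> augmentation R f \<in> carrier R"
  unfolding augmentation_def by (intro R.finsum_closed) (auto simp: group_ring_carrier)

lemma augmentation_add:
  assumes f: "f \<in> carrier A" and g: "g \<in> carrier A"
  shows "augmentation R (f \<oplus>\<^bsub>A\<^esub> g) = augmentation R f \<oplus>\<^bsub>R\<^esub> augmentation R g"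
proof -
  let ?S = "supp R f \<union> supp R g"
  have fin: "finite ?S" using f g by (auto simp: group_ring_carrier)
  have sub: "supp R (f \<oplus>\<^bsub>A\<^esub> g) \<subseteq> ?S" by (auto simp: supp_def group_ring_simps)
  show ?thesis
    unfolding augmentation_superset[OF A_add_closed[OF f g] fin sub]
      augmentation_superset[OF f fin Un_upper1] augmentation_superset[OF g fin Un_upper2]
    using f g by (simp add: group_ring_simps group_ring_carrier)
qed

lemma augmentation_mono: "r \<in> carrier R \<Longrightarrow> g \<in> carrier G \<Longrightarrow> augmentation R (grmono R r g) = r"
proof -
  assume rg: "r \<in> carrier R" "g \<in> carrier G"
  have "supp R (grmono R r g) \<subseteq> {g}" by (auto simp: supp_def grmono_def)
  hence "augmentation R (grmono R r g) = (\<Oplus>\<^bsub>R\<^esub>x\<in>{g}. grmono R r g x)"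
    by (intro augmentation_superset[OF mono_closed[OF rg]]) auto
  also have "\<dots> = r" using rg by (simp add: grmono_def)
  finally show ?thesis .
qed

lemma augmentation_zero: "augmentation R (\<lambda>x. \<zero>\<^bsub>R\<^esub>) = \<zero>\<^bsub>R\<^esub>"
  by (simp add: augmentation_def supp_def)

lemma augmentation_mult:
  assumes f: "f \<in> carrier A" and g: "g \<in> carrier A"
  shows "augmentation R (f \<otimes>\<^bsub>A\<^esub> g) = augmentation R f \<otimes>\<^bsub>R\<^esub> augmentation R g"
  using f
proof (induction f rule: A_induct)
  case zero
  thus ?case using g augmentation_closed by (simp add: A_zero_mult augmentation_zero)
next
  case (add f f')
  thus ?case using g augmentation_closed by (simp add: A_l_distr augmentation_add mult_closed R.l_distr)
next
  case f: (mono r x)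
  note fm = mono_closed[OF f]
  show ?case
    using g
  proof (induction g rule: A_induct)
    case zero
    thus ?case using fm augmentation_closed by (simp add: A_zero_mult augmentation_zero)
  next
    case (add g g')
    thus ?case using fm augmentation_closed by (simp add: A_r_distr augmentation_add mult_closed R.r_distr)
  next
    case (mono s y)
    thus ?case using f by (simp add: mono_mult augmentation_mono)
  qed
qed

lemma trivial_module_simps [simp]:
  "carrier (trivial_module R) = carrier R"
  "x \<oplus>\<^bsub>trivial_module R\<^esub> y = x \<oplus>\<^bsub>R\<^esub> y"
  "\<zero>\<^bsub>trivial_module R\<^esub> = \<zero>\<^bsub>R\<^esub>"
  "f \<odot>\<^bsub>trivial_module R\<^esub> x = augmentation R f \<otimes>\<^bsub>R\<^esub> x"
  by (simp_all add: trivial_module_def augmentation_def)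

lemma left_module_trivial: "left_module A (trivial_module R)"
proof (rule left_moduleI)
  show "ring A" by (rule A.ring_axioms)
  show "abelian_group (trivial_module R)"
  proof (rule abelian_groupI, goal_cases)
    case (6 x)
    thus ?case by (intro bexI[of _ "\<ominus>\<^bsub>R\<^esub> x"]) (auto simp: R.l_neg)
  qed (auto simp: R.a_ac)
qed (auto simp: augmentation_closed augmentation_add augmentation_mult R.l_distr R.r_distr R.m_assoc
    group_ring_simps(3) augmentation_mono)

end

lemma group_ring_subgroup_mult:
  "f \<otimes>\<^bsub>group_ring R (G\<lparr>carrier := H\<rparr>)\<^esub> g = f \<otimes>\<^bsub>group_ring R G\<^esub> g"
  by (simp add: fun_eq_iff group_ring_mult)

lemma group_ring_subgroup_carrier:
  "H \<subseteq> carrier G \<Longrightarrow> carrier (group_ring R (G\<lparr>carrier := H\<rparr>)) \<subseteq> carrier (group_ring R G)"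
  unfolding subset_iff by (simp add: group_ring_carrier subset_iff)

section \<open>The bar resolution\<close>

definition bar_set :: "('g, 'd) monoid_scheme \<Rightarrow> nat \<Rightarrow> 'g list set"
  where "bar_set G n = {l. length l = n \<and> set l \<subseteq> carrier G}"

definition bar_mod ::
    "('r, 'c) ring_scheme \<Rightarrow> ('g, 'd) monoid_scheme \<Rightarrow> nat \<Rightarrow> ('g \<Rightarrow> 'r, 'g list \<Rightarrow> 'g \<Rightarrow> 'r) module"
  where "bar_mod R G n = free_mod (group_ring R G) (bar_set G n)"

text \<open>
  The contracting homotopy \<open>r g [x] \<mapsto> r [g, x]\<close>, which is additive but not linear over the group ring.
\<close>

definition bar_shift ::
    "('r, 'c) ring_scheme \<Rightarrow> ('g, 'd) monoid_scheme \<Rightarrow> ('g list \<Rightarrow> 'g \<Rightarrow> 'r) \<Rightarrow> 'g list \<Rightarrow> 'g \<Rightarrow> 'r"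
  where "bar_shift R G f = (\<lambda>l. case l of [] \<Rightarrow> (\<lambda>h. \<zero>\<^bsub>R\<^esub>) | g # x \<Rightarrow> grmono R (f x g) \<one>\<^bsub>G\<^esub>)"

text \<open>
  The value of the differential on the basis element of a list. The identity \<open>d \<sigma> + \<sigma> d = id\<close> forces
  \<open>d [g, x] = g [x] - \<sigma> (g \<cdot> d [x])\<close>; taking this as a recursion avoids the alternating sum of faces. In degree one the
  homotopy starts with \<open>r \<mapsto> r []\<close>, so the last term is \<open>[]\<close>. The group enters only through its multiplication and
  unit, so a subgroup has the same differential.
\<close>

primrec bar_value ::
    "('r, 'c) ring_scheme \<Rightarrow> ('g, 'd) monoid_scheme \<Rightarrow> 'g list \<Rightarrow> 'g list \<Rightarrow> 'g \<Rightarrow> 'r"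
  where
    "bar_value R G [] = (\<lambda>l h. \<zero>\<^bsub>R\<^esub>)"
  | "bar_value R G (g # x) = (\<lambda>l h.
      (grmono R \<one>\<^bsub>R\<^esub> g \<otimes>\<^bsub>group_ring R G\<^esub> free_basis (group_ring R G) x l) h \<ominus>\<^bsub>R\<^esub>
      (if x = [] then free_basis (group_ring R G) []
       else bar_shift R G (\<lambda>l. grmono R \<one>\<^bsub>R\<^esub> g \<otimes>\<^bsub>group_ring R G\<^esub> bar_value R G x l)) l h)"

definition bar_d ::
    "('r, 'c) ring_scheme \<Rightarrow> ('g, 'd) monoid_scheme \<Rightarrow> nat \<Rightarrow> ('g list \<Rightarrow> 'g \<Rightarrow> 'r) \<Rightarrow> 'g list \<Rightarrow> 'g \<Rightarrow> 'r"
  where "bar_d R G n = free_ext (group_ring R G) (bar_mod R G n) (bar_value R G)"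

definition bar_e ::
    "('r, 'c) ring_scheme \<Rightarrow> ('g, 'd) monoid_scheme \<Rightarrow> ('g list \<Rightarrow> 'g \<Rightarrow> 'r) \<Rightarrow> 'r"
  where "bar_e R G = free_ext (group_ring R G) (trivial_module R) (\<lambda>x. \<one>\<^bsub>R\<^esub>)"

context group_and_ring
begin

abbreviation "F \<equiv> bar_mod R G"
abbreviation "\<sigma> \<equiv> bar_shift R G"
abbreviation "e \<equiv> free_basis A"

lemma F_left_module: "left_module A (F n)"
  unfolding bar_mod_def by (rule A.left_module_free_mod)

lemma F_simps:
  "f \<oplus>\<^bsub>F n\<^esub> g = (\<lambda>x h. f x h \<oplus>\<^bsub>R\<^esub> g x h)"
  "\<zero>\<^bsub>F n\<^esub> = (\<lambda>x h. \<zero>\<^bsub>R\<^esub>)"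
  "a \<odot>\<^bsub>F n\<^esub> f = (\<lambda>x. a \<otimes>\<^bsub>A\<^esub> f x)"
  by (simp_all add: bar_mod_def group_ring_simps)

lemma F_diff: "f \<in> carrier (F n) \<Longrightarrow> g \<in> carrier (F n) \<Longrightarrow> f \<ominus>\<^bsub>F n\<^esub> g = (\<lambda>x h. f x h \<ominus>\<^bsub>R\<^esub> g x h)"
  unfolding bar_mod_def by (subst A.free_mod_diff) (auto simp: free_mod_carrier A_diff)

lemma F_carrier: "f \<in> carrier (F n) \<longleftrightarrow>
    (\<forall>x. f x \<in> carrier A) \<and> finite {x. f x \<noteq> (\<lambda>h. \<zero>\<^bsub>R\<^esub>)} \<and> {x. f x \<noteq> (\<lambda>h. \<zero>\<^bsub>R\<^esub>)} \<subseteq> bar_set G n"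
  by (simp add: bar_mod_def free_mod_carrier group_ring_simps)

lemma e_closed: "x \<in> bar_set G n \<Longrightarrow> e x \<in> carrier (F n)"
  unfolding bar_mod_def by (rule A.free_basis_closed)

lemma mono_smult_basis:
  assumes "r \<in> carrier R" "g \<in> carrier G"
  shows "grmono R r g \<odot>\<^bsub>F n\<^esub> e x = (\<lambda>y. if y = x then grmono R r g else (\<lambda>h. \<zero>\<^bsub>R\<^esub>))"
  unfolding bar_mod_def by (subst A.smult_free_basis[OF mono_closed[OF assms]]) (auto simp: group_ring_simps fun_eq_iff)

text \<open>
  By additivity in the coefficients too, only multiples \<open>r g [x]\<close> remain to be considered.
\<close>

lemma free_A_induct [consumes 1, case_names zero add basis]:
  assumes f: "f \<in> carrier (free_mod A I)" and zero: "P (\<lambda>x h. \<zero>\<^bsub>R\<^esub>)"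
    and add: "\<And>f g. f \<in> carrier (free_mod A I) \<Longrightarrow> g \<in> carrier (free_mod A I) \<Longrightarrow> P f \<Longrightarrow> P g \<Longrightarrow>
      P (f \<oplus>\<^bsub>free_mod A I\<^esub> g)"
    and basis: "\<And>r g x. r \<in> carrier R \<Longrightarrow> g \<in> carrier G \<Longrightarrow> x \<in> I \<Longrightarrow> P (grmono R r g \<odot>\<^bsub>free_mod A I\<^esub> free_basis A x)"
  shows "P f"
proof -
  interpret F: left_module A "free_mod A I" by (rule A.left_module_free_mod)
  from f show ?thesis
  proof (induction f rule: A.free_mod_induct)
    case zero
    show ?case using assms(2) by (simp add: group_ring_simps)
  next
    case (add f g)
    thus ?case by (rule assms(3))
  next
    case (basis a x)
    note ex = A.free_basis_closed[OF basis(2)]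
    show ?case
      using basis(1)
    proof (induction a rule: A_induct)
      case zero
      have "(\<lambda>h. \<zero>\<^bsub>R\<^esub>) \<odot>\<^bsub>free_mod A I\<^esub> free_basis A x = (\<lambda>x h. \<zero>\<^bsub>R\<^esub>)"
        using F.smult_l_zero[OF ex] by (simp add: group_ring_simps)
      thus ?case using assms(2) by simp
    next
      case (add a b)
      show ?case unfolding F.smult_l_distr[OF add(1,2) ex]
        by (rule assms(3)[OF F.smult_closed[OF add(1) ex] F.smult_closed[OF add(2) ex] add(3,4)])
    next
      case (mono r g)
      show ?case by (rule assms(4)[OF mono basis(2)])
    qed
  qed
qed

lemmas F_induct [consumes 1, case_names zero add basis] = free_A_induct[of _ "bar_set G n" for n, folded bar_mod_def]

lemma one_closed: "grmono R \<one>\<^bsub>R\<^esub> g \<in> carrier A" if "g \<in> carrier G"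
  using that by (simp add: mono_closed)

lemma \<sigma>_closed:
  assumes f: "f \<in> carrier (F n)" shows "\<sigma> f \<in> carrier (F (Suc n))"
proof -
  note f' = f[unfolded F_carrier]
  have fA: "f x \<in> carrier A" for x using f' by simp
  have cl: "\<sigma> f l \<in> carrier A" for l
  proof (cases l)
    case Nil thus ?thesis using A.zero_closed by (simp add: bar_shift_def group_ring_simps)
  next
    case (Cons g x)
    have "f x g \<in> carrier R" using fA[of x] by (simp add: group_ring_carrier)
    thus ?thesis using Cons mono_closed[OF _ G.one_closed] by (simp add: bar_shift_def)
  qed
  have sub: "{l. \<sigma> f l \<noteq> (\<lambda>h. \<zero>\<^bsub>R\<^esub>)} \<subseteq> (\<lambda>(x, g). g # x) ` (SIGMA x:{x. f x \<noteq> (\<lambda>h. \<zero>\<^bsub>R\<^esub>)}. supp R (f x))" (is "_ \<subseteq> ?S")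
  proof
    fix l assume l: "l \<in> {l. \<sigma> f l \<noteq> (\<lambda>h. \<zero>\<^bsub>R\<^esub>)}"
    then obtain g x where gx: "l = g # x" by (cases l) (auto simp: bar_shift_def)
    have "f x g \<noteq> \<zero>\<^bsub>R\<^esub>" using l by (auto simp: gx bar_shift_def grmono_def split: if_splits)
    thus "l \<in> ?S" unfolding gx by (intro image_eqI[of _ _ "(x, g)"]) (auto simp: supp_def)
  qed
  have fin: "finite ?S" using f' fA by (intro finite_imageI finite_SigmaI) (auto simp: group_ring_carrier)
  have sub': "?S \<subseteq> bar_set G (Suc n)"
  proof
    fix l assume "l \<in> ?S"
    then obtain x g where l: "l = g # x" "f x \<noteq> (\<lambda>h. \<zero>\<^bsub>R\<^esub>)" "g \<in> supp R (f x)" by auto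
    have "x \<in> bar_set G n" using f' l(2) by blast
    moreover have "g \<in> carrier G" using fA[of x] l(3) by (auto simp: group_ring_carrier)
    ultimately show "l \<in> bar_set G (Suc n)" unfolding l(1) by (auto simp: bar_set_def)
  qed
  show ?thesis unfolding F_carrier
    by (intro conjI allI cl finite_subset[OF sub fin] order_trans[OF sub sub'])
qed

lemma \<sigma>_add: "\<sigma> (f \<oplus>\<^bsub>F n\<^esub> g) = \<sigma> f \<oplus>\<^bsub>F (Suc n)\<^esub> \<sigma> g"
  by (auto simp: fun_eq_iff F_simps bar_shift_def grmono_def split: list.split)

lemma \<sigma>_zero: "\<sigma> (\<lambda>x h. \<zero>\<^bsub>R\<^esub>) = (\<lambda>x h. \<zero>\<^bsub>R\<^esub>)"
  by (auto simp: fun_eq_iff bar_shift_def grmono_def split: list.split)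

lemma \<sigma>_smult:
  assumes r: "r \<in> carrier R" and f: "f \<in> carrier (F n)"
  shows "\<sigma> (grmono R r \<one>\<^bsub>G\<^esub> \<odot>\<^bsub>F n\<^esub> f) = grmono R r \<one>\<^bsub>G\<^esub> \<odot>\<^bsub>F (Suc n)\<^esub> \<sigma> f"
proof -
  have fA: "f x \<in> carrier A" for x using f by (simp add: F_carrier)
  have sA: "\<sigma> f x \<in> carrier A" for x using \<sigma>_closed[OF f] by (simp add: F_carrier)
  show ?thesis
    unfolding F_simps mono_left_mult[OF r fA] mono_left_mult[OF r sA]
    using r by (auto simp: fun_eq_iff bar_shift_def grmono_def split: list.split)
qed

lemma \<sigma>_basis:
  assumes r: "r \<in> carrier R" "g \<in> carrier G"
  shows "\<sigma> (grmono R r g \<odot>\<^bsub>F n\<^esub> e x) = grmono R r \<one>\<^bsub>G\<^esub> \<odot>\<^bsub>F (Suc n)\<^esub> e (g # x)"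
  unfolding mono_smult_basis[OF r] mono_smult_basis[OF r(1) G.one_closed]
  by (auto simp: fun_eq_iff bar_shift_def grmono_def split: list.split)

lemma smult_one_F: "x \<in> bar_set G n \<Longrightarrow> grmono R \<one>\<^bsub>R\<^esub> \<one>\<^bsub>G\<^esub> \<odot>\<^bsub>F n\<^esub> e x = e x"
  using left_module.smult_one[OF F_left_module e_closed] by (simp add: group_ring_simps)

lemma bar_value_eq:
  assumes g: "g \<in> carrier G" and x: "x \<in> bar_set G n"
    and v: "n > 0 \<Longrightarrow> bar_value R G x \<in> carrier (F (n - 1))"
  shows "bar_value R G (g # x) \<in> carrier (F n)"
    "bar_value R G (g # x) = grmono R \<one>\<^bsub>R\<^esub> g \<odot>\<^bsub>F n\<^esub> e x \<ominus>\<^bsub>F n\<^esub>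
      (if n = 0 then e [] else \<sigma> (grmono R \<one>\<^bsub>R\<^esub> g \<odot>\<^bsub>F (n - 1)\<^esub> bar_value R G x))"
proof -
  interpret F: left_module A "F n" by (rule F_left_module)
  have n: "n = 0 \<longleftrightarrow> x = []" using x by (auto simp: bar_set_def)
  let ?t = "if n = 0 then e [] else \<sigma> (grmono R \<one>\<^bsub>R\<^esub> g \<odot>\<^bsub>F (n - 1)\<^esub> bar_value R G x)"
  have t: "?t \<in> carrier (F n)"
  proof (cases "n = 0")
    case True
    thus ?thesis using e_closed[of "[]" 0] by (simp add: bar_set_def)
  next
    case False
    interpret F': left_module A "F (n - 1)" by (rule F_left_module)
    show ?thesis using \<sigma>_closed[OF F'.smult_closed[OF one_closed[OF g] v]] False by simp
  qed
  have u: "grmono R \<one>\<^bsub>R\<^esub> g \<odot>\<^bsub>F n\<^esub> e x \<in> carrier (F n)" by (rule F.smult_closed[OF one_closed[OF g] e_closed[OF x]])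
  show eq: "bar_value R G (g # x) = grmono R \<one>\<^bsub>R\<^esub> g \<odot>\<^bsub>F n\<^esub> e x \<ominus>\<^bsub>F n\<^esub> ?t"
    unfolding F_diff[OF u t] using n by (simp add: F_simps fun_eq_iff)
  show "bar_value R G (g # x) \<in> carrier (F n)" unfolding eq by (rule F.M.minus_closed[OF u t])
qed

lemma bar_value_closed: "x \<in> bar_set G (Suc n) \<Longrightarrow> bar_value R G x \<in> carrier (F n)"
proof (induction n arbitrary: x)
  case 0
  then obtain g where "x = [g]" "g \<in> carrier G" by (auto simp: bar_set_def length_Suc_conv)
  thus ?case using bar_value_eq(1)[of g "[]" 0] by (simp add: bar_set_def)
next
  case (Suc n)
  then obtain g y where x: "x = g # y" "g \<in> carrier G" "y \<in> bar_set G (Suc n)"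
    by (auto simp: bar_set_def length_Suc_conv)
  show ?case unfolding x(1) by (rule bar_value_eq(1)[OF x(2,3)]) (use Suc.IH[OF x(3)] in simp)
qed

lemma bar_d_hom: "bar_d R G n \<in> mod_hom A (F (Suc n)) (F n)"
  unfolding bar_d_def bar_mod_def[of R G "Suc n"]
  by (rule A.free_ext_hom[OF F_left_module]) (use bar_value_closed in auto)

lemma bar_d_basis: "x \<in> bar_set G (Suc n) \<Longrightarrow> bar_d R G n (e x) = bar_value R G x"
  unfolding bar_d_def
  by (rule A.free_ext_basis[OF F_left_module, of _ "bar_set G (Suc n)"]) (use bar_value_closed in auto)

lemma bar_e_hom: "bar_e R G \<in> mod_hom A (F 0) (trivial_module R)"
  unfolding bar_e_def bar_mod_def
  by (rule A.free_ext_hom[OF left_module_trivial]) auto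

lemma bar_e_basis: "bar_e R G (e []) = \<one>\<^bsub>R\<^esub>"
  unfolding bar_e_def
  by (rule A.free_ext_basis[OF left_module_trivial, of _ "bar_set G 0"]) (auto simp: bar_set_def)

text \<open>
  The contracting homotopy in the lowest degree, a section of the augmentation.
\<close>

definition \<sigma>0 :: "'r \<Rightarrow> 'g list \<Rightarrow> 'g \<Rightarrow> 'r"
  where "\<sigma>0 r = grmono R r \<one>\<^bsub>G\<^esub> \<odot>\<^bsub>F 0\<^esub> e []"

lemma Nil_bar_set: "[] \<in> bar_set G 0"
  by (simp add: bar_set_def)

lemma \<sigma>0_closed: "r \<in> carrier R \<Longrightarrow> \<sigma>0 r \<in> carrier (F 0)"
  unfolding \<sigma>0_def by (rule left_module.smult_closed[OF F_left_module mono_closed e_closed[OF Nil_bar_set]]) auto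

lemma bar_e_\<sigma>0: "r \<in> carrier R \<Longrightarrow> bar_e R G (\<sigma>0 r) = r"
  unfolding \<sigma>0_def
  by (subst mod_hom_smult[OF bar_e_hom mono_closed e_closed[OF Nil_bar_set]])
     (auto simp: bar_e_basis augmentation_mono)

lemma \<sigma>0_add:
  assumes "r \<in> carrier R" "s \<in> carrier R"
  shows "\<sigma>0 (r \<oplus>\<^bsub>R\<^esub> s) = \<sigma>0 r \<oplus>\<^bsub>F 0\<^esub> \<sigma>0 s"
proof -
  interpret F: left_module A "F 0" by (rule F_left_module)
  have "grmono R (r \<oplus>\<^bsub>R\<^esub> s) \<one>\<^bsub>G\<^esub> = grmono R r \<one>\<^bsub>G\<^esub> \<oplus>\<^bsub>A\<^esub> grmono R s \<one>\<^bsub>G\<^esub>"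
    by (auto simp: grmono_def group_ring_simps)
  thus ?thesis unfolding \<sigma>0_def
    using F.smult_l_distr[OF mono_closed[OF assms(1) G.one_closed] mono_closed[OF assms(2) G.one_closed] e_closed[OF Nil_bar_set]]
    by simp
qed

lemma \<sigma>0_zero: "\<sigma>0 \<zero>\<^bsub>R\<^esub> = \<zero>\<^bsub>F 0\<^esub>"
  unfolding \<sigma>0_def by (subst mono_smult_basis) (auto simp: F_simps grmono_def fun_eq_iff)

lemma smult_mono_split:
  assumes "r \<in> carrier R" "g \<in> carrier G" "f \<in> carrier (F n)"
  shows "grmono R r \<one>\<^bsub>G\<^esub> \<odot>\<^bsub>F n\<^esub> (grmono R \<one>\<^bsub>R\<^esub> g \<odot>\<^bsub>F n\<^esub> f) = grmono R r g \<odot>\<^bsub>F n\<^esub> f"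
  using left_module.smult_assoc[OF F_left_module mono_closed[OF assms(1) G.one_closed] one_closed[OF assms(2)] assms(3), symmetric]
    mono_mult[OF assms(1) R.one_closed G.one_closed assms(2)] assms by simp

lemma diff_add_cancel:
  assumes "abelian_group H" "x \<in> carrier H" "y \<in> carrier H"
  shows "x \<ominus>\<^bsub>H\<^esub> y \<oplus>\<^bsub>H\<^esub> y = x"
proof -
  interpret H: abelian_group H by fact
  show ?thesis using assms by (simp add: a_minus_def H.a_assoc H.l_neg)
qed

text \<open>
  On \<open>r g []\<close> the left-hand side is \<open>(r g [] - r []) + r []\<close> by the choice of the differential.
\<close>

lemma bar_homotopy_0:
  assumes f: "f \<in> carrier (F 0)"
  shows "bar_d R G 0 (\<sigma> f) \<oplus>\<^bsub>F 0\<^esub> \<sigma>0 (bar_e R G f) = f"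
  using f
proof (induction f rule: F_induct)
  case zero
  interpret F: left_module A "F 0" by (rule F_left_module)
  have "bar_d R G 0 (\<lambda>x h. \<zero>\<^bsub>R\<^esub>) = (\<lambda>x h. \<zero>\<^bsub>R\<^esub>)"
    using mod_hom_zero[OF left_module_abelian[OF F_left_module] left_module_abelian[OF F_left_module] bar_d_hom[of 0]]
    by (simp add: F_simps)
  moreover have "bar_e R G (\<lambda>x h. \<zero>\<^bsub>R\<^esub>) = \<zero>\<^bsub>R\<^esub>"
    using mod_hom_zero[OF left_module_abelian[OF F_left_module] left_module_abelian[OF left_module_trivial] bar_e_hom]
    by (simp add: F_simps)
  ultimately show ?case by (simp add: \<sigma>_zero \<sigma>0_zero) (simp add: F_simps)
next
  case (add f g)
  interpret F: left_module A "F 0" by (rule F_left_module)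
  note d = mod_hom_closed[OF bar_d_hom \<sigma>_closed[OF add(1)]] mod_hom_closed[OF bar_d_hom \<sigma>_closed[OF add(2)]]
  have s: "bar_e R G f \<in> carrier R" "bar_e R G g \<in> carrier R"
    using mod_hom_closed[OF bar_e_hom add(1)] mod_hom_closed[OF bar_e_hom add(2)] by auto
  have "bar_d R G 0 (\<sigma> (f \<oplus>\<^bsub>F 0\<^esub> g)) \<oplus>\<^bsub>F 0\<^esub> \<sigma>0 (bar_e R G (f \<oplus>\<^bsub>F 0\<^esub> g)) =
    (bar_d R G 0 (\<sigma> f) \<oplus>\<^bsub>F 0\<^esub> bar_d R G 0 (\<sigma> g)) \<oplus>\<^bsub>F 0\<^esub> (\<sigma>0 (bar_e R G f) \<oplus>\<^bsub>F 0\<^esub> \<sigma>0 (bar_e R G g))"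
    unfolding \<sigma>_add mod_hom_add[OF bar_d_hom \<sigma>_closed[OF add(1)] \<sigma>_closed[OF add(2)]]
      mod_hom_add[OF bar_e_hom add(1,2)] trivial_module_simps \<sigma>0_add[OF s] ..
  also have "\<dots> = (bar_d R G 0 (\<sigma> f) \<oplus>\<^bsub>F 0\<^esub> \<sigma>0 (bar_e R G f)) \<oplus>\<^bsub>F 0\<^esub> (bar_d R G 0 (\<sigma> g) \<oplus>\<^bsub>F 0\<^esub> \<sigma>0 (bar_e R G g))"
    using d \<sigma>0_closed[OF s(1)] \<sigma>0_closed[OF s(2)] by (simp add: F.M.a_ac)
  finally show ?case unfolding add(3,4) .
next
  case (basis r g x)
  interpret F: left_module A "F 0" by (rule F_left_module)
  have x: "x = []" using basis by (simp add: bar_set_def)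
  have gx: "[g] \<in> bar_set G (Suc 0)" using basis by (simp add: bar_set_def)
  note r1 = mono_closed[OF basis(1) G.one_closed]
  note eN = e_closed[OF Nil_bar_set]
  note u = F.smult_closed[OF one_closed[OF basis(2)] eN]
  have "bar_d R G 0 (\<sigma> (grmono R r g \<odot>\<^bsub>F 0\<^esub> e [])) = grmono R r \<one>\<^bsub>G\<^esub> \<odot>\<^bsub>F 0\<^esub> bar_value R G [g]"
    unfolding \<sigma>_basis[OF basis(1,2)] mod_hom_smult[OF bar_d_hom r1 e_closed[OF gx]] bar_d_basis[OF gx] ..
  also have "bar_value R G [g] = grmono R \<one>\<^bsub>R\<^esub> g \<odot>\<^bsub>F 0\<^esub> e [] \<ominus>\<^bsub>F 0\<^esub> e []"
    using bar_value_eq(2)[OF basis(2) Nil_bar_set] by simp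
  also have "grmono R r \<one>\<^bsub>G\<^esub> \<odot>\<^bsub>F 0\<^esub> \<dots> = grmono R r g \<odot>\<^bsub>F 0\<^esub> e [] \<ominus>\<^bsub>F 0\<^esub> \<sigma>0 r"
    unfolding a_minus_def F.smult_r_distr[OF r1 u F.M.a_inv_closed[OF eN]] F.smult_r_minus[OF r1 eN]
      smult_mono_split[OF basis(1,2) eN] \<sigma>0_def ..
  finally have 1: "bar_d R G 0 (\<sigma> (grmono R r g \<odot>\<^bsub>F 0\<^esub> e [])) = grmono R r g \<odot>\<^bsub>F 0\<^esub> e [] \<ominus>\<^bsub>F 0\<^esub> \<sigma>0 r" .
  have 2: "bar_e R G (grmono R r g \<odot>\<^bsub>F 0\<^esub> e []) = r"
    unfolding mod_hom_smult[OF bar_e_hom mono_closed[OF basis(1,2)] eN]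
    using basis by (simp add: bar_e_basis augmentation_mono)
  show ?case unfolding x 1 2
    by (rule diff_add_cancel[OF left_module_abelian[OF F_left_module] F.smult_closed[OF mono_closed[OF basis(1,2)] eN] \<sigma>0_closed[OF basis(1)]])
qed

text \<open>
  On \<open>r g [x]\<close> the first term is \<open>r d [g, x] = r g [x] - \<sigma> (r g \<cdot> d [x])\<close>, by the recursion, and the second cancels the error.
\<close>

lemma bar_homotopy_Suc:
  assumes f: "f \<in> carrier (F (Suc n))"
  shows "bar_d R G (Suc n) (\<sigma> f) \<oplus>\<^bsub>F (Suc n)\<^esub> \<sigma> (bar_d R G n f) = f"
  using f
proof (induction f rule: F_induct)
  case zero
  have "bar_d R G k (\<lambda>x h. \<zero>\<^bsub>R\<^esub>) = (\<lambda>x h. \<zero>\<^bsub>R\<^esub>)" for k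
    using mod_hom_zero[OF left_module_abelian[OF F_left_module] left_module_abelian[OF F_left_module] bar_d_hom[of k]]
    by (simp add: F_simps)
  thus ?case by (simp add: \<sigma>_zero F_simps)
next
  case (add f g)
  interpret F: left_module A "F (Suc n)" by (rule F_left_module)
  note d = mod_hom_closed[OF bar_d_hom \<sigma>_closed[OF add(1)]] mod_hom_closed[OF bar_d_hom \<sigma>_closed[OF add(2)]]
  note s = \<sigma>_closed[OF mod_hom_closed[OF bar_d_hom add(1)]] \<sigma>_closed[OF mod_hom_closed[OF bar_d_hom add(2)]]
  have "bar_d R G (Suc n) (\<sigma> (f \<oplus>\<^bsub>F (Suc n)\<^esub> g)) \<oplus>\<^bsub>F (Suc n)\<^esub> \<sigma> (bar_d R G n (f \<oplus>\<^bsub>F (Suc n)\<^esub> g)) =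
    (bar_d R G (Suc n) (\<sigma> f) \<oplus>\<^bsub>F (Suc n)\<^esub> bar_d R G (Suc n) (\<sigma> g)) \<oplus>\<^bsub>F (Suc n)\<^esub>
    (\<sigma> (bar_d R G n f) \<oplus>\<^bsub>F (Suc n)\<^esub> \<sigma> (bar_d R G n g))"
    unfolding \<sigma>_add mod_hom_add[OF bar_d_hom \<sigma>_closed[OF add(1)] \<sigma>_closed[OF add(2)]]
      mod_hom_add[OF bar_d_hom add(1,2)] ..
  also have "\<dots> = (bar_d R G (Suc n) (\<sigma> f) \<oplus>\<^bsub>F (Suc n)\<^esub> \<sigma> (bar_d R G n f)) \<oplus>\<^bsub>F (Suc n)\<^esub>
    (bar_d R G (Suc n) (\<sigma> g) \<oplus>\<^bsub>F (Suc n)\<^esub> \<sigma> (bar_d R G n g))"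
    using d s by (simp add: F.M.a_ac)
  finally show ?case unfolding add(3,4) .
next
  case (basis r g x)
  interpret F: left_module A "F (Suc n)" by (rule F_left_module)
  interpret F': left_module A "F n" by (rule F_left_module)
  have gx: "g # x \<in> bar_set G (Suc (Suc n))" using basis by (auto simp: bar_set_def)
  note r1 = mono_closed[OF basis(1) G.one_closed]
  note ex = e_closed[OF basis(3)] and v = bar_value_closed[OF basis(3)]
  note u = F.smult_closed[OF one_closed[OF basis(2)] ex]
  note gv = F'.smult_closed[OF one_closed[OF basis(2)] v]
  note w = \<sigma>_closed[OF gv]
  have "bar_d R G (Suc n) (\<sigma> (grmono R r g \<odot>\<^bsub>F (Suc n)\<^esub> e x)) = grmono R r \<one>\<^bsub>G\<^esub> \<odot>\<^bsub>F (Suc n)\<^esub> bar_value R G (g # x)"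
    unfolding \<sigma>_basis[OF basis(1,2)] mod_hom_smult[OF bar_d_hom r1 e_closed[OF gx]] bar_d_basis[OF gx] ..
  also have "bar_value R G (g # x) =
      grmono R \<one>\<^bsub>R\<^esub> g \<odot>\<^bsub>F (Suc n)\<^esub> e x \<ominus>\<^bsub>F (Suc n)\<^esub> \<sigma> (grmono R \<one>\<^bsub>R\<^esub> g \<odot>\<^bsub>F n\<^esub> bar_value R G x)"
    using bar_value_eq(2)[OF basis(2,3)] v by (simp del: bar_value.simps)
  also have "grmono R r \<one>\<^bsub>G\<^esub> \<odot>\<^bsub>F (Suc n)\<^esub> \<dots> =
      grmono R r g \<odot>\<^bsub>F (Suc n)\<^esub> e x \<ominus>\<^bsub>F (Suc n)\<^esub> \<sigma> (grmono R r g \<odot>\<^bsub>F n\<^esub> bar_value R G x)"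
    unfolding a_minus_def F.smult_r_distr[OF r1 u F.M.a_inv_closed[OF w]] F.smult_r_minus[OF r1 w]
      smult_mono_split[OF basis(1,2) ex] \<sigma>_smult[OF basis(1) gv, symmetric] smult_mono_split[OF basis(1,2) v] ..
  finally have 1: "bar_d R G (Suc n) (\<sigma> (grmono R r g \<odot>\<^bsub>F (Suc n)\<^esub> e x)) =
      grmono R r g \<odot>\<^bsub>F (Suc n)\<^esub> e x \<ominus>\<^bsub>F (Suc n)\<^esub> \<sigma> (grmono R r g \<odot>\<^bsub>F n\<^esub> bar_value R G x)" .
  have 2: "bar_d R G n (grmono R r g \<odot>\<^bsub>F (Suc n)\<^esub> e x) = grmono R r g \<odot>\<^bsub>F n\<^esub> bar_value R G x"
    unfolding mod_hom_smult[OF bar_d_hom mono_closed[OF basis(1,2)] ex] bar_d_basis[OF basis(3)] ..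
  show ?case unfolding 1 2
    by (rule diff_add_cancel[OF left_module_abelian[OF F_left_module] F.smult_closed[OF mono_closed[OF basis(1,2)] ex]
          \<sigma>_closed[OF F'.smult_closed[OF mono_closed[OF basis(1,2)] v]]])
qed

text \<open>
  The values of \<open>\<sigma>\<close> include all basis elements, so it is enough to test linear maps on them.
\<close>

lemma F_hom_zeroI:
  assumes M: "left_module A M" and f: "f \<in> mod_hom A (F (Suc n)) M"
    and *: "\<And>y. y \<in> carrier (F n) \<Longrightarrow> f (\<sigma> y) = \<zero>\<^bsub>M\<^esub>" and v: "v \<in> carrier (F (Suc n))"
  shows "f v = \<zero>\<^bsub>M\<^esub>"
proof (rule A.mod_hom_free_eqI[OF M f[unfolded bar_mod_def] mod_hom_const_zero[OF M] _ v[unfolded bar_mod_def]])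
  fix y assume "y \<in> bar_set G (Suc n)"
  then obtain g x where y: "y = g # x" "g \<in> carrier G" "x \<in> bar_set G n" by (auto simp: bar_set_def length_Suc_conv)
  have gx: "y \<in> bar_set G (Suc n)" using y by (auto simp: bar_set_def)
  have "\<sigma> (grmono R \<one>\<^bsub>R\<^esub> g \<odot>\<^bsub>F n\<^esub> e x) = e y"
    using \<sigma>_basis[OF R.one_closed y(2), of n x] smult_one_F[OF gx] y(1) by simp
  thus "f (e y) = \<zero>\<^bsub>M\<^esub>"
    using *[OF left_module.smult_closed[OF F_left_module one_closed[OF y(2)] e_closed[OF y(3)]]] by simp
qed

lemma bar_e_d: "v \<in> carrier (F (Suc 0)) \<Longrightarrow> bar_e R G (bar_d R G 0 v) = \<zero>\<^bsub>R\<^esub>"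
proof -
  assume v: "v \<in> carrier (F (Suc 0))"
  have "bar_e R G (bar_d R G 0 (\<sigma> f)) = \<zero>\<^bsub>trivial_module R\<^esub>" if f: "f \<in> carrier (F 0)" for f
  proof -
    note d = mod_hom_closed[OF bar_d_hom \<sigma>_closed[OF f]]
    have s: "bar_e R G f \<in> carrier R" using mod_hom_closed[OF bar_e_hom f] by simp
    have "bar_e R G f = bar_e R G (bar_d R G 0 (\<sigma> f)) \<oplus>\<^bsub>R\<^esub> bar_e R G f"
      using mod_hom_add[OF bar_e_hom d \<sigma>0_closed[OF s]] bar_e_\<sigma>0[OF s] bar_homotopy_0[OF f] by simp
    thus ?thesis using mod_hom_closed[OF bar_e_hom d] s by (simp add: R.add.r_cancel_one')
  qed
  from F_hom_zeroI[OF left_module_trivial mod_hom_comp[OF bar_d_hom bar_e_hom] this v] show ?thesis by simp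
qed

text \<open>
  Inductively, \<open>d d \<sigma> f = d (f - \<sigma> d f) = d f - (d f - \<sigma> d d f) = 0\<close>.
\<close>

lemma bar_d_d: "v \<in> carrier (F (Suc (Suc n))) \<Longrightarrow> bar_d R G n (bar_d R G (Suc n) v) = \<zero>\<^bsub>F n\<^esub>"
proof (induction n arbitrary: v)
  case 0
  interpret F0: left_module A "F 0" by (rule F_left_module)
  have "bar_d R G 0 (bar_d R G (Suc 0) (\<sigma> f)) = \<zero>\<^bsub>F 0\<^esub>" if f: "f \<in> carrier (F (Suc 0))" for f
  proof -
    note df = mod_hom_closed[OF bar_d_hom f]
    note ds = mod_hom_closed[OF bar_d_hom \<sigma>_closed[OF f]] and sd = \<sigma>_closed[OF df]
    have "bar_d R G 0 (\<sigma> (bar_d R G 0 f)) \<oplus>\<^bsub>F 0\<^esub> \<zero>\<^bsub>F 0\<^esub> = bar_d R G 0 f"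
      using bar_homotopy_0[OF df] bar_e_d[OF f] \<sigma>0_zero by simp
    hence "bar_d R G 0 (\<sigma> (bar_d R G 0 f)) = bar_d R G 0 f"
      using mod_hom_closed[OF bar_d_hom sd] by (metis F0.M.r_zero)
    moreover have "bar_d R G 0 f = bar_d R G 0 (bar_d R G (Suc 0) (\<sigma> f)) \<oplus>\<^bsub>F 0\<^esub> bar_d R G 0 (\<sigma> (bar_d R G 0 f))"
      using mod_hom_add[OF bar_d_hom ds sd] bar_homotopy_Suc[OF f] by simp
    ultimately show ?thesis
      using mod_hom_closed[OF bar_d_hom ds] df by (metis F0.M.add.r_cancel_one')
  qed
  from F_hom_zeroI[OF F_left_module mod_hom_comp[OF bar_d_hom bar_d_hom] this 0] show ?case .
next
  case (Suc n)
  interpret F0: left_module A "F (Suc n)" by (rule F_left_module)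
  have "bar_d R G (Suc n) (bar_d R G (Suc (Suc n)) (\<sigma> f)) = \<zero>\<^bsub>F (Suc n)\<^esub>" if f: "f \<in> carrier (F (Suc (Suc n)))" for f
  proof -
    note df = mod_hom_closed[OF bar_d_hom f]
    note ds = mod_hom_closed[OF bar_d_hom \<sigma>_closed[OF f]] and sd = \<sigma>_closed[OF df]
    have "\<sigma> \<zero>\<^bsub>F n\<^esub> = \<zero>\<^bsub>F (Suc n)\<^esub>" by (simp add: F_simps \<sigma>_zero)
    hence "bar_d R G (Suc n) (\<sigma> (bar_d R G (Suc n) f)) \<oplus>\<^bsub>F (Suc n)\<^esub> \<zero>\<^bsub>F (Suc n)\<^esub> = bar_d R G (Suc n) f"
      using bar_homotopy_Suc[OF df] Suc.IH[OF f] by simp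
    hence "bar_d R G (Suc n) (\<sigma> (bar_d R G (Suc n) f)) = bar_d R G (Suc n) f"
      using mod_hom_closed[OF bar_d_hom sd] by (metis F0.M.r_zero)
    moreover have "bar_d R G (Suc n) f = bar_d R G (Suc n) (bar_d R G (Suc (Suc n)) (\<sigma> f)) \<oplus>\<^bsub>F (Suc n)\<^esub>
        bar_d R G (Suc n) (\<sigma> (bar_d R G (Suc n) f))"
      using mod_hom_add[OF bar_d_hom ds sd] bar_homotopy_Suc[OF f] by simp
    ultimately show ?thesis
      using mod_hom_closed[OF bar_d_hom ds] df by (metis F0.M.add.r_cancel_one')
  qed
  from F_hom_zeroI[OF F_left_module mod_hom_comp[OF bar_d_hom bar_d_hom] this Suc.prems] show ?case .
qed

text \<open>
  A complex with a contracting homotopy is exact: a cycle \<open>x\<close> is \<open>d (\<sigma> x)\<close>.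
\<close>

theorem bar_resolution:
  "resolution A (trivial_module R) (\<lambda>n. free_mod A (bar_set G n)) (bar_d R G) (bar_e R G)"
proof -
  have F: "(\<lambda>n. free_mod A (bar_set G n)) = F" by (simp add: bar_mod_def fun_eq_iff)
  have 1: "bar_e R G ` carrier (F 0) = carrier R"
  proof
    show "bar_e R G ` carrier (F 0) \<subseteq> carrier R" using mod_hom_closed[OF bar_e_hom] by auto
    show "carrier R \<subseteq> bar_e R G ` carrier (F 0)"
    proof
      fix r assume r: "r \<in> carrier R"
      show "r \<in> bar_e R G ` carrier (F 0)"
        using imageI[OF \<sigma>0_closed[OF r], of "bar_e R G"] bar_e_\<sigma>0[OF r] by simp
    qed
  qed
  have 2: "bar_d R G 0 ` carrier (F (Suc 0)) = a_kernel (F 0) (trivial_module R :: ('g \<Rightarrow> 'r, 'r) module) (bar_e R G)"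
  proof (intro equalityI subsetI)
    fix x assume "x \<in> bar_d R G 0 ` carrier (F (Suc 0))"
    then obtain v where v: "v \<in> carrier (F (Suc 0))" "x = bar_d R G 0 v" by blast
    show "x \<in> a_kernel (F 0) (trivial_module R) (bar_e R G)"
      unfolding v(2) a_kernel_eq using mod_hom_closed[OF bar_d_hom v(1)] bar_e_d[OF v(1)] by simp
  next
    interpret F0: left_module A "F 0" by (rule F_left_module)
    fix x assume "x \<in> a_kernel (F 0) (trivial_module R :: ('g \<Rightarrow> 'r, 'r) module) (bar_e R G)"
    hence x: "x \<in> carrier (F 0)" "bar_e R G x = \<zero>\<^bsub>R\<^esub>" by (auto simp: a_kernel_eq)
    note c = mod_hom_closed[OF bar_d_hom \<sigma>_closed[OF x(1)]]
    have "bar_d R G 0 (\<sigma> x) = x"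
      using bar_homotopy_0[OF x(1)] F0.M.r_zero[OF c] unfolding x(2) \<sigma>0_zero by simp
    thus "x \<in> bar_d R G 0 ` carrier (F (Suc 0))" using imageI[OF \<sigma>_closed[OF x(1)], of "bar_d R G 0"] by simp
  qed
  have 3: "bar_d R G (Suc n) ` carrier (F (Suc (Suc n))) = a_kernel (F (Suc n)) (F n) (bar_d R G n)" for n
  proof (intro equalityI subsetI)
    fix x assume "x \<in> bar_d R G (Suc n) ` carrier (F (Suc (Suc n)))"
    then obtain v where v: "v \<in> carrier (F (Suc (Suc n)))" "x = bar_d R G (Suc n) v" by blast
    show "x \<in> a_kernel (F (Suc n)) (F n) (bar_d R G n)"
      unfolding v(2) a_kernel_eq using mod_hom_closed[OF bar_d_hom v(1)] bar_d_d[OF v(1)] by simp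
  next
    interpret Fn: left_module A "F (Suc n)" by (rule F_left_module)
    fix x assume "x \<in> a_kernel (F (Suc n)) (F n) (bar_d R G n)"
    hence x: "x \<in> carrier (F (Suc n))" "bar_d R G n x = \<zero>\<^bsub>F n\<^esub>" by (auto simp: a_kernel_eq)
    note c = mod_hom_closed[OF bar_d_hom \<sigma>_closed[OF x(1)]]
    have "\<sigma> \<zero>\<^bsub>F n\<^esub> = \<zero>\<^bsub>F (Suc n)\<^esub>" by (simp add: F_simps \<sigma>_zero)
    hence "bar_d R G (Suc n) (\<sigma> x) = x"
      using bar_homotopy_Suc[OF x(1)] Fn.M.r_zero[OF c] unfolding x(2) by simp
    thus "x \<in> bar_d R G (Suc n) ` carrier (F (Suc (Suc n)))"
      using imageI[OF \<sigma>_closed[OF x(1)], of "bar_d R G (Suc n)"] by simp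
  qed
  show ?thesis unfolding F resolution_def
    using left_module_trivial F_left_module bar_e_hom bar_d_hom 1 2 3 by auto
qed

end

section \<open>The dimensions of a group and of its subgroups\<close>

context group_and_ring
begin

lemma inj_\<sigma>0: "inj_on \<sigma>0 (carrier (trivial_module R))"
  by (rule inj_on_inverseI[of _ "bar_e R G"]) (simp add: bar_e_\<sigma>0)

lemma hd'_le_iff:
  "hd' R G \<le> enat n \<longleftrightarrow> locally_split A (F n) (bar_d R G n ` carrier (F (Suc n)))"
  unfolding hd'_def bar_mod_def by (rule A.flat_dim_le_iff_locally_split[OF bar_resolution inj_\<sigma>0])

lemma hd'_le_cd: "hd' R G \<le> cd R G"
  unfolding hd'_def cd_def by (rule A.flat_dim_le_projective_dim)

text \<open>
  A countable group has countably many lists of elements, so the bar resolution is countably generated.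
\<close>

lemma cd_le_Suc:
  assumes "countable (carrier G)" "hd' R G \<le> enat n" shows "cd R G \<le> enat (Suc n)"
  unfolding cd_def
proof (rule A.projective_dim_le_Suc_of_flat_dim_le[OF bar_resolution inj_\<sigma>0])
  have "bar_set G (Suc n) \<subseteq> lists (carrier G)" by (auto simp: bar_set_def)
  thus "countable (bar_set G (Suc n))" using assms(1) by (metis countable_lists countable_subset)
qed (use assms(2) in \<open>simp add: hd'_def\<close>)

lemma flat_trivial_of_hd'_le_0:
  assumes "hd' R G \<le> 0" shows "equationally_flat A (trivial_module R :: ('g \<Rightarrow> 'r, 'r) module)"
proof -
  note r = resolutionD[OF bar_resolution]
  have "locally_split A (F 0) (bar_d R G 0 ` carrier (F (Suc 0)))"
    using assms hd'_le_iff[of 0] by (simp add: zero_enat_def)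
  thus ?thesis unfolding bar_mod_def r(6) by (rule A.equationally_flat_quotient[OF r(1,3,5)])
qed

text \<open>
  Over the trivial group the section of the augmentation is linear, so the trivial module is a retract of the
  free module of rank one.
\<close>

lemma cd_trivial_group:
  assumes "carrier G = {\<one>\<^bsub>G\<^esub>}" shows "cd R G \<le> 0"
  unfolding cd_def
proof (rule A.projective_dim_le_0[OF left_module_trivial inj_\<sigma>0])
  show "bar_e R G \<in> mod_hom A (free_mod A (bar_set G 0)) (trivial_module R)"
    using bar_e_hom by (simp add: bar_mod_def)
  show "bar_e R G (\<sigma>0 x) = x" if "x \<in> carrier (trivial_module R)" for x
    using that bar_e_\<sigma>0 by simp
  interpret F: left_module A "F 0" by (rule F_left_module)
  note eN = e_closed[OF Nil_bar_set]
  show "\<sigma>0 \<in> mod_hom A (trivial_module R) (free_mod A (bar_set G 0))"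
    unfolding bar_mod_def[symmetric]
  proof (rule mod_homI)
    fix r assume "r \<in> carrier (trivial_module R)"
    hence r: "r \<in> carrier R" by simp
    show "\<sigma>0 r \<in> carrier (F 0)" by (rule \<sigma>0_closed[OF r])
    show "\<sigma>0 (r \<oplus>\<^bsub>trivial_module R\<^esub> s) = \<sigma>0 r \<oplus>\<^bsub>F 0\<^esub> \<sigma>0 s" if "s \<in> carrier (trivial_module R)" for s
      using \<sigma>0_add r that by simp
    fix a assume "a \<in> carrier A"
    thus "\<sigma>0 (a \<odot>\<^bsub>trivial_module R\<^esub> r) = a \<odot>\<^bsub>F 0\<^esub> \<sigma>0 r"
    proof (induction a rule: A_induct)
      case zero
      show ?case using F.smult_l_zero[OF \<sigma>0_closed[OF r]] r
        by (simp add: augmentation_zero \<sigma>0_zero group_ring_simps)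
    next
      case (add a b)
      have "\<sigma>0 ((a \<oplus>\<^bsub>A\<^esub> b) \<odot>\<^bsub>trivial_module R\<^esub> r) =
          \<sigma>0 (augmentation R a \<otimes>\<^bsub>R\<^esub> r) \<oplus>\<^bsub>F 0\<^esub> \<sigma>0 (augmentation R b \<otimes>\<^bsub>R\<^esub> r)"
        using add(1,2) r augmentation_closed by (simp add: augmentation_add R.l_distr \<sigma>0_add)
      thus ?case using add(3,4) F.smult_l_distr[OF add(1,2) \<sigma>0_closed[OF r]] by simp
    next
      case (mono s g)
      hence g: "g = \<one>\<^bsub>G\<^esub>" using assms by simp
      show ?case unfolding \<sigma>0_def g
        using F.smult_assoc[OF mono_closed[OF mono(1) G.one_closed] mono_closed[OF r G.one_closed] eN, symmetric]
          mono r by (simp add: mono_mult augmentation_mono)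
    qed
  qed
qed

lemma mono_mult_apply:
  assumes "r \<in> carrier R" "g \<in> carrier G" "f \<in> carrier A" "x \<in> carrier G"
  shows "(grmono R r g \<otimes>\<^bsub>A\<^esub> f) x = r \<otimes>\<^bsub>R\<^esub> f (inv\<^bsub>G\<^esub> g \<otimes>\<^bsub>G\<^esub> x)"
  using assms(3)
proof (induction f rule: A_induct)
  case zero
  thus ?case using assms(1) by (simp add: A_zero_mult)
next
  case (add f h)
  thus ?case using assms mono_closed[OF assms(1,2)]
    by (simp add: A_r_distr) (simp add: group_ring_simps group_ring_carrier R.r_distr)
next
  case (mono s h)
  have "x = g \<otimes>\<^bsub>G\<^esub> h \<longleftrightarrow> inv\<^bsub>G\<^esub> g \<otimes>\<^bsub>G\<^esub> x = h"
    using assms mono by (metis G.inv_solve_left)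
  thus ?case using assms mono by (simp add: mono_mult) (simp add: grmono_def)
qed

context
  fixes H assumes H: "subgroup H G"
begin

abbreviation "GH \<equiv> G\<lparr>carrier := H\<rparr>"
abbreviation "AH \<equiv> group_ring R (G\<lparr>carrier := H\<rparr>)"

lemma H_sub: "H \<subseteq> carrier G"
  using H by (rule subgroup.subset)

lemma group_and_ring_H: "group_and_ring GH R"
  by (intro group_and_ring.intro G.subgroup_imp_group H R.cring_axioms)

lemma AH_carrier: "carrier AH \<subseteq> carrier A"
  by (rule group_ring_subgroup_carrier[OF H_sub])

lemma AH_simps: "\<zero>\<^bsub>AH\<^esub> = \<zero>\<^bsub>A\<^esub>" "\<one>\<^bsub>AH\<^esub> = \<one>\<^bsub>A\<^esub>" "x \<oplus>\<^bsub>AH\<^esub> y = x \<oplus>\<^bsub>A\<^esub> y" "x \<otimes>\<^bsub>AH\<^esub> y = x \<otimes>\<^bsub>A\<^esub> y"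
  by (simp_all add: group_ring_simps group_ring_subgroup_mult)

lemma AH_basis: "free_basis AH = free_basis A"
  by (simp add: free_basis_def fun_eq_iff AH_simps)

lemma AH_free_carrier: "I \<subseteq> J \<Longrightarrow> carrier (free_mod AH I) \<subseteq> carrier (free_mod A J)"
  using AH_carrier unfolding free_mod_def by (auto simp: AH_simps subset_iff)

lemma AH_left_module: "left_module A M \<Longrightarrow> left_module AH M"
proof -
  assume "left_module A M"
  then interpret M: left_module A M .
  interpret H: group_and_ring GH R by (rule group_and_ring_H)
  note s = subsetD[OF AH_carrier]
  show ?thesis
    by (rule left_moduleI[OF H.A.ring_axioms M.M.abelian_group_axioms])
       (simp_all add: AH_simps M.smult_closed M.smult_l_distr M.smult_r_distr M.smult_assoc M.smult_one s)
qed

lemma AH_hom: "f \<in> mod_hom A M N \<Longrightarrow> f \<in> mod_hom AH M N"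
  using subsetD[OF AH_carrier] by (intro mod_homI) (simp_all add: mod_hom_closed mod_hom_add mod_hom_smult)

lemma AH_inclusion: "I \<subseteq> J \<Longrightarrow> (\<lambda>v. v) \<in> mod_hom AH (free_mod AH I) (free_mod A J)"
proof -
  assume "I \<subseteq> J"
  from subsetD[OF AH_free_carrier[OF this]] show ?thesis by (intro mod_homI) (simp_all add: AH_simps)
qed

text \<open>
  The group ring is free over the group ring of \<open>H\<close> on a set \<open>T\<close> of representatives of the right cosets: \<open>g = (g \<tau>\<^sup>-\<^sup>1) \<tau>\<close> with
  \<open>\<tau> = \<tau> g\<close> the representative. The maps \<open>s\<close> and \<open>t\<close> in the proof, which identify the coefficient of \<open>f j\<close> at \<open>k t\<close> with
  the coefficient at \<open>k\<close> of the coordinate \<open>(j, t)\<close>, exhibit the module as a retract of a free one.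
\<close>

lemma equationally_flat_free_AH:
  fixes J :: "'j set"
  shows "equationally_flat AH (free_mod A J)"
proof -
  interpret H: group_and_ring GH R by (rule group_and_ring_H)
  interpret FA: left_module A "free_mod A J" by (rule A.left_module_free_mod)
  define \<tau> where "\<tau> h = (SOME y. y \<in> H #>\<^bsub>G\<^esub> h)" for h
  have \<tau>: "\<tau> h \<in> H #>\<^bsub>G\<^esub> h" if "h \<in> carrier G" for h
    unfolding \<tau>_def by (rule someI, rule G.rcos_self[OF that H])
  have \<tau>G: "\<tau> h \<in> carrier G" if "h \<in> carrier G" for h
    using \<tau>[OF that] G.r_coset_subset_G[OF H_sub that] by blast
  have \<tau>H: "h \<otimes>\<^bsub>G\<^esub> inv\<^bsub>G\<^esub> \<tau> h \<in> H" if h: "h \<in> carrier G" for h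
  proof -
    obtain k where k: "k \<in> H" "\<tau> h = k \<otimes>\<^bsub>G\<^esub> h" using \<tau>[OF h] by (auto simp: r_coset_def)
    hence kG: "k \<in> carrier G" using H_sub by blast
    have "h \<otimes>\<^bsub>G\<^esub> inv\<^bsub>G\<^esub> \<tau> h = inv\<^bsub>G\<^esub> k"
      unfolding k(2) using kG h by (simp add: G.inv_mult_group G.m_assoc[symmetric])
    thus ?thesis using subgroup.m_inv_closed[OF H k(1)] by simp
  qed
  have \<tau>inv: "\<tau> (k \<otimes>\<^bsub>G\<^esub> h) = \<tau> h" if "k \<in> H" "h \<in> carrier G" for k h
  proof -
    have "k \<otimes>\<^bsub>G\<^esub> h \<in> H #>\<^bsub>G\<^esub> h" using that by (auto simp: r_coset_def)
    from G.repr_independence[OF this that(2) H] show ?thesis by (simp add: \<tau>_def)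
  qed
  define T where "T = \<tau> ` carrier G"
  have TG: "t \<in> carrier G" if "t \<in> T" for t using that \<tau>G by (auto simp: T_def)
  have \<tau>T: "\<tau> t = t" if t: "t \<in> T" for t
  proof -
    obtain h where h: "h \<in> carrier G" "t = \<tau> h" using t by (auto simp: T_def)
    from G.repr_independence[OF \<tau>[OF h(1)] h(1) H] show ?thesis by (simp add: h(2) \<tau>_def)
  qed
  define s where "s f = (\<lambda>(j, t) k. if k \<in> H \<and> t \<in> T then f j (k \<otimes>\<^bsub>G\<^esub> t) else \<zero>\<^bsub>R\<^esub>)" for f :: "'j \<Rightarrow> 'g \<Rightarrow> 'r"
  let ?FH = "free_mod AH (J \<times> T)"
  interpret FH: left_module AH ?FH by (rule H.A.left_module_free_mod)
  have sA: "s f p \<in> carrier AH" if f: "f \<in> carrier (free_mod A J)" for f p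
  proof (cases p)
    case (Pair j t)
    have fj: "f j \<in> carrier A" using f by (simp add: free_mod_carrier)
    show ?thesis
    proof (cases "t \<in> T")
      case True
      have "inj_on (\<lambda>k. k \<otimes>\<^bsub>G\<^esub> t) H" using subsetD[OF H_sub] TG[OF True]
        by (intro inj_onI) (simp add: G.r_cancel)
      moreover have "(\<lambda>k. k \<otimes>\<^bsub>G\<^esub> t) ` supp R (s f p) \<subseteq> supp R (f j)" "supp R (s f p) \<subseteq> H"
        by (auto simp: Pair s_def supp_def split: if_splits)
      moreover have "finite (supp R (f j))" using fj by (simp add: group_ring_carrier)
      ultimately have "finite (supp R (s f p))" by (meson finite_imageD finite_subset inj_on_subset)
      thus ?thesis using \<open>supp R (s f p) \<subseteq> H\<close> fj by (auto simp: group_ring_carrier Pair s_def)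
    next
      case False
      thus ?thesis by (auto simp: group_ring_carrier Pair s_def supp_def)
    qed
  qed
  have s_add: "s (f \<oplus>\<^bsub>free_mod A J\<^esub> g) = s f \<oplus>\<^bsub>?FH\<^esub> s g" for f g
    by (auto simp: s_def fun_eq_iff group_ring_simps)
  have s_mono: "s (grmono R r g \<odot>\<^bsub>free_mod A J\<^esub> free_basis A j) =
      grmono R r (g \<otimes>\<^bsub>G\<^esub> inv\<^bsub>G\<^esub> \<tau> g) \<odot>\<^bsub>?FH\<^esub> free_basis AH (j, \<tau> g)"
    if r: "r \<in> carrier R" and g: "g \<in> carrier G" for r g j
  proof -
    have 1: "grmono R r (g \<otimes>\<^bsub>G\<^esub> inv\<^bsub>G\<^esub> \<tau> g) \<in> carrier AH" using H.mono_closed[OF r] \<tau>H[OF g] by simp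
    have *: "(k \<in> H \<and> t \<in> T \<and> k \<otimes>\<^bsub>G\<^esub> t = g) \<longleftrightarrow> (t = \<tau> g \<and> k = g \<otimes>\<^bsub>G\<^esub> inv\<^bsub>G\<^esub> \<tau> g)" for k t
    proof
      assume a: "k \<in> H \<and> t \<in> T \<and> k \<otimes>\<^bsub>G\<^esub> t = g"
      hence "t = \<tau> g" using \<tau>inv[of k t] \<tau>T TG by auto
      moreover have "k = g \<otimes>\<^bsub>G\<^esub> inv\<^bsub>G\<^esub> t" using a H_sub TG by (metis G.inv_solve_right g subsetD)
      ultimately show "t = \<tau> g \<and> k = g \<otimes>\<^bsub>G\<^esub> inv\<^bsub>G\<^esub> \<tau> g" by simp
    next
      assume "t = \<tau> g \<and> k = g \<otimes>\<^bsub>G\<^esub> inv\<^bsub>G\<^esub> \<tau> g"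
      thus "k \<in> H \<and> t \<in> T \<and> k \<otimes>\<^bsub>G\<^esub> t = g"
        using \<tau>H[OF g] \<tau>G[OF g] g by (auto simp: T_def G.m_assoc)
    qed
    show ?thesis
      unfolding H.A.smult_free_basis[OF 1] A.smult_free_basis[OF mono_closed[OF r g]]
      using * by (auto simp: s_def fun_eq_iff grmono_def group_ring_simps)
  qed
  have s_closed: "s f \<in> carrier ?FH" if "f \<in> carrier (free_mod A J)" for f
    using that
  proof (induction f rule: free_A_induct)
    case zero
    have "s (\<lambda>x h. \<zero>\<^bsub>R\<^esub>) = \<zero>\<^bsub>?FH\<^esub>" by (auto simp: s_def fun_eq_iff group_ring_simps)
    thus ?case using FH.M.zero_closed by simp
  next
    case (add f g)
    thus ?case unfolding s_add by (intro FH.M.a_closed)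
  next
    case (basis r g j)
    have "(j, \<tau> g) \<in> J \<times> T" using basis by (auto simp: T_def)
    thus ?case unfolding s_mono[OF basis(1,2)] using H.mono_closed[OF basis(1)] \<tau>H[OF basis(2)]
      by (intro FH.smult_closed H.A.free_basis_closed) auto
  qed
  have s_smult: "s (a \<odot>\<^bsub>free_mod A J\<^esub> f) = a \<odot>\<^bsub>?FH\<^esub> s f" if a: "a \<in> carrier AH" and f: "f \<in> carrier (free_mod A J)" for a f
    using a
  proof (induction a rule: H.A_induct)
    case zero
    have "s (\<lambda>x. (\<lambda>h. \<zero>\<^bsub>R\<^esub>) \<otimes>\<^bsub>A\<^esub> f x) = (\<lambda>x. (\<lambda>h. \<zero>\<^bsub>R\<^esub>) \<otimes>\<^bsub>AH\<^esub> s f x)"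
      by (auto simp: A_zero_mult AH_simps s_def fun_eq_iff)
    thus ?case by simp
  next
    case (add a b)
    have ab: "a \<in> carrier A" "b \<in> carrier A" using add(1,2) AH_carrier by auto
    have "s ((a \<oplus>\<^bsub>A\<^esub> b) \<odot>\<^bsub>free_mod A J\<^esub> f) = s (a \<odot>\<^bsub>free_mod A J\<^esub> f) \<oplus>\<^bsub>?FH\<^esub> s (b \<odot>\<^bsub>free_mod A J\<^esub> f)"
      unfolding FA.smult_l_distr[OF ab f] s_add ..
    thus ?case unfolding add(3,4) using FH.smult_l_distr[OF add(1,2) s_closed[OF f]] by (simp add: AH_simps)
  next
    case (mono r h)
    hence h: "h \<in> H" by simp
    hence hG: "h \<in> carrier G" and hi: "inv\<^bsub>G\<^esub> h \<in> H" using H_sub subgroup.m_inv_closed[OF H] by auto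
    have fA: "f j \<in> carrier A" for j using f by (simp add: free_mod_carrier)
    show ?case
    proof (intro ext)
      fix p :: "'j \<times> 'g" and k
      obtain j t where p: "p = (j, t)" by (cases p)
      have "grmono R r h \<otimes>\<^bsub>A\<^esub> s f (j, t) \<in> carrier AH"
        using H.mult_closed[OF H.mono_closed[OF mono] sA[OF f]] by (simp add: AH_simps)
      hence out: "(grmono R r h \<otimes>\<^bsub>A\<^esub> s f (j, t)) k = \<zero>\<^bsub>R\<^esub>" if "k \<notin> H"
        using that by (auto simp: group_ring_carrier supp_def)
      show "s (grmono R r h \<odot>\<^bsub>free_mod A J\<^esub> f) p k = (grmono R r h \<odot>\<^bsub>?FH\<^esub> s f) p k"
      proof (cases "k \<in> H")
        case False
        thus ?thesis using out by (simp add: p s_def AH_simps)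
      next
        case True
        hence kG: "k \<in> carrier G" and hk: "inv\<^bsub>G\<^esub> h \<otimes>\<^bsub>G\<^esub> k \<in> H"
          using H_sub hi subgroup.m_closed[OF H] by auto
        have sfA: "s f (j, t) \<in> carrier A" using sA[OF f] AH_carrier by blast
        have "(grmono R r h \<odot>\<^bsub>?FH\<^esub> s f) p k = r \<otimes>\<^bsub>R\<^esub> s f (j, t) (inv\<^bsub>G\<^esub> h \<otimes>\<^bsub>G\<^esub> k)"
          using mono_mult_apply[OF mono(1) hG sfA kG] by (simp add: p AH_simps)
        also have "\<dots> = s (grmono R r h \<odot>\<^bsub>free_mod A J\<^esub> f) p k"
        proof (cases "t \<in> T")
          case t: True
          show ?thesis
            using mono_mult_apply[OF mono(1) hG fA, of "k \<otimes>\<^bsub>G\<^esub> t" j] True t hk hG kG TG[OF t]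
            by (simp add: p s_def G.m_assoc)
        next
          case False
          thus ?thesis using mono(1) by (simp add: p s_def)
        qed
        finally show ?thesis by simp
      qed
    qed
  qed
  have s: "s \<in> mod_hom AH (free_mod A J) ?FH"
    by (rule mod_homI) (simp_all only: s_closed s_add s_smult)
  let ?w = "\<lambda>(j, t). grmono R \<one>\<^bsub>R\<^esub> t \<odot>\<^bsub>free_mod A J\<^esub> free_basis A j"
  have w: "?w \<in> J \<times> T \<rightarrow> carrier (free_mod A J)"
    using FA.smult_closed[OF one_closed[OF TG] A.free_basis_closed] by auto
  note LM = AH_left_module[OF A.left_module_free_mod]
  let ?t = "free_ext AH (free_mod A J) ?w"
  have t: "?t \<in> mod_hom AH ?FH (free_mod A J)" by (rule H.A.free_ext_hom[OF LM w])
  have "?t (s f) = f" if "f \<in> carrier (free_mod A J)" for f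
    using that
  proof (induction f rule: free_A_induct)
    case zero
    have "s (\<lambda>x h. \<zero>\<^bsub>R\<^esub>) = \<zero>\<^bsub>?FH\<^esub>" by (auto simp: s_def fun_eq_iff group_ring_simps)
    thus ?case using mod_hom_zero[OF FH.M.abelian_group_axioms FA.M.abelian_group_axioms t] by (simp add: group_ring_simps)
  next
    case (add f g)
    show ?case unfolding s_add mod_hom_add[OF t s_closed[OF add(1)] s_closed[OF add(2)]] add(3,4) ..
  next
    case (basis r g j)
    note r = basis(1) and g = basis(2)
    have jt: "(j, \<tau> g) \<in> J \<times> T" using basis by (auto simp: T_def)
    have k: "g \<otimes>\<^bsub>G\<^esub> inv\<^bsub>G\<^esub> \<tau> g \<in> carrier G" using \<tau>H[OF g] H_sub by blast
    have 1: "grmono R r (g \<otimes>\<^bsub>G\<^esub> inv\<^bsub>G\<^esub> \<tau> g) \<in> carrier AH" using H.mono_closed[OF r] \<tau>H[OF g] by simp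
    have "?t (s (grmono R r g \<odot>\<^bsub>free_mod A J\<^esub> free_basis A j)) =
        grmono R r (g \<otimes>\<^bsub>G\<^esub> inv\<^bsub>G\<^esub> \<tau> g) \<odot>\<^bsub>free_mod A J\<^esub> (grmono R \<one>\<^bsub>R\<^esub> (\<tau> g) \<odot>\<^bsub>free_mod A J\<^esub> free_basis A j)"
      unfolding s_mono[OF r g] mod_hom_smult[OF t 1 H.A.free_basis_closed[OF jt]] H.A.free_ext_basis[OF LM w jt] by simp
    also have "\<dots> = (grmono R r (g \<otimes>\<^bsub>G\<^esub> inv\<^bsub>G\<^esub> \<tau> g) \<otimes>\<^bsub>A\<^esub> grmono R \<one>\<^bsub>R\<^esub> (\<tau> g)) \<odot>\<^bsub>free_mod A J\<^esub> free_basis A j"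
      by (rule FA.smult_assoc[OF mono_closed[OF r k] one_closed[OF \<tau>G[OF g]] A.free_basis_closed[OF basis(3)], symmetric])
    also have "grmono R r (g \<otimes>\<^bsub>G\<^esub> inv\<^bsub>G\<^esub> \<tau> g) \<otimes>\<^bsub>A\<^esub> grmono R \<one>\<^bsub>R\<^esub> (\<tau> g) = grmono R r g"
      using mono_mult[OF r R.one_closed k \<tau>G[OF g]] r g \<tau>G[OF g] by (simp add: G.m_assoc)
    finally show ?case .
  qed
  thus ?thesis by (rule H.A.equationally_flat_retract[OF LM H.A.equationally_flat_free s t])
qed

text \<open>
  A homomorphism from \<open>AH\<^sup>I\<close> extends to \<open>A\<^sup>I\<close>. Its factorization over \<open>A\<close> passes through \<open>A\<^sup>J\<close>, which need not be finitely generated over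
  \<open>AH\<close> but is flat; so the relation, which dies in \<open>A\<^sup>J\<close>, dies also in a finite free module over \<open>AH\<close>.
\<close>

lemma equationally_flat_AH:
  assumes P: "equationally_flat A P" shows "equationally_flat AH P"
proof -
  note PM = equationally_flat_left_module[OF P]
  interpret H: group_and_ring GH R by (rule group_and_ring_H)
  show ?thesis
  proof (rule equationally_flatI[OF AH_left_module[OF PM]])
    fix I :: "nat set" and \<phi> r
    assume I: "finite I" and \<phi>: "\<phi> \<in> mod_hom AH (free_mod AH I) P"
      and r: "r \<in> carrier (free_mod AH I)" "\<phi> r = \<zero>\<^bsub>P\<^esub>"
    note incl = AH_inclusion[OF subset_refl, of I]
    have w: "(\<lambda>i. \<phi> (free_basis A i)) \<in> I \<rightarrow> carrier P"
      using mod_hom_closed[OF \<phi> H.A.free_basis_closed] by (auto simp: AH_basis)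
    let ?\<Phi> = "free_ext A P (\<lambda>i. \<phi> (free_basis A i))"
    have \<Phi>: "?\<Phi> \<in> mod_hom A (free_mod A I) P" by (rule A.free_ext_hom[OF PM w])
    have eq: "?\<Phi> v = \<phi> v" if v: "v \<in> carrier (free_mod AH I)" for v
      by (rule H.A.mod_hom_free_eqI[OF AH_left_module[OF PM] mod_hom_comp[OF incl AH_hom[OF \<Phi>]] \<phi> _ v])
         (simp add: AH_basis A.free_ext_basis[OF PM w])
    obtain J \<psi> \<chi> where J: "finite (J::nat set)" and \<psi>: "\<psi> \<in> mod_hom A (free_mod A I) (free_mod A J)"
      and \<chi>: "\<chi> \<in> mod_hom A (free_mod A J) P" and eq': "\<And>v. v \<in> carrier (free_mod A I) \<Longrightarrow> \<chi> (\<psi> v) = ?\<Phi> v"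
      and kill: "\<psi> r = (\<lambda>x. \<zero>\<^bsub>A\<^esub>)"
      using equationally_flatD[OF P I \<Phi> mod_hom_closed[OF incl r(1)]] eq[OF r(1)] r(2) by (auto elim: factors_killingE)
    obtain J' \<theta> \<eta> where J': "finite (J'::nat set)" and \<theta>: "\<theta> \<in> mod_hom AH (free_mod AH I) (free_mod AH J')"
      and \<eta>: "\<eta> \<in> mod_hom AH (free_mod AH J') (free_mod A J)"
      and eq'': "\<And>v. v \<in> carrier (free_mod AH I) \<Longrightarrow> \<eta> (\<theta> v) = \<psi> v" and kill': "\<theta> r = (\<lambda>x. \<zero>\<^bsub>AH\<^esub>)"
      using equationally_flatD[OF equationally_flat_free_AH I mod_hom_comp[OF incl AH_hom[OF \<psi>]] r(1)] kill
      by (auto elim: factors_killingE)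
    show "factors_killing AH P I \<phi> {r}"
    proof (rule factors_killingI[OF J' \<theta> mod_hom_comp[OF \<eta> AH_hom[OF \<chi>]]])
      fix v assume v: "v \<in> carrier (free_mod AH I)"
      show "\<chi> (\<eta> (\<theta> v)) = \<phi> v" using eq''[OF v] eq'[OF mod_hom_closed[OF incl v]] eq[OF v] by simp
    qed (use kill' in simp)
  qed
qed

lemma AH_resolution:
  assumes "resolution A M P d \<epsilon>" shows "resolution AH M P d \<epsilon>"
proof -
  note r = resolutionD[OF assms]
  show ?thesis
    unfolding resolution_def One_nat_def
    by (intro conjI allI AH_left_module AH_hom r)
qed

text \<open>
  A flat resolution of the trivial module over the group ring stays one when the scalars are restricted.
\<close>

theorem hd'_subgroup_le: "hd' R GH \<le> hd' R G"
proof (cases "hd' R G")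
  case (enat n)
  interpret H: group_and_ring GH R by (rule group_and_ring_H)
  have "hd' R G \<le> enat n" using enat by simp
  then obtain P d \<epsilon> where P: "resolution A (trivial_module R) (P :: nat \<Rightarrow> ('g \<Rightarrow> 'r, 'g list \<Rightarrow> 'g \<Rightarrow> 'r) module) d \<epsilon>"
    "\<And>i. equationally_flat A (P i)" "vanishes_above n P"
    unfolding hd'_def flat_dim_le_iff_resolution A.flat_iff_equationally_flat by blast
  have "hd' R GH \<le> enat n"
    unfolding hd'_def flat_dim_le_iff_resolution H.A.flat_iff_equationally_flat
    using AH_resolution[OF P(1)] equationally_flat_AH[OF P(2)] P(3) by blast
  thus ?thesis using enat by simp
qed simp

lemma bar_value_H: "bar_value R GH x = bar_value R G x"
proof (induction x)
  case (Cons g x)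
  have one: "\<one>\<^bsub>GH\<^esub> = \<one>\<^bsub>G\<^esub>" by simp
  have "bar_shift R GH f = bar_shift R G f" for f unfolding bar_shift_def one ..
  with Cons show ?case by (simp add: AH_simps AH_basis)
qed simp

lemma bar_set_H: "bar_set GH n \<subseteq> bar_set G n"
  using H_sub by (auto simp: bar_set_def)

lemma bar_mod_H_carrier: "carrier (bar_mod R GH n) \<subseteq> carrier (F n)"
  unfolding bar_mod_def by (rule AH_free_carrier[OF bar_set_H])

lemma bar_mod_H_inclusion: "(\<lambda>v. v) \<in> mod_hom AH (bar_mod R GH n) (F n)"
  unfolding bar_mod_def by (rule AH_inclusion[OF bar_set_H])

lemma bar_d_H:
  assumes v: "v \<in> carrier (bar_mod R GH (Suc n))" shows "bar_d R GH n v = bar_d R G n v"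
proof -
  interpret H: group_and_ring GH R by (rule group_and_ring_H)
  have f: "bar_d R GH n \<in> mod_hom AH (free_mod AH (bar_set GH (Suc n))) (F n)"
    using mod_hom_comp[OF H.bar_d_hom bar_mod_H_inclusion] unfolding bar_mod_def .
  have g: "bar_d R G n \<in> mod_hom AH (free_mod AH (bar_set GH (Suc n))) (F n)"
    using mod_hom_comp[OF bar_mod_H_inclusion AH_hom[OF bar_d_hom]] unfolding bar_mod_def .
  show ?thesis
  proof (rule H.A.mod_hom_free_eqI[OF AH_left_module[OF F_left_module] f g _ v[unfolded bar_mod_def]])
    fix x assume x: "x \<in> bar_set GH (Suc n)"
    hence "x \<in> bar_set G (Suc n)" using bar_set_H by blast
    thus "bar_d R GH n (free_basis AH x) = bar_d R G n (free_basis AH x)"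
      unfolding H.bar_d_basis[OF x] unfolding AH_basis by (simp add: bar_d_basis bar_value_H)
  qed
qed

lemma bar_e_H:
  assumes v: "v \<in> carrier (bar_mod R GH 0)" shows "bar_e R GH v = bar_e R G v"
proof -
  interpret H: group_and_ring GH R by (rule group_and_ring_H)
  have f: "bar_e R GH \<in> mod_hom AH (free_mod AH (bar_set GH 0)) (trivial_module R)"
    using H.bar_e_hom unfolding bar_mod_def .
  have g: "bar_e R G \<in> mod_hom AH (free_mod AH (bar_set GH 0)) (trivial_module R)"
    using mod_hom_comp[OF bar_mod_H_inclusion AH_hom[OF bar_e_hom]] unfolding bar_mod_def .
  show ?thesis
  proof (rule H.A.mod_hom_free_eqI[OF H.left_module_trivial f g _ v[unfolded bar_mod_def]])
    fix x assume "x \<in> bar_set GH 0"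
    hence "x = []" by (simp add: bar_set_def)
    thus "bar_e R GH (free_basis AH x) = bar_e R G (free_basis AH x)"
      using H.bar_e_basis bar_e_basis by (simp add: AH_basis)
  qed
qed

text \<open>
  Syzygies are kernels, and kernels are compatible with restriction to a subset, whereas for images this would not be clear.
\<close>

lemma bar_syzygy_H:
  "bar_d R GH n ` carrier (bar_mod R GH (Suc n)) =
    bar_d R G n ` carrier (F (Suc n)) \<inter> carrier (bar_mod R GH n)"
proof -
  interpret H: group_and_ring GH R by (rule group_and_ring_H)
  note r = resolutionD[OF bar_resolution, folded bar_mod_def] and rH = resolutionD[OF H.bar_resolution, folded bar_mod_def]
  show ?thesis
  proof (cases n)
    case 0
    show ?thesis unfolding 0 r(6) rH(6) a_kernel_eq using bar_e_H bar_mod_H_carrier by auto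
  next
    case (Suc m)
    have z: "\<zero>\<^bsub>F m\<^esub> = \<zero>\<^bsub>bar_mod R GH m\<^esub>" by (simp add: F_simps H.F_simps)
    show ?thesis unfolding Suc r(7) rH(7) a_kernel_eq using bar_d_H bar_mod_H_carrier z by auto
  qed
qed

text \<open>
  A splitting homomorphism over \<open>AH\<close> is extended to the bar resolution of \<open>G\<close>: linearly over \<open>A\<close>, and by zero on the basis elements
  that are not lists in \<open>H\<close>.
\<close>

lemma locally_split_extend:
  assumes split: "locally_split AH (bar_mod R GH n) (bar_d R GH n ` carrier (bar_mod R GH (Suc n)))"
    and E: "finite E" "E \<subseteq> bar_d R G n ` carrier (F (Suc n))" "E \<subseteq> carrier (bar_mod R GH n)"
  shows "\<exists>u\<in>mod_hom A (F n) (F n\<lparr>carrier := bar_d R G n ` carrier (F (Suc n))\<rparr>). \<forall>x\<in>E. u x = x"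
proof -
  interpret H: group_and_ring GH R by (rule group_and_ring_H)
  let ?L = "bar_d R G n ` carrier (F (Suc n))" and ?LH = "bar_d R GH n ` carrier (bar_mod R GH (Suc n))"
  let ?M = "F n\<lparr>carrier := ?L\<rparr>"
  have Lsm: "submodule_set A (F n) ?L" by (rule submodule_set_image[OF F_left_module F_left_module bar_d_hom])
  have LM: "left_module A ?M" by (rule left_module_submodule[OF F_left_module Lsm])
  have Lz: "\<zero>\<^bsub>F n\<^esub> \<in> ?L" using Lsm by (simp add: submodule_set_def)
  have "E \<subseteq> ?LH" unfolding bar_syzygy_H using E by blast
  then obtain u where u: "u \<in> mod_hom AH (bar_mod R GH n) (bar_mod R GH n\<lparr>carrier := ?LH\<rparr>)" "\<And>x. x \<in> E \<Longrightarrow> u x = x"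
    using split E(1) unfolding locally_split_def by meson
  have LHL: "?LH \<subseteq> ?L" unfolding bar_syzygy_H by blast
  have uM: "u \<in> mod_hom AH (bar_mod R GH n) ?M"
  proof (rule mod_homI)
    fix v assume v: "v \<in> carrier (bar_mod R GH n)"
    have "u v \<in> ?LH" using mod_hom_closed[OF u(1) v] by simp
    thus "u v \<in> carrier ?M" using LHL by auto
  next
    fix v w assume "v \<in> carrier (bar_mod R GH n)" "w \<in> carrier (bar_mod R GH n)"
    from mod_hom_add[OF u(1) this] show "u (v \<oplus>\<^bsub>bar_mod R GH n\<^esub> w) = u v \<oplus>\<^bsub>?M\<^esub> u w"
      by (simp add: F_simps H.F_simps)
  next
    fix a v assume "a \<in> carrier AH" "v \<in> carrier (bar_mod R GH n)"
    from mod_hom_smult[OF u(1) this] show "u (a \<odot>\<^bsub>bar_mod R GH n\<^esub> v) = a \<odot>\<^bsub>?M\<^esub> u v"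
      by (simp add: F_simps H.F_simps AH_simps)
  qed
  let ?w = "\<lambda>x. if x \<in> bar_set GH n then u (free_basis A x) else \<zero>\<^bsub>F n\<^esub>"
  have w: "?w \<in> bar_set G n \<rightarrow> carrier ?M"
  proof
    fix x
    show "?w x \<in> carrier ?M"
      using mod_hom_closed[OF uM H.e_closed, of x] Lz by (simp add: AH_basis)
  qed
  let ?u = "free_ext A ?M ?w"
  have u': "?u \<in> mod_hom A (F n) ?M" unfolding bar_mod_def[of R G n, symmetric]
    using A.free_ext_hom[OF LM w] by (simp add: bar_mod_def)
  show ?thesis
  proof (intro bexI[OF _ u'] ballI)
    fix v assume v: "v \<in> E"
    hence vH: "v \<in> carrier (free_mod AH (bar_set GH n))" using E(3) by (auto simp: bar_mod_def)
    have "?u v = u v"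
    proof (rule H.A.mod_hom_free_eqI[OF AH_left_module[OF LM] _ _ _ vH])
      show "?u \<in> mod_hom AH (free_mod AH (bar_set GH n)) ?M"
        using mod_hom_comp[OF bar_mod_H_inclusion AH_hom[OF u']] unfolding bar_mod_def[of R GH] .
      show "u \<in> mod_hom AH (free_mod AH (bar_set GH n)) ?M" using uM unfolding bar_mod_def[of R GH] .
      fix x assume x: "x \<in> bar_set GH n"
      hence "x \<in> bar_set G n" using bar_set_H by blast
      from A.free_ext_basis[OF LM w this] x show "?u (free_basis AH x) = u (free_basis AH x)"
        unfolding AH_basis by simp
    qed
    with u(2)[OF v] show "?u v = v" by simp
  qed
qed

end

text \<open>
  The elements of a generated subgroup are values of words in the generators and their inverses.
\<close>

lemma countable_generate:
  assumes "S \<subseteq> carrier G" "countable S" shows "countable (generate G S)"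
proof -
  let ?L = "lists (S \<union> (\<lambda>x. inv\<^bsub>G\<^esub> x) ` S)"
  let ?f = "\<lambda>l. foldr (\<lambda>x y. x \<otimes>\<^bsub>G\<^esub> y) l \<one>\<^bsub>G\<^esub>"
  have clos: "?f l \<in> carrier G" if "l \<in> ?L" for l
    using that assms(1) by (induction l) auto
  have app: "?f (l @ m) = ?f l \<otimes>\<^bsub>G\<^esub> ?f m" if "l \<in> ?L" "m \<in> ?L" for l m
    using that(1)
  proof (induction l)
    case Nil
    show ?case using clos[OF that(2)] by simp
  next
    case (Cons x l)
    have "x \<in> carrier G" using Cons assms(1) by auto
    moreover have "l \<in> ?L" using Cons by auto
    ultimately show ?case using Cons clos[OF that(2)] clos[of l] by (simp add: G.m_assoc)
  qed
  have "generate G S \<subseteq> ?f ` ?L"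
  proof
    fix x assume "x \<in> generate G S"
    thus "x \<in> ?f ` ?L"
    proof (induction rule: generate.induct)
      case one
      show ?case by (rule image_eqI[of _ _ "[]"]) auto
    next
      case (incl h)
      thus ?case using assms(1) by (intro image_eqI[of _ _ "[h]"]) auto
    next
      case (inv h)
      thus ?case using assms(1) by (intro image_eqI[of _ _ "[inv\<^bsub>G\<^esub> h]"]) auto
    next
      case (eng h1 h2)
      then obtain l m where "l \<in> ?L" "h1 = ?f l" "m \<in> ?L" "h2 = ?f m" by blast
      thus ?case using app by (intro image_eqI[of _ _ "l @ m"]) auto
    qed
  qed
  moreover have "countable (?f ` ?L)" using assms(2) by auto
  ultimately show ?thesis by (rule countable_subset)
qed

text \<open>
  The group elements occurring in a finite set \<open>E\<close> of syzygies, either in the lists or in the coefficients, generate a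
  countable subgroup. Over this subgroup \<open>E\<close> is fixed by a splitting homomorphism, which can be extended.
\<close>

theorem hd'_le_of_countable_subgroups:
  assumes "\<And>H. subgroup H G \<Longrightarrow> countable H \<Longrightarrow> hd' R (G\<lparr>carrier := H\<rparr>) \<le> enat n"
  shows "hd' R G \<le> enat n"
  unfolding hd'_le_iff locally_split_def
proof (intro allI impI)
  let ?L = "bar_d R G n ` carrier (F (Suc n))"
  fix E assume E: "finite E" "E \<subseteq> ?L"
  have EF: "f \<in> carrier (F n)" if "f \<in> E" for f
    using E(2) that mod_hom_closed[OF bar_d_hom] by blast
  let ?X = "\<lambda>f. {x. f x \<noteq> (\<lambda>h. \<zero>\<^bsub>R\<^esub>)}"
  define S where "S = (\<Union>f\<in>E. \<Union>x\<in>?X f. set x \<union> supp R (f x))"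
  have fin: "finite (?X f)" "finite (supp R (f x))" if "f \<in> E" for f x
    using EF[OF that] by (auto simp: F_carrier group_ring_carrier)
  hence Sfin: "finite S" using E(1) by (auto simp: S_def)
  have SG: "S \<subseteq> carrier G"
  proof
    fix y assume "y \<in> S"
    then obtain f x where fx: "f \<in> E" "x \<in> ?X f" "y \<in> set x \<union> supp R (f x)" by (auto simp: S_def)
    have "x \<in> bar_set G n" "f x \<in> carrier A" using EF[OF fx(1)] fx(2) by (auto simp: F_carrier)
    thus "y \<in> carrier G" using fx(3) by (auto simp: bar_set_def group_ring_carrier)
  qed
  let ?H = "generate G S"
  have H: "subgroup ?H G" by (rule G.generate_is_subgroup[OF SG])
  have SH: "S \<subseteq> ?H" by (auto intro: generate.incl)
  interpret H: group_and_ring "G\<lparr>carrier := ?H\<rparr>" R by (rule group_and_ring_H[OF H])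
  have "hd' R (G\<lparr>carrier := ?H\<rparr>) \<le> enat n"
    by (rule assms[OF H countable_generate[OF SG countable_finite[OF Sfin]]])
  note split = this[unfolded H.hd'_le_iff]
  have "E \<subseteq> carrier (bar_mod R (G\<lparr>carrier := ?H\<rparr>) n)"
  proof
    fix f assume f: "f \<in> E"
    have "supp R (f x) \<subseteq> ?H" for x
    proof (cases "x \<in> ?X f")
      case True
      hence "supp R (f x) \<subseteq> S" using f by (auto simp: S_def)
      thus ?thesis using SH by blast
    qed (auto simp: supp_def)
    moreover have "x \<in> bar_set (G\<lparr>carrier := ?H\<rparr>) n" if "x \<in> ?X f" for x
    proof -
      have "set x \<subseteq> S" using f that by (auto simp: S_def)
      moreover have "x \<in> bar_set G n" using EF[OF f] that by (auto simp: F_carrier)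
      ultimately show ?thesis using SH by (auto simp: bar_set_def)
    qed
    ultimately show "f \<in> carrier (bar_mod R (G\<lparr>carrier := ?H\<rparr>) n)"
      using EF[OF f] unfolding F_carrier H.F_carrier by (auto simp: group_ring_carrier)
  qed
  from locally_split_extend[OF H split E this]
  show "\<exists>u\<in>mod_hom A (F n) (F n\<lparr>carrier := ?L\<rparr>). \<forall>x\<in>E. u x = x" .
qed

end

section \<open>Cyclic groups\<close>

context group_and_ring
begin

lemma mono_add: "r \<in> carrier R \<Longrightarrow> s \<in> carrier R \<Longrightarrow> grmono R (r \<oplus>\<^bsub>R\<^esub> s) g = grmono R r g \<oplus>\<^bsub>A\<^esub> grmono R s g"
  by (auto simp: grmono_def group_ring_simps fun_eq_iff)

lemma mono_zero: "grmono R \<zero>\<^bsub>R\<^esub> g = \<zero>\<^bsub>A\<^esub>"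
  by (auto simp: grmono_def group_ring_simps fun_eq_iff)

lemma bar_e_apply:
  assumes "f \<in> carrier (F 0)" shows "bar_e R G f = augmentation R (f [])"
  using assms
proof (induction f rule: F_induct)
  case zero
  thus ?case
    using mod_hom_zero[OF left_module_abelian[OF F_left_module] left_module_abelian[OF left_module_trivial] bar_e_hom]
    by (simp add: F_simps augmentation_zero)
next
  case (add f g)
  have c: "f [] \<in> carrier A" "g [] \<in> carrier A" using add by (auto simp: F_carrier)
  have "(f \<oplus>\<^bsub>F 0\<^esub> g) [] = f [] \<oplus>\<^bsub>A\<^esub> g []" by (simp add: F_simps group_ring_simps)
  thus ?case using mod_hom_add[OF bar_e_hom add(1,2)] add(3,4) augmentation_add[OF c] by simp
next
  case (basis r g x)
  hence x: "x = []" by (simp add: bar_set_def)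
  have "(grmono R r g \<odot>\<^bsub>F 0\<^esub> e []) [] = grmono R r g" by (simp add: mono_smult_basis[OF basis(1,2)])
  thus ?case using mod_hom_smult[OF bar_e_hom mono_closed[OF basis(1,2)] e_closed[OF Nil_bar_set]] basis
    unfolding x by (simp add: bar_e_basis augmentation_mono)
qed

context
  fixes x assumes x: "x \<in> carrier G" and cyclic: "carrier G = range (\<lambda>n::int. x [^]\<^bsub>G\<^esub> n)"
begin

text \<open>
  The element \<open>x - 1\<close> of the group ring, written \<open>\<delta>\<close>. It generates the augmentation ideal.
\<close>

definition gen_minus_one :: "'g \<Rightarrow> 'r" where
  "gen_minus_one = grmono R \<one>\<^bsub>R\<^esub> x \<ominus>\<^bsub>A\<^esub> \<one>\<^bsub>A\<^esub>"

abbreviation "\<delta> \<equiv> gen_minus_one"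

lemma mono_x: "grmono R \<one>\<^bsub>R\<^esub> x \<in> carrier A"
  by (rule one_closed[OF x])

lemma \<delta>_closed: "\<delta> \<in> carrier A"
  unfolding gen_minus_one_def using mono_x by simp

lemma \<delta>_mult: "a \<in> carrier A \<Longrightarrow> \<delta> \<otimes>\<^bsub>A\<^esub> a = grmono R \<one>\<^bsub>R\<^esub> x \<otimes>\<^bsub>A\<^esub> a \<ominus>\<^bsub>A\<^esub> a"
  unfolding gen_minus_one_def a_minus_def using mono_x by (simp add: A.l_distr A.l_minus)

lemma \<delta>_aug: "augmentation R \<delta> = \<zero>\<^bsub>R\<^esub>"
proof -
  have "\<delta> \<oplus>\<^bsub>A\<^esub> \<one>\<^bsub>A\<^esub> = grmono R \<one>\<^bsub>R\<^esub> x"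
    unfolding gen_minus_one_def by (rule diff_add_cancel[OF A.abelian_group_axioms mono_x A.one_closed])
  hence "augmentation R \<delta> \<oplus>\<^bsub>R\<^esub> \<one>\<^bsub>R\<^esub> = \<one>\<^bsub>R\<^esub>"
    using augmentation_add[OF \<delta>_closed A.one_closed] x by (simp add: augmentation_mono group_ring_simps(3))
  thus ?thesis using augmentation_closed[OF \<delta>_closed] by (simp add: R.add.r_cancel_one')
qed

lemma cyclic_comm: "a \<in> carrier A \<Longrightarrow> b \<in> carrier A \<Longrightarrow> a \<otimes>\<^bsub>A\<^esub> b = b \<otimes>\<^bsub>A\<^esub> a"
proof (induction a rule: A_induct)
  case zero
  show ?case by (simp add: A_zero_mult)
next
  case (add a a')
  thus ?case by (simp add: A.l_distr A.r_distr)
next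
  case a: (mono r g)
  note am = mono_closed[OF a(1,2)]
  show ?case
    using a(3)
  proof (induction b rule: A_induct)
    case zero
    show ?case by (simp add: A_zero_mult)
  next
    case (add b b')
    thus ?case using am by (simp add: A.l_distr A.r_distr)
  next
    case (mono s h)
    obtain m n :: int where "g = x [^]\<^bsub>G\<^esub> m" "h = x [^]\<^bsub>G\<^esub> n" using a(2) mono(2) cyclic by blast
    hence "g \<otimes>\<^bsub>G\<^esub> h = h \<otimes>\<^bsub>G\<^esub> g" using x by (simp add: G.int_pow_mult[symmetric] add.commute)
    thus ?case using a(1,2) mono by (simp add: mono_mult R.m_comm)
  qed
qed

definition \<delta>_ideal :: "('g \<Rightarrow> 'r) set" where "\<delta>_ideal = (\<lambda>b. \<delta> \<otimes>\<^bsub>A\<^esub> b) ` carrier A"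

lemma \<delta>_idealI: "b \<in> carrier A \<Longrightarrow> a = \<delta> \<otimes>\<^bsub>A\<^esub> b \<Longrightarrow> a \<in> \<delta>_ideal"
  unfolding \<delta>_ideal_def by blast

lemma \<delta>_ideal_add: "a \<in> \<delta>_ideal \<Longrightarrow> b \<in> \<delta>_ideal \<Longrightarrow> a \<oplus>\<^bsub>A\<^esub> b \<in> \<delta>_ideal"
  unfolding \<delta>_ideal_def using \<delta>_closed by (auto simp: A.r_distr[symmetric])

lemma \<delta>_ideal_mult: "a \<in> \<delta>_ideal \<Longrightarrow> b \<in> carrier A \<Longrightarrow> a \<otimes>\<^bsub>A\<^esub> b \<in> \<delta>_ideal"
  unfolding \<delta>_ideal_def using \<delta>_closed by (auto simp: A.m_assoc)

lemma A_telescope: "a \<in> carrier A \<Longrightarrow> b \<in> carrier A \<Longrightarrow> c \<in> carrier A \<Longrightarrow>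
    a \<ominus>\<^bsub>A\<^esub> c = (a \<ominus>\<^bsub>A\<^esub> b) \<oplus>\<^bsub>A\<^esub> (b \<ominus>\<^bsub>A\<^esub> c)"
  by (simp add: a_minus_def A.a_assoc A.r_neg1)

text \<open>
  Modulo the ideal generated by \<open>x - 1\<close> the generator is \<open>1\<close>; hence so are its powers, and \<open>r g\<close> is congruent to \<open>r\<close> for each group
  element \<open>g\<close>.
\<close>

lemma augmentation_ideal:
  assumes "a \<in> carrier A" shows "\<exists>b\<in>carrier A. a = grmono R (augmentation R a) \<one>\<^bsub>G\<^esub> \<oplus>\<^bsub>A\<^esub> \<delta> \<otimes>\<^bsub>A\<^esub> b"
proof -
  let ?m = "\<lambda>r. grmono R r \<one>\<^bsub>G\<^esub>"
  define P where "P g \<longleftrightarrow> g \<in> carrier G \<and> (\<forall>r\<in>carrier R. grmono R r g \<ominus>\<^bsub>A\<^esub> ?m r \<in> \<delta>_ideal)" for g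
  have P1: "P \<one>\<^bsub>G\<^esub>"
    unfolding P_def
  proof (intro conjI ballI)
    fix r assume "r \<in> carrier R"
    hence "?m r \<ominus>\<^bsub>A\<^esub> ?m r = \<zero>\<^bsub>A\<^esub>" using mono_closed by (simp add: a_minus_def A.r_neg)
    thus "?m r \<ominus>\<^bsub>A\<^esub> ?m r \<in> \<delta>_ideal" using \<delta>_closed by (intro \<delta>_idealI[OF A.zero_closed]) simp
  qed simp
  have Pmult: "P (g \<otimes>\<^bsub>G\<^esub> h)" if "P g" "P h" for g h
    unfolding P_def
  proof (intro conjI ballI)
    have gh: "g \<in> carrier G" "h \<in> carrier G" using that by (auto simp: P_def)
    thus "g \<otimes>\<^bsub>G\<^esub> h \<in> carrier G" by simp
    fix r assume r: "r \<in> carrier R"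
    note m = mono_closed[OF r gh(1)] mono_closed[OF r G.one_closed] one_closed[OF gh(2)] mono_closed[OF r gh(2)]
    have "grmono R r (g \<otimes>\<^bsub>G\<^esub> h) \<ominus>\<^bsub>A\<^esub> grmono R r h = (grmono R r g \<ominus>\<^bsub>A\<^esub> ?m r) \<otimes>\<^bsub>A\<^esub> grmono R \<one>\<^bsub>R\<^esub> h"
      unfolding a_minus_def using m r gh by (simp add: A.l_distr A.l_minus mono_mult)
    moreover have "grmono R r g \<ominus>\<^bsub>A\<^esub> ?m r \<in> \<delta>_ideal" "grmono R r h \<ominus>\<^bsub>A\<^esub> ?m r \<in> \<delta>_ideal" using that r by (auto simp: P_def)
    ultimately have "(grmono R r (g \<otimes>\<^bsub>G\<^esub> h) \<ominus>\<^bsub>A\<^esub> grmono R r h) \<oplus>\<^bsub>A\<^esub> (grmono R r h \<ominus>\<^bsub>A\<^esub> ?m r) \<in> \<delta>_ideal"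
      using \<delta>_ideal_add \<delta>_ideal_mult m(3) by simp
    thus "grmono R r (g \<otimes>\<^bsub>G\<^esub> h) \<ominus>\<^bsub>A\<^esub> ?m r \<in> \<delta>_ideal"
      using A_telescope[OF mono_closed[OF r G.m_closed[OF gh]] m(4) m(2)] by simp
  qed
  have Px: "P x"
    unfolding P_def
  proof (intro conjI ballI x)
    fix r assume r: "r \<in> carrier R"
    note m = mono_closed[OF r G.one_closed]
    show "grmono R r x \<ominus>\<^bsub>A\<^esub> ?m r \<in> \<delta>_ideal"
      by (rule \<delta>_idealI[OF m]) (use \<delta>_mult[OF m] r x in \<open>simp add: mono_mult\<close>)
  qed
  have Pinv: "P (inv\<^bsub>G\<^esub> x)"
    unfolding P_def
  proof (intro conjI ballI G.inv_closed x)
    fix r assume r: "r \<in> carrier R"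
    note m = mono_closed[OF r G.inv_closed[OF x]] mono_closed[OF r G.one_closed]
    have "\<delta> \<otimes>\<^bsub>A\<^esub> (\<ominus>\<^bsub>A\<^esub> grmono R r (inv\<^bsub>G\<^esub> x)) = \<ominus>\<^bsub>A\<^esub> (?m r \<ominus>\<^bsub>A\<^esub> grmono R r (inv\<^bsub>G\<^esub> x))"
      using \<delta>_mult[OF m(1)] \<delta>_closed m r x by (simp add: A.r_minus mono_mult)
    also have "\<dots> = grmono R r (inv\<^bsub>G\<^esub> x) \<ominus>\<^bsub>A\<^esub> ?m r"
      using m by (simp add: a_minus_def A.minus_add A.a_comm)
    finally show "grmono R r (inv\<^bsub>G\<^esub> x) \<ominus>\<^bsub>A\<^esub> ?m r \<in> \<delta>_ideal"
      using m by (intro \<delta>_idealI[of "\<ominus>\<^bsub>A\<^esub> grmono R r (inv\<^bsub>G\<^esub> x)"]) simp_all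
  qed
  have Pn: "P (x [^]\<^bsub>G\<^esub> n)" for n :: int
  proof (induction n rule: int_induct[where k = 0])
    case base
    show ?case using P1 by simp
  next
    case (step1 i)
    show ?case using Pmult[OF step1(2) Px] G.int_pow_mult[OF x, of i 1] x by simp
  next
    case (step2 i)
    show ?case using Pmult[OF step2(2) Pinv] G.int_pow_mult[OF x, of i "-1"] x by (simp add: G.int_pow_neg)
  qed
  have "a \<ominus>\<^bsub>A\<^esub> ?m (augmentation R a) \<in> \<delta>_ideal"
    using assms
  proof (induction a rule: A_induct)
    case zero
    have "(\<lambda>x. \<zero>\<^bsub>R\<^esub>) \<ominus>\<^bsub>A\<^esub> ?m (augmentation R (\<lambda>x. \<zero>\<^bsub>R\<^esub>)) = \<zero>\<^bsub>A\<^esub>"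
      unfolding augmentation_zero mono_zero by (simp add: a_minus_def A.r_neg flip: group_ring_simps(2)[of R G])
    thus ?case using \<delta>_closed by (intro \<delta>_idealI[OF A.zero_closed]) simp
  next
    case (add a b)
    note s = augmentation_closed[OF add(1)] augmentation_closed[OF add(2)]
    note m = mono_closed[OF s(1) G.one_closed] mono_closed[OF s(2) G.one_closed]
    have "a \<oplus>\<^bsub>A\<^esub> b \<ominus>\<^bsub>A\<^esub> ?m (augmentation R (a \<oplus>\<^bsub>A\<^esub> b)) =
        (a \<ominus>\<^bsub>A\<^esub> ?m (augmentation R a)) \<oplus>\<^bsub>A\<^esub> (b \<ominus>\<^bsub>A\<^esub> ?m (augmentation R b))"
      unfolding augmentation_add[OF add(1,2)] mono_add[OF s] a_minus_def
      using add(1,2) m by (simp add: A.minus_add A.a_ac)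
    thus ?case using \<delta>_ideal_add[OF add(3,4)] by simp
  next
    case (mono r g)
    obtain n :: int where "g = x [^]\<^bsub>G\<^esub> n" using mono(2) cyclic by blast
    thus ?case using Pn[of n] mono by (simp add: P_def augmentation_mono)
  qed
  then obtain b where b: "b \<in> carrier A" "a \<ominus>\<^bsub>A\<^esub> ?m (augmentation R a) = \<delta> \<otimes>\<^bsub>A\<^esub> b" unfolding \<delta>_ideal_def by blast
  have m: "?m (augmentation R a) \<in> carrier A" by (rule mono_closed[OF augmentation_closed[OF assms] G.one_closed])
  have "a = ?m (augmentation R a) \<oplus>\<^bsub>A\<^esub> \<delta> \<otimes>\<^bsub>A\<^esub> b"
    unfolding b(2)[symmetric] using diff_add_cancel[OF A.abelian_group_axioms assms m] assms m by (simp add: A.a_comm)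
  with b(1) show ?thesis by blast
qed

text \<open>
  Being killed by \<open>x - 1\<close> means being invariant under translation by \<open>x\<close>.
\<close>

lemma \<delta>_annihilator_constant:
  assumes c: "c \<in> carrier A" and z: "\<delta> \<otimes>\<^bsub>A\<^esub> c = \<zero>\<^bsub>A\<^esub>" and h: "h \<in> carrier G"
  shows "c h = c \<one>\<^bsub>G\<^esub>"
proof -
  have eq: "grmono R \<one>\<^bsub>R\<^esub> x \<otimes>\<^bsub>A\<^esub> c = c"
    using z A.m_closed[OF mono_x c] c unfolding \<delta>_mult[OF c] by simp
  have cR: "c h \<in> carrier R" for h using c by (simp add: group_ring_carrier)
  have step: "c (inv\<^bsub>G\<^esub> x \<otimes>\<^bsub>G\<^esub> h) = c h" if "h \<in> carrier G" for h
    using mono_mult_apply[OF R.one_closed x c that] cR unfolding eq by simp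
  have shift: "inv\<^bsub>G\<^esub> x \<otimes>\<^bsub>G\<^esub> x [^]\<^bsub>G\<^esub> i = x [^]\<^bsub>G\<^esub> (i - 1)" for i :: int
    using G.int_pow_mult[OF x, of "-1" i] x by (simp add: G.int_pow_neg)
  have "c (x [^]\<^bsub>G\<^esub> n) = c \<one>\<^bsub>G\<^esub>" for n :: int
  proof (induction n rule: int_induct[where k = 0])
    case base
    show ?case by simp
  next
    case (step1 i)
    show ?case using step[of "x [^]\<^bsub>G\<^esub> (i + 1)"] step1 x unfolding shift by simp
  next
    case (step2 i)
    show ?case using step[of "x [^]\<^bsub>G\<^esub> i"] step2 x unfolding shift by simp
  qed
  thus ?thesis using h cyclic by auto
qed

lemma A_eqI:
  assumes a: "a \<in> carrier A" and b: "b \<in> carrier A" and eq: "\<And>h. h \<in> carrier G \<Longrightarrow> a h = b h"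
  shows "a = b"
proof
  fix h
  show "a h = b h"
  proof (cases "h \<in> carrier G")
    case False
    hence "a h = \<zero>\<^bsub>R\<^esub>" "b h = \<zero>\<^bsub>R\<^esub>" using a b unfolding group_ring_carrier supp_def by blast+
    thus ?thesis by simp
  qed (rule eq)
qed

text \<open>
  Constant functions of finite support on an infinite group vanish.
\<close>

lemma \<delta>_regular:
  assumes "infinite (carrier G)" and c: "c \<in> carrier A" and z: "\<delta> \<otimes>\<^bsub>A\<^esub> c = \<zero>\<^bsub>A\<^esub>"
  shows "c = \<zero>\<^bsub>A\<^esub>"
proof -
  note const = \<delta>_annihilator_constant[OF c z]
  have "c \<one>\<^bsub>G\<^esub> = \<zero>\<^bsub>R\<^esub>"
  proof (rule ccontr)
    assume c1: "c \<one>\<^bsub>G\<^esub> \<noteq> \<zero>\<^bsub>R\<^esub>"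
    have "carrier G \<subseteq> supp R c"
    proof
      fix h assume "h \<in> carrier G"
      from const[OF this] c1 show "h \<in> supp R c" by (simp add: supp_def)
    qed
    moreover have "finite (supp R c)" using c by (simp add: group_ring_carrier)
    ultimately show False using assms(1) finite_subset by blast
  qed
  note c1 = this
  show ?thesis
  proof (rule A_eqI[OF c A.zero_closed])
    fix h assume "h \<in> carrier G"
    from const[OF this] c1 show "c h = \<zero>\<^bsub>A\<^esub> h" by (simp add: group_ring_simps)
  qed
qed

text \<open>
  On a flat module a regular element acts injectively, but \<open>x - 1\<close> acts as zero on the trivial module. This forces \<open>R = 0\<close>.
\<close>

lemma infinite_cyclic_not_flat:
  assumes "infinite (carrier G)" and flat: "equationally_flat A (trivial_module R :: ('g \<Rightarrow> 'r, 'r) module)"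
  shows "\<one>\<^bsub>R\<^esub> = \<zero>\<^bsub>R\<^esub>"
proof -
  have "exact_pair \<delta> \<zero>\<^bsub>A\<^esub> (trivial_module R :: ('g \<Rightarrow> 'r, 'r) module) (carrier (trivial_module R :: ('g \<Rightarrow> 'r, 'r) module))"
  proof (rule A.exact_pair_flat[OF flat \<delta>_closed A.zero_closed])
    fix c assume "c \<in> carrier A" "\<delta> \<otimes>\<^bsub>A\<^esub> c = \<zero>\<^bsub>A\<^esub>"
    from \<delta>_regular[OF assms(1) this] show "\<exists>c'\<in>carrier A. c = \<zero>\<^bsub>A\<^esub> \<otimes>\<^bsub>A\<^esub> c'" by (intro bexI[of _ "\<zero>\<^bsub>A\<^esub>"]) simp_all
  qed
  from this[unfolded exact_pair_def, THEN bspec, of "\<one>\<^bsub>R\<^esub>"] obtain m where "m \<in> carrier R"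
    "\<one>\<^bsub>R\<^esub> = augmentation R \<zero>\<^bsub>A\<^esub> \<otimes>\<^bsub>R\<^esub> m" by (auto simp: \<delta>_aug)
  thus ?thesis by (simp add: group_ring_simps augmentation_zero)
qed

text \<open>
  The kernel of the augmentation consists of the multiples of \<open>x - 1\<close>, and the quotient \<open>q a\<close> by \<open>x - 1\<close> is unique by regularity.
  So multiplication by \<open>x - 1\<close> identifies the first syzygy with the free module of rank one.
\<close>

lemma infinite_cyclic_cd_le_1:
  assumes inf: "infinite (carrier G)" shows "cd R G \<le> 1"
proof -
  let ?L = "bar_d R G 0 ` carrier (F (Suc 0))" and ?M = "F 0\<lparr>carrier := bar_d R G 0 ` carrier (F (Suc 0))\<rparr>"
  have Lsm: "submodule_set A (F 0) ?L" by (rule submodule_set_image[OF F_left_module F_left_module bar_d_hom])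
  have LM: "left_module A ?M" by (rule left_module_submodule[OF F_left_module Lsm])
  have L: "?L = {f \<in> carrier (F 0). augmentation R (f []) = \<zero>\<^bsub>R\<^esub>}"
    using resolutionD(6)[OF bar_resolution, folded bar_mod_def] bar_e_apply by (auto simp: a_kernel_eq)
  have cl: "f l \<in> carrier A" if "f \<in> carrier (F 0)" for f l using that by (simp add: F_carrier)
  have F0I: "(\<lambda>l. if l = [] then a else (\<lambda>h. \<zero>\<^bsub>R\<^esub>)) \<in> carrier (F 0)" if "a \<in> carrier A" for a
    using that A.zero_closed by (auto simp: F_carrier bar_set_def group_ring_simps)
  have F0: "f = (\<lambda>l. if l = [] then f [] else (\<lambda>h. \<zero>\<^bsub>R\<^esub>))" if "f \<in> carrier (F 0)" for f
  proof
    fix l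
    have "l = []" if "f l \<noteq> (\<lambda>h. \<zero>\<^bsub>R\<^esub>)"
    proof -
      have "l \<in> bar_set G 0" using \<open>f \<in> carrier (F 0)\<close> that unfolding F_carrier by blast
      thus ?thesis by (simp add: bar_set_def)
    qed
    thus "f l = (if l = [] then f [] else (\<lambda>h. \<zero>\<^bsub>R\<^esub>))" by auto
  qed
  define q where "q a = (SOME b. b \<in> carrier A \<and> \<delta> \<otimes>\<^bsub>A\<^esub> b = a)" for a
  have q: "q a \<in> carrier A \<and> \<delta> \<otimes>\<^bsub>A\<^esub> q a = a" if a: "a \<in> carrier A" "augmentation R a = \<zero>\<^bsub>R\<^esub>" for a
  proof -
    obtain b where "b \<in> carrier A" "a = \<zero>\<^bsub>A\<^esub> \<oplus>\<^bsub>A\<^esub> \<delta> \<otimes>\<^bsub>A\<^esub> b"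
      using augmentation_ideal[OF a(1)] unfolding a(2) mono_zero by blast
    hence "b \<in> carrier A \<and> \<delta> \<otimes>\<^bsub>A\<^esub> b = a" using \<delta>_closed by simp
    thus ?thesis unfolding q_def by (rule someI[of "\<lambda>b. b \<in> carrier A \<and> \<delta> \<otimes>\<^bsub>A\<^esub> b = a"])
  qed
  have cancel: "a = b" if ab: "a \<in> carrier A" "b \<in> carrier A" and eq: "\<delta> \<otimes>\<^bsub>A\<^esub> a = \<delta> \<otimes>\<^bsub>A\<^esub> b" for a b
  proof -
    have "\<delta> \<otimes>\<^bsub>A\<^esub> (a \<ominus>\<^bsub>A\<^esub> b) = \<zero>\<^bsub>A\<^esub>"
      unfolding a_minus_def using ab \<delta>_closed eq by (simp add: A.r_distr A.r_minus A.r_neg)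
    from \<delta>_regular[OF inf A.minus_closed[OF ab] this] show ?thesis using ab by simp
  qed
  let ?s = "\<lambda>f l. if l = [] then q (f []) else (\<lambda>h. \<zero>\<^bsub>R\<^esub>)"
  let ?t = "\<lambda>f l. \<delta> \<otimes>\<^bsub>A\<^esub> f l"
  have t_eq: "?t f = \<delta> \<odot>\<^bsub>F 0\<^esub> f" for f by (simp add: F_simps)
  interpret F: left_module A "F 0" by (rule F_left_module)
  have t: "?t \<in> mod_hom A (F 0) ?M"
  proof (rule mod_homI)
    fix f assume f: "f \<in> carrier (F 0)"
    show "?t f \<in> carrier ?M" using F.smult_closed[OF \<delta>_closed f] augmentation_mult[OF \<delta>_closed cl[OF f]]
        augmentation_closed[OF cl[OF f]]
      by (simp add: L \<delta>_aug F_simps)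
    {
      fix g assume g: "g \<in> carrier (F 0)"
      show "?t (f \<oplus>\<^bsub>F 0\<^esub> g) = ?t f \<oplus>\<^bsub>?M\<^esub> ?t g"
        unfolding t_eq using F.smult_r_distr[OF \<delta>_closed f g] by simp
    }
    fix a assume a: "a \<in> carrier A"
    have "\<delta> \<otimes>\<^bsub>A\<^esub> a = a \<otimes>\<^bsub>A\<^esub> \<delta>" by (rule cyclic_comm[OF \<delta>_closed a])
    thus "?t (a \<odot>\<^bsub>F 0\<^esub> f) = a \<odot>\<^bsub>?M\<^esub> ?t f"
      unfolding t_eq using F.smult_assoc[OF \<delta>_closed a f] F.smult_assoc[OF a \<delta>_closed f] by simp
  qed
  have s: "?s \<in> mod_hom A ?M (F 0)"
  proof (rule mod_homI)
    fix f assume "f \<in> carrier ?M"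
    hence f: "f \<in> carrier (F 0)" "augmentation R (f []) = \<zero>\<^bsub>R\<^esub>" by (simp_all add: L)
    note qf = q[OF cl[OF f(1)] f(2)]
    show "?s f \<in> carrier (F 0)" using F0I qf by blast
    {
      fix g assume "g \<in> carrier ?M"
      hence g: "g \<in> carrier (F 0)" "augmentation R (g []) = \<zero>\<^bsub>R\<^esub>" by (simp_all add: L)
      note qg = q[OF cl[OF g(1)] g(2)]
      have fg: "f [] \<oplus>\<^bsub>A\<^esub> g [] \<in> carrier A" "augmentation R (f [] \<oplus>\<^bsub>A\<^esub> g []) = \<zero>\<^bsub>R\<^esub>"
        using cl f g by (auto simp: augmentation_add)
      have "q (f [] \<oplus>\<^bsub>A\<^esub> g []) = q (f []) \<oplus>\<^bsub>A\<^esub> q (g [])"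
        by (rule cancel) (use q[OF fg] qf qg \<delta>_closed in \<open>simp_all add: A.r_distr\<close>)
      thus "?s (f \<oplus>\<^bsub>?M\<^esub> g) = ?s f \<oplus>\<^bsub>F 0\<^esub> ?s g"
        by (auto simp: F_simps group_ring_simps fun_eq_iff)
    }
    fix a assume a: "a \<in> carrier A"
    have af: "a \<otimes>\<^bsub>A\<^esub> f [] \<in> carrier A" "augmentation R (a \<otimes>\<^bsub>A\<^esub> f []) = \<zero>\<^bsub>R\<^esub>"
      using cl[OF f(1)] f(2) a augmentation_closed[OF a] by (auto simp: augmentation_mult)
    have "\<delta> \<otimes>\<^bsub>A\<^esub> (a \<otimes>\<^bsub>A\<^esub> q (f [])) = a \<otimes>\<^bsub>A\<^esub> (\<delta> \<otimes>\<^bsub>A\<^esub> q (f []))"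
      using A.m_assoc[OF \<delta>_closed a conjunct1[OF qf]] A.m_assoc[OF a \<delta>_closed conjunct1[OF qf]]
        cyclic_comm[OF \<delta>_closed a] by simp
    hence "\<delta> \<otimes>\<^bsub>A\<^esub> q (a \<otimes>\<^bsub>A\<^esub> f []) = \<delta> \<otimes>\<^bsub>A\<^esub> (a \<otimes>\<^bsub>A\<^esub> q (f []))"
      by (simp only: conjunct2[OF q[OF af]] conjunct2[OF qf])
    hence "q (a \<otimes>\<^bsub>A\<^esub> f []) = a \<otimes>\<^bsub>A\<^esub> q (f [])"
      by (rule cancel[OF conjunct1[OF q[OF af]] A.m_closed[OF a conjunct1[OF qf]]])
    thus "?s (a \<odot>\<^bsub>?M\<^esub> f) = a \<odot>\<^bsub>F 0\<^esub> ?s f"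
      using a by (auto simp: F_simps fun_eq_iff A_zero_mult)
  qed
  have s': "?s \<in> mod_hom A ?M (free_mod A (bar_set G 0))" using s unfolding bar_mod_def .
  have t': "?t \<in> mod_hom A (free_mod A (bar_set G 0)) ?M" using t unfolding bar_mod_def .
  have "projective_module A ?M"
  proof (rule A.projective_retract_of_free[OF LM s' t'])
    fix f assume "f \<in> carrier ?M"
    hence f: "f \<in> carrier (F 0)" "augmentation R (f []) = \<zero>\<^bsub>R\<^esub>" by (simp_all add: L)
    note qf = q[OF cl[OF f(1)] f(2)]
    show "?t (?s f) = f"
      by (subst (2) F0[OF f(1)]) (use qf in \<open>auto simp: fun_eq_iff A_zero_mult\<close>)
  qed
  hence "projective_module A (free_mod A (bar_set G 0)\<lparr>carrier := bar_d R G 0 ` carrier (free_mod A (bar_set G (Suc 0)))\<rparr>)"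
    by (simp add: bar_mod_def)
  from A.projective_dim_le_Suc[OF bar_resolution this] show ?thesis
    by (simp add: cd_def one_enat_def)
qed

text \<open>
  With the norm \<open>\<nu> = \<Sum>g. g\<close>, the annihilator of \<open>x - 1\<close> consists of constant functions, which are the multiples of \<open>\<nu>\<close>;
  and \<open>\<nu> c = \<epsilon>(c) \<nu>\<close> shows that the annihilator of \<open>\<nu>\<close> is the augmentation ideal, generated by \<open>x - 1\<close>. If the dimension is finite,
  exactness holds on the trivial module too: there \<open>x - 1\<close> acts as zero and \<open>\<nu>\<close> as the order of the group, so \<open>1\<close> is a multiple of the
  order.
\<close>

lemma finite_cyclic_order_unit:
  assumes fin: "finite (carrier G)" and hd: "hd' R G \<noteq> \<infinity>"
  shows "[card (carrier G)] \<cdot>\<^bsub>R\<^esub> \<one>\<^bsub>R\<^esub> \<in> Units R"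
proof -
  define \<nu> where "\<nu> = (\<lambda>h. if h \<in> carrier G then \<one>\<^bsub>R\<^esub> else \<zero>\<^bsub>R\<^esub>)"
  have \<nu>: "\<nu> \<in> carrier A" using fin finite_subset[of "supp R \<nu>" "carrier G"]
    by (auto simp: \<nu>_def group_ring_carrier supp_def)
  have aug: "augmentation R \<nu> = [card (carrier G)] \<cdot>\<^bsub>R\<^esub> \<one>\<^bsub>R\<^esub>"
  proof -
    have "augmentation R \<nu> = (\<Oplus>\<^bsub>R\<^esub>h\<in>carrier G. \<nu> h)"
      using \<nu> by (intro augmentation_superset[OF \<nu> fin]) (auto simp: group_ring_carrier)
    also have "\<dots> = (\<Oplus>\<^bsub>R\<^esub>h\<in>carrier G. \<one>\<^bsub>R\<^esub>)" by (intro R.finsum_cong') (auto simp: \<nu>_def)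
    also have "\<dots> = [card (carrier G)] \<cdot>\<^bsub>R\<^esub> \<one>\<^bsub>R\<^esub>" by (rule R.add.finprod_const) simp
    finally show ?thesis .
  qed
  have mono\<nu>: "grmono R r g \<otimes>\<^bsub>A\<^esub> \<nu> = (\<lambda>h. r \<otimes>\<^bsub>R\<^esub> \<nu> h)" if r: "r \<in> carrier R" and g: "g \<in> carrier G" for r g
  proof -
    have "(\<lambda>h. r \<otimes>\<^bsub>R\<^esub> \<nu> h) = grmono R r \<one>\<^bsub>G\<^esub> \<otimes>\<^bsub>A\<^esub> \<nu>" by (rule mono_left_mult[OF r \<nu>, symmetric])
    moreover have "grmono R r \<one>\<^bsub>G\<^esub> \<otimes>\<^bsub>A\<^esub> \<nu> \<in> carrier A" using mono_closed[OF r] \<nu> by simp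
    ultimately have "(\<lambda>h. r \<otimes>\<^bsub>R\<^esub> \<nu> h) \<in> carrier A" by simp
    thus ?thesis
      using mono_mult_apply[OF r g \<nu>] g by (intro A_eqI A.m_closed mono_closed[OF r g] \<nu>) (auto simp: \<nu>_def)
  qed
  have \<delta>\<nu>: "\<delta> \<otimes>\<^bsub>A\<^esub> \<nu> = \<zero>\<^bsub>A\<^esub>"
  proof -
    have "grmono R \<one>\<^bsub>R\<^esub> x \<otimes>\<^bsub>A\<^esub> \<nu> = \<nu>" unfolding mono\<nu>[OF R.one_closed x] by (auto simp: \<nu>_def)
    thus ?thesis unfolding \<delta>_mult[OF \<nu>] using \<nu> by (simp add: a_minus_def A.r_neg)
  qed
  have \<nu>\<delta>: "\<nu> \<otimes>\<^bsub>A\<^esub> \<delta> = \<zero>\<^bsub>A\<^esub>" using cyclic_comm[OF \<nu> \<delta>_closed] \<delta>\<nu> by simp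
  have ann\<delta>: "\<exists>c'\<in>carrier A. c = \<nu> \<otimes>\<^bsub>A\<^esub> c'" if c: "c \<in> carrier A" and z: "\<delta> \<otimes>\<^bsub>A\<^esub> c = \<zero>\<^bsub>A\<^esub>" for c
  proof -
    have r: "c \<one>\<^bsub>G\<^esub> \<in> carrier R" using c by (simp add: group_ring_carrier)
    note m = mono_closed[OF r G.one_closed]
    have "c = grmono R (c \<one>\<^bsub>G\<^esub>) \<one>\<^bsub>G\<^esub> \<otimes>\<^bsub>A\<^esub> \<nu>"
    proof (rule A_eqI[OF c A.m_closed[OF m \<nu>]])
      fix h assume "h \<in> carrier G"
      with \<delta>_annihilator_constant[OF c z this] r
      show "c h = (grmono R (c \<one>\<^bsub>G\<^esub>) \<one>\<^bsub>G\<^esub> \<otimes>\<^bsub>A\<^esub> \<nu>) h"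
        unfolding mono\<nu>[OF r G.one_closed] by (simp add: \<nu>_def)
    qed
    also have "\<dots> = \<nu> \<otimes>\<^bsub>A\<^esub> grmono R (c \<one>\<^bsub>G\<^esub>) \<one>\<^bsub>G\<^esub>" by (rule cyclic_comm[OF m \<nu>])
    finally show ?thesis using m by blast
  qed
  have ann\<nu>: "\<exists>c'\<in>carrier A. c = \<delta> \<otimes>\<^bsub>A\<^esub> c'" if c: "c \<in> carrier A" and z: "\<nu> \<otimes>\<^bsub>A\<^esub> c = \<zero>\<^bsub>A\<^esub>" for c
  proof -
    obtain b where b: "b \<in> carrier A" "c = grmono R (augmentation R c) \<one>\<^bsub>G\<^esub> \<oplus>\<^bsub>A\<^esub> \<delta> \<otimes>\<^bsub>A\<^esub> b"
      using augmentation_ideal[OF c] by blast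
    have r: "augmentation R c \<in> carrier R" by (rule augmentation_closed[OF c])
    note m = mono_closed[OF r G.one_closed]
    have "\<nu> \<otimes>\<^bsub>A\<^esub> c = \<nu> \<otimes>\<^bsub>A\<^esub> grmono R (augmentation R c) \<one>\<^bsub>G\<^esub> \<oplus>\<^bsub>A\<^esub> \<nu> \<otimes>\<^bsub>A\<^esub> (\<delta> \<otimes>\<^bsub>A\<^esub> b)"
      by (subst b(2)) (rule A.r_distr[OF m A.m_closed[OF \<delta>_closed b(1)] \<nu>])
    also have "\<nu> \<otimes>\<^bsub>A\<^esub> (\<delta> \<otimes>\<^bsub>A\<^esub> b) = \<zero>\<^bsub>A\<^esub>" using \<nu>\<delta> \<nu> \<delta>_closed b(1) by (simp add: A.m_assoc[symmetric])
    also have "\<nu> \<otimes>\<^bsub>A\<^esub> grmono R (augmentation R c) \<one>\<^bsub>G\<^esub> = (\<lambda>h. augmentation R c \<otimes>\<^bsub>R\<^esub> \<nu> h)"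
      using cyclic_comm[OF \<nu> m] mono\<nu>[OF r G.one_closed] by simp
    finally have "\<zero>\<^bsub>R\<^esub> = augmentation R c \<otimes>\<^bsub>R\<^esub> \<nu> \<one>\<^bsub>G\<^esub> \<oplus>\<^bsub>R\<^esub> \<zero>\<^bsub>R\<^esub>"
      unfolding z by (simp add: group_ring_simps fun_eq_iff)
    hence "augmentation R c = \<zero>\<^bsub>R\<^esub>" using r by (simp add: \<nu>_def)
    hence "c = \<delta> \<otimes>\<^bsub>A\<^esub> b" using b \<delta>_closed mono_zero by simp
    with b(1) show ?thesis by blast
  qed
  obtain n where n: "hd' R G \<le> enat n" using hd by (cases "hd' R G") auto
  then obtain P d \<epsilon> where P: "resolution A (trivial_module R) (P :: nat \<Rightarrow> ('g \<Rightarrow> 'r, 'g list \<Rightarrow> 'g \<Rightarrow> 'r) module) d \<epsilon>"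
    "\<And>i. equationally_flat A (P i)" "vanishes_above n P"
    unfolding hd'_def flat_dim_le_iff_resolution A.flat_iff_equationally_flat by blast
  have "exact_pair \<delta> \<nu> (trivial_module R :: ('g \<Rightarrow> 'r, 'r) module) (carrier (trivial_module R :: ('g \<Rightarrow> 'r, 'r) module))"
    by (rule A.exact_pair_of_finite_flat_dim[OF P \<delta>_closed \<nu> \<delta>\<nu> \<nu>\<delta> ann\<delta> ann\<nu>])
  from this[unfolded exact_pair_def, THEN bspec, of "\<one>\<^bsub>R\<^esub>"] obtain m where m: "m \<in> carrier R"
    "\<one>\<^bsub>R\<^esub> = augmentation R \<nu> \<otimes>\<^bsub>R\<^esub> m" by (auto simp: \<delta>_aug)
  have "augmentation R \<nu> \<in> carrier R" by (rule augmentation_closed[OF \<nu>])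
  with m have "augmentation R \<nu> \<in> Units R" by (auto simp: Units_def R.m_comm intro!: bexI[of _ m])
  thus ?thesis unfolding aug .
qed

end

end

section \<open>Jump heights\<close>

lemma jump_homology_bound_hjh: "jump_homology R G \<Longrightarrow> jump_homology_bound R G (hjh R G)"
  unfolding jump_homology_def hjh_def by (rule LeastI_ex)

lemma jump_cohomology_bound_cjh: "jump_cohomology R G \<Longrightarrow> jump_cohomology_bound R G (cjh R G)"
  unfolding jump_cohomology_def cjh_def by (rule LeastI_ex)

lemma hjh_le: "jump_homology_bound R G k \<Longrightarrow> jump_homology R G \<and> hjh R G \<le> k"
  unfolding jump_homology_def hjh_def by (auto intro: Least_le)

lemma cjh_le: "jump_cohomology_bound R G k \<Longrightarrow> jump_cohomology R G \<and> cjh R G \<le> k"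
  unfolding jump_cohomology_def cjh_def by (auto intro: Least_le)

context group_and_ring
begin

lemma jump_homology_bound_subgroup:
  assumes "subgroup S G" "jump_homology_bound R G k"
  shows "jump_homology_bound R (G\<lparr>carrier := S\<rparr>) k"
  using assms G.incl_subgroup[OF assms(1)] unfolding jump_homology_bound_def by simp

lemma jump_cohomology_bound_subgroup:
  assumes "subgroup S G" "jump_cohomology_bound R G k"
  shows "jump_cohomology_bound R (G\<lparr>carrier := S\<rparr>) k"
  using assms G.incl_subgroup[OF assms(1)] unfolding jump_cohomology_bound_def by simp

text \<open>
  If \<open>H\<close> is uncountable, finiteness of \<open>hd H\<close> gives no control over \<open>cd H\<close>. The detour through the countable
  subgroups \<open>K\<close>, where \<open>cd K \<le> hd K + 1\<close> is finite, makes the bound applicable.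
\<close>

lemma jump_homology_bound_of_cohomology:
  assumes k: "jump_cohomology_bound R G k" shows "jump_homology_bound R G k"
  unfolding jump_homology_bound_def
proof (intro allI impI)
  fix H assume H: "subgroup H G"
  interpret H: group_and_ring "G\<lparr>carrier := H\<rparr>" R by (rule group_and_ring_H[OF H])
  show "hd' R (G\<lparr>carrier := H\<rparr>) = \<infinity> \<or> hd' R (G\<lparr>carrier := H\<rparr>) \<le> enat k"
  proof (cases "hd' R (G\<lparr>carrier := H\<rparr>)")
    case (enat m)
    have "hd' R (G\<lparr>carrier := H\<rparr>) \<le> enat k"
    proof (rule H.hd'_le_of_countable_subgroups)
      fix K assume KH: "subgroup K (G\<lparr>carrier := H\<rparr>)" and count: "countable K"
      have K: "subgroup K G" by (rule G.incl_subgroup[OF H KH])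
      interpret K: group_and_ring "G\<lparr>carrier := K\<rparr>" R by (rule group_and_ring_H[OF K])
      have "hd' R (G\<lparr>carrier := K\<rparr>) \<le> enat m" using H.hd'_subgroup_le[OF KH] enat by simp
      hence "cd R (G\<lparr>carrier := K\<rparr>) \<le> enat (Suc m)" using count by (intro K.cd_le_Suc) simp
      hence "cd R (G\<lparr>carrier := K\<rparr>) \<le> enat k" using k K unfolding jump_cohomology_bound_def by auto
      hence "hd' R (G\<lparr>carrier := K\<rparr>) \<le> enat k" using K.hd'_le_cd order_trans by blast
      thus "hd' R (G\<lparr>carrier := H, carrier := K\<rparr>) \<le> enat k" by simp
    qed
    thus ?thesis ..
  qed simp
qed

lemma jump_cohomology_bound_of_homology:
  assumes count: "countable (carrier G)" and k: "jump_homology_bound R G k"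
  shows "jump_cohomology_bound R G (Suc k)"
  unfolding jump_cohomology_bound_def
proof (intro allI impI)
  fix H assume H: "subgroup H G"
  interpret H: group_and_ring "G\<lparr>carrier := H\<rparr>" R by (rule group_and_ring_H[OF H])
  have cH: "countable (carrier (G\<lparr>carrier := H\<rparr>))"
    using countable_subset[OF subgroup.subset[OF H] count] by simp
  show "cd R (G\<lparr>carrier := H\<rparr>) = \<infinity> \<or> cd R (G\<lparr>carrier := H\<rparr>) \<le> enat (Suc k)"
  proof (cases "cd R (G\<lparr>carrier := H\<rparr>)")
    case (enat m)
    have "hd' R (G\<lparr>carrier := H\<rparr>) \<le> enat m" using H.hd'_le_cd enat by simp
    hence "hd' R (G\<lparr>carrier := H\<rparr>) \<le> enat k" using k H unfolding jump_homology_bound_def by auto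
    from H.cd_le_Suc[OF cH this] show ?thesis ..
  qed simp
qed

text \<open>
  The data needed to regard the powers of \<open>y\<close> as a cyclic group in its own right, with powers computed in that group.
\<close>

lemma cyclic_subgroup:
  assumes y: "y \<in> carrier G"
  defines "K \<equiv> range (\<lambda>n::int. y [^]\<^bsub>G\<^esub> n)"
  shows "subgroup K G" "y \<in> K" "K = range (\<lambda>n::int. y [^]\<^bsub>G\<lparr>carrier := K\<rparr>\<^esub> n)"
    "card K = G.ord y" "infinite K \<longleftrightarrow> G.ord y = 0"
proof -
  show K: "subgroup K G" unfolding K_def by (rule G.subgroup_of_powers[OF y])
  show yK: "y \<in> K" unfolding K_def using y by (metis G.int_pow_1 rangeI)
  show "K = range (\<lambda>n::int. y [^]\<^bsub>G\<lparr>carrier := K\<rparr>\<^esub> n)"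
    unfolding G.int_pow_consistent[OF K yK, symmetric] by (simp add: K_def)
  have "carrier (subgroup_generated G {y}) = K" unfolding K_def by (rule G.carrier_subgroup_generated_by_singleton[OF y])
  thus "card K = G.ord y" "infinite K \<longleftrightarrow> G.ord y = 0"
    using G.cyclic_order_is_ord[OF y] G.infinite_cyclic_subgroup_order[OF y] by (simp_all add: order_def)
qed

text \<open>
  An element of infinite order would generate an infinite cyclic group, of homological dimension exactly one.
\<close>

lemma torsion_of_jump_homology_height_zero:
  assumes one: "\<one>\<^bsub>R\<^esub> \<noteq> \<zero>\<^bsub>R\<^esub>" and bound: "jump_homology_bound R G 0"
  shows "torsion_group G"
proof (rule ccontr)
  assume "\<not> torsion_group G"
  then obtain y where y: "y \<in> carrier G" "\<And>n::nat. n > 0 \<Longrightarrow> y [^]\<^bsub>G\<^esub> n \<noteq> \<one>\<^bsub>G\<^esub>"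
    using G.group_axioms unfolding torsion_group_def by blast
  define K where "K = range (\<lambda>n::int. y [^]\<^bsub>G\<^esub> n)"
  note K = cyclic_subgroup[OF y(1), folded K_def]
  have "G.ord y = 0" using y G.pow_ord_eq_1[OF y(1)] by blast
  hence inf: "infinite K" using K(5) by simp
  interpret K: group_and_ring "G\<lparr>carrier := K\<rparr>" R by (rule group_and_ring_H[OF K(1)])
  have gen: "y \<in> carrier (G\<lparr>carrier := K\<rparr>)"
    "carrier (G\<lparr>carrier := K\<rparr>) = range (\<lambda>n::int. y [^]\<^bsub>G\<lparr>carrier := K\<rparr>\<^esub> n)"
    "infinite (carrier (G\<lparr>carrier := K\<rparr>))" using K(2,3) inf by simp_all
  have "cd R (G\<lparr>carrier := K\<rparr>) \<le> 1" by (rule K.infinite_cyclic_cd_le_1[OF gen])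
  hence "hd' R (G\<lparr>carrier := K\<rparr>) \<noteq> \<infinity>" using K.hd'_le_cd by (metis enat_ord_simps(5) one_enat_def order_trans infinity_ne_i1)
  hence "hd' R (G\<lparr>carrier := K\<rparr>) \<le> 0" using bound K(1) unfolding jump_homology_bound_def by (auto simp: zero_enat_def)
  from K.infinite_cyclic_not_flat[OF gen K.flat_trivial_of_hd'_le_0[OF this]] one show False by simp
qed

text \<open>
  A nontrivial subgroup contains a nontrivial finite cyclic group whose order is not a unit in \<open>R\<close>. Its
  dimension is infinite, and hence so is that of the subgroup.
\<close>

lemma jump_cohomology_bound_zero_of_R_torsion:
  assumes tors: "R_torsion_group R G" shows "jump_cohomology_bound R G 0"
  unfolding jump_cohomology_bound_def
proof (intro allI impI)
  fix H assume H: "subgroup H G"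
  interpret H: group_and_ring "G\<lparr>carrier := H\<rparr>" R by (rule group_and_ring_H[OF H])
  show "cd R (G\<lparr>carrier := H\<rparr>) = \<infinity> \<or> cd R (G\<lparr>carrier := H\<rparr>) \<le> enat 0"
  proof (cases "H = {\<one>\<^bsub>G\<^esub>}")
    case True
    thus ?thesis using H.cd_trivial_group by (simp add: zero_enat_def)
  next
    case False
    then obtain y where y: "y \<in> H" "y \<noteq> \<one>\<^bsub>G\<^esub>" using subgroup.one_closed[OF H] by blast
    have yG: "y \<in> carrier G" using subgroup.subset[OF H] y(1) by blast
    define K where "K = range (\<lambda>n::int. y [^]\<^bsub>G\<^esub> n)"
    note K = cyclic_subgroup[OF yG, folded K_def]
    obtain n :: nat where "n > 0" "y [^]\<^bsub>G\<^esub> n = \<one>\<^bsub>G\<^esub>"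
      using tors yG unfolding R_torsion_group_def torsion_group_def by blast
    hence "G.ord y \<noteq> 0" using G.ord_eq_0[OF yG] by auto
    hence fin: "finite K" using K(5) by simp
    have KH: "K \<subseteq> H" unfolding K_def using G.subgroup_int_pow_closed[OF H y(1)] by auto
    interpret K: group_and_ring "G\<lparr>carrier := K\<rparr>" R by (rule group_and_ring_H[OF K(1)])
    have gen: "y \<in> carrier (G\<lparr>carrier := K\<rparr>)"
      "carrier (G\<lparr>carrier := K\<rparr>) = range (\<lambda>n::int. y [^]\<^bsub>G\<lparr>carrier := K\<rparr>\<^esub> n)"
      "finite (carrier (G\<lparr>carrier := K\<rparr>))" using K(2,3) fin by simp_all
    have nonunit: "[G.ord y] \<cdot>\<^bsub>R\<^esub> \<one>\<^bsub>R\<^esub> \<notin> Units R" using tors yG y(2) unfolding R_torsion_group_def by blast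
    have infK: "hd' R (G\<lparr>carrier := K\<rparr>) = \<infinity>"
    proof (rule ccontr)
      assume "hd' R (G\<lparr>carrier := K\<rparr>) \<noteq> \<infinity>"
      from K.finite_cyclic_order_unit[OF gen this] nonunit K(4) show False by simp
    qed
    have "subgroup K (G\<lparr>carrier := H\<rparr>)" by (rule G.subgroup_incl[OF K(1) H KH])
    from H.hd'_subgroup_le[OF this] infK have "hd' R (G\<lparr>carrier := H\<rparr>) = \<infinity>" by simp
    hence "cd R (G\<lparr>carrier := H\<rparr>) = \<infinity>" using H.hd'_le_cd by simp
    thus ?thesis ..
  qed
qed

end

theorem proposition4p3:
  fixes G :: "('g, 'd) monoid_scheme" and R :: "('r, 'c) ring_scheme"
  assumes "group G" and "cring R"
  shows
    "(jump_homology R G \<longrightarrow>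
        (\<forall>S. subgroup S G \<longrightarrow>
          jump_homology R (G\<lparr>carrier := S\<rparr>) \<and> hjh R (G\<lparr>carrier := S\<rparr>) \<le> hjh R G))
   \<and> (jump_cohomology R G \<longrightarrow>
        (\<forall>S. subgroup S G \<longrightarrow>
          jump_cohomology R (G\<lparr>carrier := S\<rparr>) \<and> cjh R (G\<lparr>carrier := S\<rparr>) \<le> cjh R G))
   \<and> (\<one>\<^bsub>R\<^esub> \<noteq> \<zero>\<^bsub>R\<^esub> \<longrightarrow>
        (jump_homology R G \<and> hjh R G = 0) \<or> (jump_cohomology R G \<and> cjh R G = 0) \<longrightarrow>
        torsion_group G)
   \<and> (R_torsion_group R G \<longrightarrow>
        (jump_homology R G \<and> hjh R G = 0) \<and> (jump_cohomology R G \<and> cjh R G = 0))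
   \<and> (jump_cohomology R G \<longrightarrow> jump_homology R G \<and> hjh R G \<le> cjh R G)
   \<and> (countable (carrier G) \<longrightarrow>
        (jump_cohomology R G \<longleftrightarrow> jump_homology R G) \<and>
        (jump_homology R G \<longrightarrow> hjh R G \<le> cjh R G \<and> cjh R G \<le> hjh R G + 1))"
proof -
  interpret group_and_ring G R using assms by (rule group_and_ring.intro)
  note hom = jump_homology_bound_hjh[of R G] and coh = jump_cohomology_bound_cjh[of R G]
  have 1: "jump_homology R (G\<lparr>carrier := S\<rparr>) \<and> hjh R (G\<lparr>carrier := S\<rparr>) \<le> hjh R G"
    if "jump_homology R G" "subgroup S G" for S
    by (rule hjh_le[OF jump_homology_bound_subgroup[OF that(2) hom[OF that(1)]]])
  have 2: "jump_cohomology R (G\<lparr>carrier := S\<rparr>) \<and> cjh R (G\<lparr>carrier := S\<rparr>) \<le> cjh R G"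
    if "jump_cohomology R G" "subgroup S G" for S
    by (rule cjh_le[OF jump_cohomology_bound_subgroup[OF that(2) coh[OF that(1)]]])
  have 3: "jump_homology R G \<and> hjh R G \<le> cjh R G" if "jump_cohomology R G"
    by (rule hjh_le[OF jump_homology_bound_of_cohomology[OF coh[OF that]]])
  have 4: "torsion_group G"
    if "\<one>\<^bsub>R\<^esub> \<noteq> \<zero>\<^bsub>R\<^esub>" and zero: "(jump_homology R G \<and> hjh R G = 0) \<or> (jump_cohomology R G \<and> cjh R G = 0)"
  proof -
    have "jump_homology R G \<and> hjh R G = 0" using zero 3 by auto
    hence "jump_homology_bound R G 0" using hom by auto
    thus ?thesis by (rule torsion_of_jump_homology_height_zero[OF that(1)])
  qed
  have 5: "(jump_homology R G \<and> hjh R G = 0) \<and> (jump_cohomology R G \<and> cjh R G = 0)" if "R_torsion_group R G"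
    using cjh_le[OF jump_cohomology_bound_zero_of_R_torsion[OF that]] 3 by auto
  have 6: "jump_cohomology R G \<and> cjh R G \<le> hjh R G + 1" if "countable (carrier G)" "jump_homology R G"
    using cjh_le[OF jump_cohomology_bound_of_homology[OF that(1) hom[OF that(2)]]] by simp
  show ?thesis
  proof (intro conjI impI allI)
    show "jump_cohomology R G \<longleftrightarrow> jump_homology R G" if "countable (carrier G)" using 3 6[OF that] by blast
    show "hjh R G \<le> cjh R G" if "countable (carrier G)" "jump_homology R G" using 3 6[OF that] by blast
  qed (use 1 2 3 4 5 6 in auto)
qed

end
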